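(* Let $\mathbf X_N=(X_1^{(N)},\ldots,X_p^{(N)})$ be independent $N\times N$ heavy Wigner matrices, $X_j^{(N)}$ having parameter $(a_{j,k})_{k\ge1}$, independent of a family $\mathbf Y_N$ of $N\times N$ random matrices satisfying Assumptions 1, 2 and 3 (stated in the context). Let $\Phi(P)=\lim_N\mathbb E[\frac1N\mathrm{Tr}\,P(\mathbf X_N,\mathbf Y_N)]$ denote the limiting joint $^*$-distribution of $(\mathbf X_N,\mathbf Y_N)$. For any $L\ge1$, any $\gamma:\{1,\ldots,L\}\to\{1,\ldots,p\}$ and any $^*$-polynomials $P_1(\mathbf y),\ldots,P_L(\mathbf y)$ in the variables $\mathbf y$, setting $P=x_{\gamma(1)}P_1(\mathbf y)\cdots x_{\gamma(L)}P_L(\mathbf y)$, one has $$\Phi(P)=\sum_{(G,c)\in\mathcal L^{(\gamma)}}\omega_{HW}(G,c)\times\omega_{TR}(G,c).$$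
   Context: All random matrices have complex entries with finite moments of all orders. Heavy Wigner matrices. A random $N\times N$ matrix $X_N$ is a heavy Wigner matrix with parameter $(a_k)_{k\ge1}$ if: (i) a.s. $X_N=X_N^*$; (ii) the sub-diagonal entries (diagonal included) are independent and centered; (iii) the diagonal entries of $\sqrt N X_N$ have law $\nu_N$ on $\mathbb R$; (iv) the strictly sub-diagonal entries of $\sqrt N X_N$ have law $\mu_N$ on $\mathbb C$, invariant under complex conjugation; (v) $\mu_N,\nu_N$ have all their moments and for every $k\ge1$, $N^{-(k-1)}\int|z|^{2k}d\mu_N(z)\to a_k$ and $N^{-(k-1)}\int t^{2k}d\nu_N(t)=O(1)$. Test graphs. A $^*$-test graph in variables $\mathbf y=(y_1,\ldots,y_q)$ is a finite connected oriented graph $T=(V,E)$ (multiple edges and loops allowed), each edge $e$ labelled $y_{\gamma(e)}^{\varepsilon(e)}$, $\varepsilon(e)\in\{1,*\}$. It is cyclic if there is a closed walk traversing each edge exactly once in the sense of its orientation. For $N\times N$ matrices $\mathbf Y_N$, $\tau_N[T(\mathbf Y_N)]=\frac1N\sum_{\phi:V\to\{1,\ldots,N\}}\prod_{e\in E}Y_{\gamma(e)}^{\varepsilon(e)}(\phi(e))$, where $\phi(e)=(\phi(v),\phi(w))$ for $e=(v,w)$ and $M(m,n)$ is the $(m,n)$ entry of $M$; $\tau_N^0$ is the same sum restricted to injective $\phi$. If edges are labelled by $^*$-polynomials $Q_e(\mathbf y)$, the same definition is used with the matrices $Q_e(\mathbf Y_N)$. $\mathfrak r(T)$: a cutting edge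 of $T$ is an edge whose removal disconnects $T$; the two-edge connected components are the maximal connected subgraphs without cutting edges; $\mathfrak T(T)$ is the tree whose vertices are these components, linked according to cutting edges; $\mathfrak r(T)$ is its number of leaves, with $\mathfrak r(T)=2$ if $\mathfrak T(T)$ has one vertex. Assumption 1: $\lim_N\mathbb E[\tau_N^0[T(\mathbf Y_N)]]$ exists for every cyclic $^*$-test graph $T$ (equivalently with $\tau_N$). Assumption 2: for all cyclic $T_1,\ldots,T_n$, $\mathbb E[\prod_i\tau_N^0[T_i(\mathbf Y_N)]]-\prod_i\mathbb E[\tau_N^0[T_i(\mathbf Y_N)]]\to0$. Assumption 3: for all (not necessarily cyclic) $^*$-test graphs $T_1,\ldots,T_n$, $\mathbb E[\prod_i\tau_N^0[T_i(\mathbf Y_N)]]=O(N^{\sum_i(\mathfrak r(T_i)/2-1)})$. Under these assumptions, $\Phi$ exists, and $\tau[T]:=\lim_N\mathbb E[\tau_N[T(\mathbf Y_N)]]$ exists for every cyclic $T$ with edges labelled by $^*$-polynomials in $\mathbf y$. The set $\mathcal L^{(\gamma)}$. It is the set of all couples $(G,c)$ where $G$ is a rooted plane tree (a rooted tree embedded in the upper half plane with root at the origin, so that the children of each vertex are ordered from left to right) with at most $\lfloor L/2\rfloor$ edges, and $c=(e_1,\ldots,e_L)$ is a cycle on $G$, i.e. a sequence of directed edges $e_n=(v_n,v_{n+1})$ with $v_{L+1}=v_1$ ($e_n$ is the $n$-th step), such that: $c$ starts at the root ($v_1$ is the root); whenever $c$ visits a new vertex, it visits the leftmost unvisited child of its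 current position; $c$ visits all vertices of $G$; and, declaring the $n$-th step to be of color $\gamma(n)$, each edge of $G$ is visited by steps of a single color. Weights. For an edge $e$ of $G$, let $j(e)$ be the color of the steps on $e$ and $2k(e)$ the number of times $c$ visits $e$ (in both directions). Then $\omega_{HW}(G,c)=\prod_{e\text{ edge of }G}a_{j(e),k(e)}$. For a vertex $v$ of $G$, let $T_v$ be the following (cyclic) graph: its vertices are the edges of $G$ incident to $v$; for each $n\in\{1,\ldots,L\}$ such that the $n$-th step $e_n$ arrives at $v$, it has an edge, labelled $P_n(\mathbf y)$, from the undirected edge of $G$ underlying $e_n$ to the undirected edge of $G$ underlying $e_{n+1}$ (with $e_{L+1}=e_1$). Then $\omega_{TR}(G,c)=\prod_{v\text{ vertex of }G}\tau[T_v]$. *)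

theory Defs
  imports
    "HOL-Probability.Probability"
    "HOL-Library.Landau_Symbols"
    "HOL-Library.Poly_Mapping"
    "Graph_Theory.Digraph_Component"
    "Jordan_Normal_Form.Schur_Decomposition"
begin

text \<open>
  All index sets are zero-based: matrix indices range over \<open>{..<N}\<close>, the families \<open>X\<close> and \<open>Y\<close> are
  indexed by \<open>{..<p}\<close> and \<open>{..<q}\<close>, and the steps of a cycle of length \<open>L\<close> by \<open>{..<L}\<close>, the
  step after \<open>n\<close> being \<open>Suc n mod L\<close>. Sequences indexed by the matrix size \<open>N\<close> are only
  constrained for \<open>N \<ge> 1\<close>.
\<close>

section \<open>Noncommutative star-polynomials\<close>

datatype 'v star_letter = Plain 'v | Star 'v

datatype 'v star_word = Word (letters: "'v star_letter list")

text \<open>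
  Words form a monoid under concatenation, written additively, so that \<open>'v star_word \<Rightarrow>\<^sub>0 complex\<close>
  with the convolution product of \<open>Poly_Mapping\<close> is the algebra of noncommutative star-polynomials.
\<close>

instantiation star_word :: (type) monoid_add
begin

definition "0 = Word []"

definition "u + w = Word (letters u @ letters w)"

instance
  by standard (auto simp: zero_star_word_def plus_star_word_def)

end

type_synonym 'v star_poly = "'v star_word \<Rightarrow>\<^sub>0 complex"

definition poly_var :: "'v \<Rightarrow> 'v star_poly" where
  "poly_var v = Poly_Mapping.single (Word [Plain v]) 1"

definition poly_vars :: "'v star_poly \<Rightarrow> 'v set" where
  "poly_vars Q = (\<Union>w\<in>Poly_Mapping.keys Q. set_star_word w)"

definition poly_rename :: "('u \<Rightarrow> 'v) \<Rightarrow> 'u star_poly \<Rightarrow> 'v star_poly" where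
  "poly_rename f Q =
     (\<Sum>w\<in>Poly_Mapping.keys Q. Poly_Mapping.single (map_star_word f w) (Poly_Mapping.lookup Q w))"

fun letter_mat :: "('v \<Rightarrow> complex mat) \<Rightarrow> 'v star_letter \<Rightarrow> complex mat" where
  "letter_mat A (Plain v) = A v"
| "letter_mat A (Star v) = mat_adjoint (A v)"

definition word_mat :: "nat \<Rightarrow> ('v \<Rightarrow> complex mat) \<Rightarrow> 'v star_word \<Rightarrow> complex mat" where
  "word_mat N A w = foldr (\<lambda>l B. letter_mat A l * B) (letters w) (1\<^sub>m N)"

definition poly_mat :: "nat \<Rightarrow> ('v \<Rightarrow> complex mat) \<Rightarrow> 'v star_poly \<Rightarrow> complex mat" where
  "poly_mat N A Q = Matrix.mat N N
     (\<lambda>mn. \<Sum>w\<in>Poly_Mapping.keys Q. Poly_Mapping.lookup Q w * word_mat N A w $$ mn)"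


section \<open>Random matrices\<close>

definition random_matrix :: "'w measure \<Rightarrow> nat \<Rightarrow> ('w \<Rightarrow> complex mat) \<Rightarrow> bool" where
  "random_matrix M N A \<longleftrightarrow>
     (\<forall>\<omega>\<in>space M. A \<omega> \<in> carrier_mat N N) \<and>
     (\<forall>m<N. \<forall>n<N. (\<lambda>\<omega>. A \<omega> $$ (m, n)) \<in> borel_measurable M \<and>
        (\<forall>k::nat. integrable M (\<lambda>\<omega>. cmod (A \<omega> $$ (m, n)) ^ k)))"

text \<open>A finite family of random matrices as one random element of a product space; used to express
  independence.\<close>

definition entry_space :: "nat set \<Rightarrow> nat \<Rightarrow> (nat \<times> nat \<times> nat \<Rightarrow> complex) measure" where
  "entry_space I N = (\<Pi>\<^sub>M _ \<in> I \<times> {..<N} \<times> {..<N}. borel)"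

definition entries ::
  "nat set \<Rightarrow> nat \<Rightarrow> (nat \<Rightarrow> 'w \<Rightarrow> complex mat) \<Rightarrow> 'w \<Rightarrow> nat \<times> nat \<times> nat \<Rightarrow> complex" where
  "entries I N A \<omega> = (\<lambda>(i, m, n) \<in> I \<times> {..<N} \<times> {..<N}. A i \<omega> $$ (m, n))"

definition heavy_wigner ::
  "(nat \<Rightarrow> 'w measure) \<Rightarrow> (nat \<Rightarrow> 'w \<Rightarrow> complex mat) \<Rightarrow> (nat \<Rightarrow> real) \<Rightarrow> bool" where
  "heavy_wigner M X a \<longleftrightarrow>
     (\<exists>(\<mu> :: nat \<Rightarrow> complex measure) (\<nu> :: nat \<Rightarrow> real measure).
       (\<forall>N\<ge>1.
          random_matrix (M N) N (X N) \<and>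
          (AE \<omega> in M N. mat_adjoint (X N \<omega>) = X N \<omega>) \<and>
          prob_space.indep_vars (M N) (\<lambda>_. borel) (\<lambda>(m, n) \<omega>. X N \<omega> $$ (m, n))
            {(m, n). n \<le> m \<and> m < N} \<and>
          (\<forall>m<N. \<forall>n\<le>m. (\<integral>\<omega>. X N \<omega> $$ (m, n) \<partial>M N) = 0) \<and>
          prob_space (\<nu> N) \<and> sets (\<nu> N) = sets borel \<and>
          (\<forall>m<N. distr (M N) borel (\<lambda>\<omega>. complex_of_real (sqrt (real N)) * X N \<omega> $$ (m, m))
                  = distr (\<nu> N) borel complex_of_real) \<and>
          prob_space (\<mu> N) \<and> sets (\<mu> N) = sets borel \<and>
          (\<forall>m<N. \<forall>n<m. distr (M N) borel (\<lambda>\<omega>. complex_of_real (sqrt (real N)) * X N \<omega> $$ (m, n))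
                  = \<mu> N) \<and>
          distr (\<mu> N) borel cnj = \<mu> N \<and>
          (\<forall>k::nat. integrable (\<mu> N) (\<lambda>z. cmod z ^ k) \<and> integrable (\<nu> N) (\<lambda>t. \<bar>t\<bar> ^ k))) \<and>
       (\<forall>k\<ge>1.
          (\<lambda>N. (\<integral>z. cmod z ^ (2 * k) \<partial>\<mu> N) / real N ^ (k - 1)) \<longlonglongrightarrow> a k \<and>
          (\<lambda>N. (\<integral>t. t ^ (2 * k) \<partial>\<nu> N) / real N ^ (k - 1)) \<in> O(\<lambda>_. 1)))"

text \<open>The first summand of the variable type indexes the \<open>X\<close>'s, the second one the \<open>Y\<close>'s.\<close>

definition mean_trace ::
  "(nat \<Rightarrow> 'w measure) \<Rightarrow> (nat \<Rightarrow> nat \<Rightarrow> 'w \<Rightarrow> complex mat) \<Rightarrow> (nat \<Rightarrow> nat \<Rightarrow> 'w \<Rightarrow> complex mat)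
     \<Rightarrow> (nat + nat) star_poly \<Rightarrow> nat \<Rightarrow> complex" where
  "mean_trace M X Y Q N =
     (\<integral>\<omega>. (\<Sum>i<N. poly_mat N (case_sum (\<lambda>j. X N j \<omega>) (\<lambda>i. Y N i \<omega>)) Q $$ (i, i)) / of_nat N \<partial>M N)"

definition limit_distribution ::
  "(nat \<Rightarrow> 'w measure) \<Rightarrow> (nat \<Rightarrow> nat \<Rightarrow> 'w \<Rightarrow> complex mat) \<Rightarrow> (nat \<Rightarrow> nat \<Rightarrow> 'w \<Rightarrow> complex mat)
     \<Rightarrow> (nat + nat) star_poly \<Rightarrow> complex" where
  "limit_distribution M X Y Q = lim (mean_trace M X Y Q)"


section \<open>Test graphs\<close>

text \<open>
  A test graph is a directed multigraph together with a labelling of its arcs. A finite graph can be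
  relabelled to have natural numbers as vertices and arcs, so the conditions on \<open>Y\<close> below, which
  quantify over all test graphs, use this type only.
\<close>

type_synonym test_graph = "(nat, nat) pre_digraph \<times> (nat \<Rightarrow> nat star_letter)"

definition test_graphs :: "nat \<Rightarrow> test_graph set" where
  "test_graphs q = {(G, l). fin_digraph G \<and> Digraph_Component.connected G \<and>
     (\<forall>e\<in>arcs G. set_star_letter (l e) \<subseteq> {..<q})}"

definition cyclic :: "('v, 'e) pre_digraph \<Rightarrow> bool" where
  "cyclic G \<longleftrightarrow> (\<exists>u es. pre_digraph.trail G u es u \<and> set es = arcs G)"

definition graph_trace :: "nat \<Rightarrow> ('v, 'e) pre_digraph \<Rightarrow> ('e \<Rightarrow> complex mat) \<Rightarrow> complex" where
  "graph_trace N G A =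
     (\<Sum>\<phi>\<in>verts G \<rightarrow>\<^sub>E {..<N}. \<Prod>e\<in>arcs G. A e $$ (\<phi> (tail G e), \<phi> (head G e))) / of_nat N"

definition inj_graph_trace :: "nat \<Rightarrow> ('v, 'e) pre_digraph \<Rightarrow> ('e \<Rightarrow> complex mat) \<Rightarrow> complex" where
  "inj_graph_trace N G A =
     (\<Sum>\<phi>\<in>{\<phi> \<in> verts G \<rightarrow>\<^sub>E {..<N}. inj_on \<phi> (verts G)}.
        \<Prod>e\<in>arcs G. A e $$ (\<phi> (tail G e), \<phi> (head G e))) / of_nat N"

definition test_trace :: "nat \<Rightarrow> (nat \<Rightarrow> complex mat) \<Rightarrow> test_graph \<Rightarrow> complex" where
  "test_trace N A T = inj_graph_trace N (fst T) (\<lambda>e. letter_mat A (snd T e))"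

definition limit_trace ::
  "(nat \<Rightarrow> 'w measure) \<Rightarrow> (nat \<Rightarrow> nat \<Rightarrow> 'w \<Rightarrow> complex mat)
     \<Rightarrow> ('v, 'e) pre_digraph \<Rightarrow> ('e \<Rightarrow> nat star_poly) \<Rightarrow> complex" where
  "limit_trace M Y G Q =
     lim (\<lambda>N. \<integral>\<omega>. graph_trace N G (\<lambda>e. poly_mat N (\<lambda>i. Y N i \<omega>) (Q e)) \<partial>M N)"

definition cutting_edges :: "('v, 'e) pre_digraph \<Rightarrow> 'e set" where
  "cutting_edges G = {e \<in> arcs G. \<not> Digraph_Component.connected (pre_digraph.del_arc G e)}"

definition two_edge_components :: "('v, 'e) pre_digraph \<Rightarrow> ('v, 'e) pre_digraph set" where
  "two_edge_components G =
     {C. pre_digraph.max_subgraph G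
           (\<lambda>H. Digraph_Component.connected H \<and> cutting_edges H = {}) C}"

text \<open>The orientation that the component tree inherits from the graph plays no role: its degrees are
  taken in the undirected sense.\<close>

definition component_tree ::
  "('v, 'e) pre_digraph \<Rightarrow> (('v, 'e) pre_digraph, 'e) pre_digraph" where
  "component_tree G =
     \<lparr> verts = two_edge_components G, arcs = cutting_edges G,
       tail = (\<lambda>e. THE C. C \<in> two_edge_components G \<and> tail G e \<in> verts C),
       head = (\<lambda>e. THE C. C \<in> two_edge_components G \<and> head G e \<in> verts C) \<rparr>"

definition num_leaves :: "('v, 'e) pre_digraph \<Rightarrow> nat" where
  "num_leaves G =
     (if card (verts (component_tree G)) = 1 then 2
      else card {C \<in> verts (component_tree G).
                   in_degree (component_tree G) C + out_degree (component_tree G) C = 1})"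

definition traces_converge ::
  "nat \<Rightarrow> (nat \<Rightarrow> 'w measure) \<Rightarrow> (nat \<Rightarrow> nat \<Rightarrow> 'w \<Rightarrow> complex mat) \<Rightarrow> bool" where
  "traces_converge q M Y \<longleftrightarrow>
     (\<forall>T\<in>test_graphs q. cyclic (fst T) \<longrightarrow>
        convergent (\<lambda>N. \<integral>\<omega>. test_trace N (\<lambda>i. Y N i \<omega>) T \<partial>M N))"

definition traces_factorize ::
  "nat \<Rightarrow> (nat \<Rightarrow> 'w measure) \<Rightarrow> (nat \<Rightarrow> nat \<Rightarrow> 'w \<Rightarrow> complex mat) \<Rightarrow> bool" where
  "traces_factorize q M Y \<longleftrightarrow>
     (\<forall>Ts. (\<forall>T\<in>set Ts. T \<in> test_graphs q \<and> cyclic (fst T)) \<longrightarrow>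
        (\<lambda>N. (\<integral>\<omega>. (\<Prod>T\<leftarrow>Ts. test_trace N (\<lambda>i. Y N i \<omega>) T) \<partial>M N)
             - (\<Prod>T\<leftarrow>Ts. \<integral>\<omega>. test_trace N (\<lambda>i. Y N i \<omega>) T \<partial>M N)) \<longlonglongrightarrow> 0)"

definition traces_bounded ::
  "nat \<Rightarrow> (nat \<Rightarrow> 'w measure) \<Rightarrow> (nat \<Rightarrow> nat \<Rightarrow> 'w \<Rightarrow> complex mat) \<Rightarrow> bool" where
  "traces_bounded q M Y \<longleftrightarrow>
     (\<forall>Ts. set Ts \<subseteq> test_graphs q \<longrightarrow>
        (\<lambda>N. cmod (\<integral>\<omega>. (\<Prod>T\<leftarrow>Ts. test_trace N (\<lambda>i. Y N i \<omega>) T) \<partial>M N))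
          \<in> O(\<lambda>N. real N powr (\<Sum>T\<leftarrow>Ts. real (num_leaves (fst T)) / 2 - 1)))"


section \<open>Coloured cycles on rooted plane trees\<close>

text \<open>
  A rooted plane tree is represented by its set of vertices in Ulam-Harris notation: the root is
  \<open>[]\<close> and \<open>u @ [i]\<close> is the child number \<open>i\<close> of \<open>u\<close>, counted from the left. Each isomorphism class
  of rooted plane trees is represented exactly once.
\<close>

definition plane_tree :: "nat list set \<Rightarrow> bool" where
  "plane_tree G \<longleftrightarrow> finite G \<and> [] \<in> G \<and> (\<forall>u i. u @ [i] \<in> G \<longrightarrow> u \<in> G \<and> (\<forall>j<i. u @ [j] \<in> G))"

definition tree_edges :: "nat list set \<Rightarrow> nat list set set" where
  "tree_edges G = {{u, u @ [i]} | u i. u @ [i] \<in> G}"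

type_synonym walk = "(nat list \<times> nat list) list"

definition undirected :: "walk \<Rightarrow> nat \<Rightarrow> nat list set" where
  "undirected c n = {fst (c ! n), snd (c ! n)}"

definition visited :: "walk \<Rightarrow> nat \<Rightarrow> nat list set" where
  "visited c n = {fst (c ! m) | m. m \<le> n}"

definition plane_cycles :: "nat \<Rightarrow> (nat \<Rightarrow> nat) \<Rightarrow> (nat list set \<times> walk) set" where
  "plane_cycles L \<gamma> = {(G, c).
     plane_tree G \<and> card (tree_edges G) \<le> L div 2 \<and>
     length c = L \<and>
     (\<forall>n<L. undirected c n \<in> tree_edges G) \<and>
     (\<forall>n<L. snd (c ! n) = fst (c ! (Suc n mod L))) \<and>
     fst (c ! 0) = [] \<and>
     (\<forall>n<L. snd (c ! n) \<notin> visited c n \<longrightarrow>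
        (\<exists>i. snd (c ! n) = fst (c ! n) @ [i] \<and> (\<forall>j<i. fst (c ! n) @ [j] \<in> visited c n))) \<and>
     (\<forall>v\<in>G. \<exists>n<L. fst (c ! n) = v) \<and>
     (\<forall>n<L. \<forall>m<L. undirected c n = undirected c m \<longrightarrow> \<gamma> n = \<gamma> m)}"

definition edge_color :: "nat \<Rightarrow> (nat \<Rightarrow> nat) \<Rightarrow> walk \<Rightarrow> nat list set \<Rightarrow> nat" where
  "edge_color L \<gamma> c e = (THE j. \<exists>n<L. undirected c n = e \<and> \<gamma> n = j)"

text \<open>The number of visits is even, since \<open>c\<close> is a closed walk on a tree.\<close>

definition half_visits :: "nat \<Rightarrow> walk \<Rightarrow> nat list set \<Rightarrow> nat" where
  "half_visits L c e = card {n. n < L \<and> undirected c n = e} div 2"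

definition weight_HW ::
  "(nat \<Rightarrow> nat \<Rightarrow> real) \<Rightarrow> nat \<Rightarrow> (nat \<Rightarrow> nat) \<Rightarrow> nat list set \<Rightarrow> walk \<Rightarrow> real" where
  "weight_HW a L \<gamma> G c = (\<Prod>e\<in>tree_edges G. a (edge_color L \<gamma> c e) (half_visits L c e))"

definition vertex_graph ::
  "nat \<Rightarrow> nat list set \<Rightarrow> walk \<Rightarrow> nat list \<Rightarrow> (nat list set, nat) pre_digraph" where
  "vertex_graph L G c v =
     \<lparr> verts = {e \<in> tree_edges G. v \<in> e}, arcs = {n. n < L \<and> snd (c ! n) = v},
       tail = undirected c, head = (\<lambda>n. undirected c (Suc n mod L)) \<rparr>"

definition weight_TR ::
  "(nat \<Rightarrow> 'w measure) \<Rightarrow> (nat \<Rightarrow> nat \<Rightarrow> 'w \<Rightarrow> complex mat) \<Rightarrow> (nat \<Rightarrow> nat star_poly)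
     \<Rightarrow> nat \<Rightarrow> nat list set \<Rightarrow> walk \<Rightarrow> complex" where
  "weight_TR M Y P L G c = (\<Prod>v\<in>G. limit_trace M Y (vertex_graph L G c v) P)"

end

theory Submission
  imports Defs "Graph_Theory.Euler"
begin

text \<open>
  Expanding the polynomials into words turns the normalised trace into a sum over maps from the
  positions around a closed walk to matrix indices, which is grouped according to the kernel \<open>\<rho>\<close> of
  the map. By independence the contribution of \<open>\<rho>\<close> is a Wigner weight times the expectation of an
  injective sum over the \<open>Y\<close>-arcs. If the \<open>X\<close>-arcs form \<open>E\<close> classes (pairs of a colour and an
  undirected edge), the weight is of order \<open>N ^ -E\<close>, it vanishes if some class is a singleton, and the
  graph of the \<open>Y\<close>-arcs has at most \<open>E + 1\<close> components, since the classes connect them. If there are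
  at most \<open>E\<close> components, counting leaves gives \<open>\<Sum> r(T\<^sub>i) \<le> 2 E\<close>, so Assumption 3 makes the
  contribution negligible. If there are \<open>E + 1\<close>, components and classes form a tree; every class is
  traversed equally often in both directions, hence the components are cyclic and Assumptions 1 and 2
  give the limit. The tree-like kernels fall into fibres indexed by the plane cycles \<open>(G, c)\<close>: the
  vertices of \<open>G\<close> are the components and its edges are the classes. Summing over a fibre turns
  injective sums back into free sums, and these factorise over the vertices of \<open>G\<close> into the
  \<open>\<tau>[T\<^sub>v]\<close>.
\<close>

section \<open>Two-edge connected components\<close>

text \<open>The obstacle that shapes the proof: Assumptions 1 to 3 control sums that are injective
  on one connected graph, while the contribution of a kernel asks for indices that differ between
  components as well. A product of injective sums over the components is the wanted sum plus the
  sums of kernels that merge vertices of different components. Every merge lowers the number of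
  components, so an induction on this number disposes of the corrections, none of which reaches the
  maximal count \<open>E + 1\<close>. The limits of the tree terms are never computed. Only their
  existence is needed, because the same limits reappear when a product of free traces is expanded
  over coarser kernels, and the formula comes from comparing the two expansions. Equality of
  partitions is obtained by counting: an inclusion of equivalence relations with equally many
  classes is an equality. The bound on the leaves is a parity argument, since a closed walk crosses
  every cut an even number of times. Polynomials are reduced to words by multilinearity, in the
  trace as well as in the weights.\<close>

definition crossing :: "('v, 'e) pre_digraph \<Rightarrow> 'v set \<Rightarrow> 'e set" where
  "crossing H S = {e \<in> arcs H. (tail H e \<in> S) \<noteq> (head H e \<in> S)}"

text \<open>If \<open>v\<close> is not reachable from \<open>u\<close>, the set reachable from
  \<open>u\<close> is a nontrivial cut that no arc crosses; conversely, an uncrossed cut traps every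
  path. Connectivity is handled through cuts below because they are insensitive to
  orientation.\<close>

lemma connected_iff_crossing:
  assumes "wf_digraph H"
  shows "Digraph_Component.connected H \<longleftrightarrow> verts H \<noteq> {} \<and>
    (\<forall>S. S \<inter> verts H \<noteq> {} \<longrightarrow> verts H - S \<noteq> {} \<longrightarrow> crossing H S \<noteq> {})"
proof -
  interpret wf_digraph H by fact
  let ?r = "(arcs_ends H)\<^sup>s"
  have sym: "(a, b) \<in> ?r \<longleftrightarrow> (\<exists>e\<in>arcs H. (tail H e = a \<and> head H e = b) \<or> (tail H e = b \<and> head H e = a))" for a b
    by (auto simp: symcl_def arcs_ends_def arc_to_ends_def)
  show ?thesis
  proof (intro iffI conjI allI impI)
    assume "Digraph_Component.connected H"
    then show "verts H \<noteq> {}" by (simp add: connected_conv)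
  next
    fix S assume c: "Digraph_Component.connected H" and S: "S \<inter> verts H \<noteq> {}" "verts H - S \<noteq> {}"
    then obtain u v where uv: "u \<in> S" "u \<in> verts H" "v \<in> verts H" "v \<notin> S" by auto
    then have "(u, v) \<in> rtrancl_on (verts H) ?r" using c by (simp add: connected_conv)
    then show "crossing H S \<noteq> {}"
    proof (rule contrapos_pp)
      assume n: "\<not> crossing H S \<noteq> {}"
      have "w \<in> S" if "(u, w) \<in> rtrancl_on (verts H) ?r" for w
        using that
      proof (induction rule: rtrancl_on_induct)
        case base then show ?case using uv by simp
      next
        case (step y z)
        then show ?case using n unfolding crossing_def sym by auto
      qed
      then show "(u, v) \<notin> rtrancl_on (verts H) ?r" using uv by auto
    qed
  next
    assume a: "verts H \<noteq> {} \<and> (\<forall>S. S \<inter> verts H \<noteq> {} \<longrightarrow> verts H - S \<noteq> {} \<longrightarrow> crossing H S \<noteq> {})"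
    have "(u, v) \<in> rtrancl_on (verts H) ?r" if uv: "u \<in> verts H" "v \<in> verts H" for u v
    proof (rule ccontr)
      assume n: "(u, v) \<notin> rtrancl_on (verts H) ?r"
      define S where "S = {w. (u, w) \<in> rtrancl_on (verts H) ?r}"
      have "u \<in> S" using uv by (simp add: S_def)
      then have "S \<inter> verts H \<noteq> {}" "verts H - S \<noteq> {}" using uv n by (auto simp: S_def)
      then have "crossing H S \<noteq> {}" using a by simp
      then obtain e where e: "e \<in> arcs H" "(tail H e \<in> S) \<noteq> (head H e \<in> S)"
        by (auto simp: crossing_def)
      have "head H e \<in> S" if "tail H e \<in> S"
        using that e(1) unfolding S_def mem_Collect_eq
        by (rule_tac rtrancl_on_into_rtrancl_on) (auto simp: sym)
      moreover have "tail H e \<in> S" if "head H e \<in> S"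
        using that e(1) unfolding S_def mem_Collect_eq
        by (rule_tac rtrancl_on_into_rtrancl_on) (auto simp: sym)
      ultimately show False using e by blast
    qed
    then show "Digraph_Component.connected H" using a by (simp add: connected_conv)
  qed
qed

abbreviation two_edge_connected :: "('v, 'e) pre_digraph \<Rightarrow> bool" where
  "two_edge_connected H \<equiv> Digraph_Component.connected H \<and> cutting_edges H = {}"

text \<open>Deleting an arc removes it from every cut and changes nothing else, so connectedness
  after each deletion means that no cut consists of a single arc.\<close>

lemma two_edge_connected_iff_crossing:
  assumes "wf_digraph H"
  shows "two_edge_connected H \<longleftrightarrow> verts H \<noteq> {} \<and>
    (\<forall>S. S \<inter> verts H \<noteq> {} \<longrightarrow> verts H - S \<noteq> {} \<longrightarrow>
       (\<exists>e\<in>crossing H S. \<exists>f\<in>crossing H S. e \<noteq> f))"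
proof -
  have wd: "wf_digraph (pre_digraph.del_arc H e)" for e
    using assms by (rule wf_digraph.wf_digraph_del_arc)
  have cd: "crossing (pre_digraph.del_arc H e) S = crossing H S - {e}" for e S
    by (auto simp: crossing_def pre_digraph.del_arc_def)
  have vd: "verts (pre_digraph.del_arc H e) = verts H" for e
    by (simp add: pre_digraph.del_arc_def)
  show ?thesis
  proof (intro iffI conjI allI impI)
    assume a: "two_edge_connected H"
    then show "verts H \<noteq> {}" by (simp add: connected_conv)
    fix S assume S: "S \<inter> verts H \<noteq> {}" "verts H - S \<noteq> {}"
    then obtain e where e: "e \<in> crossing H S"
      using a by (auto simp: connected_iff_crossing[OF assms])
    then have "e \<in> arcs H" by (simp add: crossing_def)
    then have "Digraph_Component.connected (pre_digraph.del_arc H e)"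
      using a by (auto simp: cutting_edges_def)
    then have "crossing H S - {e} \<noteq> {}"
      using S unfolding connected_iff_crossing[OF wd] cd vd by blast
    then show "\<exists>e\<in>crossing H S. \<exists>f\<in>crossing H S. e \<noteq> f" using e by blast
  next
    assume a: "verts H \<noteq> {} \<and> (\<forall>S. S \<inter> verts H \<noteq> {} \<longrightarrow> verts H - S \<noteq> {} \<longrightarrow>
       (\<exists>e\<in>crossing H S. \<exists>f\<in>crossing H S. e \<noteq> f))"
    then show "Digraph_Component.connected H"
      unfolding connected_iff_crossing[OF assms] by blast
    have "Digraph_Component.connected (pre_digraph.del_arc H e)" for e
      unfolding connected_iff_crossing[OF wd] cd vd using a by blast
    then show "cutting_edges H = {}" by (simp add: cutting_edges_def)
  qed
qed

lemma two_edge_components_subgraph: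
  "D \<in> two_edge_components G \<Longrightarrow> subgraph D G \<and> two_edge_connected D"
  by (auto simp: two_edge_components_def pre_digraph.max_subgraph_def)

lemma two_edge_components_maximal:
  assumes "D \<in> two_edge_components G" "subgraph D D'" "subgraph D' G" "two_edge_connected D'"
  shows "D' = D"
  using assms by (auto simp: two_edge_components_def pre_digraph.max_subgraph_def)

text \<open>A cut of the union of two components that share \<open>v\<close> separates
  \<open>v\<close> from a vertex of one of them. It therefore cuts that component and is crossed
  twice. So the union is two-edge connected, and by maximality it equals both.\<close>

lemma two_edge_components_disjoint:
  assumes "D\<^sub>1 \<in> two_edge_components G" "D\<^sub>2 \<in> two_edge_components G"
    and v: "v \<in> verts D\<^sub>1" "v \<in> verts D\<^sub>2"
  shows "D\<^sub>1 = D\<^sub>2"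
proof -
  note sub = two_edge_components_subgraph[OF assms(1)] two_edge_components_subgraph[OF assms(2)]
  define U where "U = \<lparr>verts = verts D\<^sub>1 \<union> verts D\<^sub>2, arcs = arcs D\<^sub>1 \<union> arcs D\<^sub>2, tail = tail G, head = head G\<rparr>"
  have wf: "wf_digraph G" "wf_digraph D\<^sub>1" "wf_digraph D\<^sub>2" using sub by (auto simp: subgraph_def)
  have th: "tail D\<^sub>1 = tail G" "head D\<^sub>1 = head G" "tail D\<^sub>2 = tail G" "head D\<^sub>2 = head G"
    using sub by (auto simp: subgraph_def compatible_def)
  have wfU: "wf_digraph U"
    using wf th by (auto simp: wf_digraph_def U_def)
  have s: "subgraph D\<^sub>1 U" "subgraph D\<^sub>2 U" "subgraph U G"
    using sub wfU th by (auto simp: subgraph_def U_def compatible_def)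
  have "two_edge_connected U"
    unfolding two_edge_connected_iff_crossing[OF wfU]
  proof (intro conjI allI impI)
    show "verts U \<noteq> {}" using v by (auto simp: U_def)
    fix S assume S: "S \<inter> verts U \<noteq> {}" "verts U - S \<noteq> {}"
    have cr: "crossing D\<^sub>1 S \<subseteq> crossing U S" "crossing D\<^sub>2 S \<subseteq> crossing U S"
      by (auto simp: crossing_def U_def th)
    have "(S \<inter> verts D\<^sub>1 \<noteq> {} \<and> verts D\<^sub>1 - S \<noteq> {}) \<or> (S \<inter> verts D\<^sub>2 \<noteq> {} \<and> verts D\<^sub>2 - S \<noteq> {})"
      using S v unfolding U_def by (cases "v \<in> S") auto
    moreover have "\<exists>e\<in>crossing D\<^sub>1 S. \<exists>f\<in>crossing D\<^sub>1 S. e \<noteq> f"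
      if "S \<inter> verts D\<^sub>1 \<noteq> {}" "verts D\<^sub>1 - S \<noteq> {}"
      using sub(1) that unfolding two_edge_connected_iff_crossing[OF wf(2)] by simp
    moreover have "\<exists>e\<in>crossing D\<^sub>2 S. \<exists>f\<in>crossing D\<^sub>2 S. e \<noteq> f"
      if "S \<inter> verts D\<^sub>2 \<noteq> {}" "verts D\<^sub>2 - S \<noteq> {}"
      using sub(2) that unfolding two_edge_connected_iff_crossing[OF wf(3)] by simp
    ultimately show "\<exists>e\<in>crossing U S. \<exists>f\<in>crossing U S. e \<noteq> f"
      using cr by blast
  qed
  then have "U = D\<^sub>1" "U = D\<^sub>2"
    using two_edge_components_maximal[OF assms(1) s(1) s(3)]
      two_edge_components_maximal[OF assms(2) s(2) s(3)] by blast+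
  then show ?thesis by (rule subst)
qed

text \<open>If \<open>e\<close> were not cutting, a shortest path back to \<open>D\<close> avoiding \<open>e\<close> would form, together
  with \<open>e\<close>, an ear that can be added to the component \<open>D\<close>.\<close>

lemma crossing_two_edge_component_cutting:
  assumes G: "wf_digraph G" and D: "D \<in> two_edge_components G"
    and e: "e \<in> crossing G (verts D)"
  shows "e \<in> cutting_edges G"
proof (rule ccontr)
  assume "e \<notin> cutting_edges G"
  moreover have eG: "e \<in> arcs G" using e by (simp add: crossing_def)
  ultimately have con: "Digraph_Component.connected (pre_digraph.del_arc G e)"
    by (simp add: cutting_edges_def)
  interpret wf_digraph G by fact
  have subD: "subgraph D G" "two_edge_connected D" using two_edge_components_subgraph[OF D] by auto
  then have wfD: "wf_digraph D" and thD: "tail D = tail G" "head D = head G"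
    and arcsD: "arcs D \<subseteq> arcs G" and vertsD: "verts D \<subseteq> verts G"
    by (auto simp: subgraph_def compatible_def)
  obtain u x where ux: "u \<in> verts D" "x \<notin> verts D" "x \<in> verts G" "{tail G e, head G e} = {u, x}"
  proof (cases "tail G e \<in> verts D")
    case True
    then show ?thesis using e eG that[of "tail G e" "head G e"] by (auto simp: crossing_def)
  next
    case False
    then show ?thesis using e eG that[of "head G e" "tail G e"] by (auto simp: crossing_def)
  qed
  define r where "r = {(a, b). \<exists>f\<in>arcs G - {e}. {tail G f, head G f} = {a, b}}"
  have "(x, u) \<in> r\<^sup>*"
  proof -
    have "(x, u) \<in> rtrancl_on (verts (pre_digraph.del_arc G e)) ((arcs_ends (pre_digraph.del_arc G e))\<^sup>s)"
      using con ux vertsD by (auto simp: connected_conv)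
    then show ?thesis
    proof (induction rule: rtrancl_on_induct)
      case (step y z)
      then have "(y, z) \<in> r" 
        by (auto simp: r_def symcl_def arcs_ends_def arc_to_ends_def pre_digraph.del_arc_def)
      then show ?case using step by simp
    qed simp
  qed
  then obtain n0 p0 where p0: "p0 0 = x" "p0 n0 = u" "\<And>i. i < n0 \<Longrightarrow> (p0 i, p0 (Suc i)) \<in> r"
    unfolding rtrancl_power relpow_fun_conv by blast
  \<comment> \<open>\<open>n\<close> will be the least length of a walk from \<open>x\<close> to
    \<open>D\<close> that avoids \<open>e\<close>; minimality makes the walk simple and keeps it
    outside \<open>D\<close> before its last vertex.\<close>
  define Q where "Q n \<longleftrightarrow> (\<exists>p. p 0 = x \<and> p n \<in> verts D \<and> (\<forall>i<n. (p i, p (Suc i)) \<in> r))" for n :: nat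
  have "Q n0" unfolding Q_def using p0 ux by blast
  define n where "n = (LEAST n. Q n)"
  have "Q n" unfolding n_def by (rule LeastI) fact
  have min: "n \<le> m" if "Q m" for m unfolding n_def using that by (rule Least_le)
  obtain p where p: "p 0 = x" "p n \<in> verts D" "\<And>i. i < n \<Longrightarrow> (p i, p (Suc i)) \<in> r"
    using \<open>Q n\<close> unfolding Q_def by blast
  have inj: "p i \<noteq> p j" if "i < j" "j \<le> n" for i j
  proof
    assume eq: "p i = p j"
    \<comment> \<open>Cutting out the loop between \<open>i\<close> and \<open>j\<close> gives a
      shorter walk.\<close>
    define p' where "p' k = (if k \<le> i then p k else p (k + (j - i)))" for k
    have "Q (n - (j - i))"
      unfolding Q_def
    proof (intro exI[of _ p'] conjI allI impI)
      show "p' 0 = x" using p by (simp add: p'_def)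
      have "p' (n - (j - i)) = p n"
      proof (cases "n = j")
        case True then show ?thesis using that eq by (simp add: p'_def)
      next
        case False
        then have "n - (j - i) > i" "n - (j - i) + (j - i) = n" using that by auto
        then show ?thesis unfolding p'_def by simp
      qed
      then show "p' (n - (j - i)) \<in> verts D" using p by simp
      fix k assume k: "k < n - (j - i)"
      consider "k < i" | "k = i" | "k > i" by linarith
      then show "(p' k, p' (Suc k)) \<in> r"
      proof cases
        case 1 then show ?thesis using p(3)[of k] k by (simp add: p'_def)
      next
        case 2
        then have "Suc i + (j - i) = Suc j" "j < n" using that k by auto
        then show ?thesis using p(3)[of j] eq 2 by (simp add: p'_def)
      next
        case 3
        then show ?thesis using p(3)[of "k + (j - i)"] k by (simp add: p'_def)
      qed
    qed
    then have "n \<le> n - (j - i)" by (rule min)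
    then show False using that by simp
  qed
  have pD: "p i \<notin> verts D" if "i < n" for i
  proof
    assume "p i \<in> verts D"
    then have "Q i" unfolding Q_def using p that by (intro exI[of _ p]) auto
    then show False using min[of i] that by simp
  qed
  have n: "n > 0" using p ux by (metis gr0I)
  \<comment> \<open>The arc \<open>f j\<close> leads along the ear to \<open>p j\<close>; index 0 is
    \<open>e\<close> itself, which joins \<open>u\<close> to \<open>p 0 = x\<close>.\<close>
  define f where "f j = (if j = 0 then e else SOME f. f \<in> arcs G - {e} \<and> {tail G f, head G f} = {p (j - 1), p j})" for j
  have f: "f j \<in> arcs G - {e} \<and> {tail G (f j), head G (f j)} = {p (j - 1), p j}" if "0 < j" "j \<le> n" for j
  proof -
    have "\<exists>f. f \<in> arcs G - {e} \<and> {tail G f, head G f} = {p (j - 1), p j}"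
    proof -
      have "j - 1 < n" "Suc (j - 1) = j" using that by auto
      then show ?thesis using p(3)[of "j - 1"] by (auto simp: r_def)
    qed
    then have "(SOME f. f \<in> arcs G - {e} \<and> {tail G f, head G f} = {p (j - 1), p j}) \<in> arcs G - {e} \<and>
      {tail G (SOME f. f \<in> arcs G - {e} \<and> {tail G f, head G f} = {p (j - 1), p j}),
       head G (SOME f. f \<in> arcs G - {e} \<and> {tail G f, head G f} = {p (j - 1), p j})} = {p (j - 1), p j}"
      by (rule someI_ex)
    then show ?thesis using that(1) by (simp only: f_def if_False less_not_refl2[OF that(1)])
  qed
  \<comment> \<open>The vertices of the whole ear, shifted by one to make room for \<open>u\<close>:
    both \<open>s 0 = u\<close> and \<open>s (Suc n) = p n\<close> lie in \<open>D\<close>.\<close>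
  define s where "s j = (if j = 0 then u else p (j - 1))" for j
  have fs: "f j \<in> arcs G \<and> {tail G (f j), head G (f j)} = {s j, s (Suc j)}" if "j \<le> n" for j
    using f[of j] that ux eG p by (cases "j = 0") (auto simp: s_def f_def)
  have fdist: "f i \<noteq> f j" if "i < j" "j \<le> n" for i j
  proof (cases "i = 0")
    case True then show ?thesis using f[of j] that by (auto simp: f_def)
  next
    case False
    have "p j \<noteq> p i" "p j \<noteq> p (i - 1)" using inj[of i j] inj[of "i - 1" j] that by fastforce+
    then have "{p (i - 1), p i} \<noteq> {p (j - 1), p j}" by blast
    then show ?thesis using f[of i] f[of j] that False by auto
  qed
  define W where "W = verts D \<union> p ` {..n}"
  have sW: "s j \<in> W" if "j \<le> Suc n" for j
    using that ux by (auto simp: s_def W_def)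
  have WG: "W \<subseteq> verts G"
  proof -
    have "s (Suc j) \<in> verts G" if "j \<le> n" for j
    proof -
      have "tail G (f j) \<in> verts G" "head G (f j) \<in> verts G" using fs[OF that] by auto
      then show ?thesis using fs[OF that] by (metis insertCI insertE singletonD)
    qed
    then show ?thesis using vertsD by (auto simp: W_def s_def)
  qed
  \<comment> \<open>The induced subgraph may have more arcs than \<open>D\<close> and the ear
    together; this is harmless, since further arcs only enlarge cuts.\<close>
  define D' where "D' = G \<restriction> W"
  have wfD': "wf_digraph D'" unfolding D'_def by (rule wellformed_induce_subgraph)
  have "subgraph D' G" unfolding D'_def using WG by (rule subgraph_induce_subgraphI)
  have arcsDW: "arcs D \<subseteq> arcs D'"
    using arcsD wf_digraph.tail_in_verts[OF wfD] wf_digraph.head_in_verts[OF wfD] thD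
    by (auto simp: D'_def induce_subgraph_def W_def)
  have vD': "verts D' = W" by (simp add: D'_def induce_subgraph_def)
  have "subgraph D D'"
    using arcsDW wfD wfD' thD unfolding subgraph_def compatible_def
    by (auto simp: D'_def induce_subgraph_def W_def)
  have fD': "f j \<in> crossing D' S" if "j \<le> n" "(s j \<in> S) \<noteq> (s (Suc j) \<in> S)" for j S
  proof -
    have eq: "{tail G (f j), head G (f j)} = {s j, s (Suc j)}" and A: "f j \<in> arcs G" using fs[OF that(1)] by auto
    have "s j \<in> W" "s (Suc j) \<in> W" using sW that by auto
    then have "tail G (f j) \<in> W" "head G (f j) \<in> W" "(tail G (f j) \<in> S) \<noteq> (head G (f j) \<in> S)"
      using eq that(2) by (auto simp: doubleton_eq_iff)
    then show ?thesis using A by (auto simp: crossing_def D'_def induce_subgraph_def)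
  qed
  have "two_edge_connected D'"
    unfolding two_edge_connected_iff_crossing[OF wfD'] vD'
  proof (intro conjI allI impI)
    show "W \<noteq> {}" using ux by (auto simp: W_def)
    fix S assume S: "S \<inter> W \<noteq> {}" "W - S \<noteq> {}"
    show "\<exists>e\<in>crossing D' S. \<exists>f\<in>crossing D' S. e \<noteq> f"
    proof (cases "S \<inter> verts D \<noteq> {} \<and> verts D - S \<noteq> {}")
      case True
      have "crossing D S \<subseteq> crossing D' S"
        using arcsDW by (auto simp: crossing_def thD D'_def induce_subgraph_def)
      moreover have "\<exists>e\<in>crossing D S. \<exists>f\<in>crossing D S. e \<noteq> f"
        using True subD(2) unfolding two_edge_connected_iff_crossing[OF wfD] by simp
      ultimately show ?thesis by blast
    next
      case False
      then have DS: "(v \<in> S) = (u \<in> S)" if "v \<in> verts D" for v using that ux by auto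
      obtain w where w: "w \<in> W" "(w \<in> S) \<noteq> (u \<in> S)" using S by blast
      then obtain i where i: "i \<le> n" "w = p i" using DS by (auto simp: W_def)
      let ?b = "u \<in> S"
      \<comment> \<open>The ear starts and ends on the side of \<open>D\<close> but visits the other
        side at \<open>w\<close>, so it crosses the cut once before \<open>w\<close> and once after
        it.\<close>
      have m: "(s 0 \<in> S) = ?b" "(s (Suc i) \<in> S) \<noteq> ?b" "(s (Suc n) \<in> S) = ?b"
        using i w DS p by (auto simp: s_def)
      have up: "\<exists>j<b. (s j \<in> S) = ?b \<and> (s (Suc j) \<in> S) \<noteq> ?b" if "(s b \<in> S) \<noteq> ?b" for b
        using that
      proof (induction b)
        case 0 then show ?case using m by simp
      next
        case (Suc b)
        then show ?case by (metis less_Suc_eq)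
      qed
      have dn: "\<exists>j\<ge>Suc i. j < b \<and> (s j \<in> S) \<noteq> ?b \<and> (s (Suc j) \<in> S) = ?b"
        if "(s b \<in> S) = ?b" "b \<ge> Suc i" for b
        using that
      proof (induction b)
        case (Suc b)
        show ?case
        proof (cases "(s b \<in> S) = ?b")
          case True
          then have "b \<ge> Suc i" using Suc m by (metis le_Suc_eq)
          then show ?thesis using Suc True by (meson less_Suc_eq)
        next
          case False
          moreover have "b \<ge> Suc i" using Suc m by (metis le_Suc_eq)
          ultimately show ?thesis using Suc by blast
        qed
      qed simp
      obtain j1 where j1: "j1 < Suc i" "(s j1 \<in> S) \<noteq> (s (Suc j1) \<in> S)" using up[OF m(2)] by auto
      obtain j2 where j2: "j2 \<ge> Suc i" "j2 < Suc n" "(s j2 \<in> S) \<noteq> (s (Suc j2) \<in> S)" using dn[OF m(3)] i by auto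
      show ?thesis
        using fD'[of j1 S] fD'[of j2 S] fdist[of j1 j2] j1 j2 i
        by (intro bexI[of _ "f j1"] bexI[of _ "f j2"]) auto
    qed
  qed
  then have "D' = D"
    using two_edge_components_maximal[OF D \<open>subgraph D D'\<close> \<open>subgraph D' G\<close>] by blast
  moreover have "x \<in> W" using p by (force simp: W_def)
  ultimately show False using vD' ux by simp
qed

text \<open>The form in which leaves are used: disjoint vertex sets, each left by exactly one arc.
  Every arc leaving a two-edge connected component is cutting, hence an edge of the component tree
  at this component. A leaf has only one of these, and connectedness provides at least one.\<close>

lemma num_leaves_cases:
  assumes "fin_digraph G" "Digraph_Component.connected G"
  obtains "num_leaves G = 2"
  | \<D> where "finite \<D>" "card \<D> = num_leaves G" "disjoint \<D>"
      "\<And>D. D \<in> \<D> \<Longrightarrow> D \<subseteq> verts G \<and> (\<exists>e. crossing G D = {e})"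
proof (cases "card (verts (component_tree G)) = 1")
  case True
  then show ?thesis using that(1) by (simp add: num_leaves_def)
next
  case False
  interpret fin_digraph G by fact
  let ?T = "component_tree G"
  define \<C> where "\<C> = {C \<in> verts ?T. in_degree ?T C + out_degree ?T C = 1}"
  have vT: "verts ?T = two_edge_components G" by (simp add: component_tree_def)
  have ne: "verts C \<noteq> {}" "verts C \<subseteq> verts G" if "C \<in> two_edge_components G" for C
    using two_edge_components_subgraph[OF that] by (auto simp: connected_conv subgraph_def)
  have inj: "inj_on verts \<C>"
  proof (rule inj_onI)
    fix x y assume xy: "x \<in> \<C>" "y \<in> \<C>" "verts x = verts y"
    then have m: "x \<in> two_edge_components G" "y \<in> two_edge_components G" by (auto simp: \<C>_def vT)
    obtain v where "v \<in> verts x" using ne[OF m(1)] by blast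
    then show "x = y" using two_edge_components_disjoint[OF m] xy by simp
  qed
  have "finite (verts ` \<C>)"
    by (rule finite_subset[of _ "Pow (verts G)"]) (use ne in \<open>auto simp: \<C>_def vT\<close>)
  moreover have "card (verts ` \<C>) = num_leaves G"
    using False inj by (simp add: card_image num_leaves_def \<C>_def)
  moreover have "disjoint (verts ` \<C>)"
    unfolding disjoint_def
  proof (intro ballI impI)
    fix A B assume AB: "A \<in> verts ` \<C>" "B \<in> verts ` \<C>" "A \<noteq> B"
    then obtain C D where m: "C \<in> two_edge_components G" "D \<in> two_edge_components G" "A = verts C" "B = verts D"
      by (auto simp: \<C>_def vT)
    then show "A \<inter> B = {}" using two_edge_components_disjoint[OF m(1,2)] AB(3) by auto
  qed
  moreover have "D \<subseteq> verts G \<and> (\<exists>e. crossing G D = {e})" if "D \<in> verts ` \<C>" for D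
  proof -
    from that obtain C where C: "C \<in> two_edge_components G" "in_degree ?T C + out_degree ?T C = 1" "D = verts C"
      by (auto simp: \<C>_def vT)
    have the: "(THE C. C \<in> two_edge_components G \<and> v \<in> verts C) = C" if "v \<in> verts C" for v
    proof (rule the_equality)
      show "C \<in> two_edge_components G \<and> v \<in> verts C" using C that by simp
      show "C' = C" if "C' \<in> two_edge_components G \<and> v \<in> verts C'" for C'
        using that \<open>v \<in> verts C\<close> C(1) two_edge_components_disjoint by metis
    qed
    have aT: "arcs ?T = cutting_edges G" by (simp add: component_tree_def)
    have fin: "finite (cutting_edges G)" by (simp add: cutting_edges_def)
    have sub: "crossing G D \<subseteq> in_arcs ?T C \<union> out_arcs ?T C"
    proof
      fix e assume e: "e \<in> crossing G D"
      then have "e \<in> cutting_edges G"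
        using crossing_two_edge_component_cutting[OF wf_digraph_axioms C(1)] C by simp
      moreover have "tail G e \<in> verts C \<or> head G e \<in> verts C" using e C by (auto simp: crossing_def)
      ultimately show "e \<in> in_arcs ?T C \<union> out_arcs ?T C"
        using the by (auto simp: in_arcs_def out_arcs_def component_tree_def)
    qed
    have finT: "finite (in_arcs ?T C)" "finite (out_arcs ?T C)"
      using fin by (auto simp: in_arcs_def out_arcs_def aT)
    have "card (crossing G D) \<le> card (in_arcs ?T C \<union> out_arcs ?T C)"
      using sub finT by (intro card_mono) auto
    also have "\<dots> \<le> 1" using C(2) card_Un_le[of "in_arcs ?T C" "out_arcs ?T C"]
      by (simp add: in_degree_def out_degree_def)
    finally have le: "card (crossing G D) \<le> 1" .
    \<comment> \<open>Otherwise \<open>C\<close> would be the only component, which the case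
      distinction excludes.\<close>
    have "verts G - D \<noteq> {}"
    proof
      assume "verts G - D = {}"
      then have "C' = C" if "C' \<in> two_edge_components G" for C'
      proof -
        obtain v where "v \<in> verts C'" using ne(1)[OF \<open>C' \<in> two_edge_components G\<close>] by blast
        then have "v \<in> verts C" using \<open>verts G - D = {}\<close> ne(2)[OF \<open>C' \<in> two_edge_components G\<close>] C(3) by blast
        then show ?thesis using two_edge_components_disjoint[OF \<open>C' \<in> two_edge_components G\<close> C(1) \<open>v \<in> verts C'\<close>] by simp
      qed
      then have "two_edge_components G = {C}" using C by blast
      then show False using False vT by simp
    qed
    moreover have "D \<inter> verts G \<noteq> {}" using ne[OF C(1)] C(3) by auto
    ultimately have "crossing G D \<noteq> {}"
      using assms(2) connected_iff_crossing[OF wf_digraph_axioms] by simp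
    moreover have "finite (crossing G D)" by (simp add: crossing_def)
    ultimately have "card (crossing G D) = 1" using le card_gt_0_iff[of "crossing G D"] by linarith
    then show ?thesis using ne[OF C(1)] C(3) by (auto simp: card_1_singleton_iff)
  qed
  ultimately show ?thesis by (rule that(2))
qed

text \<open>Euler's theorem for directed graphs; a closed Euler trail is the closed walk that
  \<open>cyclic\<close> asks for.\<close>

lemma cyclic_if_balanced:
  assumes "fin_digraph G" "Digraph_Component.connected G"
    and "\<And>v. v \<in> verts G \<Longrightarrow> card {e \<in> arcs G. tail G e = v} = card {e \<in> arcs G. head G e = v}"
  shows "cyclic G"
proof -
  interpret fin_digraph G by fact
  have "\<exists>u p. euler_trail u p u"
    using assms by (intro closed_euler1) (auto simp: in_degree_def out_degree_def in_arcs_def out_arcs_def)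
  then show ?thesis by (auto simp: cyclic_def euler_trail_def)
qed

section \<open>Closed walks with classes of arcs\<close>

definition connection :: "'a set \<Rightarrow> ('a \<times> 'a) set \<Rightarrow> ('a \<times> 'a) set" where
  "connection V E = {(x, y). x \<in> V \<and> y \<in> V \<and> (x, y) \<in> ((E \<union> E\<inverse>) \<inter> V \<times> V)\<^sup>*}"

definition components :: "'a set \<Rightarrow> ('a \<times> 'a) set \<Rightarrow> 'a set set" where
  "components V E = V // connection V E"

lemma equiv_connection: "equiv V (connection V E)"
proof -
  have "sym ((E \<union> E\<inverse>) \<inter> V \<times> V)" by (auto simp: sym_def)
  then have "sym (((E \<union> E\<inverse>) \<inter> V \<times> V)\<^sup>*)" by (rule sym_rtrancl)
  then have "sym (connection V E)" by (auto simp: sym_def connection_def)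
  moreover have "trans (connection V E)" by (auto simp: trans_def connection_def)
  ultimately show ?thesis by (auto simp: equiv_def refl_on_def connection_def)
qed

lemma connection_base: "(x, y) \<in> E \<Longrightarrow> x \<in> V \<Longrightarrow> y \<in> V \<Longrightarrow> (x, y) \<in> connection V E"
  by (auto simp: connection_def)

lemma connection_refl: "x \<in> V \<Longrightarrow> (x, x) \<in> connection V E"
  by (auto simp: connection_def)

lemma connection_sym: "(x, y) \<in> connection V E \<Longrightarrow> (y, x) \<in> connection V E"
  using equiv_connection[of V E] by (auto simp: equiv_def sym_def)

lemma connection_trans: "(x, y) \<in> connection V E \<Longrightarrow> (y, z) \<in> connection V E \<Longrightarrow> (x, z) \<in> connection V E"
  using equiv_connection[of V E] by (auto simp: equiv_def trans_def)

lemma connection_in: "(x, y) \<in> connection V E \<Longrightarrow> x \<in> V \<and> y \<in> V"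
  by (auto simp: connection_def)

lemma connection_least:
  assumes "equiv V R" "\<And>x y. (x, y) \<in> E \<Longrightarrow> x \<in> V \<Longrightarrow> y \<in> V \<Longrightarrow> (x, y) \<in> R"
  shows "connection V E \<subseteq> R"
proof (rule subrelI)
  fix x y assume "(x, y) \<in> connection V E"
  then have "(x, y) \<in> ((E \<union> E\<inverse>) \<inter> V \<times> V)\<^sup>*" "x \<in> V" by (auto simp: connection_def)
  then show "(x, y) \<in> R"
  proof (induction rule: rtrancl_induct)
    case base
    then show ?case using assms(1) by (auto simp: equiv_def refl_on_def)
  next
    case (step y z)
    then have "(y, z) \<in> R" using assms by (auto simp: equiv_def sym_def)
    then show ?case using step assms(1) by (meson equiv_def transD)
  qed
qed

lemma connection_mono: "E \<subseteq> E' \<Longrightarrow> connection V E \<subseteq> connection V E'"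
  by (rule connection_least[OF equiv_connection]) (auto intro: connection_base)

lemma connection_invariant:
  assumes "(x, y) \<in> connection V E"
    and "\<And>x y. (x, y) \<in> E \<Longrightarrow> x \<in> V \<Longrightarrow> y \<in> V \<Longrightarrow> f x = f y"
  shows "f x = f y"
proof -
  have "equiv V {(x, y). x \<in> V \<and> y \<in> V \<and> f x = f y}"
    by (auto simp: equiv_def refl_on_def sym_def trans_def)
  then have "connection V E \<subseteq> {(x, y). x \<in> V \<and> y \<in> V \<and> f x = f y}"
    by (rule connection_least) (use assms(2) in auto)
  then show ?thesis using assms(1) by auto
qed

text \<open>Sending a class of \<open>R\<close> to the class of \<open>R'\<close> around it is onto;
  when the counts agree it is injective, so no two classes were merged. The second part later turns
  a count of components into an equality of relations.\<close>

lemma card_quotient_antimono: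
  assumes "finite V" "equiv V R" "equiv V R'" "R \<subseteq> R'"
  shows "card (V // R') \<le> card (V // R)"
    and "card (V // R') = card (V // R) \<Longrightarrow> R = R'"
proof -
  have fin: "finite (V // R)" using assms by (intro finite_quotient) (auto simp: equiv_def)
  have img: "(\<lambda>C. R' `` C) ` (V // R) = V // R'"
  proof -
    have "R' `` (R `` {x}) = R' `` {x}" if "x \<in> V" for x
    proof -
      have "x \<in> R `` {x}" using assms(2) that by (auto simp: equiv_def refl_on_def)
      moreover have "(x, z) \<in> R'" if "(x, y) \<in> R" "(y, z) \<in> R'" for y z
        using that assms(3,4) by (meson equiv_def subsetD transD)
      ultimately show ?thesis by auto
    qed
    then show ?thesis unfolding quotient_def by auto
  qed
  show "card (V // R') \<le> card (V // R)" using card_image_le[OF fin, of "\<lambda>C. R' `` C"] img by simp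
  assume "card (V // R') = card (V // R)"
  then have inj: "inj_on (\<lambda>C. R' `` C) (V // R)"
    using img fin by (intro eq_card_imp_inj_on) auto
  show "R = R'"
  proof
    show "R' \<subseteq> R"
    proof (rule subrelI)
      fix x y assume xy: "(x, y) \<in> R'"
      then have xyV: "x \<in> V" "y \<in> V" using assms(3) by (auto simp: equiv_def)
      have im: "R' `` (R `` {z}) = R' `` {z}" if "z \<in> V" for z
      proof -
        have "z \<in> R `` {z}" using assms(2) that by (auto simp: equiv_def refl_on_def)
        moreover have "(z, w) \<in> R'" if "(z, y) \<in> R" "(y, w) \<in> R'" for y w
          using that assms(3,4) by (meson equiv_def subsetD transD)
        ultimately show ?thesis by auto
      qed
      have "R' `` (R `` {x}) = R' `` (R `` {y})"
        using im xyV equiv_class_eq[OF assms(3) xy] by simp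
      then have "R `` {x} = R `` {y}" using inj xyV by (auto simp: inj_on_def quotientI)
      then show "(x, y) \<in> R" using eq_equiv_class[OF _ assms(2)] xyV by blast
    qed
  qed fact
qed

lemma finite_components: "finite V \<Longrightarrow> finite (components V E)"
  unfolding components_def by (rule finite_quotient) (auto simp: connection_def)

text \<open>The new pair merges at most the classes of \<open>a\<close> and \<open>b\<close>. Away
  from the class of \<open>b\<close>, distinct old classes stay in distinct new ones.\<close>

lemma card_components_insert:
  assumes "finite V"
  shows "card (components V E) \<le> card (components V (insert (a, b) E)) + 1"
proof -
  let ?R = "connection V E" and ?R' = "connection V (insert (a, b) E)"
  show ?thesis
  proof (cases "a \<in> V \<and> b \<in> V")
    case False
    then have "?R' \<subseteq> ?R"
      by (intro connection_least[OF equiv_connection]) (auto intro: connection_base)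
    then have "?R' = ?R" using connection_mono[of E "insert (a, b) E" V] by auto
    then show ?thesis by (simp add: components_def)
  next
    case True
    define A where "A = ?R `` {a} \<union> ?R `` {b}"
    have cl: "(x \<in> A) = (y \<in> A)" if "(x, y) \<in> ?R" for x y
      using that unfolding A_def by (auto intro: connection_trans connection_sym)
    have AV: "A \<subseteq> V" unfolding A_def by (auto dest: connection_in)
    have "equiv V (?R \<union> A \<times> A)"
      unfolding equiv_def
    proof (intro conjI)
      show "?R \<union> A \<times> A \<subseteq> V \<times> V" using AV by (auto dest: connection_in)
      show "refl_on V (?R \<union> A \<times> A)" by (auto simp: refl_on_def connection_refl)
      show "sym (?R \<union> A \<times> A)" by (auto simp: sym_def connection_sym)
      show "trans (?R \<union> A \<times> A)" using cl by (auto simp: trans_def intro: connection_trans)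
    qed
    then have sub: "?R' \<subseteq> ?R \<union> A \<times> A"
      by (rule connection_least) (use True in \<open>auto simp: A_def intro: connection_base connection_refl\<close>)
    let ?Q = "components V E - {?R `` {b}}"
    have inj: "inj_on (\<lambda>C. ?R' `` C) ?Q"
    proof (rule inj_onI)
      fix C D assume C: "C \<in> ?Q" and D: "D \<in> ?Q" and eq: "?R' `` C = ?R' `` D"
      obtain x where x: "x \<in> V" "C = ?R `` {x}" using C by (auto simp: components_def elim: quotientE)
      obtain y where y: "y \<in> V" "D = ?R `` {y}" using D by (auto simp: components_def elim: quotientE)
      have RR: "?R \<subseteq> ?R'" by (rule connection_mono) auto
      have "y \<in> ?R' `` D" using y by (auto intro: connection_refl)
      then obtain z where "(x, z) \<in> ?R" "(z, y) \<in> ?R'" using eq x by auto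
      then have "(x, y) \<in> ?R'" using RR by (auto intro: connection_trans)
      then consider "(x, y) \<in> ?R" | "x \<in> A" "y \<in> A" using sub by auto
      then have "(x, y) \<in> ?R"
      proof cases
        case 2
        have "(b, x) \<notin> ?R" "(b, y) \<notin> ?R"
          using C D x y equiv_class_eq[OF equiv_connection, of b x V E]
            equiv_class_eq[OF equiv_connection, of b y V E] by auto
        then have "(a, x) \<in> ?R" "(a, y) \<in> ?R" using 2 by (auto simp: A_def)
        then show ?thesis by (blast intro: connection_sym connection_trans)
      qed
      then show "C = D" using x y equiv_class_eq[OF equiv_connection, of x y V E] by simp
    qed
    have img: "(\<lambda>C. ?R' `` C) ` ?Q \<subseteq> components V (insert (a, b) E)"
    proof
      fix Z assume "Z \<in> (\<lambda>C. ?R' `` C) ` ?Q"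
      then obtain x where x: "x \<in> V" "Z = ?R' `` (?R `` {x})" by (auto simp: components_def elim: quotientE)
      have RR: "?R \<subseteq> ?R'" by (rule connection_mono) auto
      have "?R' `` (?R `` {x}) = ?R' `` {x}"
        using RR x(1) by (auto intro: connection_trans connection_refl)
      then show "Z \<in> components V (insert (a, b) E)" using x by (auto simp: components_def quotientI)
    qed
    have "card ?Q \<le> card (components V (insert (a, b) E))"
      using card_inj_on_le[OF inj img] finite_components[OF assms] by simp
    moreover have "card (components V E) \<le> card ?Q + 1"
      using card_Diff_singleton_if[of "components V E" "?R `` {b}"] by (auto split: if_splits)
    ultimately show ?thesis by simp
  qed
qed

lemma card_components_Un:
  assumes "finite V" "finite F"
  shows "card (components V E) \<le> card (components V (E \<union> F)) + card F"
  using assms(2)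
proof (induction F rule: finite_induct)
  case (insert e F)
  then show ?case using card_components_insert[OF assms(1), of "E \<union> F" "fst e" "snd e"] by simp
qed simp

text \<open>
  A point \<open>k\<close> of \<open>V\<close> also stands for the arc from \<open>k\<close> to \<open>nx k\<close>. The arcs in \<open>XS\<close> will carry Wigner
  matrices, the other ones letters in \<open>Y\<close>.
\<close>

locale cyclic_walk =
  fixes V :: "nat set" and nx :: "nat \<Rightarrow> nat" and XS :: "nat set"
  assumes finite_V: "finite V" and nx_bij: "bij_betw nx V V" and XS_V: "XS \<subseteq> V"
    and nx_transitive: "\<And>S. S \<subseteq> V \<Longrightarrow> S \<noteq> {} \<Longrightarrow> nx ` S \<subseteq> S \<Longrightarrow> S = V"
    and V_nonempty: "V \<noteq> {}"
begin

lemma nx_V [simp]: "k \<in> V \<Longrightarrow> nx k \<in> V"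
  using nx_bij by (auto simp: bij_betw_def)

lemma finite_XS: "finite XS"
  using XS_V finite_V by (rule finite_subset)

text \<open>A map \<open>\<rho>\<close> on \<open>V\<close> matters only through its kernel, the partition of \<open>V\<close> into its fibres.\<close>

definition link :: "(nat \<Rightarrow> nat) \<Rightarrow> (nat \<times> nat) set" where
  "link \<rho> = {(k, l). k \<in> V \<and> l \<in> V \<and> \<rho> k = \<rho> l} \<union> {(k, nx k) | k. k \<in> V - XS}"

text \<open>A component is recorded as a set of points of \<open>V\<close>; its vertices are the
  values of \<rho> on it, and its arcs are its points outside \<open>XS\<close>.\<close>

definition parts :: "(nat \<Rightarrow> nat) \<Rightarrow> nat set set" where
  "parts \<rho> = components V (link \<rho>)"

text \<open>Arcs of one class are parallel or antiparallel. The labelling \<open>cl\<close> is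
  arbitrary, so that the same classes stay usable after vertices have been merged, when further arcs
  may become parallel.\<close>

definition compatible :: "(nat \<Rightarrow> 'c) \<Rightarrow> (nat \<Rightarrow> nat) \<Rightarrow> bool" where
  "compatible cl \<rho> \<longleftrightarrow>
     (\<forall>k\<in>XS. \<forall>l\<in>XS. cl k = cl l \<longrightarrow> {\<rho> k, \<rho> (nx k)} = {\<rho> l, \<rho> (nx l)})"

lemma compatibleD:
  "compatible cl \<rho> \<Longrightarrow> k \<in> XS \<Longrightarrow> l \<in> XS \<Longrightarrow> cl k = cl l \<Longrightarrow> {\<rho> k, \<rho> (nx k)} = {\<rho> l, \<rho> (nx l)}"
  unfolding compatible_def by blast

lemma card_nx: "card {k \<in> V. P (nx k)} = card {k \<in> V. P k}"
proof (rule bij_betw_same_card)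
  show "bij_betw nx {k \<in> V. P (nx k)} {k \<in> V. P k}"
    using nx_bij by (auto simp: bij_betw_def inj_on_def)
qed

text \<open>A closed walk leaves a set as often as it enters it, since \<open>nx\<close> permutes
  \<open>V\<close>.\<close>

lemma cut_balance: "card {k \<in> V. P k \<and> \<not> P (nx k)} = card {k \<in> V. \<not> P k \<and> P (nx k)}"
proof -
  have "card {k \<in> V. P k} = card ({k \<in> V. P k \<and> P (nx k)} \<union> {k \<in> V. P k \<and> \<not> P (nx k)})"
    by (rule arg_cong[of _ _ card]) auto
  also have "\<dots> = card {k \<in> V. P k \<and> P (nx k)} + card {k \<in> V. P k \<and> \<not> P (nx k)}"
    using finite_V by (intro card_Un_disjoint) auto
  finally have 1: "card {k \<in> V. P k} = card {k \<in> V. P k \<and> P (nx k)} + card {k \<in> V. P k \<and> \<not> P (nx k)}" .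
  have "card {k \<in> V. P (nx k)} = card ({k \<in> V. P k \<and> P (nx k)} \<union> {k \<in> V. \<not> P k \<and> P (nx k)})"
    by (rule arg_cong[of _ _ card]) auto
  also have "\<dots> = card {k \<in> V. P k \<and> P (nx k)} + card {k \<in> V. \<not> P k \<and> P (nx k)}"
    using finite_V by (intro card_Un_disjoint) auto
  finally show ?thesis using 1 card_nx[of P] by simp
qed

lemma cut_even:
  fixes P :: "nat \<Rightarrow> bool"
  shows "even (card {k \<in> V. P k \<noteq> P (nx k)})"
proof -
  have "card {k \<in> V. P k \<noteq> P (nx k)} = card ({k \<in> V. P k \<and> \<not> P (nx k)} \<union> {k \<in> V. \<not> P k \<and> P (nx k)})"
    by (rule arg_cong[of _ _ card]) auto
  also have "\<dots> = card {k \<in> V. P k \<and> \<not> P (nx k)} + card {k \<in> V. \<not> P k \<and> P (nx k)}"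
    using finite_V by (intro card_Un_disjoint) auto
  finally show ?thesis by (simp add: cut_balance)
qed

lemma cut_exists:
  assumes "S \<inter> V \<noteq> {}" "V - S \<noteq> {}"
  obtains k where "k \<in> V" "(k \<in> S) \<noteq> (nx k \<in> S)"
proof (rule ccontr)
  assume "\<not> thesis"
  then have "nx ` (S \<inter> V) \<subseteq> S \<inter> V" using that by auto
  then have "S \<inter> V = V" using assms by (intro nx_transitive) auto
  then show False using assms by auto
qed

text \<open>All arcs of a class join the same two vertices, so one representative connects as much
  as the whole class, and each representative lowers the number of components by at most
  one.\<close>

lemma parts_add_classes:
  assumes "compatible cl \<rho>" "K \<subseteq> cl ` XS"
  shows "card (parts \<rho>) \<le> card (components V (link \<rho> \<union> {(k, nx k) | k. k \<in> XS \<and> cl k \<in> K})) + card K"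
proof -
  define rep where "rep \<kappa> = (SOME k. k \<in> XS \<and> cl k = \<kappa>)" for \<kappa>
  have rep: "rep \<kappa> \<in> XS \<and> cl (rep \<kappa>) = \<kappa>" if "\<kappa> \<in> K" for \<kappa>
  proof -
    have "\<exists>k. k \<in> XS \<and> cl k = \<kappa>" using that assms(2) by auto
    then show ?thesis unfolding rep_def by (rule someI_ex)
  qed
  define F where "F = (\<lambda>\<kappa>. (rep \<kappa>, nx (rep \<kappa>))) ` K"
  have finK: "finite K" using assms(2) finite_XS finite_subset by blast
  then have "finite F" by (simp add: F_def)
  let ?E = "link \<rho> \<union> {(k, nx k) | k. k \<in> XS \<and> cl k \<in> K}"
  have "connection V ?E \<subseteq> connection V (link \<rho> \<union> F)"
  proof (rule connection_least[OF equiv_connection])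
    fix x y assume xy: "(x, y) \<in> ?E" "x \<in> V" "y \<in> V"
    show "(x, y) \<in> connection V (link \<rho> \<union> F)"
    proof (cases "(x, y) \<in> link \<rho>")
      case True then show ?thesis using xy by (intro connection_base) auto
    next
      case False
      then have x: "x \<in> XS" "cl x \<in> K" "y = nx x" using xy by auto
      let ?r = "rep (cl x)"
      have r: "?r \<in> XS" "cl ?r = cl x" using rep x by auto
      then have rV: "?r \<in> V" "nx ?r \<in> V" using XS_V by auto
      have ends: "{\<rho> x, \<rho> y} = {\<rho> ?r, \<rho> (nx ?r)}"
        using compatibleD[OF assms(1) x(1) r(1)] x(3) r(2) by simp
      have rr: "(?r, nx ?r) \<in> connection V (link \<rho> \<union> F)"
        using x rV by (intro connection_base) (auto simp: F_def)
      have eq: "(a, b) \<in> connection V (link \<rho> \<union> F)" if "\<rho> a = \<rho> b" "a \<in> V" "b \<in> V" for a b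
        using that by (intro connection_base) (auto simp: link_def)
      consider "\<rho> x = \<rho> ?r" "\<rho> y = \<rho> (nx ?r)" | "\<rho> x = \<rho> (nx ?r)" "\<rho> y = \<rho> ?r"
        using ends unfolding doubleton_eq_iff by blast
      then show ?thesis
      proof cases
        case 1
        show ?thesis
          using connection_trans[OF connection_trans[OF eq[OF 1(1) xy(2) rV(1)] rr] eq[OF 1(2)[symmetric] rV(2) xy(3)]] .
      next
        case 2
        show ?thesis
          using connection_trans[OF connection_trans[OF eq[OF 2(1) xy(2) rV(2)] connection_sym[OF rr]]
              eq[OF 2(2)[symmetric] rV(1) xy(3)]] .
      qed
    qed
  qed
  then have "card (components V (link \<rho> \<union> F)) \<le> card (components V ?E)"
  proof -
    assume "connection V ?E \<subseteq> connection V (link \<rho> \<union> F)"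
    moreover have "connection V (link \<rho> \<union> F) \<subseteq> connection V ?E"
      using rep by (intro connection_mono) (auto simp: F_def)
    ultimately show ?thesis by (simp add: components_def)
  qed
  moreover have "card (parts \<rho>) \<le> card (components V (link \<rho> \<union> F)) + card F"
    unfolding parts_def by (rule card_components_Un) (use finite_V \<open>finite F\<close> in auto)
  moreover have "card F \<le> card K" unfolding F_def by (rule card_image_le) fact
  ultimately show ?thesis by simp
qed

lemma components_nx:
  assumes "\<And>k. k \<in> V \<Longrightarrow> (k, nx k) \<in> connection V E"
  shows "components V E = {V}"
proof -
  have "connection V E `` {x} = V" if "x \<in> V" for x
  proof (rule nx_transitive)
    show "connection V E `` {x} \<subseteq> V" by (auto dest: connection_in)
    show "connection V E `` {x} \<noteq> {}" using that by (auto intro: connection_refl)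
    show "nx ` (connection V E `` {x}) \<subseteq> connection V E `` {x}"
      using assms by (auto intro: connection_trans dest: connection_in)
  qed
  then show ?thesis using V_nonempty unfolding components_def quotient_def by auto
qed

text \<open>Classes and remaining arcs together contain the whole closed walk, which is connected;
  \<open>E\<close> classes can have joined at most \<open>E + 1\<close> components.\<close>

lemma card_parts_le:
  assumes "compatible cl \<rho>"
  shows "card (parts \<rho>) \<le> card (cl ` XS) + 1"
proof -
  have "components V (link \<rho> \<union> {(k, nx k) | k. k \<in> XS \<and> cl k \<in> cl ` XS}) = {V}"
    by (rule components_nx, rule connection_base) (auto simp: link_def)
  then show ?thesis using parts_add_classes[OF assms order_refl] by simp
qed

text \<open>In the extremal case every class is a bridge, because the other classes leave at least
  two components. \<open>S\<close> is one of them. Only arcs of \<kappa> can cross it, some arc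
  does, and all the others have the same two ends as that one.\<close>

lemma tree_cut:
  assumes "compatible cl \<rho>" "card (parts \<rho>) = card (cl ` XS) + 1" "\<kappa> \<in> cl ` XS"
  obtains S where "\<And>k l. k \<in> V \<Longrightarrow> l \<in> V \<Longrightarrow> \<rho> k = \<rho> l \<Longrightarrow> (k \<in> S) = (l \<in> S)"
    "\<And>k. k \<in> V \<Longrightarrow> (k \<in> S) \<noteq> (nx k \<in> S) \<longleftrightarrow> k \<in> XS \<and> cl k = \<kappa>"
proof -
  let ?K = "cl ` XS - {\<kappa>}"
  let ?E = "link \<rho> \<union> {(k, nx k) | k. k \<in> XS \<and> cl k \<in> ?K}"
  have "card ?K + 1 = card (cl ` XS)" using assms(3) finite_XS
    by (metis Suc_eq_plus1 card_Suc_Diff1 finite_imageI)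
  then have two: "card (components V ?E) \<ge> 2"
    using parts_add_classes[OF assms(1), of ?K] assms(2) by simp
  obtain x where x: "x \<in> V" using V_nonempty by auto
  define S where "S = connection V ?E `` {x}"
  have SV: "S \<subseteq> V" by (auto simp: S_def dest: connection_in)
  have "S \<noteq> V"
  proof
    assume "S = V"
    have "components V ?E = {V}"
    proof (rule components_nx)
      fix k assume "k \<in> V"
      then have "(x, k) \<in> connection V ?E" "(x, nx k) \<in> connection V ?E"
        using \<open>S = V\<close> by (auto simp: S_def)
      then show "(k, nx k) \<in> connection V ?E" by (blast intro: connection_trans connection_sym)
    qed
    then show False using two by simp
  qed
  have inv: "(a \<in> S) = (b \<in> S)" if "(a, b) \<in> ?E" "a \<in> V" "b \<in> V" for a b
  proof -
    have "(a, b) \<in> connection V ?E" using that by (rule connection_base)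
    then show ?thesis unfolding S_def by (auto intro: connection_trans connection_sym)
  qed
  have sat: "(k \<in> S) = (l \<in> S)" if "k \<in> V" "l \<in> V" "\<rho> k = \<rho> l" for k l
    using that by (intro inv) (auto simp: link_def)
  have cross: "k \<in> XS \<and> cl k = \<kappa>" if "k \<in> V" "(k \<in> S) \<noteq> (nx k \<in> S)" for k
  proof (rule ccontr)
    assume "\<not> (k \<in> XS \<and> cl k = \<kappa>)"
    then have "(k, nx k) \<in> ?E" using that by (auto simp: link_def)
    then show False using inv that by auto
  qed
  have "S \<inter> V \<noteq> {}" using x by (auto simp: S_def intro: connection_refl)
  moreover have "V - S \<noteq> {}" using SV \<open>S \<noteq> V\<close> by auto
  ultimately obtain k0 where k0: "k0 \<in> V" "(k0 \<in> S) \<noteq> (nx k0 \<in> S)" by (rule cut_exists)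
  have "(k \<in> S) \<noteq> (nx k \<in> S)" if "k \<in> XS" "cl k = \<kappa>" for k
  proof -
    have "{\<rho> k, \<rho> (nx k)} = {\<rho> k0, \<rho> (nx k0)}"
      using compatibleD[OF assms(1) that(1)] cross[OF k0] that(2) by simp
    moreover have "k \<in> V" "nx k \<in> V" "nx k0 \<in> V" using that XS_V k0 by auto
    ultimately show ?thesis
      using sat[of k k0] sat[of "nx k" "nx k0"] sat[of k "nx k0"] sat[of "nx k" k0] k0
      by (auto simp: doubleton_eq_iff)
  qed
  then show thesis using that[of S] sat cross by blast
qed

section \<open>Bridges and balance in the extremal case\<close>

context
  fixes cl :: "nat \<Rightarrow> 'c" and \<rho>
  assumes compat: "compatible cl \<rho>" and tree: "card (parts \<rho>) = card (cl ` XS) + 1"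
begin

text \<open>The ends of an arc of a class lie on different sides of the cut of that class, and no
  link crosses this cut.\<close>

lemma tree_not_linked: "k \<in> XS \<Longrightarrow> (k, nx k) \<notin> connection V (link \<rho>)"
proof
  assume k: "k \<in> XS" "(k, nx k) \<in> connection V (link \<rho>)"
  obtain S where S: "\<And>k l. k \<in> V \<Longrightarrow> l \<in> V \<Longrightarrow> \<rho> k = \<rho> l \<Longrightarrow> (k \<in> S) = (l \<in> S)"
    "\<And>l. l \<in> V \<Longrightarrow> (l \<in> S) \<noteq> (nx l \<in> S) \<longleftrightarrow> l \<in> XS \<and> cl l = cl k"
    using tree_cut[OF compat tree imageI[OF k(1)]] by metis
  have "(k \<in> S) = (nx k \<in> S)"
  proof (rule connection_invariant[OF k(2)])
    fix x y assume "(x, y) \<in> link \<rho>" "x \<in> V" "y \<in> V"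
    then consider "\<rho> x = \<rho> y" | "y = nx x" "x \<notin> XS" by (auto simp: link_def)
    then show "(x \<in> S) = (y \<in> S)"
      by cases (use S(1)[of x y] S(2)[of x] \<open>x \<in> V\<close> \<open>y \<in> V\<close> in \<open>blast+\<close>)
  qed
  then show False using S(2)[of k] k XS_V by auto
qed

text \<open>The walk crosses the bridge \<kappa> equally often in both directions. From here the
  tree shape yields both the balanced moments and the cyclic components.\<close>

lemma tree_class_balanced:
  assumes "\<kappa> \<in> cl ` XS"
  shows "card {k \<in> XS. cl k = \<kappa> \<and> \<rho> k = x} = card {k \<in> XS. cl k = \<kappa> \<and> \<rho> (nx k) = x}"
proof -
  obtain S where S: "\<And>k l. k \<in> V \<Longrightarrow> l \<in> V \<Longrightarrow> \<rho> k = \<rho> l \<Longrightarrow> (k \<in> S) = (l \<in> S)"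
    "\<And>l. l \<in> V \<Longrightarrow> (l \<in> S) \<noteq> (nx l \<in> S) \<longleftrightarrow> l \<in> XS \<and> cl l = \<kappa>"
    using tree_cut[OF compat tree assms] by metis
  obtain k0 where k0: "k0 \<in> XS" "cl k0 = \<kappa>" using assms by auto
  have k0V: "k0 \<in> V" "nx k0 \<in> V" using k0 XS_V by auto
  \<comment> \<open>\<open>b\<close> is the end of the class inside \<open>S\<close> and
    \<open>b'\<close> the end outside.\<close>
  define b b' where "b = (if k0 \<in> S then \<rho> k0 else \<rho> (nx k0))" and "b' = (if k0 \<in> S then \<rho> (nx k0) else \<rho> k0)"
  have ends: "if k \<in> S then \<rho> k = b \<and> \<rho> (nx k) = b' else \<rho> k = b' \<and> \<rho> (nx k) = b"
    if "k \<in> XS" "cl k = \<kappa>" for k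
  proof -
    have "{\<rho> k, \<rho> (nx k)} = {\<rho> k0, \<rho> (nx k0)}" 
      using compatibleD[OF compat that(1) k0(1)] that(2) k0(2) by simp
    moreover have kV: "k \<in> V" "nx k \<in> V" using that XS_V by auto
    moreover have "(k \<in> S) \<noteq> (nx k \<in> S)" "(k0 \<in> S) \<noteq> (nx k0 \<in> S)" using S(2) that k0 kV k0V by auto
    ultimately show ?thesis
      using S(1)[of k k0] S(1)[of "nx k" "nx k0"] S(1)[of k "nx k0"] S(1)[of "nx k" k0] k0V
      unfolding b_def b'_def by (auto simp: doubleton_eq_iff)
  qed
  have "b \<noteq> b'"
    using S(1)[OF k0V] S(2)[OF k0V(1)] k0 unfolding b_def b'_def by (auto split: if_splits)
  have bal: "card {k \<in> XS. cl k = \<kappa> \<and> k \<in> S} = card {k \<in> XS. cl k = \<kappa> \<and> k \<notin> S}"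
  proof -
    have "{k \<in> XS. cl k = \<kappa> \<and> k \<in> S} = {k \<in> V. k \<in> S \<and> nx k \<notin> S}"
      "{k \<in> XS. cl k = \<kappa> \<and> k \<notin> S} = {k \<in> V. k \<notin> S \<and> nx k \<in> S}"
      using S(2) XS_V by blast+
    then show ?thesis using cut_balance[of "\<lambda>k. k \<in> S"] by simp
  qed
  have ends': "(\<rho> k = b) = (k \<in> S)" "(\<rho> (nx k) = b) = (k \<notin> S)" "(\<rho> k = b') = (k \<notin> S)" "(\<rho> (nx k) = b') = (k \<in> S)"
    if "k \<in> XS" "cl k = \<kappa>" for k
    using ends[OF that] \<open>b \<noteq> b'\<close> by (cases "k \<in> S"; simp)+
  consider "x = b" | "x = b'" | "x \<noteq> b" "x \<noteq> b'" by blast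
  then show ?thesis
  proof cases
    case 1
    have "{k \<in> XS. cl k = \<kappa> \<and> \<rho> k = b} = {k \<in> XS. cl k = \<kappa> \<and> k \<in> S}"
      "{k \<in> XS. cl k = \<kappa> \<and> \<rho> (nx k) = b} = {k \<in> XS. cl k = \<kappa> \<and> k \<notin> S}"
      using ends' by blast+
    then show ?thesis using bal 1 by simp
  next
    case 2
    have "{k \<in> XS. cl k = \<kappa> \<and> \<rho> k = b'} = {k \<in> XS. cl k = \<kappa> \<and> k \<notin> S}"
      "{k \<in> XS. cl k = \<kappa> \<and> \<rho> (nx k) = b'} = {k \<in> XS. cl k = \<kappa> \<and> k \<in> S}"
      using ends' by blast+
    then show ?thesis using bal 2 by simp
  next
    case 3
    have n: "\<rho> k \<noteq> x" "\<rho> (nx k) \<noteq> x" if "k \<in> XS" "cl k = \<kappa>" for k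
      using ends[OF that] 3 by (cases "k \<in> S"; simp)+
    have "{k \<in> XS. cl k = \<kappa> \<and> \<rho> k = x} = {}" "{k \<in> XS. cl k = \<kappa> \<and> \<rho> (nx k) = x} = {}"
      using n by blast+
    then show ?thesis by (simp only:)
  qed
qed

text \<open>At each vertex the whole walk is balanced and so is every class; hence the remaining
  arcs are balanced too.\<close>

lemma tree_balanced:
  "card {k \<in> V - XS. \<rho> k = x} = card {k \<in> V - XS. \<rho> (nx k) = x}"
proof -
  have XS: "card {k \<in> XS. P k} = (\<Sum>\<kappa>\<in>cl ` XS. card {k \<in> XS. cl k = \<kappa> \<and> P k})" for P
  proof -
    have "card {k \<in> XS. P k} = (\<Sum>k\<in>XS. if P k then 1 else 0)"
      using finite_XS by (simp add: sum.If_cases Int_def)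
    also have "\<dots> = (\<Sum>\<kappa>\<in>cl ` XS. \<Sum>k\<in>{k \<in> XS. cl k = \<kappa>}. if P k then 1 else 0)"
      using finite_XS by (rule sum.image_gen)
    also have "\<dots> = (\<Sum>\<kappa>\<in>cl ` XS. card {k \<in> XS. cl k = \<kappa> \<and> P k})"
      using finite_XS by (simp add: sum.If_cases Int_def conj_assoc)
    finally show ?thesis .
  qed
  have split: "card {k \<in> V. P k} = card {k \<in> V - XS. P k} + card {k \<in> XS. P k}" for P
  proof -
    have "card {k \<in> V. P k} = card ({k \<in> V - XS. P k} \<union> {k \<in> XS. P k})"
      using XS_V by (intro arg_cong[of _ _ card]) auto
    also have "\<dots> = card {k \<in> V - XS. P k} + card {k \<in> XS. P k}"
      using finite_V finite_XS by (intro card_Un_disjoint) auto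
    finally show ?thesis .
  qed
  have "card {k \<in> XS. \<rho> k = x} = card {k \<in> XS. \<rho> (nx k) = x}"
    using XS[of "\<lambda>k. \<rho> k = x"] XS[of "\<lambda>k. \<rho> (nx k) = x"] tree_class_balanced by simp
  then show ?thesis
    using split[of "\<lambda>k. \<rho> k = x"] split[of "\<lambda>k. \<rho> (nx k) = x"] card_nx[of "\<lambda>k. \<rho> k = x"] by simp
qed

end

lemma part_closed:
  assumes "C \<in> parts \<rho>" "k \<in> C"
  shows "l \<in> V \<Longrightarrow> \<rho> k = \<rho> l \<Longrightarrow> l \<in> C"
    and "k \<notin> XS \<Longrightarrow> nx k \<in> C"
    and "l \<in> V \<Longrightarrow> l \<notin> XS \<Longrightarrow> nx l = k \<Longrightarrow> l \<in> C"
    and "k \<in> V" and "C = connection V (link \<rho>) `` {k}"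
proof -
  obtain x where x: "x \<in> V" "C = connection V (link \<rho>) `` {x}"
    using assms(1) by (auto simp: parts_def components_def elim: quotientE)
  then have xk: "(x, k) \<in> connection V (link \<rho>)" using assms(2) by simp
  then show kV: "k \<in> V" using connection_in by fast
  show "C = connection V (link \<rho>) `` {k}" using equiv_class_eq[OF equiv_connection xk] x by simp
  have *: "l \<in> C" if "(k, l) \<in> connection V (link \<rho>)" for l
    using connection_trans[OF xk that] x by simp
  show "l \<in> C" if "l \<in> V" "\<rho> k = \<rho> l"
    by (rule *, rule connection_base) (use that kV in \<open>auto simp: link_def\<close>)
  show "nx k \<in> C" if "k \<notin> XS"
    by (rule *, rule connection_base) (use that kV in \<open>auto simp: link_def\<close>)
  show "l \<in> C" if "l \<in> V" "l \<notin> XS" "nx l = k"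
    by (rule *, rule connection_sym, rule connection_base) (use that kV in \<open>auto simp: link_def\<close>)
qed

lemma part_of:
  assumes "k \<in> V"
  shows "connection V (link \<rho>) `` {k} \<in> parts \<rho>" "k \<in> connection V (link \<rho>) `` {k}"
  using assms by (auto simp: parts_def components_def quotientI intro: connection_refl)

lemma parts_disjoint: "C \<in> parts \<rho> \<Longrightarrow> D \<in> parts \<rho> \<Longrightarrow> k \<in> C \<Longrightarrow> k \<in> D \<Longrightarrow> C = D"
  using part_closed(5)[of C \<rho> k] part_closed(5)[of D \<rho> k] by metis

lemma finite_parts: "finite (parts \<rho>)"
  unfolding parts_def by (rule finite_components) (rule finite_V)

lemma Union_parts: "\<Union> (parts \<rho>) = V"
proof (intro equalityI subsetI)
  show "k \<in> \<Union> (parts \<rho>)" if "k \<in> V" for k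
    using part_of[OF that] by blast
  show "k \<in> V" if "k \<in> \<Union> (parts \<rho>)" for k
    using that part_closed(4) by blast
qed

text \<open>A class crosses a union of vertices with all its arcs or with none, so modulo 2 only the
  crossing classes of odd size count.\<close>

lemma odd_crossing_classes:
  assumes compat: "compatible cl \<rho>"
    and sat: "\<And>k l. k \<in> V \<Longrightarrow> l \<in> V \<Longrightarrow> \<rho> k = \<rho> l \<Longrightarrow> (k \<in> S) = (l \<in> S)"
  shows "even (card {k \<in> XS. (k \<in> S) \<noteq> (nx k \<in> S)}) \<longleftrightarrow>
    even (card {\<kappa> \<in> cl ` XS. odd (card {k \<in> XS. cl k = \<kappa>}) \<and> (\<exists>k\<in>XS. cl k = \<kappa> \<and> (k \<in> S) \<noteq> (nx k \<in> S))})"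
    (is "even (card ?X) \<longleftrightarrow> even (card ?O)")
proof -
  let ?c = "\<lambda>k. (k \<in> S) \<noteq> (nx k \<in> S)"
  have all: "?c k = ?c l" if "k \<in> XS" "l \<in> XS" "cl k = cl l" for k l
  proof -
    have "k \<in> V" "l \<in> V" "nx k \<in> V" "nx l \<in> V" using that XS_V by auto
    moreover have "(\<rho> k = \<rho> l \<and> \<rho> (nx k) = \<rho> (nx l)) \<or> (\<rho> k = \<rho> (nx l) \<and> \<rho> (nx k) = \<rho> l)"
      using compatibleD[OF compat that] unfolding doubleton_eq_iff .
    ultimately show ?thesis
      using sat[of k l] sat[of "nx k" "nx l"] sat[of k "nx l"] sat[of "nx k" l] by metis
  qed
  have "card ?X = (\<Sum>k\<in>XS. if ?c k then 1 else 0)"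
    using finite_XS by (simp add: sum.If_cases Int_def)
  also have "\<dots> = (\<Sum>\<kappa>\<in>cl ` XS. \<Sum>k\<in>{k \<in> XS. cl k = \<kappa>}. if ?c k then 1 else 0)"
    using finite_XS by (rule sum.image_gen)
  also have "\<dots> = (\<Sum>\<kappa>\<in>cl ` XS. card {k \<in> XS. cl k = \<kappa> \<and> ?c k})"
    using finite_XS by (simp add: sum.If_cases Int_def conj_assoc)
  finally have "even (card ?X) \<longleftrightarrow> even (card {\<kappa> \<in> cl ` XS. odd (card {k \<in> XS. cl k = \<kappa> \<and> ?c k})})"
    using finite_XS by (simp add: even_sum_iff)
  also have "{\<kappa> \<in> cl ` XS. odd (card {k \<in> XS. cl k = \<kappa> \<and> ?c k})} = ?O"
  proof (rule Collect_cong, rule conj_cong[OF refl])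
    fix \<kappa> assume "\<kappa> \<in> cl ` XS"
    show "odd (card {k \<in> XS. cl k = \<kappa> \<and> ?c k}) \<longleftrightarrow>
      odd (card {k \<in> XS. cl k = \<kappa>}) \<and> (\<exists>k\<in>XS. cl k = \<kappa> \<and> ?c k)"
    proof (cases "\<exists>k\<in>XS. cl k = \<kappa> \<and> ?c k")
      case True
      then have "?c k" if "k \<in> XS" "cl k = \<kappa>" for k using all that by metis
      then have e: "{k \<in> XS. cl k = \<kappa> \<and> ?c k} = {k \<in> XS. cl k = \<kappa>}" by blast
      show ?thesis unfolding e using True by simp
    next
      case False
      then have e: "{k \<in> XS. cl k = \<kappa> \<and> ?c k} = {}" by blast
      show ?thesis unfolding e using False by simp
    qed
  qed
  finally show ?thesis .
qed

end

context cyclic_walk begin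

text \<open>The heart of the matter: a component of the graph of \<open>Y\<close>-arcs that is not two-edge
  connected contributes its leaves, each of which is left by a class of odd cardinality. Clusters of
  two-edge connected components that are joined by classes of even cardinality are left by at least
  two odd classes, unless there is only one cluster.\<close>

lemma sum_leaves_le:
  assumes compat: "compatible cl \<rho>" and card: "card (parts \<rho>) \<le> card (cl ` XS)"
    and r: "\<And>C. C \<in> parts \<rho> \<Longrightarrow> r C = 2 \<or>
      (\<exists>\<D>. finite \<D> \<and> card \<D> = r C \<and> disjoint \<D> \<and>
         (\<forall>D\<in>\<D>. D \<subseteq> \<rho> ` C \<and> card {k \<in> C - XS. (\<rho> k \<in> D) \<noteq> (\<rho> (nx k) \<in> D)} = 1))"
  shows "(\<Sum>C\<in>parts \<rho>. r C) \<le> 2 * card (cl ` XS)"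
proof -
  \<comment> \<open>A component of value 2 costs as much as one class. For the components in
    \<open>B\<close>, the leaves will be charged to ends of odd classes.\<close>
  define B where "B = {C \<in> parts \<rho>. r C \<noteq> 2}"
  have BP: "B \<subseteq> parts \<rho>" and finB: "finite B" using finite_parts by (auto simp: B_def)
  have "(\<Sum>C\<in>parts \<rho>. r C) = (\<Sum>C\<in>parts \<rho> - B. r C) + (\<Sum>C\<in>B. r C)"
    using finite_parts BP by (simp add: sum.subset_diff)
  also have "(\<Sum>C\<in>parts \<rho> - B. r C) = (\<Sum>C\<in>parts \<rho> - B. 2)"
    by (rule sum.cong) (auto simp: B_def)
  also have "\<dots> = 2 * (card (parts \<rho>) - card B)" using BP finB by (simp add: card_Diff_subset)
  finally have total: "(\<Sum>C\<in>parts \<rho>. r C) = 2 * (card (parts \<rho>) - card B) + (\<Sum>C\<in>B. r C)" .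
  show ?thesis
  proof (cases "B = {}")
    case True
    then show ?thesis using total card by simp
  next
    case False
    define good where "good C \<D> \<longleftrightarrow> finite \<D> \<and> card \<D> = r C \<and> disjoint \<D> \<and>
         (\<forall>D\<in>\<D>. D \<subseteq> \<rho> ` C \<and> card {k \<in> C - XS. (\<rho> k \<in> D) \<noteq> (\<rho> (nx k) \<in> D)} = 1)" for C \<D>
    have "\<forall>C\<in>B. \<exists>\<D>. good C \<D>"
      using r unfolding B_def good_def by blast
    then obtain \<D> where "\<forall>C\<in>B. good C (\<D> C)" by (rule bchoice[THEN exE])
    then have \<D>: "\<And>C. C \<in> B \<Longrightarrow> finite (\<D> C)" "\<And>C. C \<in> B \<Longrightarrow> card (\<D> C) = r C"
      "\<And>C. C \<in> B \<Longrightarrow> disjoint (\<D> C)" "\<And>C D. C \<in> B \<Longrightarrow> D \<in> \<D> C \<Longrightarrow> D \<subseteq> \<rho> ` C"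
      "\<And>C D. C \<in> B \<Longrightarrow> D \<in> \<D> C \<Longrightarrow> card {k \<in> C - XS. (\<rho> k \<in> D) \<noteq> (\<rho> (nx k) \<in> D)} = 1"
      unfolding good_def by blast+
    define Odd where "Odd = {\<kappa> \<in> cl ` XS. odd (card {k \<in> XS. cl k = \<kappa>})}"
    define Ev where "Ev = cl ` XS - Odd"
    have finO: "finite Odd" "finite Ev" using finite_XS by (auto simp: Odd_def Ev_def)
    have cE: "card (cl ` XS) = card Ev + card Odd"
      using finite_XS by (simp add: Ev_def card_Diff_subset Odd_def card_mono)
    let ?E = "link \<rho> \<union> {(k, nx k) | k. k \<in> XS \<and> cl k \<in> Ev}"
    \<comment> \<open>Clusters: components joined through the classes of even size.
      \<open>\<Q>'\<close> keeps the clusters that contain no member of \<open>B\<close>.\<close>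
    define \<Q> where "\<Q> = components V ?E"
    define \<Q>' where "\<Q>' = {Q \<in> \<Q>. \<forall>C\<in>B. \<not> C \<subseteq> Q}"
    have finQ: "finite \<Q>" unfolding \<Q>_def by (rule finite_components) (rule finite_V)
    have cQ: "card (parts \<rho>) \<le> card \<Q> + card Ev"
      unfolding \<Q>_def by (rule parts_add_classes[OF compat]) (simp add: Ev_def)
    have Qdisj: "Q = Q'" if "Q \<in> \<Q>" "Q' \<in> \<Q>" "k \<in> Q" "k \<in> Q'" for Q Q' k
      using quotient_disj[OF equiv_connection, of Q V ?E Q'] that unfolding \<Q>_def components_def by blast
    have cQ': "card \<Q> \<le> card \<Q>' + card B"
    proof -
      have "\<forall>Q\<in>\<Q> - \<Q>'. \<exists>C. C \<in> B \<and> C \<subseteq> Q" by (auto simp: \<Q>'_def)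
      then obtain g where "\<forall>Q\<in>\<Q> - \<Q>'. g Q \<in> B \<and> g Q \<subseteq> Q" by (rule bchoice[THEN exE])
      then have g: "\<And>Q. Q \<in> \<Q> - \<Q>' \<Longrightarrow> g Q \<in> B \<and> g Q \<subseteq> Q" by blast
      have "inj_on g (\<Q> - \<Q>')"
      proof (rule inj_onI)
        fix Q Q' assume Q: "Q \<in> \<Q> - \<Q>'" "Q' \<in> \<Q> - \<Q>'" "g Q = g Q'"
        have "g Q \<in> parts \<rho>" using g[OF Q(1)] BP by blast
        then obtain k where "k \<in> g Q"
          unfolding parts_def components_def using in_quotient_imp_non_empty[OF equiv_connection] by fast
        then show "Q = Q'" using Qdisj[of Q Q' k] g[OF Q(1)] g[OF Q(2)] Q by auto
      qed
      then have "card (\<Q> - \<Q>') \<le> card B" using g finB by (intro card_inj_on_le[of g]) auto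
      moreover have "card \<Q> \<le> card (\<Q> - \<Q>') + card \<Q>'"
        using finQ by (simp add: \<Q>'_def card_Diff_subset card_mono)
      ultimately show ?thesis by simp
    qed
    define rep where "rep \<kappa> = (SOME k. k \<in> XS \<and> cl k = \<kappa>)" for \<kappa>
    have rep: "rep \<kappa> \<in> XS" "cl (rep \<kappa>) = \<kappa>" if "\<kappa> \<in> Odd" for \<kappa>
    proof -
      have "\<exists>k. k \<in> XS \<and> cl k = \<kappa>" using that by (auto simp: Odd_def)
      then have "rep \<kappa> \<in> XS \<and> cl (rep \<kappa>) = \<kappa>" unfolding rep_def by (rule someI_ex)
      then show "rep \<kappa> \<in> XS" "cl (rep \<kappa>) = \<kappa>" by auto
    qed
    \<comment> \<open>The number of ends of odd classes in \<open>S\<close>, each class being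
      represented by one arc, whereas \<open>wt S\<close> counts the odd classes that cross
      \<open>S\<close>.\<close>
    define ep where "ep S = (\<Sum>\<kappa>\<in>Odd. of_bool (rep \<kappa> \<in> S) + of_bool (nx (rep \<kappa>) \<in> S) :: nat)" for S
    define wt where "wt S = card {\<kappa> \<in> cl ` XS. odd (card {k \<in> XS. cl k = \<kappa>}) \<and>
      (\<exists>k\<in>XS. cl k = \<kappa> \<and> (k \<in> S) \<noteq> (nx k \<in> S))}" for S
    have wt_le: "wt S \<le> ep S"
      if sat: "\<And>k l. k \<in> V \<Longrightarrow> l \<in> V \<Longrightarrow> \<rho> k = \<rho> l \<Longrightarrow> (k \<in> S) = (l \<in> S)" for S
    proof -
      have "wt S = (\<Sum>\<kappa>\<in>Odd. of_bool (\<exists>k\<in>XS. cl k = \<kappa> \<and> (k \<in> S) \<noteq> (nx k \<in> S)))"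
        using finO by (simp add: wt_def Odd_def of_bool_def sum.If_cases Int_def conj_assoc)
      also have "\<dots> \<le> ep S"
        unfolding ep_def
      proof (rule sum_mono)
        fix \<kappa> assume \<kappa>: "\<kappa> \<in> Odd"
        let ?r = "rep \<kappa>"
        have "(?r \<in> S) \<noteq> (nx ?r \<in> S)" if k: "k \<in> XS" "cl k = \<kappa>" "(k \<in> S) \<noteq> (nx k \<in> S)" for k
        proof -
          have "k \<in> V" "?r \<in> V" "nx k \<in> V" "nx ?r \<in> V" using k rep[OF \<kappa>] XS_V by auto
          moreover have "(\<rho> k = \<rho> ?r \<and> \<rho> (nx k) = \<rho> (nx ?r)) \<or> (\<rho> k = \<rho> (nx ?r) \<and> \<rho> (nx k) = \<rho> ?r)"
            using compatibleD[OF compat k(1) rep(1)[OF \<kappa>] trans[OF k(2) rep(2)[OF \<kappa>, symmetric]]]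
            unfolding doubleton_eq_iff .
          ultimately show ?thesis
            using sat[of k ?r] sat[of "nx k" "nx ?r"] sat[of k "nx ?r"] sat[of "nx k" ?r] k(3) by metis
        qed
        then show "of_bool (\<exists>k\<in>XS. cl k = \<kappa> \<and> (k \<in> S) \<noteq> (nx k \<in> S))
          \<le> (of_bool (?r \<in> S) + of_bool (nx ?r \<in> S) :: nat)"
          by (cases "?r \<in> S"; cases "nx ?r \<in> S") (auto simp: of_bool_def)
      qed
      finally show ?thesis .
    qed
    define pre where "pre D = {k \<in> V. \<rho> k \<in> D}" for D
    \<comment> \<open>Exactly one \<open>Y\<close>-arc leaves \<open>D\<close>, while the closed
      walk crosses it an even number of times. So an odd number of Wigner arcs crosses it, and hence
      an odd number of odd classes.\<close>
    have leaf: "1 \<le> ep (pre D)" if C: "C \<in> B" and D: "D \<in> \<D> C" for C D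
    proof -
      have sat: "(k \<in> pre D) = (l \<in> pre D)" if "k \<in> V" "l \<in> V" "\<rho> k = \<rho> l" for k l
        using that by (simp add: pre_def)
      have CP: "C \<in> parts \<rho>" using C BP by auto
      have inC: "k \<in> C" if "k \<in> V" "\<rho> k \<in> D" for k
      proof -
        obtain c where "c \<in> C" "\<rho> c = \<rho> k" using \<D>(4)[OF C D] \<open>\<rho> k \<in> D\<close> by auto
        then show ?thesis using part_closed(1)[OF CP] that by metis
      qed
      have Y: "{k \<in> V - XS. (k \<in> pre D) \<noteq> (nx k \<in> pre D)} = {k \<in> C - XS. (\<rho> k \<in> D) \<noteq> (\<rho> (nx k) \<in> D)}"
      proof (intro equalityI subsetI)
        fix k assume k: "k \<in> {k \<in> V - XS. (k \<in> pre D) \<noteq> (nx k \<in> pre D)}"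
        then have kV: "k \<in> V" "nx k \<in> V" "k \<notin> XS" "(\<rho> k \<in> D) \<noteq> (\<rho> (nx k) \<in> D)" by (auto simp: pre_def)
        have "k \<in> C"
        proof (cases "\<rho> k \<in> D")
          case True then show ?thesis using inC kV by simp
        next
          case False
          then have "nx k \<in> C" using inC kV by simp
          then show ?thesis using part_closed(3)[OF CP _ kV(1,3) refl] by simp
        qed
        then show "k \<in> {k \<in> C - XS. (\<rho> k \<in> D) \<noteq> (\<rho> (nx k) \<in> D)}" using kV by simp
      next
        fix k assume k: "k \<in> {k \<in> C - XS. (\<rho> k \<in> D) \<noteq> (\<rho> (nx k) \<in> D)}"
        then have "k \<in> V" using part_closed(4)[OF CP] by simp
        then show "k \<in> {k \<in> V - XS. (k \<in> pre D) \<noteq> (nx k \<in> pre D)}" using k by (simp add: pre_def)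
      qed
      have "card {k \<in> V. (k \<in> pre D) \<noteq> (nx k \<in> pre D)} =
        card ({k \<in> V - XS. (k \<in> pre D) \<noteq> (nx k \<in> pre D)} \<union> {k \<in> XS. (k \<in> pre D) \<noteq> (nx k \<in> pre D)})"
        using XS_V by (intro arg_cong[of _ _ card]) auto
      also have "\<dots> = card {k \<in> V - XS. (k \<in> pre D) \<noteq> (nx k \<in> pre D)} + card {k \<in> XS. (k \<in> pre D) \<noteq> (nx k \<in> pre D)}"
        using finite_V finite_XS by (intro card_Un_disjoint) auto
      also have "card {k \<in> V - XS. (k \<in> pre D) \<noteq> (nx k \<in> pre D)} = 1"
        unfolding Y by (rule \<D>(5)[OF C D])
      finally have "odd (card {k \<in> XS. (k \<in> pre D) \<noteq> (nx k \<in> pre D)})"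
        using cut_even[of "\<lambda>k. k \<in> pre D"] by simp
      then have "odd (wt (pre D))"
        using odd_crossing_classes[OF compat sat] unfolding wt_def by blast
      then have "1 \<le> wt (pre D)" by (cases "wt (pre D)") auto
      then show ?thesis by (rule le_trans[OF _ wt_le[OF sat]])
    qed
    \<comment> \<open>Neither \<open>Y\<close>-arcs nor even classes leave a cluster, so the number
      of odd classes crossing it is even. It is positive, since \<open>B\<close> has a member and
      that member is not contained in \<open>Q\<close>.\<close>
    have cluster: "2 \<le> ep Q" if Q: "Q \<in> \<Q>'" for Q
    proof -
      obtain x where x: "x \<in> V" "Q = connection V ?E `` {x}"
        using Q by (auto simp: \<Q>'_def \<Q>_def components_def elim: quotientE)
      have inv: "(a \<in> Q) = (b \<in> Q)" if "(a, b) \<in> ?E" "a \<in> V" "b \<in> V" for a b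
      proof -
        have "(a, b) \<in> connection V ?E" using that by (rule connection_base)
        then show ?thesis unfolding x by (auto intro: connection_trans connection_sym)
      qed
      have sat: "(k \<in> Q) = (l \<in> Q)" if "k \<in> V" "l \<in> V" "\<rho> k = \<rho> l" for k l
        using that by (intro inv) (auto simp: link_def)
      have noY: "k \<in> XS \<and> cl k \<in> Odd" if "k \<in> V" "(k \<in> Q) \<noteq> (nx k \<in> Q)" for k
      proof (rule ccontr)
        assume "\<not> (k \<in> XS \<and> cl k \<in> Odd)"
        then have "(k, nx k) \<in> ?E" using that by (auto simp: link_def Ev_def)
        then show False using inv[of k "nx k"] that by simp
      qed
      obtain C where C: "C \<in> B" using False by auto
      have QV: "Q \<subseteq> V" using x by (auto dest: connection_in)
      have "V - Q \<noteq> {}"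
      proof -
        have "C \<subseteq> V" using C BP part_closed(4) by blast
        then show ?thesis using Q C by (auto simp: \<Q>'_def)
      qed
      moreover have "Q \<inter> V \<noteq> {}" using x by (auto intro: connection_refl)
      ultimately obtain k where k: "k \<in> V" "(k \<in> Q) \<noteq> (nx k \<in> Q)" using cut_exists[of Q] by blast
      have "{k \<in> V. (k \<in> Q) \<noteq> (nx k \<in> Q)} = {k \<in> XS. (k \<in> Q) \<noteq> (nx k \<in> Q)}"
        using noY XS_V by blast
      then have "even (card {k \<in> XS. (k \<in> Q) \<noteq> (nx k \<in> Q)})" using cut_even[of "\<lambda>k. k \<in> Q"] by simp
      then have "even (wt Q)"
        using odd_crossing_classes[OF compat sat] unfolding wt_def by blast
      moreover have "wt Q \<noteq> 0"
      proof -
        have "cl k \<in> {\<kappa> \<in> cl ` XS. odd (card {k \<in> XS. cl k = \<kappa>}) \<and>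
            (\<exists>k\<in>XS. cl k = \<kappa> \<and> (k \<in> Q) \<noteq> (nx k \<in> Q))}"
          using noY[OF k] k by (auto simp: Odd_def)
        moreover have "finite {\<kappa> \<in> cl ` XS. odd (card {k \<in> XS. cl k = \<kappa>}) \<and>
            (\<exists>k\<in>XS. cl k = \<kappa> \<and> (k \<in> Q) \<noteq> (nx k \<in> Q))}" using finite_XS by (rule_tac finite_subset[of _ "cl ` XS"]) blast+
        ultimately show ?thesis unfolding wt_def using card_0_eq by blast
      qed
      ultimately have "2 \<le> wt Q" by presburger
      then show ?thesis by (rule le_trans[OF _ wt_le[OF sat]])
    qed
    \<comment> \<open>Leaves are disjoint from each other and, lying in members of \<open>B\<close>,
      from the clusters in \<open>\<Q>'\<close>; each end of an odd class is charged at most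
      once.\<close>
    have pos: "(\<Sum>(C, D)\<in>Sigma B \<D>. of_bool (p \<in> pre D)) + (\<Sum>Q\<in>\<Q>'. of_bool (p \<in> Q)) \<le> (1 :: nat)"
      if p: "p \<in> V" for p
    proof -
      let ?Cp = "connection V (link \<rho>) `` {p}"
      have finS: "finite (Sigma B \<D>)" using finB \<D>(1) by auto
      have one: "x = y" if xy: "x \<in> {x \<in> Sigma B \<D>. p \<in> pre (snd x)}" "y \<in> {x \<in> Sigma B \<D>. p \<in> pre (snd x)}"
 for x y
      proof -
        obtain C D C' D' where x: "x = (C, D)" "C \<in> B" "D \<in> \<D> C" "\<rho> p \<in> D"
          and y: "y = (C', D')" "C' \<in> B" "D' \<in> \<D> C'" "\<rho> p \<in> D'"
          using xy by (auto simp: pre_def)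
        have "p \<in> C"
        proof -
          obtain c where "c \<in> C" "\<rho> c = \<rho> p" using \<D>(4)[OF x(2,3)] x by auto
          then show ?thesis using part_closed(1)[of C \<rho> c p] x BP p by auto
        qed
        moreover have "p \<in> C'"
        proof -
          obtain c where "c \<in> C'" "\<rho> c = \<rho> p" using \<D>(4)[OF y(2,3)] y by auto
          then show ?thesis using part_closed(1)[of C' \<rho> c p] y BP p by auto
        qed
        ultimately have "C = C'" using parts_disjoint[of C \<rho> C' p] x y BP by blast
        moreover have "D = D'"
          using \<D>(3)[OF x(2)] x y \<open>C = C'\<close> by (auto simp: disjoint_def)
        ultimately show ?thesis using x y by simp
      qed
      have s1: "(\<Sum>(C, D)\<in>Sigma B \<D>. of_bool (p \<in> pre D)) = card {x \<in> Sigma B \<D>. p \<in> pre (snd x)}"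
        using finS by (simp add: of_bool_def sum.If_cases Int_def case_prod_beta)
      have s2: "(\<Sum>Q\<in>\<Q>'. of_bool (p \<in> Q)) = card {Q \<in> \<Q>'. p \<in> Q}"
        using finQ by (simp add: of_bool_def sum.If_cases Int_def \<Q>'_def)
      have le1: "card {x \<in> Sigma B \<D>. p \<in> pre (snd x)} \<le> 1"
        using one finS by (intro card_le_Suc0_iff_eq[THEN iffD2, unfolded One_nat_def[symmetric]]) auto
      have le2: "card {Q \<in> \<Q>'. p \<in> Q} \<le> 1"
        using Qdisj finQ by (intro card_le_Suc0_iff_eq[THEN iffD2, unfolded One_nat_def[symmetric]]) (auto simp: \<Q>'_def)
      have excl: "{Q \<in> \<Q>'. p \<in> Q} = {}" if ne: "{x \<in> Sigma B \<D>. p \<in> pre (snd x)} \<noteq> {}"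
      proof (rule ccontr)
        assume "{Q \<in> \<Q>'. p \<in> Q} \<noteq> {}"
        then obtain Q where Q: "Q \<in> \<Q>'" "p \<in> Q" by auto
        obtain C D where x: "C \<in> B" "D \<in> \<D> C" "\<rho> p \<in> D" using ne by (auto simp: pre_def)
        have CP: "C \<in> parts \<rho>" using x BP by auto
        have pC: "p \<in> C"
        proof -
          obtain c where "c \<in> C" "\<rho> c = \<rho> p" using \<D>(4)[OF x(1,2)] x by auto
          then show ?thesis using part_closed(1)[OF CP] p by metis
        qed
        have "C = connection V (link \<rho>) `` {p}" by (rule part_closed(5)[OF CP pC])
        moreover have "Q = connection V ?E `` {p}"
        proof -
          have "Q \<in> \<Q>" using Q by (simp add: \<Q>'_def)
          moreover have "connection V ?E `` {p} \<in> \<Q>" using p by (simp add: \<Q>_def components_def quotientI)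
          moreover have "p \<in> connection V ?E `` {p}" using p by (auto intro: connection_refl)
          ultimately show ?thesis using Qdisj Q by blast
        qed
        moreover have "connection V (link \<rho>) \<subseteq> connection V ?E" by (rule connection_mono) auto
        ultimately have "C \<subseteq> Q" by auto
        then show False using Q x by (auto simp: \<Q>'_def)
      qed
      show ?thesis
      proof (cases "{x \<in> Sigma B \<D>. p \<in> pre (snd x)} = {}")
        case True
        then show ?thesis unfolding s1 s2 using le2 by (simp only: card.empty)
      next
        case F: False
        show ?thesis unfolding s1 s2 excl[OF F] using le1 by simp
      qed
    qed
    \<comment> \<open>Each odd class has two ends, so leaves and clusters together receive at most
      \<open>2 * card Odd\<close>.\<close>
    have "(\<Sum>C\<in>B. r C) + 2 * card \<Q>' \<le> (\<Sum>(C, D)\<in>Sigma B \<D>. ep (pre D)) + (\<Sum>Q\<in>\<Q>'. ep Q)"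
    proof (rule add_mono)
      have "(\<Sum>C\<in>B. r C) = (\<Sum>(C, D)\<in>Sigma B \<D>. 1)"
        using finB \<D>(1,2) by (simp add: card_SigmaI)
      also have "\<dots> \<le> (\<Sum>(C, D)\<in>Sigma B \<D>. ep (pre D))"
        using leaf by (intro sum_mono) auto
      finally show "(\<Sum>C\<in>B. r C) \<le> (\<Sum>(C, D)\<in>Sigma B \<D>. ep (pre D))" .
      have "2 * card \<Q>' = (\<Sum>Q\<in>\<Q>'. 2)" by simp
      also have "\<dots> \<le> (\<Sum>Q\<in>\<Q>'. ep Q)" using cluster by (rule sum_mono)
      finally show "2 * card \<Q>' \<le> (\<Sum>Q\<in>\<Q>'. ep Q)" .
    qed
    also have "\<dots> = (\<Sum>\<kappa>\<in>Odd. ((\<Sum>(C, D)\<in>Sigma B \<D>. of_bool (rep \<kappa> \<in> pre D)) + (\<Sum>Q\<in>\<Q>'. of_bool (rep \<kappa> \<in> Q))) +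
        ((\<Sum>(C, D)\<in>Sigma B \<D>. of_bool (nx (rep \<kappa>) \<in> pre D)) + (\<Sum>Q\<in>\<Q>'. of_bool (nx (rep \<kappa>) \<in> Q))))"
    proof -
      have a: "(\<Sum>Q\<in>\<Q>'. ep Q) = (\<Sum>\<kappa>\<in>Odd. (\<Sum>Q\<in>\<Q>'. of_bool (rep \<kappa> \<in> Q)) + (\<Sum>Q\<in>\<Q>'. of_bool (nx (rep \<kappa>) \<in> Q)))"
        unfolding ep_def sum.distrib[symmetric] by (rule sum.swap)
      have b: "(\<Sum>(C, D)\<in>Sigma B \<D>. ep (pre D)) =
        (\<Sum>\<kappa>\<in>Odd. (\<Sum>(C, D)\<in>Sigma B \<D>. of_bool (rep \<kappa> \<in> pre D)) + (\<Sum>(C, D)\<in>Sigma B \<D>. of_bool (nx (rep \<kappa>) \<in> pre D)))"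
        unfolding ep_def case_prod_beta sum.distrib[symmetric] by (rule sum.swap)
      show ?thesis unfolding a b by (simp only: sum.distrib add.assoc add.left_commute)
    qed
    also have "\<dots> \<le> (\<Sum>\<kappa>\<in>Odd. 1 + 1)"
    proof (rule sum_mono)
      fix \<kappa> assume "\<kappa> \<in> Odd"
      then have "rep \<kappa> \<in> V" using rep(1) XS_V by blast
      moreover from this have "nx (rep \<kappa>) \<in> V" by simp
      ultimately show "(\<Sum>(C, D)\<in>Sigma B \<D>. of_bool (rep \<kappa> \<in> pre D)) + (\<Sum>Q\<in>\<Q>'. of_bool (rep \<kappa> \<in> Q)) +
        ((\<Sum>(C, D)\<in>Sigma B \<D>. of_bool (nx (rep \<kappa>) \<in> pre D)) + (\<Sum>Q\<in>\<Q>'. of_bool (nx (rep \<kappa>) \<in> Q))) \<le> (1 + 1 :: nat)"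
        using pos by (intro add_mono) auto
    qed
    finally have "(\<Sum>C\<in>B. r C) + 2 * card \<Q>' \<le> 2 * card Odd" by simp
    moreover have "card B \<le> card (parts \<rho>)" using BP finite_parts by (rule card_mono[rotated])
    \<comment> \<open>The components outside \<open>B\<close> cost
      \<open>2 * (card (parts \<rho>) - card B)\<close>, which by \<open>cQ\<close> and
      \<open>cQ'\<close> is at most \<open>2 * card \<Q>' + 2 * card Ev\<close>; the first summand
      is what the clusters have saved on the other side.\<close>
    ultimately show ?thesis using total cQ cQ' cE by linarith
  qed
qed

end

section \<open>Kernels\<close>

text \<open>A set partition is represented by the map that sends every point to the least point of its
  block.\<close>

definition kernels :: "nat set \<Rightarrow> (nat \<Rightarrow> nat) set" where
  "kernels V = {\<sigma> \<in> V \<rightarrow>\<^sub>E V. \<forall>x\<in>V. \<sigma> x = Min {y \<in> V. \<sigma> y = \<sigma> x}}"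

definition kernel_of :: "nat set \<Rightarrow> (nat \<Rightarrow> 'a) \<Rightarrow> nat \<Rightarrow> nat" where
  "kernel_of V \<psi> = (\<lambda>x\<in>V. Min {y \<in> V. \<psi> y = \<psi> x})"

definition inj_maps :: "nat set \<Rightarrow> nat \<Rightarrow> (nat \<Rightarrow> nat) set" where
  "inj_maps A n = {\<psi> \<in> A \<rightarrow>\<^sub>E {..<n}. inj_on \<psi> A}"

lemma finite_kernels: "finite V \<Longrightarrow> finite (kernels V)"
  unfolding kernels_def by (rule finite_subset[of _ "V \<rightarrow>\<^sub>E V"]) (auto intro: finite_PiE)

lemma kernel_of_rep:
  assumes "finite V" "x \<in> V"
  shows "kernel_of V \<psi> x \<in> V" "\<psi> (kernel_of V \<psi> x) = \<psi> x"
proof -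
  have "Min {y \<in> V. \<psi> y = \<psi> x} \<in> {y \<in> V. \<psi> y = \<psi> x}"
    using assms by (intro Min_in) auto
  then show "kernel_of V \<psi> x \<in> V" "\<psi> (kernel_of V \<psi> x) = \<psi> x"
    using assms by (auto simp: kernel_of_def)
qed

lemma kernel_of_eq_iff:
  assumes "finite V" "x \<in> V" "y \<in> V"
  shows "kernel_of V \<psi> x = kernel_of V \<psi> y \<longleftrightarrow> \<psi> x = \<psi> y"
proof
  assume "kernel_of V \<psi> x = kernel_of V \<psi> y"
  then show "\<psi> x = \<psi> y" using kernel_of_rep(2)[OF assms(1,2), of \<psi>] kernel_of_rep(2)[OF assms(1,3), of \<psi>] by simp
next
  assume "\<psi> x = \<psi> y"
  then show "kernel_of V \<psi> x = kernel_of V \<psi> y" using assms by (simp add: kernel_of_def)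
qed

lemma kernel_of_kernels:
  assumes "finite V"
  shows "kernel_of V \<psi> \<in> kernels V"
proof -
  have "kernel_of V \<psi> x = Min {y \<in> V. kernel_of V \<psi> y = kernel_of V \<psi> x}" if "x \<in> V" for x
  proof -
    have "{y \<in> V. kernel_of V \<psi> y = kernel_of V \<psi> x} = {y \<in> V. \<psi> y = \<psi> x}"
      using kernel_of_eq_iff[OF assms] that by blast
    then show ?thesis using that by (simp add: kernel_of_def)
  qed
  moreover have "kernel_of V \<psi> \<in> V \<rightarrow>\<^sub>E V"
    using kernel_of_rep(1)[OF assms] by (auto simp: kernel_of_def)
  ultimately show ?thesis unfolding kernels_def by blast
qed

lemma kernels_idem:
  assumes "finite V" "\<sigma> \<in> kernels V" "x \<in> V"
  shows "\<sigma> x \<in> V" "\<sigma> (\<sigma> x) = \<sigma> x"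
proof -
  have "Min {y \<in> V. \<sigma> y = \<sigma> x} \<in> {y \<in> V. \<sigma> y = \<sigma> x}"
    using assms by (intro Min_in) auto
  moreover have "\<sigma> x = Min {y \<in> V. \<sigma> y = \<sigma> x}" using assms by (simp add: kernels_def)
  ultimately have "\<sigma> x \<in> {y \<in> V. \<sigma> y = \<sigma> x}" by (simp only:)
  then show "\<sigma> x \<in> V" "\<sigma> (\<sigma> x) = \<sigma> x" by auto
qed

lemma kernels_unique:
  assumes "\<sigma> \<in> kernels V" "\<And>x y. x \<in> V \<Longrightarrow> y \<in> V \<Longrightarrow> \<sigma> x = \<sigma> y \<longleftrightarrow> \<psi> x = \<psi> y"
  shows "kernel_of V \<psi> = \<sigma>"
proof
  fix x
  show "kernel_of V \<psi> x = \<sigma> x"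
  proof (cases "x \<in> V")
    case True
    then have "{y \<in> V. \<psi> y = \<psi> x} = {y \<in> V. \<sigma> y = \<sigma> x}" using assms(2) by blast
    moreover have "\<sigma> x = Min {y \<in> V. \<sigma> y = \<sigma> x}" using assms(1) True by (simp add: kernels_def)
    ultimately show ?thesis using True by (simp add: kernel_of_def)
  next
    case False
    then show ?thesis using assms(1) by (auto simp: kernel_of_def kernels_def PiE_def extensional_def)
  qed
qed

text \<open>A map with kernel \<sigma> is an injective map on the representatives, which are the
  values of \<sigma>, composed with \<sigma>; this splitting is unique.\<close>

lemma sum_kernels:
  assumes "finite V"
  shows "(\<Sum>\<psi>\<in>V \<rightarrow>\<^sub>E {..<n}. f \<psi>) = (\<Sum>\<sigma>\<in>kernels V. \<Sum>\<psi>\<in>inj_maps (\<sigma> ` V) n. f (restrict (\<psi> \<circ> \<sigma>) V))"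
proof -
  have "(\<Sum>\<psi>\<in>V \<rightarrow>\<^sub>E {..<n}. f \<psi>) = (\<Sum>\<sigma>\<in>kernels V. \<Sum>\<psi>\<in>{\<psi> \<in> V \<rightarrow>\<^sub>E {..<n}. kernel_of V \<psi> = \<sigma>}. f \<psi>)"
    using assms kernel_of_kernels[OF assms]
    by (intro sum.group[symmetric]) (auto intro: finite_PiE finite_kernels)
  also have "\<dots> = (\<Sum>\<sigma>\<in>kernels V. \<Sum>\<psi>\<in>inj_maps (\<sigma> ` V) n. f (restrict (\<psi> \<circ> \<sigma>) V))"
  proof (rule sum.cong[OF refl])
    fix \<sigma> assume \<sigma>: "\<sigma> \<in> kernels V"
    note idem = kernels_idem[OF assms \<sigma>]
    show "(\<Sum>\<psi>\<in>{\<psi> \<in> V \<rightarrow>\<^sub>E {..<n}. kernel_of V \<psi> = \<sigma>}. f \<psi>) = (\<Sum>\<psi>\<in>inj_maps (\<sigma> ` V) n. f (restrict (\<psi> \<circ> \<sigma>) V))"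
    proof (rule sum.reindex_bij_witness[where i = "\<lambda>\<psi>. restrict (\<psi> \<circ> \<sigma>) V" and j = "\<lambda>\<psi>. restrict \<psi> (\<sigma> ` V)"])
      fix \<psi> assume "\<psi> \<in> {\<psi> \<in> V \<rightarrow>\<^sub>E {..<n}. kernel_of V \<psi> = \<sigma>}"
      then have \<psi>: "\<psi> \<in> V \<rightarrow>\<^sub>E {..<n}" "kernel_of V \<psi> = \<sigma>" by auto
      have rep: "\<psi> (\<sigma> x) = \<psi> x" if "x \<in> V" for x
        using kernel_of_rep(2)[OF assms that, of \<psi>] \<psi>(2) by simp
      show eq: "restrict (restrict \<psi> (\<sigma> ` V) \<circ> \<sigma>) V = \<psi>"
      proof
        fix x show "restrict (restrict \<psi> (\<sigma> ` V) \<circ> \<sigma>) V x = \<psi> x"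
          using \<psi>(1) rep by (cases "x \<in> V") (auto simp: PiE_def extensional_def)
      qed
      then show "f (restrict (restrict \<psi> (\<sigma> ` V) \<circ> \<sigma>) V) = f \<psi>" by simp
      have inj: "inj_on \<psi> (\<sigma> ` V)"
      proof (rule inj_onI)
        fix a b assume "a \<in> \<sigma> ` V" "b \<in> \<sigma> ` V" "\<psi> a = \<psi> b"
        then obtain x y where xy: "x \<in> V" "y \<in> V" "a = \<sigma> x" "b = \<sigma> y" by auto
        then have "\<psi> x = \<psi> y" using \<open>\<psi> a = \<psi> b\<close> rep by simp
        then have "kernel_of V \<psi> x = kernel_of V \<psi> y" using kernel_of_eq_iff[OF assms xy(1,2), of \<psi>] by simp
        then show "a = b" using xy \<psi>(2) by simp
      qed
      moreover have "\<sigma> ` V \<subseteq> V" using idem(1) by auto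
      ultimately show "restrict \<psi> (\<sigma> ` V) \<in> inj_maps (\<sigma> ` V) n"
        using \<psi>(1) by (auto simp: inj_maps_def)
    next
      fix \<psi> assume "\<psi> \<in> inj_maps (\<sigma> ` V) n"
      then have \<psi>: "\<psi> \<in> \<sigma> ` V \<rightarrow>\<^sub>E {..<n}" "inj_on \<psi> (\<sigma> ` V)" by (auto simp: inj_maps_def)
      show "restrict (restrict (\<psi> \<circ> \<sigma>) V) (\<sigma> ` V) = \<psi>"
      proof
        fix x show "restrict (restrict (\<psi> \<circ> \<sigma>) V) (\<sigma> ` V) x = \<psi> x"
          using \<psi>(1) idem by (cases "x \<in> \<sigma> ` V") (auto simp: PiE_def extensional_def)
      qed
      have "kernel_of V (restrict (\<psi> \<circ> \<sigma>) V) = \<sigma>"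
      proof (rule kernels_unique[OF \<sigma>])
        fix x y assume "x \<in> V" "y \<in> V"
        then show "\<sigma> x = \<sigma> y \<longleftrightarrow> restrict (\<psi> \<circ> \<sigma>) V x = restrict (\<psi> \<circ> \<sigma>) V y"
          using \<psi>(2) by (auto simp: inj_on_def)
      qed
      then show "restrict (\<psi> \<circ> \<sigma>) V \<in> {\<psi> \<in> V \<rightarrow>\<^sub>E {..<n}. kernel_of V \<psi> = \<sigma>}"
        using \<psi>(1) by (auto simp: PiE_def Pi_def)
    qed
  qed
  finally show ?thesis .
qed

text \<open>Distributivity over disjoint blocks: independent choices on the blocks glue to one map
  on the union. The predicate \<open>P\<close> admits side conditions on each block, such as
  injectivity.\<close>

lemma prod_sum_partition:
  fixes g :: "'i \<Rightarrow> ('a \<Rightarrow> 'b) \<Rightarrow> 'c :: comm_semiring_1"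
  assumes I: "finite I" and S: "\<And>i. i \<in> I \<Longrightarrow> finite (S i)" and T: "\<And>i x. i \<in> I \<Longrightarrow> x \<in> S i \<Longrightarrow> finite (T x)"
    and disj: "\<And>i j x. i \<in> I \<Longrightarrow> j \<in> I \<Longrightarrow> x \<in> S i \<Longrightarrow> x \<in> S j \<Longrightarrow> i = j"
  shows "(\<Prod>i\<in>I. \<Sum>\<psi>\<in>{\<psi> \<in> Pi\<^sub>E (S i) T. P i \<psi>}. g i \<psi>) =
    (\<Sum>\<psi>\<in>{\<psi> \<in> Pi\<^sub>E (\<Union>i\<in>I. S i) T. \<forall>i\<in>I. P i (restrict \<psi> (S i))}. \<Prod>i\<in>I. g i (restrict \<psi> (S i)))"
proof -
  let ?idx = "\<lambda>x. THE i. i \<in> I \<and> x \<in> S i"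
  have idx: "?idx x = i" if "i \<in> I" "x \<in> S i" for i x
    using that disj by blast
  have "(\<Prod>i\<in>I. \<Sum>\<psi>\<in>{\<psi> \<in> Pi\<^sub>E (S i) T. P i \<psi>}. g i \<psi>) =
      (\<Sum>h\<in>Pi\<^sub>E I (\<lambda>i. {\<psi> \<in> Pi\<^sub>E (S i) T. P i \<psi>}). \<Prod>i\<in>I. g i (h i))"
  proof (rule prod_sum_PiE[OF I])
    fix i assume i: "i \<in> I"
    have "finite (Pi\<^sub>E (S i) T)" using S[OF i] T[OF i] by (rule finite_PiE)
    then show "finite {\<psi> \<in> Pi\<^sub>E (S i) T. P i \<psi>}" by simp
  qed
  also have "\<dots> = (\<Sum>\<psi>\<in>{\<psi> \<in> Pi\<^sub>E (\<Union>i\<in>I. S i) T. \<forall>i\<in>I. P i (restrict \<psi> (S i))}. \<Prod>i\<in>I. g i (restrict \<psi> (S i)))"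
  proof (rule sum.reindex_bij_witness[where i = "\<lambda>\<psi>. \<lambda>i\<in>I. restrict \<psi> (S i)"
        and j = "\<lambda>h. \<lambda>x\<in>(\<Union>i\<in>I. S i). h (?idx x) x"])
    fix h assume h: "h \<in> Pi\<^sub>E I (\<lambda>i. {\<psi> \<in> Pi\<^sub>E (S i) T. P i \<psi>})"
    let ?\<psi> = "\<lambda>x\<in>(\<Union>i\<in>I. S i). h (?idx x) x"
    have hi: "h i \<in> Pi\<^sub>E (S i) T" "P i (h i)" if "i \<in> I" for i using h that by auto
    have r: "restrict ?\<psi> (S i) = h i" if i: "i \<in> I" for i
    proof
      fix x show "restrict ?\<psi> (S i) x = h i x"
      proof (cases "x \<in> S i")
        case True
        then show ?thesis using idx[OF i True] i by auto
      next
        case False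
        then show ?thesis using PiE_arb[OF hi(1)[OF i] False] by simp
      qed
    qed
    show "(\<lambda>i\<in>I. restrict ?\<psi> (S i)) = h"
    proof
      fix i show "(\<lambda>i\<in>I. restrict ?\<psi> (S i)) i = h i"
        using r PiE_arb[OF h] by (cases "i \<in> I") auto
    qed
    have "?\<psi> x \<in> T x" if x: "x \<in> (\<Union>i\<in>I. S i)" for x
    proof -
      obtain i where i: "i \<in> I" "x \<in> S i" using x by auto
      then show ?thesis using idx[OF i] PiE_mem[OF hi(1)[OF i(1)] i(2)] by auto
    qed
    then have "?\<psi> \<in> Pi\<^sub>E (\<Union>i\<in>I. S i) T" by (intro PiE_I) auto
    then show "?\<psi> \<in> {\<psi> \<in> Pi\<^sub>E (\<Union>i\<in>I. S i) T. \<forall>i\<in>I. P i (restrict \<psi> (S i))}"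
      using r hi by simp
    show "(\<Prod>i\<in>I. g i (restrict ?\<psi> (S i))) = (\<Prod>i\<in>I. g i (h i))"
      using r by (intro prod.cong) auto
  next
    fix \<psi> assume \<psi>: "\<psi> \<in> {\<psi> \<in> Pi\<^sub>E (\<Union>i\<in>I. S i) T. \<forall>i\<in>I. P i (restrict \<psi> (S i))}"
    show "(\<lambda>x\<in>(\<Union>i\<in>I. S i). (\<lambda>i\<in>I. restrict \<psi> (S i)) (?idx x) x) = \<psi>"
    proof
      fix x show "(\<lambda>x\<in>(\<Union>i\<in>I. S i). (\<lambda>i\<in>I. restrict \<psi> (S i)) (?idx x) x) x = \<psi> x"
      proof (cases "x \<in> (\<Union>i\<in>I. S i)")
        case True
        then obtain i where i: "i \<in> I" "x \<in> S i" by auto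
        then show ?thesis using idx[OF i] True by auto
      next
        case False
        have "\<psi> \<in> Pi\<^sub>E (\<Union>i\<in>I. S i) T" using \<psi> by simp
        then show ?thesis using PiE_arb False by fastforce
      qed
    qed
    show "(\<lambda>i\<in>I. restrict \<psi> (S i)) \<in> Pi\<^sub>E I (\<lambda>i. {\<psi> \<in> Pi\<^sub>E (S i) T. P i \<psi>})"
    proof (rule PiE_I)
      fix i assume i: "i \<in> I"
      have "restrict \<psi> (S i) \<in> Pi\<^sub>E (S i) T" using \<psi> i by (intro PiE_I) (auto simp: PiE_def Pi_def)
      then show "(\<lambda>i\<in>I. restrict \<psi> (S i)) i \<in> {\<psi> \<in> Pi\<^sub>E (S i) T. P i \<psi>}" using \<psi> i by simp
    qed simp
  qed
  finally show ?thesis .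
qed

lemma inj_kernel_id:
  assumes "\<sigma> \<in> kernels V" "inj_on \<sigma> V" "x \<in> V"
  shows "\<sigma> x = x"
proof -
  have "{y \<in> V. \<sigma> y = \<sigma> x} = {x}" using assms(2,3) by (auto simp: inj_on_def)
  moreover have "\<sigma> x = Min {y \<in> V. \<sigma> y = \<sigma> x}" using assms(1,3) by (simp add: kernels_def)
  ultimately show ?thesis by simp
qed

lemma id_kernel: "restrict id V \<in> kernels V"
proof -
  have "{y \<in> V. restrict id V y = restrict id V x} = {x}" if "x \<in> V" for x using that by auto
  then show ?thesis by (auto simp: kernels_def)
qed

section \<open>Injective sums over a kernel and over its components\<close>

context cyclic_walk begin

definition inj_sum :: "nat \<Rightarrow> (nat \<Rightarrow> nat \<Rightarrow> nat \<Rightarrow> 'a :: comm_semiring_1) \<Rightarrow> (nat \<Rightarrow> nat) \<Rightarrow> 'a" where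
  "inj_sum n el \<rho> = (\<Sum>\<psi>\<in>inj_maps (\<rho> ` V) n. \<Prod>k\<in>V - XS. el k (\<psi> (\<rho> k)) (\<psi> (\<rho> (nx k))))"

definition part_sum :: "nat \<Rightarrow> (nat \<Rightarrow> nat \<Rightarrow> nat \<Rightarrow> 'a :: comm_semiring_1) \<Rightarrow> (nat \<Rightarrow> nat) \<Rightarrow> nat set \<Rightarrow> 'a" where
  "part_sum n el \<rho> C = (\<Sum>\<psi>\<in>inj_maps (\<rho> ` C) n. \<Prod>k\<in>C - XS. el k (\<psi> (\<rho> k)) (\<psi> (\<rho> (nx k))))"

text \<open>Identifications between different components only. They describe how a map that is
  injective on each component can fail to be injective.\<close>

definition part_kernels :: "(nat \<Rightarrow> nat) \<Rightarrow> (nat \<Rightarrow> nat) set" where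
  "part_kernels \<rho> = {\<sigma> \<in> kernels (\<rho> ` V). \<forall>C\<in>parts \<rho>. inj_on \<sigma> (\<rho> ` C)}"

lemma inj_sum_cong:
  assumes "\<And>k. k \<in> V \<Longrightarrow> \<rho> k = \<rho>' k"
  shows "inj_sum n el \<rho> = inj_sum n el \<rho>'"
proof -
  have "\<rho> ` V = \<rho>' ` V" using assms by (intro image_cong) auto
  then show ?thesis unfolding inj_sum_def using assms by (intro sum.cong prod.cong) auto
qed

lemma link_comp: "link \<rho> \<subseteq> link (\<sigma> \<circ> \<rho>)"
  by (auto simp: link_def)

lemma compatible_comp: "compatible cl \<rho> \<Longrightarrow> compatible cl (\<sigma> \<circ> \<rho>)"
  unfolding compatible_def
proof (intro ballI impI)
  fix k l assume "\<forall>k\<in>XS. \<forall>l\<in>XS. cl k = cl l \<longrightarrow> {\<rho> k, \<rho> (nx k)} = {\<rho> l, \<rho> (nx l)}"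
    "k \<in> XS" "l \<in> XS" "cl k = cl l"
  then have "{\<rho> k, \<rho> (nx k)} = {\<rho> l, \<rho> (nx l)}" by blast
  then have "\<sigma> ` {\<rho> k, \<rho> (nx k)} = \<sigma> ` {\<rho> l, \<rho> (nx l)}" by (rule arg_cong)
  then show "{(\<sigma> \<circ> \<rho>) k, (\<sigma> \<circ> \<rho>) (nx k)} = {(\<sigma> \<circ> \<rho>) l, (\<sigma> \<circ> \<rho>) (nx l)}" by (simp only: image_insert image_empty o_apply)
qed

lemma part_images_disjoint:
  assumes "C \<in> parts \<rho>" "D \<in> parts \<rho>" "x \<in> \<rho> ` C" "x \<in> \<rho> ` D"
  shows "C = D"
proof -
  obtain c d where cd: "c \<in> C" "d \<in> D" "\<rho> c = x" "\<rho> d = x" using assms by auto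
  have "c \<in> V" using part_closed(4)[OF assms(1) cd(1)] .
  then have "c \<in> D" using part_closed(1)[OF assms(2) cd(2)] cd by simp
  then show ?thesis using parts_disjoint assms cd by metis
qed

lemma finite_part: "C \<in> parts \<rho> \<Longrightarrow> finite C"
  using finite_V part_closed(4) by (metis finite_subset subsetI)

text \<open>The maps on the left are injective on each component separately; on the right they are
  sorted by the identifications that they make across components.\<close>

lemma prod_part_sum:
  "(\<Prod>C\<in>parts \<rho>. part_sum n el \<rho> C) = (\<Sum>\<sigma>\<in>part_kernels \<rho>. inj_sum n el (\<sigma> \<circ> \<rho>))"
proof -
  let ?A = "\<rho> ` V"
  let ?Q = "\<lambda>\<psi>. \<forall>C\<in>parts \<rho>. inj_on \<psi> (\<rho> ` C)"
  let ?f = "\<lambda>\<psi>. \<Prod>k\<in>V - XS. el k (\<psi> (\<rho> k)) (\<psi> (\<rho> (nx k)))"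
  have UA: "(\<Union>C\<in>parts \<rho>. \<rho> ` C) = ?A" using Union_parts[of \<rho>] by auto
  have "(\<Prod>C\<in>parts \<rho>. part_sum n el \<rho> C) =
    (\<Prod>C\<in>parts \<rho>. \<Sum>\<psi>\<in>{\<psi> \<in> \<rho> ` C \<rightarrow>\<^sub>E {..<n}. inj_on \<psi> (\<rho> ` C)}. \<Prod>k\<in>C - XS. el k (\<psi> (\<rho> k)) (\<psi> (\<rho> (nx k))))"
    by (simp add: part_sum_def inj_maps_def)
  also have "\<dots> = (\<Sum>\<psi>\<in>{\<psi> \<in> Pi\<^sub>E (\<Union>C\<in>parts \<rho>. \<rho> ` C) (\<lambda>_. {..<n}). \<forall>C\<in>parts \<rho>. inj_on (restrict \<psi> (\<rho> ` C)) (\<rho> ` C)}.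
      \<Prod>C\<in>parts \<rho>. \<Prod>k\<in>C - XS. el k (restrict \<psi> (\<rho> ` C) (\<rho> k)) (restrict \<psi> (\<rho> ` C) (\<rho> (nx k))))"
    using finite_parts finite_part part_images_disjoint
    by (intro prod_sum_partition) auto
  also have "\<dots> = (\<Sum>\<psi>\<in>{\<psi> \<in> ?A \<rightarrow>\<^sub>E {..<n}. ?Q \<psi>}. ?f \<psi>)"
  proof (rule sum.cong)
    show "{\<psi> \<in> Pi\<^sub>E (\<Union>C\<in>parts \<rho>. \<rho> ` C) (\<lambda>_. {..<n}). \<forall>C\<in>parts \<rho>. inj_on (restrict \<psi> (\<rho> ` C)) (\<rho> ` C)} =
      {\<psi> \<in> ?A \<rightarrow>\<^sub>E {..<n}. ?Q \<psi>}" unfolding UA by simp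
    fix \<psi>
    have "(\<Prod>C\<in>parts \<rho>. \<Prod>k\<in>C - XS. el k (restrict \<psi> (\<rho> ` C) (\<rho> k)) (restrict \<psi> (\<rho> ` C) (\<rho> (nx k)))) =
      (\<Prod>C\<in>parts \<rho>. \<Prod>k\<in>C - XS. el k (\<psi> (\<rho> k)) (\<psi> (\<rho> (nx k))))"
    proof (intro prod.cong refl)
      fix C k assume C: "C \<in> parts \<rho>" "k \<in> C - XS"
      then have "nx k \<in> C" using part_closed(2) by blast
      then show "el k (restrict \<psi> (\<rho> ` C) (\<rho> k)) (restrict \<psi> (\<rho> ` C) (\<rho> (nx k))) = el k (\<psi> (\<rho> k)) (\<psi> (\<rho> (nx k)))"
        using C by simp
    qed
    also have "\<dots> = (\<Prod>k\<in>(\<Union>C\<in>parts \<rho>. C - XS). el k (\<psi> (\<rho> k)) (\<psi> (\<rho> (nx k))))"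
      using finite_parts finite_part parts_disjoint[of _ \<rho>]
      by (intro prod.UNION_disjoint[symmetric]) blast+
    also have "(\<Union>C\<in>parts \<rho>. C - XS) = V - XS" using Union_parts[of \<rho>] by auto
    finally show "(\<Prod>C\<in>parts \<rho>. \<Prod>k\<in>C - XS. el k (restrict \<psi> (\<rho> ` C) (\<rho> k)) (restrict \<psi> (\<rho> ` C) (\<rho> (nx k)))) = ?f \<psi>" .
  qed
  also have "\<dots> = (\<Sum>\<psi>\<in>?A \<rightarrow>\<^sub>E {..<n}. if ?Q \<psi> then ?f \<psi> else 0)"
    using finite_V by (intro sum.inter_filter finite_PiE) auto
  also have "\<dots> = (\<Sum>\<sigma>\<in>kernels ?A. \<Sum>\<psi>\<in>inj_maps (\<sigma> ` ?A) n.
      if ?Q (restrict (\<psi> \<circ> \<sigma>) ?A) then ?f (restrict (\<psi> \<circ> \<sigma>) ?A) else 0)"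
    using finite_V by (intro sum_kernels) auto
  also have "\<dots> = (\<Sum>\<sigma>\<in>kernels ?A. if ?Q \<sigma> then inj_sum n el (\<sigma> \<circ> \<rho>) else 0)"
  proof (rule sum.cong[OF refl])
    fix \<sigma> assume "\<sigma> \<in> kernels ?A"
    have "?Q (restrict (\<psi> \<circ> \<sigma>) ?A) \<longleftrightarrow> ?Q \<sigma>" if "\<psi> \<in> inj_maps (\<sigma> ` ?A) n" for \<psi>
    proof (rule ball_cong[OF refl])
      fix C assume C: "C \<in> parts \<rho>"
      then have sub: "\<rho> ` C \<subseteq> ?A" using part_closed(4) by blast
      have inj: "inj_on \<psi> (\<sigma> ` ?A)" using that by (simp add: inj_maps_def)
      have "inj_on (restrict (\<psi> \<circ> \<sigma>) ?A) (\<rho> ` C) \<longleftrightarrow> inj_on (\<psi> \<circ> \<sigma>) (\<rho> ` C)"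
        using sub by (intro inj_on_cong) auto
      also have "\<dots> \<longleftrightarrow> inj_on \<sigma> (\<rho> ` C)"
      proof
        show "inj_on \<sigma> (\<rho> ` C)" if "inj_on (\<psi> \<circ> \<sigma>) (\<rho> ` C)" using that by (rule inj_on_imageI2)
        show "inj_on (\<psi> \<circ> \<sigma>) (\<rho> ` C)" if "inj_on \<sigma> (\<rho> ` C)"
          using that inj_on_subset[OF inj image_mono[OF sub]] by (rule comp_inj_on)
      qed
      finally show "inj_on (restrict (\<psi> \<circ> \<sigma>) ?A) (\<rho> ` C) \<longleftrightarrow> inj_on \<sigma> (\<rho> ` C)" .
    qed
    moreover have "?f (restrict (\<psi> \<circ> \<sigma>) ?A) = (\<Prod>k\<in>V - XS. el k (\<psi> ((\<sigma> \<circ> \<rho>) k)) (\<psi> ((\<sigma> \<circ> \<rho>) (nx k))))" for \<psi>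
      by (intro prod.cong) auto
    ultimately have "(\<Sum>\<psi>\<in>inj_maps (\<sigma> ` ?A) n. if ?Q (restrict (\<psi> \<circ> \<sigma>) ?A) then ?f (restrict (\<psi> \<circ> \<sigma>) ?A) else 0)
      = (\<Sum>\<psi>\<in>inj_maps (\<sigma> ` ?A) n. if ?Q \<sigma> then (\<Prod>k\<in>V - XS. el k (\<psi> ((\<sigma> \<circ> \<rho>) k)) (\<psi> ((\<sigma> \<circ> \<rho>) (nx k)))) else 0)"
      by (intro sum.cong refl) presburger
    also have "\<dots> = (if ?Q \<sigma> then inj_sum n el (\<sigma> \<circ> \<rho>) else 0)"
    proof -
      have "(\<Sum>x\<in>A. if b then h x else 0) = (if b then sum h A else 0)" for A b and h :: "(nat \<Rightarrow> nat) \<Rightarrow> 'a"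
        by simp
      then show ?thesis by (simp only: inj_sum_def image_comp)
    qed
    finally show "(\<Sum>\<psi>\<in>inj_maps (\<sigma> ` ?A) n. if ?Q (restrict (\<psi> \<circ> \<sigma>) ?A) then ?f (restrict (\<psi> \<circ> \<sigma>) ?A) else 0)
      = (if ?Q \<sigma> then inj_sum n el (\<sigma> \<circ> \<rho>) else 0)" .
  qed
  also have "\<dots> = (\<Sum>\<sigma>\<in>part_kernels \<rho>. inj_sum n el (\<sigma> \<circ> \<rho>))"
    unfolding part_kernels_def using finite_V by (intro sum.inter_filter[symmetric] finite_kernels) auto
  finally show ?thesis .
qed

lemma finite_part_kernels: "finite (part_kernels \<rho>)"
  unfolding part_kernels_def using finite_kernels[of "\<rho> ` V"] finite_V by simp

lemma id_part_kernel: "restrict id (\<rho> ` V) \<in> part_kernels \<rho>"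
proof -
  have "inj_on (restrict id (\<rho> ` V)) (\<rho> ` C)" if "C \<in> parts \<rho>" for C
  proof -
    have "\<rho> ` C \<subseteq> \<rho> ` V" using part_closed(4)[OF that] by blast
    then show ?thesis by (auto simp: inj_on_def subset_iff)
  qed
  then show ?thesis using id_kernel unfolding part_kernels_def by blast
qed

text \<open>A nontrivial \<sigma> identifies two vertices, necessarily of different components, and
  thereby joins these components. This drives the induction that removes the correction
  terms.\<close>

lemma card_parts_comp:
  assumes "\<sigma> \<in> part_kernels \<rho>" "\<sigma> \<noteq> restrict id (\<rho> ` V)"
  shows "card (parts (\<sigma> \<circ> \<rho>)) < card (parts \<rho>)"
proof -
  have \<sigma>: "\<sigma> \<in> kernels (\<rho> ` V)" "\<And>C. C \<in> parts \<rho> \<Longrightarrow> inj_on \<sigma> (\<rho> ` C)"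
    using assms(1) by (auto simp: part_kernels_def)
  have "\<not> inj_on \<sigma> (\<rho> ` V)"
  proof
    assume inj: "inj_on \<sigma> (\<rho> ` V)"
    have "\<sigma> x = restrict id (\<rho> ` V) x" for x
    proof (cases "x \<in> \<rho> ` V")
      case True then show ?thesis using inj_kernel_id[OF \<sigma>(1) inj True] by simp
    next
      case False then show ?thesis using \<sigma>(1) PiE_arb[of \<sigma> "\<rho> ` V" "\<lambda>_. \<rho> ` V" x] by (simp add: kernels_def)
    qed
    then show False using assms(2) by blast
  qed
  then obtain k l where kl: "k \<in> V" "l \<in> V" "\<rho> k \<noteq> \<rho> l" "\<sigma> (\<rho> k) = \<sigma> (\<rho> l)"
    unfolding inj_on_def by blast
  have sub: "connection V (link \<rho>) \<subseteq> connection V (link (\<sigma> \<circ> \<rho>))"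
    by (rule connection_mono) (rule link_comp)
  note mono = card_quotient_antimono[OF finite_V equiv_connection equiv_connection sub]
  have "card (parts (\<sigma> \<circ> \<rho>)) \<noteq> card (parts \<rho>)"
  proof
    assume "card (parts (\<sigma> \<circ> \<rho>)) = card (parts \<rho>)"
    then have eq: "connection V (link \<rho>) = connection V (link (\<sigma> \<circ> \<rho>))"
      using mono(2) by (simp add: parts_def components_def)
    have "(k, l) \<in> connection V (link (\<sigma> \<circ> \<rho>))"
      using kl by (intro connection_base) (auto simp: link_def)
    then have "l \<in> connection V (link \<rho>) `` {k}" using eq by simp
    moreover have "k \<in> connection V (link \<rho>) `` {k}" "connection V (link \<rho>) `` {k} \<in> parts \<rho>"
      using part_of[OF kl(1)] by auto
    ultimately show False using \<sigma>(2)[of "connection V (link \<rho>) `` {k}"] kl by (auto simp: inj_on_def)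
  qed
  then show ?thesis using mono(1) by (simp add: parts_def components_def)
qed

end

section \<open>Expectations of injective sums\<close>

text \<open>A class closed under sums, products and conjugation, so that integrability of every
  polynomial in the entries needs no bookkeeping of exponents.\<close>

definition all_moments :: "'w measure \<Rightarrow> ('w \<Rightarrow> complex) \<Rightarrow> bool" where
  "all_moments M f \<longleftrightarrow> f \<in> borel_measurable M \<and> (\<forall>k::nat. integrable M (\<lambda>\<omega>. cmod (f \<omega>) ^ k))"

lemma all_moments_integrable: "all_moments M f \<Longrightarrow> integrable M f"
proof -
  assume f: "all_moments M f"
  then have "integrable M (\<lambda>\<omega>. cmod (f \<omega>) ^ 1)" unfolding all_moments_def by blast
  then show "integrable M f" using f by (intro integrable_norm_cancel[of M f]) (simp_all add: all_moments_def)
qed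

lemma all_moments_cong:
  "(\<And>\<omega>. \<omega> \<in> space M \<Longrightarrow> f \<omega> = g \<omega>) \<Longrightarrow> all_moments M f \<longleftrightarrow> all_moments M g"
  unfolding all_moments_def by (intro conj_cong measurable_cong all_cong1 Bochner_Integration.integrable_cong) auto

lemma all_moments_cnj: "all_moments M f \<Longrightarrow> all_moments M (\<lambda>\<omega>. cnj (f \<omega>))"
  unfolding all_moments_def by (auto intro!: borel_measurable_continuous_on[where f = cnj] continuous_intros)

context prob_space begin

lemma all_moments_const: "all_moments M (\<lambda>_. c)"
  by (simp add: all_moments_def)

lemma all_moments_mult:
  assumes "all_moments M f" "all_moments M g"
  shows "all_moments M (\<lambda>\<omega>. f \<omega> * g \<omega>)"
  unfolding all_moments_def
proof (intro conjI allI)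
  have [measurable]: "f \<in> borel_measurable M" "g \<in> borel_measurable M" using assms by (auto simp: all_moments_def)
  show "(\<lambda>\<omega>. f \<omega> * g \<omega>) \<in> borel_measurable M" by measurable
  fix k :: nat
  show "integrable M (\<lambda>\<omega>. cmod (f \<omega> * g \<omega>) ^ k)"
  proof (rule Bochner_Integration.integrable_bound)
    show "integrable M (\<lambda>\<omega>. cmod (f \<omega>) ^ (2 * k) + cmod (g \<omega>) ^ (2 * k))"
      using assms unfolding all_moments_def by (intro Bochner_Integration.integrable_add) auto
    show "AE \<omega> in M. norm (cmod (f \<omega> * g \<omega>) ^ k) \<le> norm (cmod (f \<omega>) ^ (2 * k) + cmod (g \<omega>) ^ (2 * k))"
    proof (rule AE_I2)
      fix \<omega>
      let ?a = "cmod (f \<omega>) ^ k" and ?b = "cmod (g \<omega>) ^ k"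
      have "?a * ?b \<le> ?a\<^sup>2 + ?b\<^sup>2" 
      proof -
        have "2 * ?a * ?b \<le> ?a\<^sup>2 + ?b\<^sup>2" by (rule sum_squares_bound)
        moreover have "0 \<le> ?a * ?b" by simp
        ultimately show ?thesis by linarith
      qed
      then show "norm (cmod (f \<omega> * g \<omega>) ^ k) \<le> norm (cmod (f \<omega>) ^ (2 * k) + cmod (g \<omega>) ^ (2 * k))"
        by (simp add: norm_mult power_mult_distrib power_mult[symmetric] mult.commute)
    qed
  qed measurable
qed

lemma all_moments_add:
  assumes "all_moments M f" "all_moments M g"
  shows "all_moments M (\<lambda>\<omega>. f \<omega> + g \<omega>)"
  unfolding all_moments_def
proof (intro conjI allI)
  have [measurable]: "f \<in> borel_measurable M" "g \<in> borel_measurable M" using assms by (auto simp: all_moments_def)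
  show "(\<lambda>\<omega>. f \<omega> + g \<omega>) \<in> borel_measurable M" by measurable
  fix k :: nat
  show "integrable M (\<lambda>\<omega>. cmod (f \<omega> + g \<omega>) ^ k)"
  proof (rule Bochner_Integration.integrable_bound)
    show "integrable M (\<lambda>\<omega>. 2 ^ k * (cmod (f \<omega>) ^ k + cmod (g \<omega>) ^ k))"
      using assms unfolding all_moments_def by (intro integrable_mult_right Bochner_Integration.integrable_add) auto
    show "AE \<omega> in M. norm (cmod (f \<omega> + g \<omega>) ^ k) \<le> norm (2 ^ k * (cmod (f \<omega>) ^ k + cmod (g \<omega>) ^ k))"
    proof (rule AE_I2)
      fix \<omega>
      let ?m = "max (cmod (f \<omega>)) (cmod (g \<omega>))"
      have "cmod (f \<omega> + g \<omega>) \<le> 2 * ?m" using norm_triangle_ineq[of "f \<omega>" "g \<omega>"] by simp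
      then have "cmod (f \<omega> + g \<omega>) ^ k \<le> (2 * ?m) ^ k" by (rule power_mono) simp
      also have "\<dots> = 2 ^ k * ?m ^ k" by (rule power_mult_distrib)
      also have "?m ^ k \<le> cmod (f \<omega>) ^ k + cmod (g \<omega>) ^ k" by (auto simp: max_def)
      finally show "norm (cmod (f \<omega> + g \<omega>) ^ k) \<le> norm (2 ^ k * (cmod (f \<omega>) ^ k + cmod (g \<omega>) ^ k))"
        by simp
    qed
  qed measurable
qed

lemma all_moments_sum:
  "(\<And>i. i \<in> I \<Longrightarrow> all_moments M (f i)) \<Longrightarrow> all_moments M (\<lambda>\<omega>. \<Sum>i\<in>I. f i \<omega>)"
  by (induction I rule: infinite_finite_induct) (auto intro: all_moments_const all_moments_add)

lemma all_moments_prod: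
  "(\<And>i. i \<in> I \<Longrightarrow> all_moments M (f i)) \<Longrightarrow> all_moments M (\<lambda>\<omega>. \<Prod>i\<in>I. f i \<omega>)"
  by (induction I rule: infinite_finite_induct) (auto intro: all_moments_const all_moments_mult)

end

lemma mat_adjoint_index:
  assumes "A \<in> carrier_mat N N" "i < N" "j < N"
  shows "mat_adjoint A $$ (i, j) = cnj (A $$ (j, i) :: complex)"
  using assms by (simp add: mat_adjoint_def mat_of_rows_def)

definition label_entry :: "('v \<Rightarrow> complex mat) \<Rightarrow> 'v star_letter option \<Rightarrow> nat \<Rightarrow> nat \<Rightarrow> complex" where
  "label_entry A l i j = (case l of None \<Rightarrow> of_bool (i = j) | Some l \<Rightarrow> letter_mat A l $$ (i, j))"

section \<open>Matrices satisfying the assumptions on traces\<close>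

locale random_family =
  fixes q :: nat and M :: "nat \<Rightarrow> 'w measure" and Y :: "nat \<Rightarrow> nat \<Rightarrow> 'w \<Rightarrow> complex mat"
  assumes prob: "\<And>N. N \<ge> 1 \<Longrightarrow> prob_space (M N)"
    and random: "\<And>N i. N \<ge> 1 \<Longrightarrow> i < q \<Longrightarrow> random_matrix (M N) N (Y N i)"
    and converge: "traces_converge q M Y" and factorize: "traces_factorize q M Y"
    and bounded: "traces_bounded q M Y"
begin

lemma all_moments_label:
  assumes "N \<ge> 1" "i < N" "j < N" "\<And>a. l = Some a \<Longrightarrow> set_star_letter a \<subseteq> {..<q}"
  shows "all_moments (M N) (\<lambda>\<omega>. label_entry (\<lambda>i. Y N i \<omega>) l i j)"
proof -
  interpret prob_space "M N" by (rule prob) fact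
  have plain: "all_moments (M N) (\<lambda>\<omega>. Y N v \<omega> $$ (m, n))" if "v < q" "m < N" "n < N" for v m n
    using random[OF assms(1) that(1)] that unfolding random_matrix_def all_moments_def by blast
  show ?thesis
  proof (cases l)
    case None
    then show ?thesis by (simp add: label_entry_def all_moments_const)
  next
    case (Some a)
    then have a: "set_star_letter a \<subseteq> {..<q}" using assms(4) by simp
    show ?thesis
    proof (cases a)
      case (Plain v)
      then show ?thesis using plain[of v i j] a assms Some by (simp add: label_entry_def)
    next
      case (Star v)
      then have v: "v < q" using a by simp
      have "all_moments (M N) (\<lambda>\<omega>. cnj (Y N v \<omega> $$ (j, i)))"
        using plain[OF v assms(3,2)] by (rule all_moments_cnj)
      moreover have "label_entry (\<lambda>i. Y N i \<omega>) l i j = cnj (Y N v \<omega> $$ (j, i))" if "\<omega> \<in> space (M N)" for \<omega>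
      proof -
        have "Y N v \<omega> \<in> carrier_mat N N" using random[OF assms(1) v] that by (simp add: random_matrix_def)
        then show ?thesis using assms Star Some by (simp add: label_entry_def mat_adjoint_index)
      qed
      then have "all_moments (M N) (\<lambda>\<omega>. label_entry (\<lambda>i. Y N i \<omega>) l i j) \<longleftrightarrow>
        all_moments (M N) (\<lambda>\<omega>. cnj (Y N v \<omega> $$ (j, i)))" by (rule all_moments_cong)
      ultimately show ?thesis by simp
    qed
  qed
qed

end

section \<open>Components as test graphs\<close>

locale labelled_walk = cyclic_walk V nx XS + random_family q M Y
  for V nx XS q and M :: "nat \<Rightarrow> 'w measure" and Y +
  fixes lab :: "nat \<Rightarrow> nat star_letter option"
  assumes lab_vars: "\<And>k l. k \<in> V - XS \<Longrightarrow> lab k = Some l \<Longrightarrow> set_star_letter l \<subseteq> {..<q}"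
begin

definition el :: "nat \<Rightarrow> 'w \<Rightarrow> nat \<Rightarrow> nat \<Rightarrow> nat \<Rightarrow> complex" where
  "el N \<omega> k = label_entry (\<lambda>i. Y N i \<omega>) (lab k)"

text \<open>An identity arc (label \<open>None\<close>) between distinct vertices makes an injective
  sum vanish, so only kernels that turn these arcs into loops contribute.\<close>

definition proper :: "(nat \<Rightarrow> nat) \<Rightarrow> bool" where
  "proper \<rho> \<longleftrightarrow> (\<forall>k\<in>V - XS. lab k = None \<longrightarrow> \<rho> k = \<rho> (nx k))"

definition proper_on :: "(nat \<Rightarrow> nat) \<Rightarrow> nat set \<Rightarrow> bool" where
  "proper_on \<rho> C \<longleftrightarrow> (\<forall>k\<in>C - XS. lab k = None \<longrightarrow> \<rho> k = \<rho> (nx k))"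

lemma proper_imp_on: "proper \<rho> \<Longrightarrow> C \<in> parts \<rho> \<Longrightarrow> proper_on \<rho> C"
  using part_closed(4)[of C \<rho>] unfolding proper_def proper_on_def by blast

text \<open>The identity arcs are left out: for a proper kernel they are loops with factor 1, and
  the letters of a test graph contain no identity.\<close>

definition part_graph :: "(nat \<Rightarrow> nat) \<Rightarrow> nat set \<Rightarrow> test_graph" where
  "part_graph \<rho> C = (\<lparr>verts = \<rho> ` C, arcs = {k \<in> C - XS. lab k \<noteq> None},
     tail = \<rho>, head = (\<lambda>k. \<rho> (nx k))\<rparr>, \<lambda>k. the (lab k))"

lemma all_moments_inj_sum:
  assumes "N \<ge> 1"
  shows "all_moments (M N) (\<lambda>\<omega>. inj_sum N (el N \<omega>) \<rho>)"
proof -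
  interpret prob_space "M N" by (rule prob) fact
  show ?thesis
    unfolding inj_sum_def el_def
  proof (intro all_moments_sum all_moments_prod all_moments_label assms)
    fix \<psi> k assume a: "\<psi> \<in> inj_maps (\<rho> ` V) N" "k \<in> V - XS"
    then have "\<rho> k \<in> \<rho> ` V" "\<rho> (nx k) \<in> \<rho> ` V" by auto
    then show "\<psi> (\<rho> k) < N" "\<psi> (\<rho> (nx k)) < N" using a(1) unfolding inj_maps_def by auto
    show "\<And>l. lab k = Some l \<Longrightarrow> set_star_letter l \<subseteq> {..<q}" using lab_vars[OF a(2)] .
  qed
qed

lemma improper_inj_sum: "\<not> proper \<rho> \<Longrightarrow> inj_sum N (el N \<omega>) \<rho> = 0"
proof -
  assume "\<not> proper \<rho>"
  then obtain k where k: "k \<in> V - XS" "lab k = None" "\<rho> k \<noteq> \<rho> (nx k)" by (auto simp: proper_def)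
  show ?thesis
    unfolding inj_sum_def
  proof (rule sum.neutral, rule ballI, rule prod_zero)
    fix \<psi> assume "\<psi> \<in> inj_maps (\<rho> ` V) N"
    then have "\<psi> (\<rho> k) \<noteq> \<psi> (\<rho> (nx k))" using k unfolding inj_maps_def inj_on_def by auto
    then have "el N \<omega> k (\<psi> (\<rho> k)) (\<psi> (\<rho> (nx k))) = 0" using k by (simp add: el_def label_entry_def)
    then show "\<exists>k\<in>V - XS. el N \<omega> k (\<psi> (\<rho> k)) (\<psi> (\<rho> (nx k))) = 0" using k(1) by blast
    show "finite (V - XS)" using finite_V by simp
  qed
qed

context
  fixes \<rho> C
  assumes proper: "proper_on \<rho> C" and C: "C \<in> parts \<rho>"
begin

lemma fin_part_graph: "fin_digraph (fst (part_graph \<rho> C))"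
proof
  show "finite (verts (fst (part_graph \<rho> C)))" "finite (arcs (fst (part_graph \<rho> C)))"
    using finite_part[OF C] by (auto simp: part_graph_def)
  fix e assume "e \<in> arcs (fst (part_graph \<rho> C))"
  then have "e \<in> C" "nx e \<in> C" using part_closed(2)[OF C] by (auto simp: part_graph_def)
  then show "tail (fst (part_graph \<rho> C)) e \<in> verts (fst (part_graph \<rho> C))"
    "head (fst (part_graph \<rho> C)) e \<in> verts (fst (part_graph \<rho> C))" by (auto simp: part_graph_def)
qed

text \<open>The omitted arcs are loops and cross nothing, so cuts of the test graph are cuts of the
  component.\<close>

lemma part_graph_crossing:
  "crossing (fst (part_graph \<rho> C)) S = {k \<in> C - XS. (\<rho> k \<in> S) \<noteq> (\<rho> (nx k) \<in> S)}"
proof -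
  have "lab k \<noteq> None" if "k \<in> C - XS" "(\<rho> k \<in> S) \<noteq> (\<rho> (nx k) \<in> S)" for k
  proof
    assume "lab k = None"
    then have "\<rho> k = \<rho> (nx k)" using proper that(1) by (simp add: proper_on_def)
    then show False using that by simp
  qed
  then show ?thesis by (auto simp: crossing_def part_graph_def)
qed

lemma connected_part_graph: "Digraph_Component.connected (fst (part_graph \<rho> C))"
proof -
  interpret fin_digraph "fst (part_graph \<rho> C)" by (rule fin_part_graph)
  obtain x where x: "x \<in> V" "C = connection V (link \<rho>) `` {x}"
    using C by (auto simp: parts_def components_def elim: quotientE)
  show ?thesis
    unfolding connected_iff_crossing[OF wf_digraph_axioms]
  proof (intro conjI allI impI)
    show "verts (fst (part_graph \<rho> C)) \<noteq> {}" using x by (auto simp: part_graph_def intro: connection_refl)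
    fix S assume S: "S \<inter> verts (fst (part_graph \<rho> C)) \<noteq> {}" "verts (fst (part_graph \<rho> C)) - S \<noteq> {}"
    then obtain a b where ab: "a \<in> C" "b \<in> C" "\<rho> a \<in> S" "\<rho> b \<notin> S" by (auto simp: part_graph_def)
    show "crossing (fst (part_graph \<rho> C)) S \<noteq> {}"
    proof
      assume none: "crossing (fst (part_graph \<rho> C)) S = {}"
      let ?f = "\<lambda>k. k \<in> C \<and> \<rho> k \<in> S"
      have "(a, b) \<in> connection V (link \<rho>)" using ab x by (auto intro: connection_trans connection_sym)
      then have "?f a = ?f b"
      proof (rule connection_invariant)
        fix k l assume kl: "(k, l) \<in> link \<rho>" "k \<in> V" "l \<in> V"
        then have "(k, l) \<in> connection V (link \<rho>)" by (intro connection_base)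
        then have kC: "k \<in> C \<longleftrightarrow> l \<in> C" using x by (auto intro: connection_trans connection_sym)
        show "?f k = ?f l"
        proof (cases "k \<in> C")
          case True
          from kl consider "\<rho> k = \<rho> l" | "l = nx k" "k \<notin> XS" by (auto simp: link_def)
          then show ?thesis
          proof cases
            case 1 then show ?thesis using kC by simp
          next
            case 2
            then have "(\<rho> k \<in> S) = (\<rho> (nx k) \<in> S)" using none True unfolding part_graph_crossing by blast
            then show ?thesis using 2 kC by simp
          qed
        qed (use kC in simp)
      qed
      then show False using ab by simp
    qed
  qed
qed

lemma part_graph_test_graphs: "part_graph \<rho> C \<in> test_graphs q"
proof -
  have "set_star_letter (the (lab e)) \<subseteq> {..<q}" if "e \<in> C - XS" "lab e \<noteq> None" for e
    using lab_vars[of e] part_closed(4)[OF C] that by auto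
  then show ?thesis
    using fin_part_graph connected_part_graph unfolding test_graphs_def
    by (auto simp: part_graph_def)
qed

text \<open>\<open>tree_balanced\<close> also counts the identity arcs. These are loops, so leaving
  them out lowers both degrees at a vertex by the same number, and Euler's theorem applies.\<close>

lemma part_graph_cyclic:
  assumes "compatible cl \<rho>" "card (parts \<rho>) = card (cl ` XS) + 1"
  shows "cyclic (fst (part_graph \<rho> C))"
proof (rule cyclic_if_balanced[OF fin_part_graph connected_part_graph])
  fix v assume "v \<in> verts (fst (part_graph \<rho> C))"
  then obtain c where c: "c \<in> C" "v = \<rho> c" by (auto simp: part_graph_def)
  have inC: "k \<in> C" if "k \<in> V" "\<rho> k = v" for k
    using part_closed(1)[OF C c(1) that(1)] that(2) c(2) by simp
  have CV: "k \<in> V" if "k \<in> C" for k using part_closed(4)[OF C that] .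
  have t: "{e \<in> arcs (fst (part_graph \<rho> C)). tail (fst (part_graph \<rho> C)) e = v} =
     {k \<in> V - XS. \<rho> k = v} - {k \<in> C - XS. lab k = None \<and> \<rho> k = v}"
    using inC CV by (auto simp: part_graph_def)
  have inC': "k \<in> C" if "k \<in> V - XS" "\<rho> (nx k) = v" for k
    using part_closed(3)[OF C inC[of "nx k"], of k] that by simp
  have h: "{e \<in> arcs (fst (part_graph \<rho> C)). head (fst (part_graph \<rho> C)) e = v} =
     {k \<in> V - XS. \<rho> (nx k) = v} - {k \<in> C - XS. lab k = None \<and> \<rho> k = v}"
    using inC' CV proper by (auto simp: part_graph_def proper_on_def)
  have sub: "{k \<in> C - XS. lab k = None \<and> \<rho> k = v} \<subseteq> {k \<in> V - XS. \<rho> k = v}"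
    "{k \<in> C - XS. lab k = None \<and> \<rho> k = v} \<subseteq> {k \<in> V - XS. \<rho> (nx k) = v}"
    using proper CV by (auto simp: proper_on_def)
  have "finite C" by (rule finite_part[OF C])
  show "card {e \<in> arcs (fst (part_graph \<rho> C)). tail (fst (part_graph \<rho> C)) e = v} =
    card {e \<in> arcs (fst (part_graph \<rho> C)). head (fst (part_graph \<rho> C)) e = v}"
    unfolding t h using \<open>finite C\<close> sub tree_balanced[OF assms, of v] by (simp add: card_Diff_subset)
qed

lemma part_sum_eq:
  assumes "N \<ge> 1"
  shows "part_sum N (el N \<omega>) \<rho> C = of_nat N * test_trace N (\<lambda>i. Y N i \<omega>) (part_graph \<rho> C)"
proof -
  have "part_sum N (el N \<omega>) \<rho> C = (\<Sum>\<psi>\<in>inj_maps (\<rho> ` C) N.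
      \<Prod>k\<in>{k \<in> C - XS. lab k \<noteq> None}. letter_mat (\<lambda>i. Y N i \<omega>) (the (lab k)) $$ (\<psi> (\<rho> k), \<psi> (\<rho> (nx k))))"
    unfolding part_sum_def
  proof (rule sum.cong[OF refl])
    fix \<psi>
    have "(\<Prod>k\<in>C - XS. el N \<omega> k (\<psi> (\<rho> k)) (\<psi> (\<rho> (nx k)))) =
      (\<Prod>k\<in>{k \<in> C - XS. lab k \<noteq> None}. el N \<omega> k (\<psi> (\<rho> k)) (\<psi> (\<rho> (nx k))))"
    proof (rule prod.mono_neutral_right)
      show "finite (C - XS)" using finite_part[OF C] by simp
      show "\<forall>k\<in>C - XS - {k \<in> C - XS. lab k \<noteq> None}. el N \<omega> k (\<psi> (\<rho> k)) (\<psi> (\<rho> (nx k))) = 1"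
      proof
        fix k assume k: "k \<in> C - XS - {k \<in> C - XS. lab k \<noteq> None}"
        then have "k \<in> C - XS" "lab k = None" by blast+
        moreover from this have "\<rho> k = \<rho> (nx k)" using proper by (simp add: proper_on_def)
        ultimately show "el N \<omega> k (\<psi> (\<rho> k)) (\<psi> (\<rho> (nx k))) = 1"
          by (simp add: el_def label_entry_def)
      qed
    qed auto
    also have "\<dots> = (\<Prod>k\<in>{k \<in> C - XS. lab k \<noteq> None}. letter_mat (\<lambda>i. Y N i \<omega>) (the (lab k)) $$ (\<psi> (\<rho> k), \<psi> (\<rho> (nx k))))"
      by (intro prod.cong refl) (auto simp: el_def label_entry_def)
    finally show "(\<Prod>k\<in>C - XS. el N \<omega> k (\<psi> (\<rho> k)) (\<psi> (\<rho> (nx k)))) =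
      (\<Prod>k\<in>{k \<in> C - XS. lab k \<noteq> None}. letter_mat (\<lambda>i. Y N i \<omega>) (the (lab k)) $$ (\<psi> (\<rho> k), \<psi> (\<rho> (nx k))))" .
  qed
  then show ?thesis using assms by (simp add: test_trace_def inj_graph_trace_def part_graph_def inj_maps_def)
qed

end

text \<open>The assumptions on traces speak about lists of graphs, so the components are enumerated
  in some order.\<close>

definition part_list :: "(nat \<Rightarrow> nat) \<Rightarrow> nat set list" where
  "part_list \<rho> = (SOME xs. set xs = parts \<rho> \<and> distinct xs)"

lemma part_list: "set (part_list \<rho>) = parts \<rho>" "distinct (part_list \<rho>)"
proof -
  have "set (part_list \<rho>) = parts \<rho> \<and> distinct (part_list \<rho>)"
    unfolding part_list_def by (rule someI_ex) (rule finite_distinct_list[OF finite_parts])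
  then show "set (part_list \<rho>) = parts \<rho>" "distinct (part_list \<rho>)" by auto
qed

lemma prod_part_sum_eq:
  assumes "proper \<rho>" "N \<ge> 1"
  shows "(\<Prod>C\<in>parts \<rho>. part_sum N (el N \<omega>) \<rho> C) = of_nat N ^ card (parts \<rho>) *
    (\<Prod>T\<leftarrow>map (part_graph \<rho>) (part_list \<rho>). test_trace N (\<lambda>i. Y N i \<omega>) T)"
proof -
  have "(\<Prod>C\<in>parts \<rho>. part_sum N (el N \<omega>) \<rho> C) =
    (\<Prod>C\<in>parts \<rho>. of_nat N * test_trace N (\<lambda>i. Y N i \<omega>) (part_graph \<rho> C))"
    using part_sum_eq[OF proper_imp_on[OF assms(1)] _ assms(2)] by (intro prod.cong) auto
  also have "\<dots> = of_nat N ^ card (parts \<rho>) * (\<Prod>C\<in>parts \<rho>. test_trace N (\<lambda>i. Y N i \<omega>) (part_graph \<rho> C))"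
    by (simp add: prod.distrib)
  also have "(\<Prod>C\<in>parts \<rho>. test_trace N (\<lambda>i. Y N i \<omega>) (part_graph \<rho> C)) =
    (\<Prod>T\<leftarrow>map (part_graph \<rho>) (part_list \<rho>). test_trace N (\<lambda>i. Y N i \<omega>) T)"
    using prod.distinct_set_conv_list[OF part_list(2), of "\<lambda>C. test_trace N (\<lambda>i. Y N i \<omega>) (part_graph \<rho> C)" \<rho>]
    by (simp add: part_list(1) o_def)
  finally show ?thesis .
qed

lemma integral_prod_part_sum:
  assumes "proper \<rho>" "N \<ge> 1"
  shows "(\<integral>\<omega>. (\<Prod>C\<in>parts \<rho>. part_sum N (el N \<omega>) \<rho> C) \<partial>M N) = of_nat N ^ card (parts \<rho>) *
    (\<integral>\<omega>. (\<Prod>T\<leftarrow>map (part_graph \<rho>) (part_list \<rho>). test_trace N (\<lambda>i. Y N i \<omega>) T) \<partial>M N)"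
  unfolding prod_part_sum_eq[OF assms] by (rule integral_mult_right_zero)

text \<open>With \<open>c\<close> components, the exponent of \<open>N\<close> is \<open>c\<close>
  from the normalisations plus the sum of the \<open>r / 2 - 1\<close> from Assumption 3, together
  half the number of leaves. By \<open>sum_leaves_le\<close> this is at most \<open>E\<close>, one
  less than the exponent in the denominator.\<close>

lemma prod_part_sum_small:
  assumes proper: "proper \<rho>" and compat: "compatible cl \<rho>" and card: "card (parts \<rho>) \<le> card (cl ` XS)"
  shows "(\<lambda>N. (\<integral>\<omega>. (\<Prod>C\<in>parts \<rho>. part_sum N (el N \<omega>) \<rho> C) \<partial>M N) / of_nat N ^ (card (cl ` XS) + 1)) \<longlonglongrightarrow> 0"
proof -
  let ?Ts = "map (part_graph \<rho>) (part_list \<rho>)"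
  let ?I = "\<lambda>N. \<integral>\<omega>. (\<Prod>T\<leftarrow>?Ts. test_trace N (\<lambda>i. Y N i \<omega>) T) \<partial>M N"
  let ?E = "card (cl ` XS)" and ?c = "card (parts \<rho>)"
  let ?r = "\<lambda>C. num_leaves (fst (part_graph \<rho> C))"
  define s where "s = (\<Sum>T\<leftarrow>?Ts. real (num_leaves (fst T)) / 2 - 1)"
  have "set ?Ts \<subseteq> test_graphs q" using part_graph_test_graphs[OF proper_imp_on[OF proper]] part_list(1) by auto
  then have "(\<lambda>N. cmod (?I N)) \<in> O(\<lambda>N. real N powr s)"
    using bounded unfolding traces_bounded_def s_def by blast
  then obtain K where K: "eventually (\<lambda>N. norm (cmod (?I N)) \<le> K * norm (real N powr s)) at_top"
    by (rule landau_o.bigE)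
  have "s = (\<Sum>C\<in>parts \<rho>. real (?r C) / 2 - 1)"
    unfolding s_def using sum.distinct_set_conv_list[OF part_list(2), of "\<lambda>C. real (?r C) / 2 - 1" \<rho>]
    by (simp add: part_list(1) o_def)
  also have "\<dots> = real (\<Sum>C\<in>parts \<rho>. ?r C) / 2 - ?c"
    by (simp add: sum_subtractf sum_divide_distrib)
  also have "\<dots> \<le> real ?E - ?c"
  proof -
    have "(\<Sum>C\<in>parts \<rho>. ?r C) \<le> 2 * ?E"
    proof (rule sum_leaves_le[OF compat card])
      fix C assume C: "C \<in> parts \<rho>"
      show "?r C = 2 \<or> (\<exists>\<D>. finite \<D> \<and> card \<D> = ?r C \<and> disjoint \<D> \<and>
         (\<forall>D\<in>\<D>. D \<subseteq> \<rho> ` C \<and> card {k \<in> C - XS. (\<rho> k \<in> D) \<noteq> (\<rho> (nx k) \<in> D)} = 1))"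
      proof (rule num_leaves_cases[OF fin_part_graph[OF proper_imp_on[OF proper C] C] connected_part_graph[OF proper_imp_on[OF proper C] C]])
        fix \<D> assume \<D>: "finite \<D>" "card \<D> = ?r C" "disjoint \<D>"
          "\<And>D. D \<in> \<D> \<Longrightarrow> D \<subseteq> verts (fst (part_graph \<rho> C)) \<and> (\<exists>e. crossing (fst (part_graph \<rho> C)) D = {e})"
        have "D \<subseteq> \<rho> ` C \<and> card {k \<in> C - XS. (\<rho> k \<in> D) \<noteq> (\<rho> (nx k) \<in> D)} = 1" if D: "D \<in> \<D>" for D
        proof -
          obtain e where "{k \<in> C - XS. (\<rho> k \<in> D) \<noteq> (\<rho> (nx k) \<in> D)} = {e}"
            using \<D>(4)[OF D] unfolding part_graph_crossing[OF proper_imp_on[OF proper C] C] by blast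
          then have "card {k \<in> C - XS. (\<rho> k \<in> D) \<noteq> (\<rho> (nx k) \<in> D)} = card {e}" by (rule arg_cong)
          moreover have "D \<subseteq> \<rho> ` C" using \<D>(4)[OF D] by (simp add: part_graph_def)
          ultimately show ?thesis by simp
        qed
        then show ?thesis using \<D>(1-3) by blast
      qed blast
    qed
    then show ?thesis by linarith
  qed
  finally have s: "s + ?c \<le> real ?E" by simp
  show ?thesis
  proof (rule Lim_null_comparison)
    show "(\<lambda>N. K * inverse (real N)) \<longlonglongrightarrow> 0"
      using tendsto_mult_right_zero[OF lim_inverse_n, of K] by simp
    show "eventually (\<lambda>N. norm ((\<integral>\<omega>. (\<Prod>C\<in>parts \<rho>. part_sum N (el N \<omega>) \<rho> C) \<partial>M N) / of_nat N ^ (?E + 1))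
      \<le> K * inverse (real N)) sequentially"
      using K eventually_ge_at_top[of 1]
    proof eventually_elim
      case (elim N)
      have N: "real N \<ge> 1" using elim by simp
      have "cmod (?I N) \<le> K * real N powr s" using elim(1) by simp
      then have K0: "0 \<le> K * real N powr s" by (rule order_trans[OF norm_ge_zero])
      then have K0: "0 \<le> K" using N by (simp add: zero_le_mult_iff)
      have "norm ((\<integral>\<omega>. (\<Prod>C\<in>parts \<rho>. part_sum N (el N \<omega>) \<rho> C) \<partial>M N) / of_nat N ^ (?E + 1)) =
        real N ^ ?c * cmod (?I N) / real N ^ (?E + 1)"
        unfolding integral_prod_part_sum[OF proper elim(2)] by (simp add: norm_mult norm_divide norm_power)
      also have "\<dots> \<le> real N ^ ?c * (K * real N powr s) / real N ^ (?E + 1)"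
        using elim(1) by (intro divide_right_mono mult_left_mono) auto
      also have "\<dots> = K * (real N powr (s + ?c) / real N ^ (?E + 1))"
        using N by (simp add: powr_add powr_realpow)
      also have "\<dots> \<le> K * (real N powr real ?E / real N ^ (?E + 1))"
        using K0 N s by (intro mult_left_mono divide_right_mono powr_mono) auto
      also have "\<dots> = K * inverse (real N)"
        using N by (simp add: powr_realpow field_simps)
      finally show ?case .
    qed
  qed
qed

text \<open>Assumption 2 splits the expectation and Assumption 1 gives the limits of the factors.
  The normalisations of the \<open>E + 1\<close> traces cancel the denominator exactly.\<close>

lemma prod_part_sum_convergent:
  assumes proper: "proper \<rho>" and compat: "compatible cl \<rho>" and card: "card (parts \<rho>) = card (cl ` XS) + 1"
  shows "convergent (\<lambda>N. (\<integral>\<omega>. (\<Prod>C\<in>parts \<rho>. part_sum N (el N \<omega>) \<rho> C) \<partial>M N) / of_nat N ^ (card (cl ` XS) + 1))"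
proof -
  let ?Ts = "map (part_graph \<rho>) (part_list \<rho>)"
  let ?I = "\<lambda>N. \<integral>\<omega>. (\<Prod>T\<leftarrow>?Ts. test_trace N (\<lambda>i. Y N i \<omega>) T) \<partial>M N"
  let ?J = "\<lambda>N. \<Prod>T\<leftarrow>?Ts. \<integral>\<omega>. test_trace N (\<lambda>i. Y N i \<omega>) T \<partial>M N"
  have T: "T \<in> test_graphs q" "cyclic (fst T)" if "T \<in> set ?Ts" for T
    using that part_graph_test_graphs[OF proper_imp_on[OF proper]] part_graph_cyclic[OF proper_imp_on[OF proper] _ compat card] part_list(1) by auto
  then have d: "(\<lambda>N. ?I N - ?J N) \<longlonglongrightarrow> 0"
    using factorize unfolding traces_factorize_def by blast
  have J: "convergent ?J"
  proof -
    have "convergent (\<lambda>N. \<Prod>T\<leftarrow>Us. \<integral>\<omega>. test_trace N (\<lambda>i. Y N i \<omega>) T \<partial>M N)" if "set Us \<subseteq> set ?Ts" for Us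
      using that
    proof (induction Us)
      case (Cons T Us)
      have "convergent (\<lambda>N. \<integral>\<omega>. test_trace N (\<lambda>i. Y N i \<omega>) T \<partial>M N)"
        using converge T[of T] Cons(2) unfolding traces_converge_def by auto
      then show ?case using Cons by (auto intro: convergent_mult)
    qed (simp add: convergent_const)
    then show ?thesis by blast
  qed
  have "convergent (\<lambda>N. (?I N - ?J N) + ?J N)"
    using convergentI[OF d] J by (rule convergent_add)
  then have I: "convergent ?I" by (simp only: diff_add_cancel)
  have ev: "eventually (\<lambda>N. (\<integral>\<omega>. (\<Prod>C\<in>parts \<rho>. part_sum N (el N \<omega>) \<rho> C) \<partial>M N) / of_nat N ^ (card (cl ` XS) + 1) = ?I N) sequentially"
    using eventually_ge_at_top[of 1]
  proof eventually_elim
    case (elim N)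
    show ?case unfolding integral_prod_part_sum[OF proper elim] card using elim by simp
  qed
  show ?thesis by (rule iffD2[OF convergent_cong[OF ev] I])
qed

text \<open>With \<open>E\<close> classes there are at most \<open>E + 1\<close> components, so this
  exponent leaves a possibly nonzero limit only to the extremal kernels.\<close>

definition scaled :: "nat \<Rightarrow> (nat \<Rightarrow> nat) \<Rightarrow> nat \<Rightarrow> complex" where
  "scaled E \<rho> N = (\<integral>\<omega>. inj_sum N (el N \<omega>) \<rho> \<partial>M N) / of_nat N ^ (E + 1)"

text \<open>Strong induction on the number of components. \<open>prod_part_sum\<close> separates the
  term of \<rho> from the terms of \<open>\<sigma> \<circ> \<rho>\<close>, which have fewer
  components and are compatible with the same \<open>cl\<close>. Having at most \<open>E\<close>
  components, they tend to 0, and the product over the components decides the limit.\<close>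

lemma scaled_limit:
  assumes "compatible cl \<rho>"
  shows "(card (parts \<rho>) \<le> card (cl ` XS) \<longrightarrow> scaled (card (cl ` XS)) \<rho> \<longlonglongrightarrow> 0) \<and>
    convergent (scaled (card (cl ` XS)) \<rho>)"
  using assms
proof (induction "card (parts \<rho>)" arbitrary: \<rho> rule: less_induct)
  case less
  let ?E = "card (cl ` XS)"
  show ?case
  proof (cases "proper \<rho>")
    case False
    then have "scaled ?E \<rho> = (\<lambda>_. 0)" by (simp add: scaled_def improper_inj_sum fun_eq_iff)
    then show ?thesis by (simp add: convergent_const)
  next
    case proper: True
    let ?R = "\<lambda>N. (\<integral>\<omega>. (\<Prod>C\<in>parts \<rho>. part_sum N (el N \<omega>) \<rho> C) \<partial>M N) / of_nat N ^ (?E + 1)"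
    let ?id = "restrict id (\<rho> ` V)"
    let ?K = "part_kernels \<rho> - {?id}"
    have eq: "?R N = scaled ?E \<rho> N + (\<Sum>\<sigma>\<in>?K. scaled ?E (\<sigma> \<circ> \<rho>) N)" if N: "N \<ge> 1" for N
    proof -
      interpret prob_space "M N" by (rule prob) fact
      have int: "integrable (M N) (\<lambda>\<omega>. inj_sum N (el N \<omega>) \<rho>')" for \<rho>'
        by (rule all_moments_integrable) (rule all_moments_inj_sum[OF N])
      have "(\<integral>\<omega>. (\<Prod>C\<in>parts \<rho>. part_sum N (el N \<omega>) \<rho> C) \<partial>M N) =
        (\<integral>\<omega>. inj_sum N (el N \<omega>) (?id \<circ> \<rho>) + (\<Sum>\<sigma>\<in>?K. inj_sum N (el N \<omega>) (\<sigma> \<circ> \<rho>)) \<partial>M N)"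
        unfolding prod_part_sum by (subst sum.remove[OF finite_part_kernels id_part_kernel]) simp
      also have "\<dots> = (\<integral>\<omega>. inj_sum N (el N \<omega>) (?id \<circ> \<rho>) \<partial>M N) + (\<Sum>\<sigma>\<in>?K. \<integral>\<omega>. inj_sum N (el N \<omega>) (\<sigma> \<circ> \<rho>) \<partial>M N)"
        using int by (simp add: Bochner_Integration.integral_add Bochner_Integration.integral_sum)
      also have "\<dots> = (\<integral>\<omega>. inj_sum N (el N \<omega>) \<rho> \<partial>M N) + (\<Sum>\<sigma>\<in>?K. \<integral>\<omega>. inj_sum N (el N \<omega>) (\<sigma> \<circ> \<rho>) \<partial>M N)"
      proof -
        have "inj_sum N (el N \<omega>) (?id \<circ> \<rho>) = inj_sum N (el N \<omega>) \<rho>" for \<omega>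
          by (rule inj_sum_cong) simp
        then show ?thesis by (simp only:)
      qed
      finally show ?thesis by (simp only: scaled_def add_divide_distrib sum_divide_distrib)
    qed
    have IH: "scaled ?E (\<sigma> \<circ> \<rho>) \<longlonglongrightarrow> 0" if "\<sigma> \<in> ?K" for \<sigma>
    proof -
      have lt: "card (parts (\<sigma> \<circ> \<rho>)) < card (parts \<rho>)" using card_parts_comp[of \<sigma> \<rho>] that by blast
      moreover have "card (parts (\<sigma> \<circ> \<rho>)) \<le> ?E" using lt card_parts_le[OF less.prems] by simp
      ultimately show ?thesis using less.hyps[OF lt compatible_comp[OF less.prems]] by blast
    qed
    then have rest: "(\<lambda>N. \<Sum>\<sigma>\<in>?K. scaled ?E (\<sigma> \<circ> \<rho>) N) \<longlonglongrightarrow> 0"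
      by (rule tendsto_null_sum)
    have ev: "eventually (\<lambda>N. ?R N - (\<Sum>\<sigma>\<in>?K. scaled ?E (\<sigma> \<circ> \<rho>) N) = scaled ?E \<rho> N) sequentially"
      using eventually_ge_at_top[of 1] by eventually_elim (simp only: eq add_diff_cancel_right')
    show ?thesis
    proof (cases "card (parts \<rho>) \<le> ?E")
      case True
      have "(\<lambda>N. ?R N - (\<Sum>\<sigma>\<in>?K. scaled ?E (\<sigma> \<circ> \<rho>) N)) \<longlonglongrightarrow> 0 - 0"
        by (rule tendsto_diff[OF prod_part_sum_small[OF proper less.prems True] rest])
      then have "scaled ?E \<rho> \<longlonglongrightarrow> 0" using tendsto_cong[OF ev] by simp
      then show ?thesis using convergentI by blast
    next
      case False
      then have "card (parts \<rho>) = ?E + 1" using card_parts_le[OF less.prems] by simp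
      then have "convergent ?R" by (rule prod_part_sum_convergent[OF proper less.prems])
      then have "convergent (\<lambda>N. ?R N - (\<Sum>\<sigma>\<in>?K. scaled ?E (\<sigma> \<circ> \<rho>) N))"
        using convergentI[OF rest] by (rule convergent_diff)
      then show ?thesis using convergent_cong[OF ev] False by simp
    qed
  qed
qed

end

section \<open>Moments of heavy Wigner matrices\<close>

text \<open>The body of \<open>heavy_wigner\<close> with its two families of laws as arguments, so
  that they can be chosen once and then kept fixed.\<close>

definition wigner_laws ::
  "(nat \<Rightarrow> 'w measure) \<Rightarrow> (nat \<Rightarrow> 'w \<Rightarrow> complex mat) \<Rightarrow> (nat \<Rightarrow> real) \<Rightarrow>
     (nat \<Rightarrow> complex measure) \<Rightarrow> (nat \<Rightarrow> real measure) \<Rightarrow> bool" where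
  "wigner_laws M X a \<mu> \<nu> \<longleftrightarrow>
       (\<forall>N\<ge>1.
          random_matrix (M N) N (X N) \<and>
          (AE \<omega> in M N. mat_adjoint (X N \<omega>) = X N \<omega>) \<and>
          prob_space.indep_vars (M N) (\<lambda>_. borel) (\<lambda>(m, n) \<omega>. X N \<omega> $$ (m, n))
            {(m, n). n \<le> m \<and> m < N} \<and>
          (\<forall>m<N. \<forall>n\<le>m. (\<integral>\<omega>. X N \<omega> $$ (m, n) \<partial>M N) = 0) \<and>
          prob_space (\<nu> N) \<and> sets (\<nu> N) = sets borel \<and>
          (\<forall>m<N. distr (M N) borel (\<lambda>\<omega>. complex_of_real (sqrt (real N)) * X N \<omega> $$ (m, m))
                  = distr (\<nu> N) borel complex_of_real) \<and>
          prob_space (\<mu> N) \<and> sets (\<mu> N) = sets borel \<and>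
          (\<forall>m<N. \<forall>n<m. distr (M N) borel (\<lambda>\<omega>. complex_of_real (sqrt (real N)) * X N \<omega> $$ (m, n))
                  = \<mu> N) \<and>
          distr (\<mu> N) borel cnj = \<mu> N \<and>
          (\<forall>k::nat. integrable (\<mu> N) (\<lambda>z. cmod z ^ k) \<and> integrable (\<nu> N) (\<lambda>t. \<bar>t\<bar> ^ k))) \<and>
       (\<forall>k\<ge>1.
          (\<lambda>N. (\<integral>z. cmod z ^ (2 * k) \<partial>\<mu> N) / real N ^ (k - 1)) \<longlonglongrightarrow> a k \<and>
          (\<lambda>N. (\<integral>t. t ^ (2 * k) \<partial>\<nu> N) / real N ^ (k - 1)) \<in> O(\<lambda>_. 1))"

lemma heavy_wigner_laws: "heavy_wigner M X a \<longleftrightarrow> (\<exists>\<mu> \<nu>. wigner_laws M X a \<mu> \<nu>)"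
  unfolding heavy_wigner_def wigner_laws_def ..

lemma prod_fibres_set:
  fixes G :: "'a set \<Rightarrow> 'c :: comm_monoid_mult"
  shows "(\<Prod>\<kappa>\<in>h ` S. G {k \<in> S. h k = \<kappa>}) = (\<Prod>K\<in>(\<lambda>k. {l \<in> S. h l = h k}) ` S. G K)"
proof -
  have "inj_on (\<lambda>\<kappa>. {k \<in> S. h k = \<kappa>}) (h ` S)"
  proof (rule inj_onI)
    fix x y assume "x \<in> h ` S" "y \<in> h ` S" "{k \<in> S. h k = x} = {k \<in> S. h k = y}"
    then show "x = y" by blast
  qed
  then have "(\<Prod>\<kappa>\<in>h ` S. G {k \<in> S. h k = \<kappa>}) = (\<Prod>K\<in>(\<lambda>\<kappa>. {k \<in> S. h k = \<kappa>}) ` (h ` S). G K)"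
    by (simp add: prod.reindex)
  then show ?thesis by (simp add: image_image)
qed

text \<open>A product over fibres depends only on the partition that the function induces; this
  serves to replace one labelling of the classes by another.\<close>

lemma prod_fibres:
  fixes G :: "'a set \<Rightarrow> 'c :: comm_monoid_mult"
  assumes "\<And>k l. k \<in> S \<Longrightarrow> l \<in> S \<Longrightarrow> f k = f l \<longleftrightarrow> g k = g l"
  shows "(\<Prod>\<kappa>\<in>f ` S. G {k \<in> S. f k = \<kappa>}) = (\<Prod>\<kappa>\<in>g ` S. G {k \<in> S. g k = \<kappa>})"
proof -
  have "(\<lambda>k. {l \<in> S. f l = f k}) ` S = (\<lambda>k. {l \<in> S. g l = g k}) ` S"
    using assms by (intro image_cong refl Collect_cong) blast
  then show ?thesis unfolding prod_fibres_set by (simp only:)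
qed

text \<open>The definition of a heavy Wigner matrix controls even moments only. An odd moment is
  bounded by its two even neighbours, and the weights \<open>sqrt (real N)\<close> and its inverse
  give both of them the order at which the scaled quantity stays bounded.\<close>

lemma scaled_moment_bounded:
  fixes m :: "nat \<Rightarrow> nat \<Rightarrow> real"
  assumes even: "\<And>k. k \<ge> 1 \<Longrightarrow> \<exists>C. eventually (\<lambda>N. m (2 * k) N / real N ^ (k - 1) \<le> C) sequentially"
    and odd: "\<And>k N. k \<ge> 1 \<Longrightarrow> N \<ge> 1 \<Longrightarrow>
      m (2 * k + 1) N \<le> (sqrt (real N) * m (2 * k) N + m (2 * k + 2) N / sqrt (real N)) / 2"
    and r: "r \<ge> 2"
  shows "\<exists>C. eventually (\<lambda>N. real N * (m r N / sqrt (real N) ^ r) \<le> C) sequentially"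
proof (cases "even r")
  case True
  then obtain k where k: "r = 2 * k" by blast
  with r have k1: "k \<ge> 1" by simp
  obtain C where C: "eventually (\<lambda>N. m (2 * k) N / real N ^ (k - 1) \<le> C) sequentially"
    using even[OF k1] by blast
  have "eventually (\<lambda>N. real N * (m r N / sqrt (real N) ^ r) \<le> C) sequentially"
    using C eventually_ge_at_top[of 1]
  proof eventually_elim
    case (elim N)
    have "real N * (m r N / sqrt (real N) ^ r) = m (2 * k) N / real N ^ (k - 1)"
    proof -
      obtain l where l: "k = Suc l" using k1 by (cases k) auto
      have "sqrt (real N) ^ r = real N * real N ^ l" by (simp add: k l power_mult)
      then show ?thesis using elim(2) by (simp add: k l)
    qed
    then show ?case using elim by simp
  qed
  then show ?thesis by blast
next
  case False
  then obtain k where k: "r = 2 * k + 1" by (rule oddE)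
  with r have k1: "k \<ge> 1" by simp
  obtain C where C: "eventually (\<lambda>N. m (2 * k) N / real N ^ (k - 1) \<le> C) sequentially"
    using even[OF k1] by blast
  obtain D where D: "eventually (\<lambda>N. m (2 * (k + 1)) N / real N ^ (k + 1 - 1) \<le> D) sequentially"
    using even[of "k + 1"] by auto
  have "eventually (\<lambda>N. real N * (m r N / sqrt (real N) ^ r) \<le> (C + D) / 2) sequentially"
    using C D eventually_ge_at_top[of 1]
  proof eventually_elim
    case (elim N)
    let ?s = "sqrt (real N)"
    have s: "?s > 0" "?s * ?s = real N" using elim(3) by auto
    have "real N * (m r N / ?s ^ r) \<le>
        real N * (((?s * m (2 * k) N + m (2 * k + 2) N / ?s) / 2) / ?s ^ r)"
      using odd[OF k1 elim(3)] s k by (intro mult_left_mono divide_right_mono) auto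
    also have "\<dots> = (m (2 * k) N / real N ^ (k - 1) + m (2 * (k + 1)) N / real N ^ (k + 1 - 1)) / 2"
    proof -
      obtain l where l: "k = Suc l" using k1 by (cases k) auto
      have p: "?s ^ r = ?s * (real N * real N ^ l)"
        using s by (simp add: k l power_mult power2_eq_square)
      have "real N * (((?s * A + B / ?s) / 2) / (?s * (real N * real N ^ l))) = (A / real N ^ l + B / (real N * real N ^ l)) / 2"
        for A B
      proof -
        have "B / ?s / ?s = B / real N" using s by (simp add: divide_divide_eq_left)
        then have "(?s * A + B / ?s) / ?s = A + B / real N" using s by (simp add: add_divide_distrib)
        moreover have "real N * (((?s * A + B / ?s) / 2) / (?s * (real N * real N ^ l))) =
            ((?s * A + B / ?s) / ?s) / real N ^ l / 2"
        proof -
          have "n * ((T / 2) / (s * (n * L))) = (T / s) / L / 2" if "n > 0" for n T s L :: real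
            using that by (simp add: field_simps)
          then show ?thesis using elim(3) by simp
        qed
        ultimately show ?thesis by (simp add: add_divide_distrib)
      qed
      then show ?thesis unfolding p by (simp add: l)
    qed
    also have "\<dots> \<le> (C + D) / 2"
      by (rule divide_right_mono, rule add_mono[OF elim(1,2)]) simp
    finally show ?case .
  qed
  then show ?thesis by blast
qed

text \<open>Divide \<open>2 * s * x \<le> s\<^sup>2 + x\<^sup>2\<close> by \<open>2 * s\<close> and
  multiply by an even power of \<open>x\<close>.\<close>

lemma odd_power_le:
  fixes x s :: real
  assumes "x \<ge> 0" "s > 0"
  shows "x ^ (2 * k + 1) \<le> (s * x ^ (2 * k) + x ^ (2 * k + 2) / s) / 2"
proof -
  have "2 * s * x \<le> s\<^sup>2 + x\<^sup>2" by (rule sum_squares_bound)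
  then have "x \<le> (s + x\<^sup>2 / s) / 2" using assms(2) by (simp add: field_simps power2_eq_square)
  then have "x ^ (2 * k) * x \<le> x ^ (2 * k) * ((s + x\<^sup>2 / s) / 2)"
    using assms(1) by (intro mult_left_mono) auto
  then show ?thesis by (simp add: algebra_simps power2_eq_square)
qed

lemma integral_odd_power_le:
  fixes f :: "'a \<Rightarrow> real"
  assumes int: "\<And>k. integrable K (\<lambda>x. f x ^ k)" and f: "\<And>x. f x \<ge> 0" and s: "s > 0"
  shows "(\<integral>x. f x ^ (2 * k + 1) \<partial>K) \<le> (s * (\<integral>x. f x ^ (2 * k) \<partial>K) + (\<integral>x. f x ^ (2 * k + 2) \<partial>K) / s) / 2"
proof -
  have i: "integrable K (\<lambda>x. s * f x ^ (2 * k))" "integrable K (\<lambda>x. f x ^ (2 * k + 2) / s)"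
    by (intro integrable_mult_right integrable_divide int)+
  have "(\<integral>x. f x ^ (2 * k + 1) \<partial>K) \<le> (\<integral>x. (s * f x ^ (2 * k) + f x ^ (2 * k + 2) / s) / 2 \<partial>K)"
    by (intro integral_mono odd_power_le integrable_divide Bochner_Integration.integrable_add i int f s)
  also have "\<dots> = (s * (\<integral>x. f x ^ (2 * k) \<partial>K) + (\<integral>x. f x ^ (2 * k + 2) \<partial>K) / s) / 2"
    unfolding integral_divide_zero Bochner_Integration.integral_add[OF i] integral_mult_right_zero ..
  finally show ?thesis .
qed

section \<open>Moments of the entries of heavy Wigner matrices\<close>

locale wigner_family =
  fixes p :: nat and M :: "nat \<Rightarrow> 'w measure" and X :: "nat \<Rightarrow> nat \<Rightarrow> 'w \<Rightarrow> complex mat"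
    and a :: "nat \<Rightarrow> nat \<Rightarrow> real" and \<mu> :: "nat \<Rightarrow> nat \<Rightarrow> complex measure" and \<nu> :: "nat \<Rightarrow> nat \<Rightarrow> real measure"
  assumes probX: "\<And>N. N \<ge> 1 \<Longrightarrow> prob_space (M N)"
    and laws: "\<And>j. j < p \<Longrightarrow> wigner_laws M (\<lambda>N. X N j) (a j) (\<mu> j) (\<nu> j)"
    and indepX: "\<And>N. N \<ge> 1 \<Longrightarrow> prob_space.indep_vars (M N)
           (\<lambda>j. entry_space {j} N) (\<lambda>j. entries {j} N (X N)) {..<p}"
begin

definition off_moment :: "nat \<Rightarrow> nat \<Rightarrow> nat \<Rightarrow> nat \<Rightarrow> complex" where
  "off_moment N j r s = (\<integral>z. z ^ r * cnj z ^ s \<partial>\<mu> j N)"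

definition diag_moment :: "nat \<Rightarrow> nat \<Rightarrow> nat \<Rightarrow> complex" where
  "diag_moment N j r = (\<integral>t. complex_of_real t ^ r \<partial>\<nu> j N)"

abbreviation inv_sqrt :: "nat \<Rightarrow> complex" where
  "inv_sqrt N \<equiv> complex_of_real (1 / sqrt (real N))"

lemma cnj_borel [measurable]: "cnj \<in> borel_measurable borel"
  by (intro borel_measurable_continuous_onI continuous_intros)

context
  fixes N j :: nat assumes N: "N \<ge> 1" and j: "j < p"
begin

lemma law_facts:
  shows "random_matrix (M N) N (X N j)"
    and "AE \<omega> in M N. mat_adjoint (X N j \<omega>) = X N j \<omega>"
    and "prob_space.indep_vars (M N) (\<lambda>_. borel) (\<lambda>(m, n) \<omega>. X N j \<omega> $$ (m, n)) {(m, n). n \<le> m \<and> m < N}"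
    and "m < N \<Longrightarrow> n \<le> m \<Longrightarrow> (\<integral>\<omega>. X N j \<omega> $$ (m, n) \<partial>M N) = 0"
    and "prob_space (\<nu> j N)" "sets (\<nu> j N) = sets borel"
    and "m < N \<Longrightarrow> distr (M N) borel (\<lambda>\<omega>. complex_of_real (sqrt (real N)) * X N j \<omega> $$ (m, m)) = distr (\<nu> j N) borel complex_of_real"
    and "prob_space (\<mu> j N)" "sets (\<mu> j N) = sets borel"
    and "m < N \<Longrightarrow> n < m \<Longrightarrow> distr (M N) borel (\<lambda>\<omega>. complex_of_real (sqrt (real N)) * X N j \<omega> $$ (m, n)) = \<mu> j N"
    and "distr (\<mu> j N) borel cnj = \<mu> j N"
    and "integrable (\<mu> j N) (\<lambda>z. cmod z ^ k)" "integrable (\<nu> j N) (\<lambda>t. \<bar>t\<bar> ^ k)"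
  using laws[OF j] N unfolding wigner_laws_def by blast+

lemma all_moments_X: "m < N \<Longrightarrow> n < N \<Longrightarrow> all_moments (M N) (\<lambda>\<omega>. X N j \<omega> $$ (m, n))"
  using law_facts(1) unfolding random_matrix_def all_moments_def by blast

lemma hermitian: "AE \<omega> in M N. \<forall>m<N. \<forall>n<N. X N j \<omega> $$ (n, m) = cnj (X N j \<omega> $$ (m, n))"
  using law_facts(2) AE_space
proof eventually_elim
  case (elim \<omega>)
  have c: "X N j \<omega> \<in> carrier_mat N N" using law_facts(1) elim(2) by (simp add: random_matrix_def)
  show ?case
  proof (intro allI impI)
    fix m n assume "m < N" "n < N"
    then have "mat_adjoint (X N j \<omega>) $$ (n, m) = cnj (X N j \<omega> $$ (m, n))"
      using mat_adjoint_index[OF c] by blast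
    then show "X N j \<omega> $$ (n, m) = cnj (X N j \<omega> $$ (m, n))" unfolding elim(1) .
  qed
qed

lemma sqrt_cancel: "inv_sqrt N ^ r * (complex_of_real (sqrt (real N)) * z) ^ r = z ^ r"
proof -
  have "inv_sqrt N * complex_of_real (sqrt (real N)) = 1"
    using N by (simp flip: of_real_mult)
  then show ?thesis by (simp add: power_mult_distrib[symmetric] mult.assoc[symmetric])
qed

lemma moment_below:
  assumes "m < N" "n < m"
  shows "(\<integral>\<omega>. X N j \<omega> $$ (m, n) ^ r * X N j \<omega> $$ (n, m) ^ s \<partial>M N) = inv_sqrt N ^ (r + s) * off_moment N j r s"
proof -
  let ?x = "\<lambda>\<omega>. X N j \<omega> $$ (m, n)" and ?c = "complex_of_real (sqrt (real N))"
  have [measurable]: "?x \<in> borel_measurable (M N)"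
    using all_moments_X[of m n] assms by (simp add: all_moments_def)
  have [measurable]: "(\<lambda>\<omega>. X N j \<omega> $$ (n, m)) \<in> borel_measurable (M N)"
    using all_moments_X[of n m] assms by (simp add: all_moments_def)
  have "(\<integral>\<omega>. ?x \<omega> ^ r * X N j \<omega> $$ (n, m) ^ s \<partial>M N) = (\<integral>\<omega>. ?x \<omega> ^ r * cnj (?x \<omega>) ^ s \<partial>M N)"
  proof (rule integral_cong_AE)
    show "AE \<omega> in M N. ?x \<omega> ^ r * X N j \<omega> $$ (n, m) ^ s = ?x \<omega> ^ r * cnj (?x \<omega>) ^ s"
      using hermitian
    proof eventually_elim
      case (elim \<omega>)
      have "n < N" using assms by simp
      then have "X N j \<omega> $$ (n, m) = cnj (?x \<omega>)" using elim assms(1) by blast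
      then show ?case by (simp only:)
    qed
  qed measurable
  also have "\<dots> = (\<integral>\<omega>. inv_sqrt N ^ (r + s) * ((?c * ?x \<omega>) ^ r * cnj (?c * ?x \<omega>) ^ s) \<partial>M N)"
  proof (rule Bochner_Integration.integral_cong[OF refl])
    fix \<omega>
    have "inv_sqrt N ^ (r + s) * ((?c * ?x \<omega>) ^ r * cnj (?c * ?x \<omega>) ^ s) =
      (inv_sqrt N ^ r * (?c * ?x \<omega>) ^ r) * (inv_sqrt N ^ s * (?c * cnj (?x \<omega>)) ^ s)"
      by (simp add: power_add)
    then show "?x \<omega> ^ r * cnj (?x \<omega>) ^ s = inv_sqrt N ^ (r + s) * ((?c * ?x \<omega>) ^ r * cnj (?c * ?x \<omega>) ^ s)"
      by (simp only: sqrt_cancel)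
  qed
  also have "\<dots> = inv_sqrt N ^ (r + s) * (\<integral>\<omega>. (?c * ?x \<omega>) ^ r * cnj (?c * ?x \<omega>) ^ s \<partial>M N)"
    by (rule integral_mult_right_zero)
  also have "(\<integral>\<omega>. (?c * ?x \<omega>) ^ r * cnj (?c * ?x \<omega>) ^ s \<partial>M N) =
    (\<integral>z. z ^ r * cnj z ^ s \<partial>distr (M N) borel (\<lambda>\<omega>. ?c * ?x \<omega>))"
    by (rule integral_distr[symmetric]) measurable
  also have "distr (M N) borel (\<lambda>\<omega>. ?c * ?x \<omega>) = \<mu> j N" by (rule law_facts(10)) fact+
  finally show ?thesis by (simp add: off_moment_def)
qed

text \<open>Invariance of the law under conjugation. It makes entries above and below the diagonal
  contribute alike, whichever orientation is counted first.\<close>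

lemma off_moment_sym: "off_moment N j r s = off_moment N j s r"
proof -
  note [measurable_cong] = law_facts(9)
  have "off_moment N j r s = (\<integral>z. z ^ r * cnj z ^ s \<partial>distr (\<mu> j N) borel cnj)"
    by (simp add: off_moment_def law_facts(11))
  also have "\<dots> = (\<integral>z. cnj z ^ r * cnj (cnj z) ^ s \<partial>\<mu> j N)"
    by (rule integral_distr) measurable
  finally show ?thesis by (simp add: off_moment_def mult.commute)
qed

lemma moment_off:
  assumes "m < N" "n < N" "m \<noteq> n"
  shows "(\<integral>\<omega>. X N j \<omega> $$ (m, n) ^ r * X N j \<omega> $$ (n, m) ^ s \<partial>M N) = inv_sqrt N ^ (r + s) * off_moment N j r s"
proof (cases "n < m")
  case True
  then show ?thesis using moment_below assms by simp
next
  case False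
  then have "m < n" using assms by simp
  then show ?thesis using moment_below[of n m s r] assms off_moment_sym[of r s]
    by (simp add: mult.commute add.commute)
qed

lemma moment_diag:
  assumes "m < N"
  shows "(\<integral>\<omega>. X N j \<omega> $$ (m, m) ^ r \<partial>M N) = inv_sqrt N ^ r * diag_moment N j r"
proof -
  let ?x = "\<lambda>\<omega>. X N j \<omega> $$ (m, m)" and ?c = "complex_of_real (sqrt (real N))"
  note [measurable_cong] = law_facts(6)
  have [measurable]: "?x \<in> borel_measurable (M N)"
    using all_moments_X[of m m] assms by (simp add: all_moments_def)
  have "(\<integral>\<omega>. ?x \<omega> ^ r \<partial>M N) = (\<integral>\<omega>. inv_sqrt N ^ r * (?c * ?x \<omega>) ^ r \<partial>M N)"
    by (simp only: sqrt_cancel)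
  also have "\<dots> = inv_sqrt N ^ r * (\<integral>\<omega>. (?c * ?x \<omega>) ^ r \<partial>M N)" by (rule integral_mult_right_zero)
  also have "(\<integral>\<omega>. (?c * ?x \<omega>) ^ r \<partial>M N) = (\<integral>z. z ^ r \<partial>distr (M N) borel (\<lambda>\<omega>. ?c * ?x \<omega>))"
    by (rule integral_distr[symmetric]) measurable
  also have "distr (M N) borel (\<lambda>\<omega>. ?c * ?x \<omega>) = distr (\<nu> j N) borel complex_of_real"
    by (rule law_facts(7)) fact
  also have "(\<integral>z. z ^ r \<partial>distr (\<nu> j N) borel complex_of_real) = diag_moment N j r"
    unfolding diag_moment_def by (rule integral_distr) measurable
  finally show ?thesis .
qed

text \<open>Centring is assumed for matrix entries; it reaches the law through the entry
  \<open>(1, 0)\<close>, which exists from size 2 on.\<close>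

lemma off_moment_one: "N \<ge> 2 \<Longrightarrow> off_moment N j 1 0 = 0"
  using moment_below[of 1 0 1 0] law_facts(4)[of 1 0] N by simp

lemma diag_moment_one: "diag_moment N j 1 = 0"
  using moment_diag[of 0 1] law_facts(4)[of 0 0] N by simp

lemma norm_off_moment: "cmod (off_moment N j r s) \<le> (\<integral>z. cmod z ^ (r + s) \<partial>\<mu> j N)"
  unfolding off_moment_def
  by (rule order_trans[OF integral_norm_bound]) (simp add: norm_mult norm_power power_add)

lemma norm_diag_moment: "cmod (diag_moment N j r) \<le> (\<integral>t. \<bar>t\<bar> ^ r \<partial>\<nu> j N)"
  unfolding diag_moment_def
  by (rule order_trans[OF integral_norm_bound]) (simp add: norm_power)

lemma off_moment_balanced: "off_moment N j r r = complex_of_real (\<integral>z. cmod z ^ (2 * r) \<partial>\<mu> j N)"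
proof -
  have "z ^ r * cnj z ^ r = complex_of_real (cmod z ^ (2 * r))" for z
  proof -
    have "z ^ r * cnj z ^ r = (z * cnj z) ^ r" by (rule power_mult_distrib[symmetric])
    also have "z * cnj z = complex_of_real ((cmod z)\<^sup>2)" by (rule complex_norm_square[symmetric])
    finally show ?thesis by (simp add: power_mult)
  qed
  then have "off_moment N j r r = (\<integral>z. complex_of_real (cmod z ^ (2 * r)) \<partial>\<mu> j N)"
    unfolding off_moment_def by (intro Bochner_Integration.integral_cong refl)
  also have "\<dots> = complex_of_real (\<integral>z. cmod z ^ (2 * r) \<partial>\<mu> j N)" by (rule integral_complex_of_real)
  finally show ?thesis .
qed

end

lemma law_limits:
  assumes "j < p" "k \<ge> 1"
  shows "(\<lambda>N. (\<integral>z. cmod z ^ (2 * k) \<partial>\<mu> j N) / real N ^ (k - 1)) \<longlonglongrightarrow> a j k"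
    and "(\<lambda>N. (\<integral>t. t ^ (2 * k) \<partial>\<nu> j N) / real N ^ (k - 1)) \<in> O(\<lambda>_. 1)"
  using laws[OF assms(1), unfolded wigner_laws_def, THEN conjunct2, rule_format, OF assms(2)] by simp_all

text \<open>Each class of at least two arcs has weight of order \<open>1 / N\<close>, whatever the
  orientations of its arcs.\<close>

lemma off_moment_bound:
  assumes j: "j < p" and "r + s \<ge> 2"
  shows "\<exists>C. eventually (\<lambda>N. cmod (of_nat N * (inv_sqrt N ^ (r + s) * off_moment N j r s)) \<le> C) sequentially"
proof -
  define m where "m r N = (\<integral>z. cmod z ^ r \<partial>\<mu> j N)" for r N
  have "\<exists>C. eventually (\<lambda>N. real N * (m (r + s) N / sqrt (real N) ^ (r + s)) \<le> C) sequentially"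
  proof (rule scaled_moment_bounded)
    fix k :: nat assume k: "k \<ge> 1"
    have "(\<lambda>N. m (2 * k) N / real N ^ (k - 1)) \<longlonglongrightarrow> a j k"
      unfolding m_def by (rule law_limits(1)[OF j k])
    then have "eventually (\<lambda>N. m (2 * k) N / real N ^ (k - 1) < a j k + 1) sequentially"
      by (rule order_tendstoD) simp
    then have "eventually (\<lambda>N. m (2 * k) N / real N ^ (k - 1) \<le> a j k + 1) sequentially"
      by (rule eventually_mono) simp
    then show "\<exists>C. eventually (\<lambda>N. m (2 * k) N / real N ^ (k - 1) \<le> C) sequentially" by blast
  next
    fix k N :: nat assume k: "k \<ge> 1" and N: "N \<ge> 1"
    show "m (2 * k + 1) N \<le> (sqrt (real N) * m (2 * k) N + m (2 * k + 2) N / sqrt (real N)) / 2"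
      unfolding m_def using N by (intro integral_odd_power_le law_facts(12)[OF N j]) auto
  qed fact
  then obtain C where C: "eventually (\<lambda>N. real N * (m (r + s) N / sqrt (real N) ^ (r + s)) \<le> C) sequentially" by blast
  have "eventually (\<lambda>N. cmod (of_nat N * (inv_sqrt N ^ (r + s) * off_moment N j r s)) \<le> C) sequentially"
    using C eventually_ge_at_top[of 1]
  proof eventually_elim
    case (elim N)
    have inv: "cmod (inv_sqrt N) = 1 / sqrt (real N)" by (simp only: norm_of_real abs_of_nonneg real_sqrt_ge_zero of_nat_0_le_iff zero_le_divide_1_iff)
    have "cmod (of_nat N * (inv_sqrt N ^ (r + s) * off_moment N j r s)) =
      real N * ((1 / sqrt (real N)) ^ (r + s) * cmod (off_moment N j r s))"
      by (simp only: norm_mult norm_power norm_of_nat inv)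
    also have "\<dots> \<le> real N * ((1 / sqrt (real N)) ^ (r + s) * m (r + s) N)"
      using norm_off_moment[OF elim(2) j, of r s] by (intro mult_left_mono) (auto simp: m_def)
    also have "\<dots> = real N * (m (r + s) N / sqrt (real N) ^ (r + s))" by (simp add: power_divide)
    finally show ?case using elim(1) by simp
  qed
  then show ?thesis by blast
qed

lemma diag_moment_bound:
  assumes j: "j < p" and "r \<ge> 2"
  shows "\<exists>C. eventually (\<lambda>N. cmod (of_nat N * (inv_sqrt N ^ r * diag_moment N j r)) \<le> C) sequentially"
proof -
  define m where "m r N = (\<integral>t. \<bar>t\<bar> ^ r \<partial>\<nu> j N)" for r N
  have "\<exists>C. eventually (\<lambda>N. real N * (m r N / sqrt (real N) ^ r) \<le> C) sequentially"
  proof (rule scaled_moment_bounded)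
    fix k :: nat assume k: "k \<ge> 1"
    have "(\<lambda>N. (\<integral>t. t ^ (2 * k) \<partial>\<nu> j N) / real N ^ (k - 1)) \<in> O(\<lambda>_. 1)"
      by (rule law_limits(2)[OF j k])
    then obtain C where C: "eventually (\<lambda>N. norm ((\<integral>t. t ^ (2 * k) \<partial>\<nu> j N) / real N ^ (k - 1)) \<le> C * norm (1::real)) sequentially"
      by (rule landau_o.bigE)
    have m: "m (2 * k) N = (\<integral>t. t ^ (2 * k) \<partial>\<nu> j N)" for N
      unfolding m_def by (simp add: power_mult power_even_abs)
    have "eventually (\<lambda>N. m (2 * k) N / real N ^ (k - 1) \<le> C) sequentially"
      using C by (rule eventually_mono) (simp add: m)
    then show "\<exists>C. eventually (\<lambda>N. m (2 * k) N / real N ^ (k - 1) \<le> C) sequentially" by blast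
  next
    fix k N :: nat assume k: "k \<ge> 1" and N: "N \<ge> 1"
    show "m (2 * k + 1) N \<le> (sqrt (real N) * m (2 * k) N + m (2 * k + 2) N / sqrt (real N)) / 2"
      unfolding m_def using N by (intro integral_odd_power_le law_facts(13)[OF N j]) auto
  qed fact
  then obtain C where C: "eventually (\<lambda>N. real N * (m r N / sqrt (real N) ^ r) \<le> C) sequentially" by blast
  have "eventually (\<lambda>N. cmod (of_nat N * (inv_sqrt N ^ r * diag_moment N j r)) \<le> C) sequentially"
    using C eventually_ge_at_top[of 1]
  proof eventually_elim
    case (elim N)
    have inv: "cmod (inv_sqrt N) = 1 / sqrt (real N)" by (simp only: norm_of_real abs_of_nonneg real_sqrt_ge_zero of_nat_0_le_iff zero_le_divide_1_iff)
    have "cmod (of_nat N * (inv_sqrt N ^ r * diag_moment N j r)) =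
      real N * ((1 / sqrt (real N)) ^ r * cmod (diag_moment N j r))"
      by (simp only: norm_mult norm_power norm_of_nat inv)
    also have "\<dots> \<le> real N * ((1 / sqrt (real N)) ^ r * m r N)"
      using norm_diag_moment[OF elim(2) j, of r] by (intro mult_left_mono) (auto simp: m_def)
    also have "\<dots> = real N * (m r N / sqrt (real N) ^ r)" by (simp add: power_divide)
    finally show ?case using elim(1) by simp
  qed
  then show ?thesis by blast
qed

text \<open>The scaling of the entries contributes \<open>N ^ -r\<close>; with the extra factor
  \<open>N\<close> this is the normalisation by \<open>N ^ (r - 1)\<close> in the definition of the
  parameter \<open>a\<close>.\<close>

lemma off_moment_limit:
  assumes j: "j < p" and r: "r \<ge> 1"
  shows "(\<lambda>N. of_nat N * (inv_sqrt N ^ (r + r) * off_moment N j r r)) \<longlonglongrightarrow> complex_of_real (a j r)"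
proof -
  have "(\<lambda>N. (\<integral>z. cmod z ^ (2 * r) \<partial>\<mu> j N) / real N ^ (r - 1)) \<longlonglongrightarrow> a j r"
    by (rule law_limits(1)[OF j r])
  then have "(\<lambda>N. complex_of_real ((\<integral>z. cmod z ^ (2 * r) \<partial>\<mu> j N) / real N ^ (r - 1))) \<longlonglongrightarrow> complex_of_real (a j r)"
    by (rule tendsto_of_real)
  then show ?thesis
  proof (rule Lim_transform_eventually)
    show "eventually (\<lambda>N. complex_of_real ((\<integral>z. cmod z ^ (2 * r) \<partial>\<mu> j N) / real N ^ (r - 1)) =
      of_nat N * (inv_sqrt N ^ (r + r) * off_moment N j r r)) sequentially"
    using eventually_ge_at_top[of 1]
  proof eventually_elim
    case (elim N)
    obtain l where l: "r = Suc l" using r by (cases r) auto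
    have "inv_sqrt N ^ (r + r) = complex_of_real ((1 / sqrt (real N)) ^ (2 * r))" by (simp add: mult_2)
    also have "(1 / sqrt (real N)) ^ (2 * r) = 1 / real N ^ r" by (simp add: power_divide power_mult)
    finally have "of_nat N * (inv_sqrt N ^ (r + r) * off_moment N j r r) =
      complex_of_real (real N * (1 / real N ^ r * (\<integral>z. cmod z ^ (2 * r) \<partial>\<mu> j N)))"
      unfolding off_moment_balanced[OF elim j] by simp
    also have "real N * (1 / real N ^ r * (\<integral>z. cmod z ^ (2 * r) \<partial>\<mu> j N)) = (\<integral>z. cmod z ^ (2 * r) \<partial>\<mu> j N) / real N ^ (r - 1)"
      using elim by (simp add: l)
    finally show ?case by simp
    qed
  qed
qed

end

lemma doubleton_other_end: "{x, y} = {u, v} \<Longrightarrow> u \<noteq> v \<Longrightarrow> x \<noteq> u \<longleftrightarrow> y = u"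
  unfolding doubleton_eq_iff by blast

section \<open>Expectations of products of Wigner entries\<close>

locale wigner_walk = cyclic_walk V nx XS + wigner_family p M X a \<mu> \<nu>
  for V nx XS p and M :: "nat \<Rightarrow> 'w measure" and X a \<mu> \<nu> +
  fixes col :: "nat \<Rightarrow> nat"
  assumes col: "\<And>k. k \<in> XS \<Longrightarrow> col k < p"
begin

definition xentry :: "nat \<Rightarrow> 'w \<Rightarrow> (nat \<Rightarrow> nat) \<Rightarrow> nat \<Rightarrow> complex" where
  "xentry N \<omega> \<phi> k = X N (col k) \<omega> $$ (\<phi> k, \<phi> (nx k))"

context
  fixes N :: nat and \<phi> :: "nat \<Rightarrow> nat"
  assumes N: "N \<ge> 1" and \<phi>: "\<And>k. k \<in> XS \<Longrightarrow> \<phi> k < N \<and> \<phi> (nx k) < N"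
begin

lemma all_moments_xentry: "k \<in> XS \<Longrightarrow> all_moments (M N) (\<lambda>\<omega>. xentry N \<omega> \<phi> k)"
  unfolding xentry_def using \<phi> by (intro all_moments_X N col) auto

lemma all_moments_prod_xentry: "K \<subseteq> XS \<Longrightarrow> all_moments (M N) (\<lambda>\<omega>. \<Prod>k\<in>K. xentry N \<omega> \<phi> k)"
  by (rule prob_space.all_moments_prod[OF probX[OF N]]) (auto intro: all_moments_xentry)

lemma integral_colours:
  "(\<integral>\<omega>. (\<Prod>k\<in>XS. xentry N \<omega> \<phi> k) \<partial>M N) =
    (\<Prod>j<p. \<integral>\<omega>. (\<Prod>k\<in>{k \<in> XS. col k = j}. xentry N \<omega> \<phi> k) \<partial>M N)"
proof -
  interpret prob_space "M N" by (rule probX[OF N])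
  \<comment> \<open>\<open>F j\<close> reads the product off the vector of entries of the matrix
    \<open>j\<close>, which is the object that the independence hypothesis speaks about.\<close>
  define F where "F j g = (\<Prod>k\<in>{k \<in> XS. col k = j}. g (j, \<phi> k, \<phi> (nx k)))" for j and g :: "nat \<times> nat \<times> nat \<Rightarrow> complex"
  have F: "F j (entries {j} N (X N) \<omega>) = (\<Prod>k\<in>{k \<in> XS. col k = j}. xentry N \<omega> \<phi> k)" for j \<omega>
    unfolding F_def
  proof (intro prod.cong refl)
    fix k assume "k \<in> {k \<in> XS. col k = j}"
    then show "entries {j} N (X N) \<omega> (j, \<phi> k, \<phi> (nx k)) = xentry N \<omega> \<phi> k"
      using \<phi>[of k] by (simp add: entries_def xentry_def)
  qed
  have "indep_vars (\<lambda>_. borel) (\<lambda>j \<omega>. F j (entries {j} N (X N) \<omega>)) {..<p}"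
  proof (rule indep_vars_compose2[OF indepX[OF N]])
    fix j
    show "F j \<in> borel_measurable (entry_space {j} N)"
      unfolding F_def entry_space_def using \<phi>
      by (intro borel_measurable_prod measurable_component_singleton) auto
  qed
  then have indep: "indep_vars (\<lambda>_. borel) (\<lambda>j \<omega>. \<Prod>k\<in>{k \<in> XS. col k = j}. xentry N \<omega> \<phi> k) {..<p}"
    unfolding F .
  have "(\<integral>\<omega>. (\<Prod>k\<in>XS. xentry N \<omega> \<phi> k) \<partial>M N) =
    (\<integral>\<omega>. (\<Prod>j<p. \<Prod>k\<in>{k \<in> XS. col k = j}. xentry N \<omega> \<phi> k) \<partial>M N)"
  proof -
    have "(\<Prod>j<p. \<Prod>k\<in>{k \<in> XS. col k = j}. xentry N \<omega> \<phi> k) = (\<Prod>k\<in>XS. xentry N \<omega> \<phi> k)" for \<omega>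
      by (rule prod.group) (use finite_XS col in auto)
    then show ?thesis by (simp only:)
  qed
  also have "\<dots> = (\<Prod>j<p. \<integral>\<omega>. (\<Prod>k\<in>{k \<in> XS. col k = j}. xentry N \<omega> \<phi> k) \<partial>M N)"
    by (intro indep_vars_lebesgue_integral indep all_moments_integrable all_moments_prod_xentry) auto
  finally show ?thesis .
qed

text \<open>The row is never smaller than the column: an index into the lower triangle, where the
  entries are independent.\<close>

definition ends :: "nat \<Rightarrow> nat \<times> nat" where
  "ends k = (max (\<phi> k) (\<phi> (nx k)), min (\<phi> k) (\<phi> (nx k)))"

text \<open>Almost surely each factor is the lower triangular entry at \<open>ends k\<close> or its
  conjugate. The product becomes a product of functions of one lower triangular entry each, and
  these entries are independent.\<close>

lemma integral_pairs:
  assumes j: "j < p" and K: "K = {k \<in> XS. col k = j}"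
  shows "(\<integral>\<omega>. (\<Prod>k\<in>K. xentry N \<omega> \<phi> k) \<partial>M N) =
    (\<Prod>e\<in>ends ` K. \<integral>\<omega>. (\<Prod>k\<in>{k \<in> K. ends k = e}. xentry N \<omega> \<phi> k) \<partial>M N)"
proof -
  interpret prob_space "M N" by (rule probX[OF N])
  have finK: "finite K" using finite_XS K by simp
  define Z where "Z e \<omega> = X N j \<omega> $$ e" for e \<omega>
  define h where "h e z = (\<Prod>k\<in>{k \<in> K. ends k = e}. if \<phi> (nx k) \<le> \<phi> k then z else cnj z)" for e z
  have ends_range: "fst e < N" "snd e < N" "snd e \<le> fst e" if e: "e \<in> ends ` K" for e
  proof -
    obtain k where "k \<in> XS" "e = ends k" using e K by auto
    then show "fst e < N" "snd e < N" "snd e \<le> fst e" using \<phi>[of k] by (auto simp: ends_def max_def min_def)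
  qed
  have Zm: "all_moments (M N) (Z e)" if "e \<in> ends ` K" for e
  proof -
    have "all_moments (M N) (\<lambda>\<omega>. X N j \<omega> $$ (fst e, snd e))"
      using ends_range[OF that] by (intro all_moments_X N j)
    then show ?thesis by (simp add: Z_def[abs_def])
  qed
  have herm: "AE \<omega> in M N. \<forall>k\<in>K. xentry N \<omega> \<phi> k = (if \<phi> (nx k) \<le> \<phi> k then Z (ends k) \<omega> else cnj (Z (ends k) \<omega>))"
    using hermitian[OF N j]
  proof eventually_elim
    case (elim \<omega>)
    show ?case
    proof
      fix k assume k: "k \<in> K"
      then have kk: "col k = j" "\<phi> k < N" "\<phi> (nx k) < N" using \<phi> K by auto
      show "xentry N \<omega> \<phi> k = (if \<phi> (nx k) \<le> \<phi> k then Z (ends k) \<omega> else cnj (Z (ends k) \<omega>))"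
      proof (cases "\<phi> (nx k) \<le> \<phi> k")
        case True
        then show ?thesis using kk by (simp add: xentry_def Z_def ends_def max_def min_def)
      next
        case False
        have "X N j \<omega> $$ (\<phi> k, \<phi> (nx k)) = cnj (X N j \<omega> $$ (\<phi> (nx k), \<phi> k))"
          using elim kk by blast
        then show ?thesis using kk False by (simp add: xentry_def Z_def ends_def max_def min_def)
      qed
    qed
  qed
  have meas_h: "h e \<in> borel_measurable borel" for e
    unfolding h_def by (intro borel_measurable_prod) auto
  have Zmeas: "Z e \<in> borel_measurable (M N)" if "e \<in> ends ` K" for e
    using Zm[OF that] by (simp add: all_moments_def)
  have hm: "all_moments (M N) (\<lambda>\<omega>. h e (Z e \<omega>))" if "e \<in> ends ` K" for e
    unfolding h_def
  proof (rule all_moments_prod)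
    fix k
    show "all_moments (M N) (\<lambda>\<omega>. if \<phi> (nx k) \<le> \<phi> k then Z e \<omega> else cnj (Z e \<omega>))"
      using Zm[OF that] all_moments_cnj[OF Zm[OF that]] by (cases "\<phi> (nx k) \<le> \<phi> k") simp_all
  qed
  have "indep_vars (\<lambda>_. borel) (\<lambda>e \<omega>. h e ((case e of (m, n) \<Rightarrow> \<lambda>\<omega>. X N j \<omega> $$ (m, n)) \<omega>)) (ends ` K)"
  proof (rule indep_vars_compose2[where Y = h and X = "\<lambda>e. case e of (m, n) \<Rightarrow> \<lambda>\<omega>. X N j \<omega> $$ (m, n)" and M' = "\<lambda>_. borel"])
    show "indep_vars (\<lambda>_. borel) (\<lambda>e. case e of (m, n) \<Rightarrow> \<lambda>\<omega>. X N j \<omega> $$ (m, n)) (ends ` K)"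
    proof (rule indep_vars_subset[OF law_facts(3)[OF N j]])
      show "ends ` K \<subseteq> {(m, n). n \<le> m \<and> m < N}"
      proof
        fix e assume "e \<in> ends ` K"
        then show "e \<in> {(m, n). n \<le> m \<and> m < N}" using ends_range[of e] by (simp add: case_prod_beta)
      qed
    qed
  qed (rule meas_h)
  then have indep: "indep_vars (\<lambda>_. borel) (\<lambda>e \<omega>. h e (Z e \<omega>)) (ends ` K)"
    by (simp add: Z_def case_prod_beta)
  have "(\<integral>\<omega>. (\<Prod>k\<in>K. xentry N \<omega> \<phi> k) \<partial>M N) = (\<integral>\<omega>. (\<Prod>e\<in>ends ` K. h e (Z e \<omega>)) \<partial>M N)"
  proof (rule integral_cong_AE)
    show "(\<lambda>\<omega>. \<Prod>k\<in>K. xentry N \<omega> \<phi> k) \<in> borel_measurable (M N)"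
      using all_moments_prod_xentry[of K] K by (auto simp: all_moments_def)
    show "(\<lambda>\<omega>. \<Prod>e\<in>ends ` K. h e (Z e \<omega>)) \<in> borel_measurable (M N)"
      using hm by (intro borel_measurable_prod) (simp add: all_moments_def)
    show "AE \<omega> in M N. (\<Prod>k\<in>K. xentry N \<omega> \<phi> k) = (\<Prod>e\<in>ends ` K. h e (Z e \<omega>))"
      using herm
    proof eventually_elim
      case (elim \<omega>)
      have "(\<Prod>e\<in>ends ` K. h e (Z e \<omega>)) = (\<Prod>e\<in>ends ` K. \<Prod>k\<in>{k \<in> K. ends k = e}. xentry N \<omega> \<phi> k)"
        unfolding h_def
      proof (intro prod.cong refl)
        fix e k assume "k \<in> {k \<in> K. ends k = e}"
        then have "k \<in> K" "ends k = e" by auto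
        then show "(if \<phi> (nx k) \<le> \<phi> k then Z e \<omega> else cnj (Z e \<omega>)) = xentry N \<omega> \<phi> k"
          using elim by metis
      qed
      also have "\<dots> = (\<Prod>k\<in>K. xentry N \<omega> \<phi> k)" using finK by (intro prod.group) auto
      finally show ?case by (rule sym)
    qed
  qed
  also have "\<dots> = (\<Prod>e\<in>ends ` K. \<integral>\<omega>. h e (Z e \<omega>) \<partial>M N)"
    using finK hm by (intro indep_vars_lebesgue_integral indep all_moments_integrable) auto
  also have "\<dots> = (\<Prod>e\<in>ends ` K. \<integral>\<omega>. (\<Prod>k\<in>{k \<in> K. ends k = e}. xentry N \<omega> \<phi> k) \<partial>M N)"
  proof (rule prod.cong[OF refl])
    fix e assume e: "e \<in> ends ` K"
    show "(\<integral>\<omega>. h e (Z e \<omega>) \<partial>M N) = (\<integral>\<omega>. (\<Prod>k\<in>{k \<in> K. ends k = e}. xentry N \<omega> \<phi> k) \<partial>M N)"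
    proof (rule integral_cong_AE)
      show "(\<lambda>\<omega>. h e (Z e \<omega>)) \<in> borel_measurable (M N)" using hm[OF e] by (simp add: all_moments_def)
      have "{k \<in> K. ends k = e} \<subseteq> XS" using K by auto
      then show "(\<lambda>\<omega>. \<Prod>k\<in>{k \<in> K. ends k = e}. xentry N \<omega> \<phi> k) \<in> borel_measurable (M N)"
        using all_moments_prod_xentry by (simp add: all_moments_def)
      show "AE \<omega> in M N. h e (Z e \<omega>) = (\<Prod>k\<in>{k \<in> K. ends k = e}. xentry N \<omega> \<phi> k)"
        using herm
      proof eventually_elim
        case (elim \<omega>)
        show ?case
          unfolding h_def
        proof (intro prod.cong refl)
          fix k assume "k \<in> {k \<in> K. ends k = e}"
          then have "k \<in> K" "ends k = e" by auto
          then show "(if \<phi> (nx k) \<le> \<phi> k then Z e \<omega> else cnj (Z e \<omega>)) = xentry N \<omega> \<phi> k"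
            using elim by metis
        qed
      qed
    qed
  qed
  finally show ?thesis .
qed

text \<open>Independence of the matrices separates the colours and independence of the entries
  separates the positions; ordered and unordered ends have the same fibres.\<close>

lemma integral_classes:
  "(\<integral>\<omega>. (\<Prod>k\<in>XS. xentry N \<omega> \<phi> k) \<partial>M N) =
    (\<Prod>\<kappa>\<in>(\<lambda>k. (col k, {\<phi> k, \<phi> (nx k)})) ` XS.
       \<integral>\<omega>. (\<Prod>k\<in>{k \<in> XS. (col k, {\<phi> k, \<phi> (nx k)}) = \<kappa>}. xentry N \<omega> \<phi> k) \<partial>M N)"
proof -
  let ?G = "\<lambda>K. \<integral>\<omega>. (\<Prod>k\<in>K. xentry N \<omega> \<phi> k) \<partial>M N"
  let ?g = "\<lambda>k. (col k, ends k)"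
  have "?G XS = (\<Prod>j<p. \<Prod>e\<in>ends ` {k \<in> XS. col k = j}. ?G {k \<in> {k \<in> XS. col k = j}. ends k = e})"
    unfolding integral_colours by (intro prod.cong refl integral_pairs) auto
  also have "\<dots> = (\<Prod>(j, e)\<in>Sigma {..<p} (\<lambda>j. ends ` {k \<in> XS. col k = j}). ?G {k \<in> {k \<in> XS. col k = j}. ends k = e})"
    using finite_XS by (intro prod.Sigma) auto
  also have "\<dots> = (\<Prod>\<kappa>\<in>?g ` XS. ?G {k \<in> XS. ?g k = \<kappa>})"
  proof (rule prod.cong)
    show "Sigma {..<p} (\<lambda>j. ends ` {k \<in> XS. col k = j}) = ?g ` XS" using col by auto
    fix \<kappa>
    have "{k \<in> {k \<in> XS. col k = fst \<kappa>}. ends k = snd \<kappa>} = {k \<in> XS. ?g k = \<kappa>}" by auto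
    then show "(case \<kappa> of (j, e) \<Rightarrow> ?G {k \<in> {k \<in> XS. col k = j}. ends k = e}) = ?G {k \<in> XS. ?g k = \<kappa>}"
      by (simp only: case_prod_beta)
  qed
  also have "\<dots> = (\<Prod>\<kappa>\<in>(\<lambda>k. (col k, {\<phi> k, \<phi> (nx k)})) ` XS. ?G {k \<in> XS. (col k, {\<phi> k, \<phi> (nx k)}) = \<kappa>})"
  proof (rule prod_fibres)
    fix k l
    have "ends k = ends l \<longleftrightarrow> {\<phi> k, \<phi> (nx k)} = {\<phi> l, \<phi> (nx l)}"
      unfolding ends_def doubleton_eq_iff max_def min_def by auto
    then show "?g k = ?g l \<longleftrightarrow> (col k, {\<phi> k, \<phi> (nx k)}) = (col l, {\<phi> l, \<phi> (nx l)})" by simp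
  qed
  finally show ?thesis .
qed

end

text \<open>\<open>Min K\<close> serves as a representative that fixes an orientation of the class:
  the other arcs are parallel or antiparallel to it, and their two numbers are the arguments of
  \<open>off_moment\<close>. The first case is a class of loops.\<close>

definition class_moment :: "nat \<Rightarrow> nat \<Rightarrow> (nat \<Rightarrow> nat) \<Rightarrow> nat set \<Rightarrow> complex" where
  "class_moment N j \<rho> K =
     (if \<rho> (Min K) = \<rho> (nx (Min K)) then inv_sqrt N ^ card K * diag_moment N j (card K)
      else inv_sqrt N ^ (card {k \<in> K. \<rho> k = \<rho> (Min K)} + card {k \<in> K. \<rho> k \<noteq> \<rho> (Min K)}) *
        off_moment N j (card {k \<in> K. \<rho> k = \<rho> (Min K)}) (card {k \<in> K. \<rho> k \<noteq> \<rho> (Min K)}))"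

definition edge_class :: "(nat \<Rightarrow> nat) \<Rightarrow> nat \<Rightarrow> nat \<times> nat set" where
  "edge_class \<rho> k = (col k, {\<rho> k, \<rho> (nx k)})"

definition weight :: "nat \<Rightarrow> (nat \<Rightarrow> nat) \<Rightarrow> complex" where
  "weight N \<rho> = (\<Prod>\<kappa>\<in>edge_class \<rho> ` XS. class_moment N (fst \<kappa>) \<rho> {k \<in> XS. edge_class \<rho> k = \<kappa>})"

lemma integral_class:
  assumes N: "N \<ge> 1" and \<psi>: "\<psi> \<in> inj_maps (\<rho> ` V) N" and \<kappa>: "\<kappa> \<in> edge_class \<rho> ` XS"
    and K: "K = {k \<in> XS. edge_class \<rho> k = \<kappa>}"
  shows "(\<integral>\<omega>. (\<Prod>k\<in>K. xentry N \<omega> (\<psi> \<circ> \<rho>) k) \<partial>M N) = class_moment N (fst \<kappa>) \<rho> K"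
proof -
  define k0 where "k0 = Min K"
  have finK: "finite K" "K \<noteq> {}" using finite_XS \<kappa> K by auto
  then have k0: "k0 \<in> K" unfolding k0_def by (rule Min_in)
  have KV: "k \<in> V" "nx k \<in> V" if "k \<in> K" for k using that K XS_V by auto
  let ?\<phi> = "\<psi> \<circ> \<rho>"
  let ?m = "?\<phi> k0" and ?n = "?\<phi> (nx k0)" and ?j = "fst \<kappa>"
  have lt: "?\<phi> k < N" if "k \<in> V" for k using \<psi> that by (auto simp: inj_maps_def)
  have j: "?j < p" using \<kappa> col by (auto simp: edge_class_def)
  have inj: "\<psi> x = \<psi> y \<longleftrightarrow> x = y" if "x \<in> \<rho> ` V" "y \<in> \<rho> ` V" for x y
    using \<psi> that by (auto simp: inj_maps_def inj_on_def)
  have colK: "col k = ?j" if "k \<in> K" for k using that K by (auto simp: edge_class_def)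
  have ends: "(\<rho> k = \<rho> k0 \<and> \<rho> (nx k) = \<rho> (nx k0)) \<or> (\<rho> k = \<rho> (nx k0) \<and> \<rho> (nx k) = \<rho> k0)" if "k \<in> K" for k
  proof -
    have "edge_class \<rho> k = edge_class \<rho> k0" using that k0 K by simp
    then have "{\<rho> k, \<rho> (nx k)} = {\<rho> k0, \<rho> (nx k0)}" by (simp add: edge_class_def)
    then show ?thesis unfolding doubleton_eq_iff .
  qed
  show ?thesis
  proof (cases "\<rho> k0 = \<rho> (nx k0)")
    case True
    have "xentry N \<omega> ?\<phi> k = X N ?j \<omega> $$ (?m, ?m)" if "k \<in> K" for k \<omega>
      using ends[OF that] colK[OF that] True by (auto simp: xentry_def)
    then have "(\<Prod>k\<in>K. xentry N \<omega> ?\<phi> k) = X N ?j \<omega> $$ (?m, ?m) ^ card K" for \<omega>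
      by (simp add: prod_constant)
    then have "(\<integral>\<omega>. (\<Prod>k\<in>K. xentry N \<omega> ?\<phi> k) \<partial>M N) = inv_sqrt N ^ card K * diag_moment N ?j (card K)"
      using moment_diag[OF N j lt[OF KV(1)[OF k0]], of "card K"] by (simp only:)
    then show ?thesis using True by (simp add: class_moment_def k0_def)
  next
    case False
    let ?A = "{k \<in> K. \<rho> k = \<rho> k0}" and ?B = "{k \<in> K. \<rho> k \<noteq> \<rho> k0}"
    have A: "xentry N \<omega> ?\<phi> k = X N ?j \<omega> $$ (?m, ?n)" if k: "k \<in> ?A" for k \<omega>
    proof -
      have "k \<in> K" "\<rho> k = \<rho> k0" using k by auto
      then have "\<rho> (nx k) = \<rho> (nx k0)" using ends[of k] False by metis
      then show ?thesis using colK[of k] k by (simp add: xentry_def)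
    qed
    have B: "xentry N \<omega> ?\<phi> k = X N ?j \<omega> $$ (?n, ?m)" if k: "k \<in> ?B" for k \<omega>
    proof -
      have "k \<in> K" "\<rho> k \<noteq> \<rho> k0" using k by auto
      then have "\<rho> k = \<rho> (nx k0)" "\<rho> (nx k) = \<rho> k0" using ends[of k] by blast+
      then show ?thesis using colK[of k] k by (simp add: xentry_def)
    qed
    have "(\<Prod>k\<in>K. xentry N \<omega> ?\<phi> k) = X N ?j \<omega> $$ (?m, ?n) ^ card ?A * X N ?j \<omega> $$ (?n, ?m) ^ card ?B" for \<omega>
    proof -
      have "(\<Prod>k\<in>K. xentry N \<omega> ?\<phi> k) = (\<Prod>k\<in>?A \<union> ?B. xentry N \<omega> ?\<phi> k)"
        by (rule prod.cong) auto
      also have "\<dots> = (\<Prod>k\<in>?A. xentry N \<omega> ?\<phi> k) * (\<Prod>k\<in>?B. xentry N \<omega> ?\<phi> k)"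
        using finK by (intro prod.union_disjoint) auto
      also have "(\<Prod>k\<in>?A. xentry N \<omega> ?\<phi> k) = (\<Prod>k\<in>?A. X N ?j \<omega> $$ (?m, ?n))"
        by (intro prod.cong refl A)
      also have "(\<Prod>k\<in>?B. xentry N \<omega> ?\<phi> k) = (\<Prod>k\<in>?B. X N ?j \<omega> $$ (?n, ?m))"
        by (intro prod.cong refl B)
      finally show ?thesis by (simp only: prod_constant)
    qed
    moreover have "?m \<noteq> ?n" using inj[of "\<rho> k0" "\<rho> (nx k0)"] False KV[OF k0] by simp
    ultimately have "(\<integral>\<omega>. (\<Prod>k\<in>K. xentry N \<omega> ?\<phi> k) \<partial>M N) =
        inv_sqrt N ^ (card ?A + card ?B) * off_moment N ?j (card ?A) (card ?B)"
      using moment_off[OF N j lt[OF KV(1)[OF k0]] lt[OF KV(2)[OF k0]], of "card ?A" "card ?B"] by (simp only: simp_thms)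
    then show ?thesis using False by (simp add: class_moment_def k0_def)
  qed
qed

text \<open>The value does not depend on \<psi>: an injective \<psi> keeps the classes and their
  orientations, and the moments of an entry depend only on whether it is diagonal.\<close>

lemma integral_weight:
  assumes N: "N \<ge> 1" and \<psi>: "\<psi> \<in> inj_maps (\<rho> ` V) N"
  shows "(\<integral>\<omega>. (\<Prod>k\<in>XS. xentry N \<omega> (\<psi> \<circ> \<rho>) k) \<partial>M N) = weight N \<rho>"
proof -
  let ?\<phi> = "\<psi> \<circ> \<rho>"
  let ?G = "\<lambda>K. \<integral>\<omega>. (\<Prod>k\<in>K. xentry N \<omega> ?\<phi> k) \<partial>M N"
  have lt: "?\<phi> k < N \<and> ?\<phi> (nx k) < N" if "k \<in> XS" for k
  proof -
    have "k \<in> V" "nx k \<in> V" using that XS_V by auto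
    then show ?thesis using \<psi> by (auto simp: inj_maps_def)
  qed
  have inj: "inj_on \<psi> (\<rho> ` V)" using \<psi> by (simp add: inj_maps_def)
  have "?G XS = (\<Prod>\<kappa>\<in>(\<lambda>k. (col k, {?\<phi> k, ?\<phi> (nx k)})) ` XS. ?G {k \<in> XS. (col k, {?\<phi> k, ?\<phi> (nx k)}) = \<kappa>})"
    by (rule integral_classes[OF N]) (use lt in blast)
  also have "\<dots> = (\<Prod>\<kappa>\<in>edge_class \<rho> ` XS. ?G {k \<in> XS. edge_class \<rho> k = \<kappa>})"
  proof (rule prod_fibres)
    fix k l assume kl: "k \<in> XS" "l \<in> XS"
    then have V: "{\<rho> k, \<rho> (nx k)} \<subseteq> \<rho> ` V" "{\<rho> l, \<rho> (nx l)} \<subseteq> \<rho> ` V" using XS_V by auto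
    have "{?\<phi> k, ?\<phi> (nx k)} = {?\<phi> l, ?\<phi> (nx l)} \<longleftrightarrow> \<psi> ` {\<rho> k, \<rho> (nx k)} = \<psi> ` {\<rho> l, \<rho> (nx l)}" by simp
    also have "\<dots> \<longleftrightarrow> {\<rho> k, \<rho> (nx k)} = {\<rho> l, \<rho> (nx l)}"
      by (rule inj_on_image_eq_iff[OF inj V])
    finally show "(col k, {?\<phi> k, ?\<phi> (nx k)}) = (col l, {?\<phi> l, ?\<phi> (nx l)}) \<longleftrightarrow> edge_class \<rho> k = edge_class \<rho> l"
      unfolding edge_class_def by simp
  qed
  also have "\<dots> = weight N \<rho>"
    unfolding weight_def by (intro prod.cong refl integral_class[OF N \<psi>])
  finally show ?thesis .
qed

text \<open>The only factor of the class is centred. The statement is eventual because off-diagonal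
  entries exist from size 2 on.\<close>

lemma weight_singleton:
  assumes "\<kappa> \<in> edge_class \<rho> ` XS" "card {k \<in> XS. edge_class \<rho> k = \<kappa>} = 1"
  shows "eventually (\<lambda>N. weight N \<rho> = 0) sequentially"
  using eventually_ge_at_top[of 2]
proof eventually_elim
  case (elim N)
  have j: "fst \<kappa> < p" using assms(1) col by (auto simp: edge_class_def)
  obtain k where k: "{k \<in> XS. edge_class \<rho> k = \<kappa>} = {k}" using assms(2) by (auto simp: card_1_singleton_iff)
  have "N \<ge> 1" using elim by simp
  have e: "{l \<in> {k}. \<rho> l = \<rho> k} = {k}" "{l \<in> {k}. \<rho> l \<noteq> \<rho> k} = {}" by auto
  have 0: "class_moment N (fst \<kappa>) \<rho> {k} = 0"
    using off_moment_one[OF \<open>N \<ge> 1\<close> j elim] diag_moment_one[OF \<open>N \<ge> 1\<close> j]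
    unfolding class_moment_def Min_singleton e by simp
  show ?case
    unfolding weight_def
  proof (rule prod_zero)
    show "finite (edge_class \<rho> ` XS)" using finite_XS by simp
    show "\<exists>\<kappa>\<in>edge_class \<rho> ` XS. class_moment N (fst \<kappa>) \<rho> {k \<in> XS. edge_class \<rho> k = \<kappa>} = 0"
      by (rule bexI[OF _ assms(1)]) (simp only: k 0)
  qed
qed

lemma class_moment_bound:
  assumes j: "j < p" and K: "finite K" "card K \<ge> 2"
  shows "\<exists>C. eventually (\<lambda>N. cmod (of_nat N * class_moment N j \<rho> K) \<le> C) sequentially"
proof (cases "\<rho> (Min K) = \<rho> (nx (Min K))")
  case True
  show ?thesis using diag_moment_bound[OF j K(2)] unfolding class_moment_def if_P[OF True] .
next
  case False
  let ?A = "{k \<in> K. \<rho> k = \<rho> (Min K)}" and ?B = "{k \<in> K. \<rho> k \<noteq> \<rho> (Min K)}"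
  have "card (?A \<union> ?B) = card ?A + card ?B" using K by (intro card_Un_disjoint) auto
  moreover have "?A \<union> ?B = K" by auto
  ultimately have "card ?A + card ?B \<ge> 2" using K by simp
  from off_moment_bound[OF j this] show ?thesis unfolding class_moment_def if_not_P[OF False] .
qed

lemma weight_bound:
  assumes "\<And>\<kappa>. \<kappa> \<in> edge_class \<rho> ` XS \<Longrightarrow> card {k \<in> XS. edge_class \<rho> k = \<kappa>} \<ge> 2"
  shows "\<exists>C. eventually (\<lambda>N. cmod (of_nat N ^ card (edge_class \<rho> ` XS) * weight N \<rho>) \<le> C) sequentially"
proof -
  let ?f = "\<lambda>\<kappa> N. of_nat N * class_moment N (fst \<kappa>) \<rho> {k \<in> XS. edge_class \<rho> k = \<kappa>}"
  have "\<exists>C. eventually (\<lambda>N. cmod (\<Prod>\<kappa>\<in>S. ?f \<kappa> N) \<le> C) sequentially" if S: "S \<subseteq> edge_class \<rho> ` XS" for S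
  proof -
    have "finite S" using S finite_XS finite_subset by blast
    then show ?thesis using S
    proof (induction S rule: finite_induct)
      case empty
      then show ?case by (intro exI[of _ 1]) simp
    next
      case (insert \<kappa> S)
      then obtain C where C: "eventually (\<lambda>N. cmod (\<Prod>\<kappa>\<in>S. ?f \<kappa> N) \<le> C) sequentially" by auto
      have "fst \<kappa> < p" using insert.prems col by (auto simp: edge_class_def)
      then obtain D where D: "eventually (\<lambda>N. cmod (?f \<kappa> N) \<le> D) sequentially"
        using class_moment_bound[of "fst \<kappa>" "{k \<in> XS. edge_class \<rho> k = \<kappa>}" \<rho>] finite_XS assms[of \<kappa>] insert.prems
        by auto
      have "eventually (\<lambda>N. cmod (\<Prod>\<kappa>\<in>insert \<kappa> S. ?f \<kappa> N) \<le> D * C) sequentially"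
        using C D
      proof eventually_elim
        case (elim N)
        have "cmod (\<Prod>\<kappa>\<in>insert \<kappa> S. ?f \<kappa> N) = cmod (?f \<kappa> N) * cmod (\<Prod>\<kappa>\<in>S. ?f \<kappa> N)"
          by (subst prod.insert[OF insert.hyps]) (rule norm_mult)
        also have "\<dots> \<le> D * C"
          using elim by (intro mult_mono) (auto intro: order_trans[OF norm_ge_zero])
        finally show ?case .
      qed
      then show ?case by blast
    qed
  qed
  from this[OF order_refl] show ?thesis
    by (simp only: weight_def prod.distrib prod_constant)
qed

text \<open>In a tree no class consists of loops, so diagonal moments do not occur, and each class
  is traversed equally often in both directions. Its moment is \<open>off_moment\<close> with both
  arguments equal to half the size of the class.\<close>

lemma weight_limit:
  assumes compat: "compatible (edge_class \<rho>) \<rho>" and tree: "card (parts \<rho>) = card (edge_class \<rho> ` XS) + 1"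
  shows "(\<lambda>N. of_nat N ^ card (edge_class \<rho> ` XS) * weight N \<rho>) \<longlonglongrightarrow>
    complex_of_real (\<Prod>\<kappa>\<in>edge_class \<rho> ` XS. a (fst \<kappa>) (card {k \<in> XS. edge_class \<rho> k = \<kappa>} div 2))"
proof -
  have "(\<lambda>N. \<Prod>\<kappa>\<in>edge_class \<rho> ` XS. of_nat N * class_moment N (fst \<kappa>) \<rho> {k \<in> XS. edge_class \<rho> k = \<kappa>}) \<longlonglongrightarrow>
    (\<Prod>\<kappa>\<in>edge_class \<rho> ` XS. complex_of_real (a (fst \<kappa>) (card {k \<in> XS. edge_class \<rho> k = \<kappa>} div 2)))"
  proof (rule tendsto_prod)
    fix \<kappa> assume \<kappa>: "\<kappa> \<in> edge_class \<rho> ` XS"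
    define K where "K = {k \<in> XS. edge_class \<rho> k = \<kappa>}"
    define k where "k = Min K"
    define A where "A = {l \<in> K. \<rho> l = \<rho> k}"
    define B where "B = {l \<in> K. \<rho> l \<noteq> \<rho> k}"
    have finK: "finite K" "K \<noteq> {}" using finite_XS \<kappa> by (auto simp: K_def)
    then have k: "k \<in> K" unfolding k_def by (rule Min_in)
    then have kX: "k \<in> XS" "edge_class \<rho> k = \<kappa>" by (auto simp: K_def)
    have kV: "k \<in> V" using kX(1) XS_V by blast
    have ne: "\<rho> k \<noteq> \<rho> (nx k)"
    proof
      assume "\<rho> k = \<rho> (nx k)"
      then have "(k, nx k) \<in> connection V (link \<rho>)"
        using kV by (intro connection_base) (auto simp: link_def)
      then show False using tree_not_linked[OF compat tree kX(1)] by simp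
    qed
    have ends: "\<rho> l \<noteq> \<rho> k \<longleftrightarrow> \<rho> (nx l) = \<rho> k" if "l \<in> K" for l
    proof -
      have "edge_class \<rho> l = edge_class \<rho> k" using that kX by (simp add: K_def)
      then have "{\<rho> l, \<rho> (nx l)} = {\<rho> k, \<rho> (nx k)}" by (simp add: edge_class_def)
      then show ?thesis using ne by (rule doubleton_other_end)
    qed
    have A: "A = {l \<in> XS. edge_class \<rho> l = \<kappa> \<and> \<rho> l = \<rho> k}" unfolding A_def K_def by blast
    have B: "B = {l \<in> XS. edge_class \<rho> l = \<kappa> \<and> \<rho> (nx l) = \<rho> k}"
      unfolding B_def using ends unfolding K_def by blast
    have AB: "card A = card B"
      unfolding A B by (rule tree_class_balanced[OF compat tree \<kappa>])
    have "card (A \<union> B) = card A + card B" using finK by (intro card_Un_disjoint) (auto simp: A_def B_def)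
    moreover have "A \<union> B = K" by (auto simp: A_def B_def)
    ultimately have half: "card K div 2 = card A" using AB by simp
    have "A \<noteq> {}" "finite A" using k finK by (auto simp: A_def)
    then have "card A > 0" by (simp add: card_gt_0_iff)
    then have "card A \<ge> 1" by linarith
    moreover have "fst \<kappa> < p" using \<kappa> col by (auto simp: edge_class_def)
    ultimately have "(\<lambda>N. of_nat N * (inv_sqrt N ^ (card A + card A) * off_moment N (fst \<kappa>) (card A) (card A)))
        \<longlonglongrightarrow> complex_of_real (a (fst \<kappa>) (card A))" by (intro off_moment_limit)
    moreover have "class_moment N (fst \<kappa>) \<rho> K = inv_sqrt N ^ (card A + card A) * off_moment N (fst \<kappa>) (card A) (card A)" for N
      unfolding class_moment_def k_def[symmetric] if_not_P[OF ne] A_def[symmetric] B_def[symmetric] AB[symmetric] ..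
    ultimately show "(\<lambda>N. of_nat N * class_moment N (fst \<kappa>) \<rho> {k \<in> XS. edge_class \<rho> k = \<kappa>}) \<longlonglongrightarrow>
        complex_of_real (a (fst \<kappa>) (card {k \<in> XS. edge_class \<rho> k = \<kappa>} div 2))"
      unfolding K_def[symmetric] half by (simp only:)
  qed
  then show ?thesis by (simp only: weight_def prod.distrib prod_constant of_real_prod)
qed

end

section \<open>Limits of traces along a walk\<close>

text \<open>A map on the image of \<epsilon> is the same as a map on \<open>D\<close> that is
  constant on the fibres of \<epsilon>.\<close>

lemma sum_PiE_factor:
  assumes "\<epsilon> ` D = E"
  shows "(\<Sum>\<psi>\<in>E \<rightarrow>\<^sub>E T. f (\<lambda>k\<in>D. \<psi> (\<epsilon> k))) =
    (\<Sum>\<eta>\<in>{\<eta> \<in> D \<rightarrow>\<^sub>E T. \<forall>k\<in>D. \<forall>l\<in>D. \<epsilon> k = \<epsilon> l \<longrightarrow> \<eta> k = \<eta> l}. f \<eta>)"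
proof -
  define rep where "rep e = (SOME k. k \<in> D \<and> \<epsilon> k = e)" for e
  have rep: "rep e \<in> D \<and> \<epsilon> (rep e) = e" if "e \<in> E" for e
  proof -
    have "\<exists>k. k \<in> D \<and> \<epsilon> k = e" using that assms by auto
    then show ?thesis unfolding rep_def by (rule someI_ex)
  qed
  have \<epsilon>: "\<epsilon> k \<in> E" if "k \<in> D" for k using that assms by auto
  show ?thesis
  proof (rule sum.reindex_bij_witness[where i = "\<lambda>\<eta>. \<lambda>e\<in>E. \<eta> (rep e)" and j = "\<lambda>\<psi>. \<lambda>k\<in>D. \<psi> (\<epsilon> k)"])
    fix \<psi> assume \<psi>: "\<psi> \<in> E \<rightarrow>\<^sub>E T"
    show "(\<lambda>e\<in>E. (\<lambda>k\<in>D. \<psi> (\<epsilon> k)) (rep e)) = \<psi>"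
    proof
      fix e show "(\<lambda>e\<in>E. (\<lambda>k\<in>D. \<psi> (\<epsilon> k)) (rep e)) e = \<psi> e"
        using rep[of e] PiE_arb[OF \<psi>, of e] by (cases "e \<in> E") auto
    qed
    show "(\<lambda>k\<in>D. \<psi> (\<epsilon> k)) \<in> {\<eta> \<in> D \<rightarrow>\<^sub>E T. \<forall>k\<in>D. \<forall>l\<in>D. \<epsilon> k = \<epsilon> l \<longrightarrow> \<eta> k = \<eta> l}"
      using \<psi> \<epsilon> by auto
  next
    fix \<eta> assume "\<eta> \<in> {\<eta> \<in> D \<rightarrow>\<^sub>E T. \<forall>k\<in>D. \<forall>l\<in>D. \<epsilon> k = \<epsilon> l \<longrightarrow> \<eta> k = \<eta> l}"
    then have \<eta>: "\<eta> \<in> D \<rightarrow>\<^sub>E T" "\<And>k l. k \<in> D \<Longrightarrow> l \<in> D \<Longrightarrow> \<epsilon> k = \<epsilon> l \<Longrightarrow> \<eta> k = \<eta> l" by blast+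
    show "(\<lambda>k\<in>D. (\<lambda>e\<in>E. \<eta> (rep e)) (\<epsilon> k)) = \<eta>"
    proof
      fix k show "(\<lambda>k\<in>D. (\<lambda>e\<in>E. \<eta> (rep e)) (\<epsilon> k)) k = \<eta> k"
      proof (cases "k \<in> D")
        case True
        then show ?thesis using \<eta>(2)[of "rep (\<epsilon> k)" k] rep[OF \<epsilon>[OF True]] \<epsilon>[OF True] by simp
      next
        case False
        then show ?thesis using PiE_arb[OF \<eta>(1) False] by simp
      qed
    qed
    show "(\<lambda>e\<in>E. \<eta> (rep e)) \<in> E \<rightarrow>\<^sub>E T" using \<eta>(1) rep by auto
  qed simp
qed

section \<open>Free sums and coarser kernels\<close>

context cyclic_walk begin

definition free_sum :: "nat \<Rightarrow> (nat \<Rightarrow> nat \<Rightarrow> nat \<Rightarrow> 'a :: comm_semiring_1) \<Rightarrow> (nat \<Rightarrow> nat) \<Rightarrow> nat set \<Rightarrow> 'a" where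
  "free_sum n el \<rho> C = (\<Sum>\<psi>\<in>\<rho> ` C \<rightarrow>\<^sub>E {..<n}. \<Prod>k\<in>C - XS. el k (\<psi> (\<rho> k)) (\<psi> (\<rho> (nx k))))"

text \<open>Vertices are merged within the component \<open>C\<close> only, and \<sigma> is extended
  by the identity, so that the result is again a map on all of \<open>V\<close> to which the notions
  of the locale apply.\<close>

definition refine :: "(nat \<Rightarrow> nat) \<Rightarrow> nat set \<Rightarrow> (nat \<Rightarrow> nat) \<Rightarrow> nat \<Rightarrow> nat" where
  "refine \<rho> C \<sigma> = (\<lambda>x. if x \<in> \<rho> ` C then \<sigma> x else x) \<circ> \<rho>"

definition coarser :: "(nat \<Rightarrow> nat) \<Rightarrow> (nat \<Rightarrow> nat) \<Rightarrow> bool" where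
  "coarser \<rho> \<rho>' \<longleftrightarrow> (\<forall>k\<in>V. \<forall>l\<in>V. \<rho> k = \<rho> l \<longrightarrow> \<rho>' k = \<rho>' l)"

lemma compatible_coarser:
  assumes "compatible cl \<rho>" "coarser \<rho> \<rho>'"
  shows "compatible cl \<rho>'"
  unfolding compatible_def
proof (intro ballI impI)
  fix k l assume kl: "k \<in> XS" "l \<in> XS" "cl k = cl l"
  have V: "k \<in> V" "l \<in> V" "nx k \<in> V" "nx l \<in> V" using kl XS_V by auto
  have "(\<rho> k = \<rho> l \<and> \<rho> (nx k) = \<rho> (nx l)) \<or> (\<rho> k = \<rho> (nx l) \<and> \<rho> (nx k) = \<rho> l)"
    using compatibleD[OF assms(1) kl] unfolding doubleton_eq_iff .
  then have "(\<rho>' k = \<rho>' l \<and> \<rho>' (nx k) = \<rho>' (nx l)) \<or> (\<rho>' k = \<rho>' (nx l) \<and> \<rho>' (nx k) = \<rho>' l)"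
    using assms(2) V unfolding coarser_def by blast
  then show "{\<rho>' k, \<rho>' (nx k)} = {\<rho>' l, \<rho>' (nx l)}" unfolding doubleton_eq_iff .
qed

lemma prod_free_sum:
  "(\<Prod>C\<in>parts \<rho>. free_sum n el \<rho> C) =
    (\<Sum>\<psi>\<in>\<rho> ` V \<rightarrow>\<^sub>E {..<n}. \<Prod>k\<in>V - XS. el k (\<psi> (\<rho> k)) (\<psi> (\<rho> (nx k))))"
proof -
  have UA: "(\<Union>C\<in>parts \<rho>. \<rho> ` C) = \<rho> ` V" using Union_parts[of \<rho>] by auto
  have "(\<Prod>C\<in>parts \<rho>. free_sum n el \<rho> C) =
    (\<Prod>C\<in>parts \<rho>. \<Sum>\<psi>\<in>{\<psi> \<in> Pi\<^sub>E (\<rho> ` C) (\<lambda>_. {..<n}). True}. \<Prod>k\<in>C - XS. el k (\<psi> (\<rho> k)) (\<psi> (\<rho> (nx k))))"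
    by (simp add: free_sum_def)
  also have "\<dots> = (\<Sum>\<psi>\<in>{\<psi> \<in> Pi\<^sub>E (\<Union>C\<in>parts \<rho>. \<rho> ` C) (\<lambda>_. {..<n}). \<forall>C\<in>parts \<rho>. True}.
      \<Prod>C\<in>parts \<rho>. \<Prod>k\<in>C - XS. el k (restrict \<psi> (\<rho> ` C) (\<rho> k)) (restrict \<psi> (\<rho> ` C) (\<rho> (nx k))))"
    using finite_parts finite_part part_images_disjoint
    by (intro prod_sum_partition) auto
  also have "\<dots> = (\<Sum>\<psi>\<in>\<rho> ` V \<rightarrow>\<^sub>E {..<n}. \<Prod>k\<in>V - XS. el k (\<psi> (\<rho> k)) (\<psi> (\<rho> (nx k))))"
  proof (rule sum.cong)
    show "{\<psi> \<in> Pi\<^sub>E (\<Union>C\<in>parts \<rho>. \<rho> ` C) (\<lambda>_. {..<n}). \<forall>C\<in>parts \<rho>. True} = \<rho> ` V \<rightarrow>\<^sub>E {..<n}"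
      unfolding UA by simp
    fix \<psi>
    have "(\<Prod>C\<in>parts \<rho>. \<Prod>k\<in>C - XS. el k (restrict \<psi> (\<rho> ` C) (\<rho> k)) (restrict \<psi> (\<rho> ` C) (\<rho> (nx k)))) =
      (\<Prod>C\<in>parts \<rho>. \<Prod>k\<in>C - XS. el k (\<psi> (\<rho> k)) (\<psi> (\<rho> (nx k))))"
    proof (intro prod.cong refl)
      fix C k assume C: "C \<in> parts \<rho>" "k \<in> C - XS"
      then have "nx k \<in> C" using part_closed(2) by blast
      then show "el k (restrict \<psi> (\<rho> ` C) (\<rho> k)) (restrict \<psi> (\<rho> ` C) (\<rho> (nx k))) = el k (\<psi> (\<rho> k)) (\<psi> (\<rho> (nx k)))"
        using C by simp
    qed
    also have "\<dots> = (\<Prod>k\<in>(\<Union>C\<in>parts \<rho>. C - XS). el k (\<psi> (\<rho> k)) (\<psi> (\<rho> (nx k))))"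
      using finite_parts finite_part parts_disjoint[of _ \<rho>]
      by (intro prod.UNION_disjoint[symmetric]) blast+
    also have "(\<Union>C\<in>parts \<rho>. C - XS) = V - XS" using Union_parts[of \<rho>] by auto
    finally show "(\<Prod>C\<in>parts \<rho>. \<Prod>k\<in>C - XS. el k (restrict \<psi> (\<rho> ` C) (\<rho> k)) (restrict \<psi> (\<rho> ` C) (\<rho> (nx k)))) =
      (\<Prod>k\<in>V - XS. el k (\<psi> (\<rho> k)) (\<psi> (\<rho> (nx k))))" .
  qed
  finally show ?thesis .
qed

lemma free_sum_refine:
  assumes C: "C \<in> parts \<rho>"
  shows "free_sum n el \<rho> C = (\<Sum>\<sigma>\<in>kernels (\<rho> ` C). part_sum n el (refine \<rho> C \<sigma>) C)"
proof -
  have fin: "finite (\<rho> ` C)" using finite_part[OF C] by simp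
  have "free_sum n el \<rho> C = (\<Sum>\<sigma>\<in>kernels (\<rho> ` C). \<Sum>\<psi>\<in>inj_maps (\<sigma> ` \<rho> ` C) n.
      \<Prod>k\<in>C - XS. el k (restrict (\<psi> \<circ> \<sigma>) (\<rho> ` C) (\<rho> k)) (restrict (\<psi> \<circ> \<sigma>) (\<rho> ` C) (\<rho> (nx k))))"
    unfolding free_sum_def by (rule sum_kernels[OF fin])
  also have "\<dots> = (\<Sum>\<sigma>\<in>kernels (\<rho> ` C). part_sum n el (refine \<rho> C \<sigma>) C)"
  proof (rule sum.cong[OF refl])
    fix \<sigma>
    have r: "refine \<rho> C \<sigma> k = \<sigma> (\<rho> k)" if "k \<in> C" for k using that by (simp add: refine_def)
    have "refine \<rho> C \<sigma> ` C = (\<lambda>k. \<sigma> (\<rho> k)) ` C" using r by (intro image_cong) auto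
    then have img: "refine \<rho> C \<sigma> ` C = \<sigma> ` \<rho> ` C" by (simp add: image_image)
    have "el k (restrict (\<psi> \<circ> \<sigma>) (\<rho> ` C) (\<rho> k)) (restrict (\<psi> \<circ> \<sigma>) (\<rho> ` C) (\<rho> (nx k))) =
      el k (\<psi> (refine \<rho> C \<sigma> k)) (\<psi> (refine \<rho> C \<sigma> (nx k)))" if k: "k \<in> C - XS" for k \<psi>
    proof -
      have "nx k \<in> C" using part_closed(2)[OF C] k by blast
      then show ?thesis using k r by simp
    qed
    then show "(\<Sum>\<psi>\<in>inj_maps (\<sigma> ` \<rho> ` C) n.
        \<Prod>k\<in>C - XS. el k (restrict (\<psi> \<circ> \<sigma>) (\<rho> ` C) (\<rho> k)) (restrict (\<psi> \<circ> \<sigma>) (\<rho> ` C) (\<rho> (nx k)))) =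
      part_sum n el (refine \<rho> C \<sigma>) C"
      unfolding part_sum_def img by (intro sum.cong prod.cong refl)
  qed
  finally show ?thesis .
qed

text \<open>\<sigma> maps the vertices of \<open>C\<close> to each other, so it merges only vertices
  that were connected before.\<close>

lemma parts_refine:
  assumes C: "C \<in> parts \<rho>" and \<sigma>: "\<sigma> \<in> kernels (\<rho> ` C)"
  shows "parts (refine \<rho> C \<sigma>) = parts \<rho>"
proof -
  have fin: "finite (\<rho> ` C)" using finite_part[OF C] by simp
  have inC: "k \<in> C \<longleftrightarrow> \<rho> k \<in> \<rho> ` C" if "k \<in> V" for k
  proof
    assume "\<rho> k \<in> \<rho> ` C"
    then obtain c where "c \<in> C" "\<rho> c = \<rho> k" by auto
    then show "k \<in> C" using part_closed(1)[OF C] that by simp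
  qed simp
  have "connection V (link (refine \<rho> C \<sigma>)) \<subseteq> connection V (link \<rho>)"
  proof (rule connection_least[OF equiv_connection])
    fix k l assume kl: "(k, l) \<in> link (refine \<rho> C \<sigma>)" "k \<in> V" "l \<in> V"
    show "(k, l) \<in> connection V (link \<rho>)"
    proof (cases "(k, l) \<in> link \<rho>")
      case True
      then show ?thesis using kl(2,3) by (rule connection_base)
    next
      case False
      then have r: "refine \<rho> C \<sigma> k = refine \<rho> C \<sigma> l" "\<rho> k \<noteq> \<rho> l" using kl by (auto simp: link_def)
      have "k \<in> C \<and> l \<in> C"
      proof (rule ccontr)
        assume n: "\<not> (k \<in> C \<and> l \<in> C)"
        have s: "\<sigma> x \<in> \<rho> ` C" if "x \<in> \<rho> ` C" for x using kernels_idem(1)[OF fin \<sigma> that] .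
        show False
        proof (cases "k \<in> C")
          case True
          then have "l \<notin> C" using n by simp
          then have "refine \<rho> C \<sigma> l = \<rho> l" "\<rho> l \<notin> \<rho> ` C" using inC[OF kl(3)] by (auto simp: refine_def)
          moreover have "refine \<rho> C \<sigma> k \<in> \<rho> ` C" using s[of "\<rho> k"] True by (simp add: refine_def)
          ultimately show False using r by simp
        next
          case F: False
          then have k: "refine \<rho> C \<sigma> k = \<rho> k" "\<rho> k \<notin> \<rho> ` C" using inC[OF kl(2)] by (auto simp: refine_def)
          show False
          proof (cases "l \<in> C")
            case True
            then have "refine \<rho> C \<sigma> l \<in> \<rho> ` C" using s[of "\<rho> l"] by (simp add: refine_def)
            then show False using k r by simp
          next
            case False
            then have "refine \<rho> C \<sigma> l = \<rho> l" using inC[OF kl(3)] by (auto simp: refine_def)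
            then show False using k r by simp
          qed
        qed
      qed
      then have "l \<in> connection V (link \<rho>) `` {k}" using part_closed(5)[OF C, of k] by blast
      then show ?thesis by simp
    qed
  qed
  moreover have "connection V (link \<rho>) \<subseteq> connection V (link (refine \<rho> C \<sigma>))"
    unfolding refine_def by (rule connection_mono) (rule link_comp)
  ultimately show ?thesis unfolding parts_def components_def by simp
qed

text \<open>Maps on the vertices are maps on \<open>V\<close> that are constant on the fibres of
  \<rho>; sorted by their kernels, they run through the kernels coarser than \<rho>.\<close>

lemma sum_coarser:
  "(\<Sum>\<psi>\<in>\<rho> ` V \<rightarrow>\<^sub>E {..<n}. \<Prod>k\<in>V - XS. el k (\<psi> (\<rho> k)) (\<psi> (\<rho> (nx k)))) =
    (\<Sum>\<rho>'\<in>{\<rho>' \<in> kernels V. coarser \<rho> \<rho>'}. inj_sum n el \<rho>')"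
proof -
  let ?f = "\<lambda>\<phi>. \<Prod>k\<in>V - XS. el k (\<phi> k) (\<phi> (nx k))"
  have "(\<Sum>\<psi>\<in>\<rho> ` V \<rightarrow>\<^sub>E {..<n}. \<Prod>k\<in>V - XS. el k (\<psi> (\<rho> k)) (\<psi> (\<rho> (nx k)))) =
    (\<Sum>\<psi>\<in>\<rho> ` V \<rightarrow>\<^sub>E {..<n}. ?f (\<lambda>k\<in>V. \<psi> (\<rho> k)))"
    by (intro sum.cong prod.cong refl) auto
  also have "\<dots> = (\<Sum>\<phi>\<in>{\<phi> \<in> V \<rightarrow>\<^sub>E {..<n}. coarser \<rho> \<phi>}. ?f \<phi>)"
    unfolding coarser_def by (rule sum_PiE_factor[OF refl])
  also have "\<dots> = (\<Sum>\<phi>\<in>V \<rightarrow>\<^sub>E {..<n}. if coarser \<rho> \<phi> then ?f \<phi> else 0)"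
    using finite_V by (intro sum.inter_filter finite_PiE) auto
  also have "\<dots> = (\<Sum>\<sigma>\<in>kernels V. \<Sum>\<psi>\<in>inj_maps (\<sigma> ` V) n.
      if coarser \<rho> (restrict (\<psi> \<circ> \<sigma>) V) then ?f (restrict (\<psi> \<circ> \<sigma>) V) else 0)"
    by (rule sum_kernels[OF finite_V])
  also have "\<dots> = (\<Sum>\<sigma>\<in>kernels V. if coarser \<rho> \<sigma> then inj_sum n el \<sigma> else 0)"
  proof (rule sum.cong[OF refl])
    fix \<sigma>
    have "coarser \<rho> (restrict (\<psi> \<circ> \<sigma>) V) \<longleftrightarrow> coarser \<rho> \<sigma>" if "\<psi> \<in> inj_maps (\<sigma> ` V) n" for \<psi>
    proof -
      have "\<psi> (\<sigma> k) = \<psi> (\<sigma> l) \<longleftrightarrow> \<sigma> k = \<sigma> l" if "k \<in> V" "l \<in> V" for k l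
        using \<open>\<psi> \<in> inj_maps (\<sigma> ` V) n\<close> that by (auto simp: inj_maps_def inj_on_def)
      then show ?thesis unfolding coarser_def by simp
    qed
    moreover have "?f (restrict (\<psi> \<circ> \<sigma>) V) = (\<Prod>k\<in>V - XS. el k (\<psi> (\<sigma> k)) (\<psi> (\<sigma> (nx k))))" for \<psi>
      by (intro prod.cong) auto
    ultimately have "(\<Sum>\<psi>\<in>inj_maps (\<sigma> ` V) n. if coarser \<rho> (restrict (\<psi> \<circ> \<sigma>) V) then ?f (restrict (\<psi> \<circ> \<sigma>) V) else 0)
      = (\<Sum>\<psi>\<in>inj_maps (\<sigma> ` V) n. if coarser \<rho> \<sigma> then (\<Prod>k\<in>V - XS. el k (\<psi> (\<sigma> k)) (\<psi> (\<sigma> (nx k)))) else 0)"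
      by (intro sum.cong refl) presburger
    also have "\<dots> = (if coarser \<rho> \<sigma> then inj_sum n el \<sigma> else 0)"
    proof -
      have "(\<Sum>x\<in>A. if b then h x else 0) = (if b then sum h A else 0)" for A b and h :: "(nat \<Rightarrow> nat) \<Rightarrow> 'a"
        by simp
      then show ?thesis by (simp only: inj_sum_def)
    qed
    finally show "(\<Sum>\<psi>\<in>inj_maps (\<sigma> ` V) n. if coarser \<rho> (restrict (\<psi> \<circ> \<sigma>) V) then ?f (restrict (\<psi> \<circ> \<sigma>) V) else 0)
      = (if coarser \<rho> \<sigma> then inj_sum n el \<sigma> else 0)" .
  qed
  also have "\<dots> = (\<Sum>\<rho>'\<in>{\<rho>' \<in> kernels V. coarser \<rho> \<rho>'}. inj_sum n el \<rho>')"
    using finite_V by (intro sum.inter_filter[symmetric] finite_kernels)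
  finally show ?thesis .
qed

end

context labelled_walk begin

lemma all_moments_part_sum:
  assumes "N \<ge> 1" and C: "C \<in> parts \<rho>"
  shows "all_moments (M N) (\<lambda>\<omega>. part_sum N (el N \<omega>) \<rho> C)"
proof -
  interpret prob_space "M N" by (rule prob) fact
  show ?thesis
    unfolding part_sum_def el_def
  proof (intro all_moments_sum all_moments_prod all_moments_label assms)
    fix \<psi> k assume a: "\<psi> \<in> inj_maps (\<rho> ` C) N" "k \<in> C - XS"
    then have "nx k \<in> C" using part_closed(2)[OF C] by blast
    then have "\<rho> k \<in> \<rho> ` C" "\<rho> (nx k) \<in> \<rho> ` C" using a by auto
    then show "\<psi> (\<rho> k) < N" "\<psi> (\<rho> (nx k)) < N" using a(1) unfolding inj_maps_def by auto
    have "k \<in> V - XS" using a(2) part_closed(4)[OF C] by blast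
    then show "\<And>l. lab k = Some l \<Longrightarrow> set_star_letter l \<subseteq> {..<q}" using lab_vars by blast
  qed
qed

lemma improper_part_sum:
  assumes C: "C \<in> parts \<rho>" and "\<not> proper_on \<rho> C"
  shows "part_sum N (el N \<omega>) \<rho> C = 0"
proof -
  obtain k where k: "k \<in> C - XS" "lab k = None" "\<rho> k \<noteq> \<rho> (nx k)" using assms(2) by (auto simp: proper_on_def)
  have nC: "nx k \<in> C" using k part_closed(2)[OF C] by blast
  show ?thesis
    unfolding part_sum_def
  proof (rule sum.neutral, rule ballI, rule prod_zero)
    fix \<psi> assume "\<psi> \<in> inj_maps (\<rho> ` C) N"
    then have "\<psi> (\<rho> k) \<noteq> \<psi> (\<rho> (nx k))" using k nC unfolding inj_maps_def inj_on_def by auto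
    then have "el N \<omega> k (\<psi> (\<rho> k)) (\<psi> (\<rho> (nx k))) = 0" using k by (simp add: el_def label_entry_def)
    then show "\<exists>k\<in>C - XS. el N \<omega> k (\<psi> (\<rho> k)) (\<psi> (\<rho> (nx k))) = 0" using k(1) by blast
    show "finite (C - XS)" using finite_part[OF C] by simp
  qed
qed

context
  fixes cl :: "nat \<Rightarrow> 'c" and \<rho>
  assumes compat: "compatible cl \<rho>" and tree: "card (parts \<rho>) = card (cl ` XS) + 1"
begin

text \<open>For a kernel \<sigma> of the vertices of \<open>C\<close>, this is zero or the injective
  trace of one cyclic test graph, hence within reach of Assumptions 1 and 2.\<close>

definition piece :: "nat \<Rightarrow> 'w \<Rightarrow> nat set \<Rightarrow> (nat \<Rightarrow> nat) \<Rightarrow> complex" where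
  "piece N \<omega> C \<sigma> = part_sum N (el N \<omega>) (refine \<rho> C \<sigma>) C / of_nat N"

lemma all_moments_piece:
  assumes "N \<ge> 1" "C \<in> parts \<rho>" "\<sigma> \<in> kernels (\<rho> ` C)"
  shows "all_moments (M N) (\<lambda>\<omega>. piece N \<omega> C \<sigma>)"
proof -
  interpret prob_space "M N" by (rule prob) fact
  have "C \<in> parts (refine \<rho> C \<sigma>)" using parts_refine[OF assms(2,3)] assms(2) by simp
  then have "all_moments (M N) (\<lambda>\<omega>. part_sum N (el N \<omega>) (refine \<rho> C \<sigma>) C * (1 / of_nat N))"
    by (intro all_moments_mult all_moments_const all_moments_part_sum assms(1))
  then show ?thesis by (simp add: piece_def)
qed

lemma piece_improper:
  assumes "C \<in> parts \<rho>" "\<sigma> \<in> kernels (\<rho> ` C)" "\<not> proper_on (refine \<rho> C \<sigma>) C"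
  shows "piece N \<omega> C \<sigma> = 0"
proof -
  have "C \<in> parts (refine \<rho> C \<sigma>)" using parts_refine[OF assms(1,2)] assms(1) by simp
  then show ?thesis using improper_part_sum assms(3) by (simp add: piece_def)
qed

lemma piece_test_graph:
  assumes "C \<in> parts \<rho>" "\<sigma> \<in> kernels (\<rho> ` C)" and proper: "proper_on (refine \<rho> C \<sigma>) C"
  shows "part_graph (refine \<rho> C \<sigma>) C \<in> test_graphs q" "cyclic (fst (part_graph (refine \<rho> C \<sigma>) C))"
    and "N \<ge> 1 \<Longrightarrow> piece N \<omega> C \<sigma> = test_trace N (\<lambda>i. Y N i \<omega>) (part_graph (refine \<rho> C \<sigma>) C)"
proof -
  have p: "parts (refine \<rho> C \<sigma>) = parts \<rho>" by (rule parts_refine[OF assms(1,2)])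
  then have C: "C \<in> parts (refine \<rho> C \<sigma>)" using assms(1) by simp
  have c: "compatible cl (refine \<rho> C \<sigma>)" unfolding refine_def by (rule compatible_comp[OF compat])
  have t: "card (parts (refine \<rho> C \<sigma>)) = card (cl ` XS) + 1" unfolding p by (rule tree)
  show "part_graph (refine \<rho> C \<sigma>) C \<in> test_graphs q" by (rule part_graph_test_graphs[OF proper C])
  show "cyclic (fst (part_graph (refine \<rho> C \<sigma>) C))" by (rule part_graph_cyclic[OF proper C c t])
  show "piece N \<omega> C \<sigma> = test_trace N (\<lambda>i. Y N i \<omega>) (part_graph (refine \<rho> C \<sigma>) C)" if "N \<ge> 1"
    unfolding piece_def part_sum_eq[OF proper C that] using that by simp
qed

lemma piece_convergent:
  assumes "C \<in> parts \<rho>" "\<sigma> \<in> kernels (\<rho> ` C)"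
  shows "convergent (\<lambda>N. \<integral>\<omega>. piece N \<omega> C \<sigma> \<partial>M N)"
proof (cases "proper_on (refine \<rho> C \<sigma>) C")
  case False
  then show ?thesis using piece_improper[OF assms False] by (simp add: convergent_const)
next
  case True
  note g = piece_test_graph[OF assms True]
  have c: "convergent (\<lambda>N. \<integral>\<omega>. test_trace N (\<lambda>i. Y N i \<omega>) (part_graph (refine \<rho> C \<sigma>) C) \<partial>M N)"
    using converge g(1,2) unfolding traces_converge_def by blast
  have ev: "eventually (\<lambda>N. (\<integral>\<omega>. piece N \<omega> C \<sigma> \<partial>M N) =
      (\<integral>\<omega>. test_trace N (\<lambda>i. Y N i \<omega>) (part_graph (refine \<rho> C \<sigma>) C) \<partial>M N)) sequentially"
    using eventually_ge_at_top[of 1] by eventually_elim (simp only: g(3))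
  show ?thesis by (rule iffD2[OF convergent_cong[OF ev] c])
qed

text \<open>If some piece is improper, both terms vanish; otherwise the pieces are traces of cyclic
  test graphs and Assumption 2 applies.\<close>

lemma pieces_factorize:
  assumes s: "\<And>C. C \<in> parts \<rho> \<Longrightarrow> s C \<in> kernels (\<rho> ` C)"
  shows "(\<lambda>N. (\<integral>\<omega>. (\<Prod>C\<in>parts \<rho>. piece N \<omega> C (s C)) \<partial>M N) - (\<Prod>C\<in>parts \<rho>. \<integral>\<omega>. piece N \<omega> C (s C) \<partial>M N)) \<longlonglongrightarrow> 0"
proof (cases "\<forall>C\<in>parts \<rho>. proper_on (refine \<rho> C (s C)) C")
  case False
  then obtain C where C: "C \<in> parts \<rho>" "\<not> proper_on (refine \<rho> C (s C)) C" by blast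
  have z: "piece N \<omega> C (s C) = 0" for N \<omega> by (rule piece_improper[OF C(1) s[OF C(1)] C(2)])
  have "(\<Prod>C\<in>parts \<rho>. piece N \<omega> C (s C)) = 0" for N \<omega>
    by (rule prod_zero[OF finite_parts]) (use C(1) z in blast)
  moreover have "(\<Prod>C\<in>parts \<rho>. \<integral>\<omega>. piece N \<omega> C (s C) \<partial>M N) = 0" for N
    by (rule prod_zero[OF finite_parts], rule bexI[OF _ C(1)]) (simp add: z)
  ultimately show ?thesis by simp
next
  case True
  let ?T = "\<lambda>C. part_graph (refine \<rho> C (s C)) C"
  let ?Ts = "map ?T (part_list \<rho>)"
  have g: "?T C \<in> test_graphs q" "cyclic (fst (?T C))"
    "N \<ge> 1 \<Longrightarrow> piece N \<omega> C (s C) = test_trace N (\<lambda>i. Y N i \<omega>) (?T C)" if "C \<in> parts \<rho>" for C N \<omega>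
    using piece_test_graph[OF that s[OF that]] True that by blast+
  have "\<forall>T\<in>set ?Ts. T \<in> test_graphs q \<and> cyclic (fst T)" using g(1,2) part_list(1) by auto
  then have "(\<lambda>N. (\<integral>\<omega>. (\<Prod>T\<leftarrow>?Ts. test_trace N (\<lambda>i. Y N i \<omega>) T) \<partial>M N)
             - (\<Prod>T\<leftarrow>?Ts. \<integral>\<omega>. test_trace N (\<lambda>i. Y N i \<omega>) T \<partial>M N)) \<longlonglongrightarrow> 0"
    using factorize unfolding traces_factorize_def by blast
  then show ?thesis
  proof (rule Lim_transform_eventually)
    have conv: "(\<Prod>T\<leftarrow>?Ts. h T) = (\<Prod>C\<in>parts \<rho>. h (?T C))" for h :: "test_graph \<Rightarrow> complex"
      using prod.distinct_set_conv_list[OF part_list(2), of "\<lambda>C. h (?T C)" \<rho>] by (simp add: part_list(1) o_def)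
    show "eventually (\<lambda>N. (\<integral>\<omega>. (\<Prod>T\<leftarrow>?Ts. test_trace N (\<lambda>i. Y N i \<omega>) T) \<partial>M N)
             - (\<Prod>T\<leftarrow>?Ts. \<integral>\<omega>. test_trace N (\<lambda>i. Y N i \<omega>) T \<partial>M N) =
      (\<integral>\<omega>. (\<Prod>C\<in>parts \<rho>. piece N \<omega> C (s C)) \<partial>M N) - (\<Prod>C\<in>parts \<rho>. \<integral>\<omega>. piece N \<omega> C (s C) \<partial>M N)) sequentially"
      using eventually_ge_at_top[of 1]
    proof eventually_elim
      case (elim N)
      have "(\<Prod>C\<in>parts \<rho>. piece N \<omega> C (s C)) = (\<Prod>C\<in>parts \<rho>. test_trace N (\<lambda>i. Y N i \<omega>) (?T C))" for \<omega>
        using g(3)[OF _ elim] by (intro prod.cong refl)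
      moreover have "(\<Prod>C\<in>parts \<rho>. \<integral>\<omega>. piece N \<omega> C (s C) \<partial>M N) =
          (\<Prod>C\<in>parts \<rho>. \<integral>\<omega>. test_trace N (\<lambda>i. Y N i \<omega>) (?T C) \<partial>M N)"
        using g(3)[OF _ elim] by (intro prod.cong refl) simp
      ultimately show ?case unfolding conv by (simp only:)
    qed
  qed
qed

lemma free_sum_pieces:
  assumes "C \<in> parts \<rho>"
  shows "free_sum N (el N \<omega>) \<rho> C / of_nat N = (\<Sum>\<sigma>\<in>kernels (\<rho> ` C). piece N \<omega> C \<sigma>)"
  unfolding free_sum_refine[OF assms] piece_def by (rule sum_divide_distrib)

lemma integral_free_sum:
  assumes "C \<in> parts \<rho>" "N \<ge> 1"
  shows "(\<integral>\<omega>. free_sum N (el N \<omega>) \<rho> C / of_nat N \<partial>M N) = (\<Sum>\<sigma>\<in>kernels (\<rho> ` C). \<integral>\<omega>. piece N \<omega> C \<sigma> \<partial>M N)"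
  unfolding free_sum_pieces[OF assms(1)]
  using all_moments_piece[OF assms(2,1)] by (intro Bochner_Integration.integral_sum all_moments_integrable)

lemma free_sum_convergent:
  assumes C: "C \<in> parts \<rho>"
  shows "convergent (\<lambda>N. \<integral>\<omega>. free_sum N (el N \<omega>) \<rho> C / of_nat N \<partial>M N)"
proof -
  have "finite (kernels (\<rho> ` C))" using finite_part[OF C] by (intro finite_kernels) simp
  then have c: "convergent (\<lambda>N. \<Sum>\<sigma>\<in>kernels (\<rho> ` C). \<integral>\<omega>. piece N \<omega> C \<sigma> \<partial>M N)"
    using piece_convergent[OF C] by (intro convergent_sum)
  have ev: "eventually (\<lambda>N. (\<integral>\<omega>. free_sum N (el N \<omega>) \<rho> C / of_nat N \<partial>M N) =
      (\<Sum>\<sigma>\<in>kernels (\<rho> ` C). \<integral>\<omega>. piece N \<omega> C \<sigma> \<partial>M N)) sequentially"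
    using eventually_ge_at_top[of 1] by eventually_elim (rule integral_free_sum[OF C])
  show ?thesis by (rule iffD2[OF convergent_cong[OF ev] c])
qed

text \<open>The assumptions concern injective traces. So each free sum is expanded over the kernels
  of its component and the product over all simultaneous choices; the expectation factorises in the
  limit for each choice separately.\<close>

lemma free_sums_factorize:
  "(\<lambda>N. \<integral>\<omega>. (\<Prod>C\<in>parts \<rho>. free_sum N (el N \<omega>) \<rho> C / of_nat N) \<partial>M N) \<longlonglongrightarrow>
    (\<Prod>C\<in>parts \<rho>. lim (\<lambda>N. \<integral>\<omega>. free_sum N (el N \<omega>) \<rho> C / of_nat N \<partial>M N))"
proof -
  let ?S = "Pi\<^sub>E (parts \<rho>) (\<lambda>C. kernels (\<rho> ` C))"
  have finK: "finite (kernels (\<rho> ` C))" if "C \<in> parts \<rho>" for C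
    using finite_part[OF that] by (intro finite_kernels) simp
  have finS: "finite ?S" using finite_parts finK by (intro finite_PiE)
  have sK: "s C \<in> kernels (\<rho> ` C)" if "s \<in> ?S" "C \<in> parts \<rho>" for s C using that by (rule PiE_mem)
  let ?E = "\<lambda>N C. \<integral>\<omega>. free_sum N (el N \<omega>) \<rho> C / of_nat N \<partial>M N"
  let ?d = "\<lambda>N. \<Sum>s\<in>?S. (\<integral>\<omega>. (\<Prod>C\<in>parts \<rho>. piece N \<omega> C (s C)) \<partial>M N) - (\<Prod>C\<in>parts \<rho>. \<integral>\<omega>. piece N \<omega> C (s C) \<partial>M N)"
  have d: "?d \<longlonglongrightarrow> 0"
    by (intro tendsto_null_sum pieces_factorize sK)
  have "(\<lambda>N. \<Prod>C\<in>parts \<rho>. ?E N C) \<longlonglongrightarrow> (\<Prod>C\<in>parts \<rho>. lim (\<lambda>N. ?E N C))"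
    using free_sum_convergent by (intro tendsto_prod) (simp add: convergent_LIMSEQ_iff)
  then have "(\<lambda>N. ?d N +
      (\<Prod>C\<in>parts \<rho>. ?E N C)) \<longlonglongrightarrow> 0 + (\<Prod>C\<in>parts \<rho>. lim (\<lambda>N. ?E N C))"
    by (rule tendsto_add[OF d])
  then have "(\<lambda>N. ?d N +
      (\<Prod>C\<in>parts \<rho>. ?E N C)) \<longlonglongrightarrow> (\<Prod>C\<in>parts \<rho>. lim (\<lambda>N. ?E N C))" by simp
  then show ?thesis
  proof (rule Lim_transform_eventually)
    show "eventually (\<lambda>N. ?d N +
      (\<Prod>C\<in>parts \<rho>. ?E N C) = (\<integral>\<omega>. (\<Prod>C\<in>parts \<rho>. free_sum N (el N \<omega>) \<rho> C / of_nat N) \<partial>M N)) sequentially"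
      using eventually_ge_at_top[of 1]
    proof eventually_elim
      case (elim N)
      interpret prob_space "M N" by (rule prob) fact
      have "(\<Prod>C\<in>parts \<rho>. free_sum N (el N \<omega>) \<rho> C / of_nat N) = (\<Sum>s\<in>?S. \<Prod>C\<in>parts \<rho>. piece N \<omega> C (s C))" for \<omega>
      proof -
        have "(\<Prod>C\<in>parts \<rho>. free_sum N (el N \<omega>) \<rho> C / of_nat N) = (\<Prod>C\<in>parts \<rho>. \<Sum>\<sigma>\<in>kernels (\<rho> ` C). piece N \<omega> C \<sigma>)"
          by (intro prod.cong refl free_sum_pieces)
        also have "\<dots> = (\<Sum>s\<in>?S. \<Prod>C\<in>parts \<rho>. piece N \<omega> C (s C))"
          using finK by (intro prod_sum_PiE finite_parts)
        finally show ?thesis .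
      qed
      then have "(\<integral>\<omega>. (\<Prod>C\<in>parts \<rho>. free_sum N (el N \<omega>) \<rho> C / of_nat N) \<partial>M N) =
          (\<integral>\<omega>. (\<Sum>s\<in>?S. \<Prod>C\<in>parts \<rho>. piece N \<omega> C (s C)) \<partial>M N)" by (simp only:)
      also have "\<dots> = (\<Sum>s\<in>?S. \<integral>\<omega>. (\<Prod>C\<in>parts \<rho>. piece N \<omega> C (s C)) \<partial>M N)"
        by (intro Bochner_Integration.integral_sum all_moments_integrable all_moments_prod all_moments_piece[OF elim] sK)
      moreover have "(\<Prod>C\<in>parts \<rho>. ?E N C) = (\<Sum>s\<in>?S. \<Prod>C\<in>parts \<rho>. \<integral>\<omega>. piece N \<omega> C (s C) \<partial>M N)"
      proof -
        have "(\<Prod>C\<in>parts \<rho>. ?E N C) = (\<Prod>C\<in>parts \<rho>. \<Sum>\<sigma>\<in>kernels (\<rho> ` C). \<integral>\<omega>. piece N \<omega> C \<sigma> \<partial>M N)"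
          by (intro prod.cong refl integral_free_sum[OF _ elim])
        also have "\<dots> = (\<Sum>s\<in>?S. \<Prod>C\<in>parts \<rho>. \<integral>\<omega>. piece N \<omega> C (s C) \<partial>M N)"
          using finK by (intro prod_sum_PiE finite_parts)
        finally show ?thesis .
      qed
      ultimately show ?case by (simp only: sum_subtractf diff_add_cancel)
    qed
  qed
qed

text \<open>One expectation with two limits: by factorisation it tends to the left-hand side, and
  expanded over all coarser kernels it tends to the sum of the limits of \<open>scaled\<close>. The
  coarser kernels with fewer components drop out.\<close>

lemma prod_lim_free_sum:
  "(\<Prod>C\<in>parts \<rho>. lim (\<lambda>N. \<integral>\<omega>. free_sum N (el N \<omega>) \<rho> C / of_nat N \<partial>M N)) =
    (\<Sum>\<rho>'\<in>{\<rho>' \<in> kernels V. coarser \<rho> \<rho>' \<and> card (parts \<rho>') = card (cl ` XS) + 1}. lim (scaled (card (cl ` XS)) \<rho>'))"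
    (is "?P = _")
proof -
  let ?E = "card (cl ` XS)"
  let ?K = "{\<rho>' \<in> kernels V. coarser \<rho> \<rho>'}"
  have finK: "finite ?K" using finite_kernels[OF finite_V] by simp
  have comp: "compatible cl \<rho>'" if "\<rho>' \<in> ?K" for \<rho>' using compatible_coarser[OF compat] that by blast
  have "(\<lambda>N. \<Sum>\<rho>'\<in>?K. scaled ?E \<rho>' N) \<longlonglongrightarrow> (\<Sum>\<rho>'\<in>?K. lim (scaled ?E \<rho>'))"
    using scaled_limit[OF comp] by (intro tendsto_sum) (simp add: convergent_LIMSEQ_iff)
  then have "(\<lambda>N. \<integral>\<omega>. (\<Prod>C\<in>parts \<rho>. free_sum N (el N \<omega>) \<rho> C / of_nat N) \<partial>M N) \<longlonglongrightarrow> (\<Sum>\<rho>'\<in>?K. lim (scaled ?E \<rho>'))"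
  proof (rule Lim_transform_eventually)
    show "eventually (\<lambda>N. (\<Sum>\<rho>'\<in>?K. scaled ?E \<rho>' N) =
        (\<integral>\<omega>. (\<Prod>C\<in>parts \<rho>. free_sum N (el N \<omega>) \<rho> C / of_nat N) \<partial>M N)) sequentially"
      using eventually_ge_at_top[of 1]
    proof eventually_elim
      case (elim N)
      interpret prob_space "M N" by (rule prob) fact
      have "(\<Prod>C\<in>parts \<rho>. free_sum N (el N \<omega>) \<rho> C / of_nat N) = (\<Sum>\<rho>'\<in>?K. inj_sum N (el N \<omega>) \<rho>') / of_nat N ^ (?E + 1)" for \<omega>
        unfolding prod_dividef prod_free_sum sum_coarser prod_constant tree ..
      then have "(\<integral>\<omega>. (\<Prod>C\<in>parts \<rho>. free_sum N (el N \<omega>) \<rho> C / of_nat N) \<partial>M N) =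
          (\<integral>\<omega>. (\<Sum>\<rho>'\<in>?K. inj_sum N (el N \<omega>) \<rho>') / of_nat N ^ (?E + 1) \<partial>M N)" by (simp only:)
      also have "\<dots> = (\<integral>\<omega>. (\<Sum>\<rho>'\<in>?K. inj_sum N (el N \<omega>) \<rho>') \<partial>M N) / of_nat N ^ (?E + 1)"
        by (rule integral_divide_zero)
      also have "(\<integral>\<omega>. (\<Sum>\<rho>'\<in>?K. inj_sum N (el N \<omega>) \<rho>') \<partial>M N) = (\<Sum>\<rho>'\<in>?K. \<integral>\<omega>. inj_sum N (el N \<omega>) \<rho>' \<partial>M N)"
        by (intro Bochner_Integration.integral_sum all_moments_integrable all_moments_inj_sum elim)
      finally show ?case by (simp only: scaled_def sum_divide_distrib)
    qed
  qed
  then have "?P = (\<Sum>\<rho>'\<in>?K. lim (scaled ?E \<rho>'))" using free_sums_factorize LIMSEQ_unique by blast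
  also have "\<dots> = (\<Sum>\<rho>'\<in>{\<rho>' \<in> kernels V. coarser \<rho> \<rho>' \<and> card (parts \<rho>') = ?E + 1}. lim (scaled ?E \<rho>'))"
  proof (rule sum.mono_neutral_right[OF finK])
    show "\<forall>\<rho>'\<in>?K - {\<rho>' \<in> kernels V. coarser \<rho> \<rho>' \<and> card (parts \<rho>') = ?E + 1}. lim (scaled ?E \<rho>') = 0"
    proof
      fix \<rho>' assume r: "\<rho>' \<in> ?K - {\<rho>' \<in> kernels V. coarser \<rho> \<rho>' \<and> card (parts \<rho>') = ?E + 1}"
      then have c: "compatible cl \<rho>'" using comp by blast
      have "card (parts \<rho>') \<le> ?E" using card_parts_le[OF c] r by auto
      then have "scaled ?E \<rho>' \<longlonglongrightarrow> 0" using scaled_limit[OF c] by blast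
      then show "lim (scaled ?E \<rho>') = 0" by (rule limI)
    qed
  qed auto
  finally show ?thesis .
qed

end

end

section \<open>The mean trace along a closed walk\<close>

locale trace_walk = labelled_walk V nx XS q M Y lab + wigner_walk V nx XS p M X a \<mu> \<nu> col
  for V nx XS q and M :: "nat \<Rightarrow> 'w measure" and Y lab p X a \<mu> \<nu> col +
  assumes indepXY: "\<And>N. N \<ge> 1 \<Longrightarrow> prob_space.indep_var (M N)
           (entry_space {..<p} N) (entries {..<p} N (X N))
           (entry_space {..<q} N) (entries {..<q} N (Y N))"
begin

lemma integral_X_Y:
  assumes N: "N \<ge> 1" and \<phi>: "\<And>k. k \<in> V \<Longrightarrow> \<phi> k < N"
  shows "(\<integral>\<omega>. (\<Prod>k\<in>XS. xentry N \<omega> \<phi> k) * (\<Prod>k\<in>V - XS. el N \<omega> k (\<phi> k) (\<phi> (nx k))) \<partial>M N) =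
    (\<integral>\<omega>. (\<Prod>k\<in>XS. xentry N \<omega> \<phi> k) \<partial>M N) * (\<integral>\<omega>. (\<Prod>k\<in>V - XS. el N \<omega> k (\<phi> k) (\<phi> (nx k))) \<partial>M N)"
    and "integrable (M N) (\<lambda>\<omega>. (\<Prod>k\<in>XS. xentry N \<omega> \<phi> k) * (\<Prod>k\<in>V - XS. el N \<omega> k (\<phi> k) (\<phi> (nx k))))"
proof -
  interpret prob_space "M N" by (rule prob[OF N])
  have XSN: "\<phi> k < N \<and> \<phi> (nx k) < N" if "k \<in> XS" for k
  proof -
    have "k \<in> V" using that XS_V by blast
    then show ?thesis using \<phi> by simp
  qed
  define F where "F g = (\<Prod>k\<in>XS. g (col k, \<phi> k, \<phi> (nx k)))" for g :: "nat \<times> nat \<times> nat \<Rightarrow> complex"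
  \<comment> \<open>\<open>label_entry\<close> as a function of the vector of entries. The adjoint
    is unfolded into a conjugate, which agrees with \<open>letter_mat\<close> for matrices of the
    right size, that is, on the space of \<open>M N\<close>.\<close>
  define ent where "ent g l i j = (case l of None \<Rightarrow> of_bool (i = j)
      | Some l \<Rightarrow> (case l of Plain v \<Rightarrow> g (v, i, j) | Star v \<Rightarrow> cnj (g (v, j, i))))"
    for g :: "nat \<times> nat \<times> nat \<Rightarrow> complex" and l :: "nat star_letter option" and i j :: nat
  define H where "H g = (\<Prod>k\<in>V - XS. ent g (lab k) (\<phi> k) (\<phi> (nx k)))" for g
  have F: "F (entries {..<p} N (X N) \<omega>) = (\<Prod>k\<in>XS. xentry N \<omega> \<phi> k)" for \<omega>
    unfolding F_def using XSN col by (intro prod.cong refl) (auto simp: entries_def xentry_def)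
  have vars: "v < q" if "k \<in> V - XS" "lab k = Some (Plain v) \<or> lab k = Some (Star v)" for k v
    using lab_vars[OF that(1)] that(2) by fastforce
  have H: "H (entries {..<q} N (Y N) \<omega>) = (\<Prod>k\<in>V - XS. el N \<omega> k (\<phi> k) (\<phi> (nx k)))" if \<omega>: "\<omega> \<in> space (M N)" for \<omega>
    unfolding H_def
  proof (intro prod.cong refl)
    fix k assume k: "k \<in> V - XS"
    then have lt: "\<phi> k < N" "\<phi> (nx k) < N" using \<phi> by auto
    show "ent (entries {..<q} N (Y N) \<omega>) (lab k) (\<phi> k) (\<phi> (nx k)) = el N \<omega> k (\<phi> k) (\<phi> (nx k))"
    proof (cases "lab k")
      case None
      then show ?thesis by (simp add: ent_def el_def label_entry_def)
    next
      case (Some l)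
      show ?thesis
      proof (cases l)
        case (Plain v)
        then have "v < q" using vars[OF k] Some by blast
        then show ?thesis using Some Plain lt by (simp add: ent_def el_def label_entry_def entries_def)
      next
        case (Star v)
        then have v: "v < q" using vars[OF k] Some by blast
        have "Y N v \<omega> \<in> carrier_mat N N" using random[OF N v] \<omega> by (simp add: random_matrix_def)
        then show ?thesis using Some Star lt v
          by (simp add: ent_def el_def label_entry_def entries_def mat_adjoint_index)
      qed
    qed
  qed
  have Fm: "F \<in> borel_measurable (entry_space {..<p} N)"
    unfolding F_def entry_space_def using XSN col
    by (intro borel_measurable_prod measurable_component_singleton) auto
  have Hm: "H \<in> borel_measurable (entry_space {..<q} N)"
    unfolding H_def
  proof (intro borel_measurable_prod)
    fix k assume k: "k \<in> V - XS"
    then have lt: "\<phi> k < N" "\<phi> (nx k) < N" using \<phi> by auto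
    have c: "(\<lambda>g. g (v, i, j)) \<in> borel_measurable (entry_space {..<q} N)" if "v < q" "i < N" "j < N" for v i j
      unfolding entry_space_def using that by (intro measurable_component_singleton) auto
    show "(\<lambda>g. ent g (lab k) (\<phi> k) (\<phi> (nx k))) \<in> borel_measurable (entry_space {..<q} N)"
    proof (cases "lab k")
      case None
      then show ?thesis by (simp add: ent_def)
    next
      case (Some l)
      show ?thesis
      proof (cases l)
        case (Plain v)
        then have "v < q" using vars[OF k] Some by blast
        then show ?thesis using Some Plain lt c by (simp add: ent_def)
      next
        case (Star v)
        then have v: "v < q" using vars[OF k] Some by blast
        have "(\<lambda>g. cnj (g (v, \<phi> (nx k), \<phi> k))) \<in> borel_measurable (entry_space {..<q} N)"
          by (rule measurable_compose[OF c[OF v lt(2,1)] cnj_borel])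
        then show ?thesis using Some Star by (simp add: ent_def)
      qed
    qed
  qed
  have indep: "indep_var borel (\<lambda>\<omega>. \<Prod>k\<in>XS. xentry N \<omega> \<phi> k) borel (H \<circ> entries {..<q} N (Y N))"
    using indep_var_compose[OF indepXY[OF N] Fm Hm] unfolding comp_def F .
  have Xi: "integrable (M N) (\<lambda>\<omega>. \<Prod>k\<in>XS. xentry N \<omega> \<phi> k)"
    by (rule all_moments_integrable) (rule all_moments_prod_xentry[where K = XS and \<phi> = \<phi>, OF N XSN order_refl])
  have "all_moments (M N) (\<lambda>\<omega>. \<Prod>k\<in>V - XS. el N \<omega> k (\<phi> k) (\<phi> (nx k)))"
    unfolding el_def using \<phi> lab_vars by (intro all_moments_prod all_moments_label N) auto
  then have "integrable (M N) (\<lambda>\<omega>. \<Prod>k\<in>V - XS. el N \<omega> k (\<phi> k) (\<phi> (nx k)))" by (rule all_moments_integrable)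
  then have Yi: "integrable (M N) (H \<circ> entries {..<q} N (Y N))"
    by (rule iffD1[OF Bochner_Integration.integrable_cong, rotated 2]) (use H in auto)
  have e: "(\<integral>\<omega>. (\<Prod>k\<in>XS. xentry N \<omega> \<phi> k) * (\<Prod>k\<in>V - XS. el N \<omega> k (\<phi> k) (\<phi> (nx k))) \<partial>M N) =
    (\<integral>\<omega>. (\<Prod>k\<in>XS. xentry N \<omega> \<phi> k) * (H \<circ> entries {..<q} N (Y N)) \<omega> \<partial>M N)"
    using H by (intro Bochner_Integration.integral_cong) auto
  also have "\<dots> = (\<integral>\<omega>. (\<Prod>k\<in>XS. xentry N \<omega> \<phi> k) \<partial>M N) * (\<integral>\<omega>. (H \<circ> entries {..<q} N (Y N)) \<omega> \<partial>M N)"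
    by (rule indep_var_lebesgue_integral[OF indep Xi Yi])
  also have "(\<integral>\<omega>. (H \<circ> entries {..<q} N (Y N)) \<omega> \<partial>M N) = (\<integral>\<omega>. (\<Prod>k\<in>V - XS. el N \<omega> k (\<phi> k) (\<phi> (nx k))) \<partial>M N)"
    using H by (intro Bochner_Integration.integral_cong) auto
  finally show "(\<integral>\<omega>. (\<Prod>k\<in>XS. xentry N \<omega> \<phi> k) * (\<Prod>k\<in>V - XS. el N \<omega> k (\<phi> k) (\<phi> (nx k))) \<partial>M N) =
    (\<integral>\<omega>. (\<Prod>k\<in>XS. xentry N \<omega> \<phi> k) \<partial>M N) * (\<integral>\<omega>. (\<Prod>k\<in>V - XS. el N \<omega> k (\<phi> k) (\<phi> (nx k))) \<partial>M N)" .
  show "integrable (M N) (\<lambda>\<omega>. (\<Prod>k\<in>XS. xentry N \<omega> \<phi> k) * (\<Prod>k\<in>V - XS. el N \<omega> k (\<phi> k) (\<phi> (nx k))))"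
    by (rule iffD1[OF Bochner_Integration.integrable_cong indep_var_integrable[OF indep Xi Yi]]) (use H in auto)
qed

definition walk_trace :: "nat \<Rightarrow> 'w \<Rightarrow> complex" where
  "walk_trace N \<omega> = (\<Sum>\<phi>\<in>V \<rightarrow>\<^sub>E {..<N}. (\<Prod>k\<in>XS. xentry N \<omega> \<phi> k) * (\<Prod>k\<in>V - XS. el N \<omega> k (\<phi> k) (\<phi> (nx k))))"

lemma integrable_walk_trace:
  assumes "N \<ge> 1"
  shows "integrable (M N) (walk_trace N)"
  unfolding walk_trace_def
  by (intro Bochner_Integration.integrable_sum integral_X_Y(2)[OF assms]) auto

text \<open>Once the maps are sorted by kernel, the Wigner expectation is the constant
  \<open>weight N \<rho>\<close>, and only the injective sum over the \<open>Y\<close>-arcs remains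
  under the integral.\<close>

lemma integral_walk_trace:
  assumes N: "N \<ge> 1"
  shows "(\<integral>\<omega>. walk_trace N \<omega> \<partial>M N) = (\<Sum>\<rho>\<in>kernels V. weight N \<rho> * (\<integral>\<omega>. inj_sum N (el N \<omega>) \<rho> \<partial>M N))"
proof -
  interpret prob_space "M N" by (rule prob[OF N])
  let ?x = "\<lambda>\<omega> \<phi>. \<Prod>k\<in>XS. xentry N \<omega> \<phi> k" and ?y = "\<lambda>\<omega> \<phi>. \<Prod>k\<in>V - XS. el N \<omega> k (\<phi> k) (\<phi> (nx k))"
  have "(\<integral>\<omega>. walk_trace N \<omega> \<partial>M N) = (\<Sum>\<phi>\<in>V \<rightarrow>\<^sub>E {..<N}. \<integral>\<omega>. ?x \<omega> \<phi> * ?y \<omega> \<phi> \<partial>M N)"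
    unfolding walk_trace_def
    by (intro Bochner_Integration.integral_sum integral_X_Y(2)[OF N]) auto
  also have "\<dots> = (\<Sum>\<phi>\<in>V \<rightarrow>\<^sub>E {..<N}. (\<integral>\<omega>. ?x \<omega> \<phi> \<partial>M N) * (\<integral>\<omega>. ?y \<omega> \<phi> \<partial>M N))"
    by (intro sum.cong refl integral_X_Y(1)[OF N]) auto
  also have "\<dots> = (\<Sum>\<rho>\<in>kernels V. \<Sum>\<psi>\<in>inj_maps (\<rho> ` V) N.
      (\<integral>\<omega>. ?x \<omega> (restrict (\<psi> \<circ> \<rho>) V) \<partial>M N) * (\<integral>\<omega>. ?y \<omega> (restrict (\<psi> \<circ> \<rho>) V) \<partial>M N))"
    by (rule sum_kernels[OF finite_V])
  also have "\<dots> = (\<Sum>\<rho>\<in>kernels V. weight N \<rho> * (\<integral>\<omega>. inj_sum N (el N \<omega>) \<rho> \<partial>M N))"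
  proof (rule sum.cong[OF refl])
    fix \<rho>
    have x: "(\<integral>\<omega>. ?x \<omega> (restrict (\<psi> \<circ> \<rho>) V) \<partial>M N) = weight N \<rho>" if \<psi>: "\<psi> \<in> inj_maps (\<rho> ` V) N" for \<psi>
    proof -
      have "?x \<omega> (restrict (\<psi> \<circ> \<rho>) V) = ?x \<omega> (\<psi> \<circ> \<rho>)" for \<omega>
      proof (intro prod.cong refl)
        fix k assume "k \<in> XS"
        then have "k \<in> V" using XS_V by blast
        then show "xentry N \<omega> (restrict (\<psi> \<circ> \<rho>) V) k = xentry N \<omega> (\<psi> \<circ> \<rho>) k" by (simp add: xentry_def)
      qed
      then show ?thesis using integral_weight[OF N \<psi>] by (simp only:)
    qed
    have y: "?y \<omega> (restrict (\<psi> \<circ> \<rho>) V) = (\<Prod>k\<in>V - XS. el N \<omega> k (\<psi> (\<rho> k)) (\<psi> (\<rho> (nx k))))" for \<omega> \<psi>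
      by (intro prod.cong) auto
    have "(\<Sum>\<psi>\<in>inj_maps (\<rho> ` V) N. (\<integral>\<omega>. ?x \<omega> (restrict (\<psi> \<circ> \<rho>) V) \<partial>M N) * (\<integral>\<omega>. ?y \<omega> (restrict (\<psi> \<circ> \<rho>) V) \<partial>M N)) =
      (\<Sum>\<psi>\<in>inj_maps (\<rho> ` V) N. weight N \<rho> * (\<integral>\<omega>. (\<Prod>k\<in>V - XS. el N \<omega> k (\<psi> (\<rho> k)) (\<psi> (\<rho> (nx k)))) \<partial>M N))"
      unfolding y using x by (intro sum.cong refl) (simp only:)
    also have "\<dots> = weight N \<rho> * (\<Sum>\<psi>\<in>inj_maps (\<rho> ` V) N. \<integral>\<omega>. (\<Prod>k\<in>V - XS. el N \<omega> k (\<psi> (\<rho> k)) (\<psi> (\<rho> (nx k)))) \<partial>M N)"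
      by (rule sum_distrib_left[symmetric])
    also have "(\<Sum>\<psi>\<in>inj_maps (\<rho> ` V) N. \<integral>\<omega>. (\<Prod>k\<in>V - XS. el N \<omega> k (\<psi> (\<rho> k)) (\<psi> (\<rho> (nx k)))) \<partial>M N) =
      (\<integral>\<omega>. inj_sum N (el N \<omega>) \<rho> \<partial>M N)"
      unfolding inj_sum_def
    proof (rule Bochner_Integration.integral_sum[symmetric])
      fix \<psi> assume \<psi>: "\<psi> \<in> inj_maps (\<rho> ` V) N"
      show "integrable (M N) (\<lambda>\<omega>. \<Prod>k\<in>V - XS. el N \<omega> k (\<psi> (\<rho> k)) (\<psi> (\<rho> (nx k))))"
        unfolding el_def
      proof (intro all_moments_integrable all_moments_prod all_moments_label N)
        fix k assume k: "k \<in> V - XS"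
        then show "\<psi> (\<rho> k) < N" "\<psi> (\<rho> (nx k)) < N" using \<psi> by (auto simp: inj_maps_def)
        show "\<And>l. lab k = Some l \<Longrightarrow> set_star_letter l \<subseteq> {..<q}" using lab_vars[OF k] .
      qed
    qed
    finally show "(\<Sum>\<psi>\<in>inj_maps (\<rho> ` V) N. (\<integral>\<omega>. ?x \<omega> (restrict (\<psi> \<circ> \<rho>) V) \<partial>M N) * (\<integral>\<omega>. ?y \<omega> (restrict (\<psi> \<circ> \<rho>) V) \<partial>M N)) =
      weight N \<rho> * (\<integral>\<omega>. inj_sum N (el N \<omega>) \<rho> \<partial>M N)" .
  qed
  finally show ?thesis .
qed

definition is_tree :: "(nat \<Rightarrow> nat) \<Rightarrow> bool" where
  "is_tree \<rho> \<longleftrightarrow> card (parts \<rho>) = card (edge_class \<rho> ` XS) + 1"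

definition tree_weight :: "(nat \<Rightarrow> nat) \<Rightarrow> real" where
  "tree_weight \<rho> = (\<Prod>\<kappa>\<in>edge_class \<rho> ` XS. a (fst \<kappa>) (card {k \<in> XS. edge_class \<rho> k = \<kappa>} div 2))"

lemma compatible_edge_class: "compatible (edge_class \<rho>) \<rho>"
  by (simp add: compatible_def edge_class_def)

text \<open>\<open>1 / N\<close> is written as \<open>N ^ E / N ^ (E + 1)\<close>, one power for the
  weight and one for the injective sum. For a tree both factors converge. Otherwise the second tends
  to 0, while the first is bounded or, if some class is a singleton, eventually zero.\<close>

lemma walk_trace_limit:
  "(\<lambda>N. (\<integral>\<omega>. walk_trace N \<omega> \<partial>M N) / of_nat N) \<longlonglongrightarrow>
    (\<Sum>\<rho>\<in>{\<rho> \<in> kernels V. is_tree \<rho>}. complex_of_real (tree_weight \<rho>) * lim (scaled (card (edge_class \<rho> ` XS)) \<rho>))"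
proof -
  let ?E = "\<lambda>\<rho>. card (edge_class \<rho> ` XS)"
  let ?t = "\<lambda>\<rho> N. (of_nat N ^ ?E \<rho> * weight N \<rho>) * scaled (?E \<rho>) \<rho> N"
  have "(\<lambda>N. \<Sum>\<rho>\<in>kernels V. ?t \<rho> N) \<longlonglongrightarrow>
    (\<Sum>\<rho>\<in>kernels V. if is_tree \<rho> then complex_of_real (tree_weight \<rho>) * lim (scaled (?E \<rho>) \<rho>) else 0)"
  proof (rule tendsto_sum)
    fix \<rho>
    note lims = scaled_limit[OF compatible_edge_class[of \<rho>]]
    show "?t \<rho> \<longlonglongrightarrow> (if is_tree \<rho> then complex_of_real (tree_weight \<rho>) * lim (scaled (?E \<rho>) \<rho>) else 0)"
    proof (cases "is_tree \<rho>")
      case True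
      have "?t \<rho> \<longlonglongrightarrow> complex_of_real (tree_weight \<rho>) * lim (scaled (?E \<rho>) \<rho>)"
        unfolding tree_weight_def
        using weight_limit[OF compatible_edge_class, of \<rho>] True lims
        by (intro tendsto_mult) (auto simp: is_tree_def convergent_LIMSEQ_iff)
      then show ?thesis using True by simp
    next
      case False
      then have "card (parts \<rho>) \<le> ?E \<rho>" using card_parts_le[OF compatible_edge_class, of \<rho>] by (simp add: is_tree_def)
      then have s: "scaled (?E \<rho>) \<rho> \<longlonglongrightarrow> 0" using lims by blast
      have "?t \<rho> \<longlonglongrightarrow> 0"
      proof (cases "\<forall>\<kappa>\<in>edge_class \<rho> ` XS. card {k \<in> XS. edge_class \<rho> k = \<kappa>} \<ge> 2")
        case True
        then obtain C where "eventually (\<lambda>N. cmod (of_nat N ^ ?E \<rho> * weight N \<rho>) \<le> C) sequentially"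
          using weight_bound[of \<rho>] by blast
        then have "Bfun (\<lambda>N. of_nat N ^ ?E \<rho> * weight N \<rho>) sequentially" by (rule BfunI)
        moreover have "Zfun (scaled (?E \<rho>) \<rho>) sequentially" using s by (simp add: tendsto_Zfun_iff)
        ultimately have "Zfun (?t \<rho>) sequentially"
          by (rule bounded_bilinear.Bfun_prod_Zfun[OF bounded_bilinear_mult])
        then show ?thesis by (simp add: tendsto_Zfun_iff)
      next
        case False
        then obtain \<kappa> where \<kappa>: "\<kappa> \<in> edge_class \<rho> ` XS" "card {k \<in> XS. edge_class \<rho> k = \<kappa>} < 2" by force
        have "{k \<in> XS. edge_class \<rho> k = \<kappa>} \<noteq> {}" "finite {k \<in> XS. edge_class \<rho> k = \<kappa>}"
          using \<kappa>(1) finite_XS by auto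
        then have "card {k \<in> XS. edge_class \<rho> k = \<kappa>} = 1" using \<kappa>(2) card_gt_0_iff[of "{k \<in> XS. edge_class \<rho> k = \<kappa>}"] by linarith
        then have "eventually (\<lambda>N. weight N \<rho> = 0) sequentially" by (rule weight_singleton[OF \<kappa>(1)])
        then have "eventually (\<lambda>N. 0 = ?t \<rho> N) sequentially" by (rule eventually_mono) simp
        then show ?thesis by (rule Lim_transform_eventually[OF tendsto_const])
      qed
      then show ?thesis using False by simp
    qed
  qed
  also have "(\<Sum>\<rho>\<in>kernels V. if is_tree \<rho> then complex_of_real (tree_weight \<rho>) * lim (scaled (?E \<rho>) \<rho>) else 0) =
    (\<Sum>\<rho>\<in>{\<rho> \<in> kernels V. is_tree \<rho>}. complex_of_real (tree_weight \<rho>) * lim (scaled (?E \<rho>) \<rho>))"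
    by (rule sum.inter_filter[symmetric]) (rule finite_kernels[OF finite_V])
  finally show ?thesis
  proof (rule Lim_transform_eventually)
    show "eventually (\<lambda>N. (\<Sum>\<rho>\<in>kernels V. ?t \<rho> N) = (\<integral>\<omega>. walk_trace N \<omega> \<partial>M N) / of_nat N) sequentially"
      using eventually_ge_at_top[of 1]
    proof eventually_elim
      case (elim N)
      have "?t \<rho> N = weight N \<rho> * (\<integral>\<omega>. inj_sum N (el N \<omega>) \<rho> \<partial>M N) / of_nat N" for \<rho>
        using elim by (simp add: scaled_def field_simps)
      then show ?case unfolding integral_walk_trace[OF elim] sum_divide_distrib by (intro sum.cong refl)
    qed
  qed
qed

end

section \<open>Plane cycles\<close>

text \<open>Every vertex but the root owns the edge to its parent, which is
  \<open>butlast v\<close>.\<close>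

lemma card_tree_edges:
  assumes "plane_tree G"
  shows "card G = card (tree_edges G) + 1"
proof -
  have fin: "finite G" and root: "[] \<in> G" using assms by (auto simp: plane_tree_def)
  have "bij_betw (\<lambda>v. {butlast v, v}) (G - {[]}) (tree_edges G)"
    unfolding bij_betw_def
  proof
    show "inj_on (\<lambda>v. {butlast v, v}) (G - {[]})"
    proof (rule inj_onI)
      fix v w assume vw: "v \<in> G - {[]}" "w \<in> G - {[]}" "{butlast v, v} = {butlast w, w}"
      show "v = w"
      proof (rule ccontr)
        assume "v \<noteq> w"
        then have "v = butlast w" "w = butlast v" using vw(3) by (auto simp: doubleton_eq_iff)
        then have "length v = length w - 1" "length w = length v - 1" by (metis length_butlast)+
        moreover have "length v > 0" using vw(1) by simp
        ultimately show False by linarith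
      qed
    qed
    show "(\<lambda>v. {butlast v, v}) ` (G - {[]}) = tree_edges G"
    proof (intro equalityI subsetI)
      fix e assume "e \<in> (\<lambda>v. {butlast v, v}) ` (G - {[]})"
      then obtain v where v: "v \<in> G" "v \<noteq> []" "e = {butlast v, v}" by auto
      then have "v = butlast v @ [last v]" by simp
      then show "e \<in> tree_edges G" using v unfolding tree_edges_def by (metis (mono_tags, lifting) mem_Collect_eq)
    next
      fix e assume "e \<in> tree_edges G"
      then obtain u i where "e = {u, u @ [i]}" "u @ [i] \<in> G" by (auto simp: tree_edges_def)
      then show "e \<in> (\<lambda>v. {butlast v, v}) ` (G - {[]})"
        by (intro image_eqI[of _ _ "u @ [i]"]) auto
    qed
  qed
  then have "card (G - {[]}) = card (tree_edges G)" by (rule bij_betw_same_card)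
  moreover have "card G = Suc (card (G - {[]}))" using fin root by (rule card.remove)
  ultimately show ?thesis by linarith
qed

context
  fixes L \<gamma> G c
  assumes cyc: "(G, c) \<in> plane_cycles L \<gamma>" and L: "L \<ge> 1"
begin

lemma cycle_facts:
  shows "plane_tree G" "length c = L"
    and "n < L \<Longrightarrow> undirected c n \<in> tree_edges G"
    and "n < L \<Longrightarrow> snd (c ! n) = fst (c ! (Suc n mod L))"
    and "fst (c ! 0) = []"
    and "n < L \<Longrightarrow> snd (c ! n) \<notin> visited c n \<Longrightarrow>
        \<exists>i. snd (c ! n) = fst (c ! n) @ [i] \<and> (\<forall>j<i. fst (c ! n) @ [j] \<in> visited c n)"
    and "v \<in> G \<Longrightarrow> \<exists>n<L. fst (c ! n) = v"
    and "n < L \<Longrightarrow> m < L \<Longrightarrow> undirected c n = undirected c m \<Longrightarrow> \<gamma> n = \<gamma> m"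
  using cyc unfolding plane_cycles_def by blast+

lemma cycle_vertices: "G = (\<lambda>n. fst (c ! n)) ` {..<L}"
proof (intro equalityI subsetI)
  fix v assume "v \<in> G"
  then show "v \<in> (\<lambda>n. fst (c ! n)) ` {..<L}" using cycle_facts(7) by blast
next
  fix v assume "v \<in> (\<lambda>n. fst (c ! n)) ` {..<L}"
  then obtain n where n: "n < L" "v = fst (c ! n)" by auto
  then obtain u i where "{fst (c ! n), snd (c ! n)} = {u, u @ [i]}" "u @ [i] \<in> G"
    using cycle_facts(3)[OF n(1)] by (auto simp: tree_edges_def undirected_def)
  moreover from this(2) have "u \<in> G" using cycle_facts(1) by (auto simp: plane_tree_def)
  ultimately show "v \<in> G" using n(2) by (auto simp: doubleton_eq_iff)
qed

text \<open>The vertex \<open>u @ [i]\<close> is first entered as a new vertex, hence from its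
  parent, and this step traverses the edge.\<close>

lemma cycle_edges: "tree_edges G = undirected c ` {..<L}"
proof (intro equalityI subsetI)
  fix e assume "e \<in> tree_edges G"
  then obtain u i where ui: "e = {u, u @ [i]}" "u @ [i] \<in> G" by (auto simp: tree_edges_def)
  define n where "n = (LEAST n. n < L \<and> fst (c ! n) = u @ [i])"
  have "\<exists>n. n < L \<and> fst (c ! n) = u @ [i]" using cycle_facts(7)[OF ui(2)] by blast
  then have n: "n < L \<and> fst (c ! n) = u @ [i]" unfolding n_def by (rule LeastI_ex)
  have least: "n \<le> m" if "m < L" "fst (c ! m) = u @ [i]" for m
    unfolding n_def using that by (intro Least_le) simp
  have "n \<noteq> 0" using n cycle_facts(5) by (intro notI) simp
  then obtain m where m: "n = Suc m" by (cases n) auto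
  then have mL: "m < L" "Suc m mod L = n" using n by auto
  have s: "snd (c ! m) = u @ [i]" using cycle_facts(4)[OF mL(1)] mL(2) n by simp
  have "snd (c ! m) \<notin> visited c m"
  proof
    assume "snd (c ! m) \<in> visited c m"
    then obtain k where "k \<le> m" "fst (c ! k) = u @ [i]" using s by (auto simp: visited_def)
    then show False using least[of k] mL m by simp
  qed
  then have "fst (c ! m) = u" using cycle_facts(6)[OF mL(1)] s by auto
  then have "undirected c m = e" using s ui by (simp add: undirected_def)
  then show "e \<in> undirected c ` {..<L}" using mL by blast
qed (use cycle_facts(3) in auto)

end

text \<open>Whether a step goes to a new vertex can be seen from the coincidences, and the new
  address is then forced: it is the leftmost child not yet visited. So the addresses agree by
  induction on time.\<close>

lemma plane_cycle_unique:
  assumes "(G, c) \<in> plane_cycles L \<gamma>" "(G', c') \<in> plane_cycles L \<gamma>'" "L \<ge> 1"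
    and eq: "\<And>n m. n < L \<Longrightarrow> m < L \<Longrightarrow> fst (c ! n) = fst (c ! m) \<longleftrightarrow> fst (c' ! n) = fst (c' ! m)"
  shows "(G, c) = (G', c')"
proof -
  note A = cycle_facts[OF assms(1,3)] and B = cycle_facts[OF assms(2,3)]
  have fst_eq: "fst (c ! n) = fst (c' ! n)" if "n < L" for n
    using that
  proof (induction n rule: less_induct)
    case (less n)
    show ?case
    proof (cases n)
      case 0
      then show ?thesis using A(5) B(5) by simp
    next
      case (Suc m)
      then have mL: "m < L" "Suc m mod L = n" using less.prems by auto
      have s: "snd (c ! m) = fst (c ! n)" "snd (c' ! m) = fst (c' ! n)" using A(4) B(4) mL by auto
      have vis: "visited c m = visited c' m"
      proof -
        have "fst (c ! k) = fst (c' ! k)" if "k \<le> m" for k using less.IH[of k] that Suc mL by simp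
        then show ?thesis unfolding visited_def by (intro Collect_cong) metis
      qed
      show ?thesis
      proof (cases "fst (c ! n) \<in> visited c m")
        case True
        then obtain k where k: "k \<le> m" "fst (c ! k) = fst (c ! n)" by (auto simp: visited_def)
        then have "fst (c' ! k) = fst (c' ! n)" using eq[of k n] less.prems mL by simp
        moreover have "fst (c ! k) = fst (c' ! k)" using less.IH[of k] k Suc mL by simp
        ultimately show ?thesis using k by simp
      next
        case False
        have False': "fst (c' ! n) \<notin> visited c' m"
        proof
          assume "fst (c' ! n) \<in> visited c' m"
          then obtain k where k: "k \<le> m" "fst (c' ! k) = fst (c' ! n)" by (auto simp: visited_def)
          then have "fst (c ! k) = fst (c ! n)" using eq[of k n] less.prems mL by simp
          then show False using False k by (auto simp: visited_def)
        qed
        obtain i where i: "fst (c ! n) = fst (c ! m) @ [i]" "\<forall>j<i. fst (c ! m) @ [j] \<in> visited c m"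
          using A(6)[OF mL(1)] False s by auto
        obtain i' where i': "fst (c' ! n) = fst (c' ! m) @ [i']" "\<forall>j<i'. fst (c' ! m) @ [j] \<in> visited c' m"
          using B(6)[OF mL(1)] False' s by auto
        have m: "fst (c ! m) = fst (c' ! m)" using less.IH[of m] Suc mL by simp
        \<comment> \<open>If \<open>i < i'\<close>, the child number \<open>i\<close> would already
          have been visited by \<open>c'\<close>, and so by \<open>c\<close>, although it is a new
          vertex of \<open>c\<close>.\<close>
        have "\<not> i < i'" using i i' False False' m vis by auto
        moreover have "\<not> i' < i" using i i' False False' m vis by auto
        ultimately have "i = i'" by simp
        then show ?thesis using i(1) i'(1) m by simp
      qed
    qed
  qed
  have "c = c'"
  proof (rule nth_equalityI)
    show "length c = length c'" using A(2) B(2) by simp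
    fix n assume "n < length c"
    then have n: "n < L" using A(2) by simp
    then have "Suc n mod L < L" using assms(3) by simp
    then have "snd (c ! n) = snd (c' ! n)" using A(4)[OF n] B(4)[OF n] fst_eq by simp
    then show "c ! n = c' ! n" using fst_eq[OF n] by (simp add: prod_eq_iff)
  qed
  moreover have "G = G'"
    unfolding cycle_vertices[OF assms(1,3)] cycle_vertices[OF assms(2,3)] using fst_eq by (intro image_cong) auto
  ultimately show ?thesis by simp
qed

text \<open>By \<open>plane_cycle_unique\<close> a cycle is determined by the coincidences among its
  vertices, which form a relation on \<open>{..<L}\<close>.\<close>

lemma finite_plane_cycles:
  assumes "L \<ge> 1"
  shows "finite (plane_cycles L \<gamma>)"
proof -
  let ?f = "\<lambda>(G, c). {(n, m). n < L \<and> m < L \<and> fst (c ! n) = fst (c ! m)}"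
  have "inj_on ?f (plane_cycles L \<gamma>)"
  proof (rule inj_onI)
    fix x y assume xy: "x \<in> plane_cycles L \<gamma>" "y \<in> plane_cycles L \<gamma>" "?f x = ?f y"
    obtain G c G' c' where [simp]: "x = (G, c)" "y = (G', c')" by (cases x; cases y) blast
    have sets: "{(n, m). n < L \<and> m < L \<and> fst (c ! n) = fst (c ! m)} = {(n, m). n < L \<and> m < L \<and> fst (c' ! n) = fst (c' ! m)}"
      using xy(3) by simp
    have "fst (c ! n) = fst (c ! m) \<longleftrightarrow> fst (c' ! n) = fst (c' ! m)" if "n < L" "m < L" for n m
    proof -
      have "(n, m) \<in> {(n, m). n < L \<and> m < L \<and> fst (c ! n) = fst (c ! m)} \<longleftrightarrow>
        (n, m) \<in> {(n, m). n < L \<and> m < L \<and> fst (c' ! n) = fst (c' ! m)}" by (simp only: sets)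
      then show ?thesis using that by simp
    qed
    then have "(G, c) = (G', c')"
      using xy(1,2) assms by (intro plane_cycle_unique[where \<gamma> = \<gamma> and \<gamma>' = \<gamma>]) auto
    then show "x = y" by simp
  qed
  moreover have "?f ` plane_cycles L \<gamma> \<subseteq> Pow ({..<L} \<times> {..<L})" by auto
  ultimately show ?thesis by (meson finite_Pow_iff finite_SigmaI finite_lessThan finite_subset inj_on_finite)
qed

text \<open>Vertices are numbered in the order of their first visit; \<open>tree_label f n\<close> is the Ulam-Harris
  address of \<open>f n\<close> that this order forces.\<close>

definition new_vertex :: "(nat \<Rightarrow> 'a) \<Rightarrow> nat \<Rightarrow> bool" where
  "new_vertex f n \<longleftrightarrow> (\<forall>m<n. f m \<noteq> f n)"

text \<open>Each earlier step from the vertex \<open>f n\<close> to a new vertex creates one child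
  of it, so the cardinality is the next free child number.\<close>

definition old_children :: "(nat \<Rightarrow> 'a) \<Rightarrow> nat \<Rightarrow> nat set" where
  "old_children f n = {m. m < n \<and> new_vertex f (Suc m) \<and> f m = f n}"

text \<open>The whole list of earlier addresses is carried along because a revisit looks up the
  address given at the first visit.\<close>

primrec tree_labels :: "(nat \<Rightarrow> 'a) \<Rightarrow> nat \<Rightarrow> nat list list" where
  "tree_labels f 0 = [[]]"
| "tree_labels f (Suc n) = tree_labels f n @
     [if new_vertex f (Suc n) then tree_labels f n ! n @ [card (old_children f n)]
      else tree_labels f n ! (LEAST m. f m = f (Suc n))]"

definition tree_label :: "(nat \<Rightarrow> 'a) \<Rightarrow> nat \<Rightarrow> nat list" where
  "tree_label f n = tree_labels f n ! n"

lemma length_tree_labels: "length (tree_labels f n) = Suc n"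
  by (induction n) auto

lemma nth_tree_labels: "m \<le> n \<Longrightarrow> tree_labels f n ! m = tree_label f m"
proof (induction n)
  case (Suc n)
  show ?case
  proof (cases "m = Suc n")
    case False
    then have "m \<le> n" using Suc.prems by simp
    then show ?thesis using Suc.IH length_tree_labels[of f n] by (simp add: nth_append)
  qed (simp add: tree_label_def)
qed (simp add: tree_label_def)

lemma tree_label_0: "tree_label f 0 = []"
  by (simp add: tree_label_def)

lemma tree_label_new:
  "new_vertex f (Suc n) \<Longrightarrow> tree_label f (Suc n) = tree_label f n @ [card (old_children f n)]"
  using length_tree_labels[of f n] by (simp add: tree_label_def nth_append)

lemma tree_label_first: "tree_label f n = tree_label f (LEAST m. f m = f n)"
proof (cases "new_vertex f n")
  case True
  have "(LEAST m. f m = f n) = n"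
    using True by (intro Least_equality) (auto simp: new_vertex_def not_less)
  then show ?thesis by simp
next
  case False
  then obtain k where k: "n = Suc k" by (cases n) (auto simp: new_vertex_def)
  have "\<exists>m<n. f m = f n" using False by (auto simp: new_vertex_def)
  then obtain m where m: "m < n" "f m = f n" by blast
  have "(LEAST m. f m = f n) \<le> m" using m by (intro Least_le)
  then have "(LEAST m. f m = f n) \<le> k" using m k by simp
  then show ?thesis
    using False length_tree_labels[of f k] nth_tree_labels[of "LEAST m. f m = f n" k f]
    unfolding k by (simp add: tree_label_def[of f "Suc k"] nth_append)
qed

lemma tree_label_cong: "f m = f n \<Longrightarrow> tree_label f m = tree_label f n"
  using tree_label_first[of f m] tree_label_first[of f n] by simp

lemma old_children_mono:
  "f m = f n \<Longrightarrow> m < n \<Longrightarrow> new_vertex f (Suc m) \<Longrightarrow> card (old_children f m) < card (old_children f n)"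
proof (rule psubset_card_mono)
  assume a: "f m = f n" "m < n" "new_vertex f (Suc m)"
  then have "m \<in> old_children f n" "m \<notin> old_children f m" by (auto simp: old_children_def)
  moreover have "old_children f m \<subseteq> old_children f n" using a by (auto simp: old_children_def)
  ultimately show "old_children f m \<subset> old_children f n" by blast
qed (simp add: old_children_def)

text \<open>Equal addresses have equal parent addresses and equal child numbers. By induction the
  parents coincide, and below one parent the child numbers increase strictly with time.\<close>

lemma tree_label_inj_less:
  assumes "new_vertex f n" "m < n"
  shows "tree_label f m \<noteq> tree_label f n"
  using assms
proof (induction n arbitrary: m rule: less_induct)
  case (less n)
  obtain n' where n': "n = Suc n'" using less.prems by (cases n) auto
  have ln: "tree_label f n = tree_label f n' @ [card (old_children f n')]"
    using tree_label_new less.prems n' by blast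
  \<comment> \<open>At the first visit of \<open>f m\<close> the address is the root or is built
    from the preceding vertex.\<close>
  define m0 where "m0 = (LEAST i. f i = f m)"
  have m0: "f m0 = f m" "m0 \<le> m" unfolding m0_def by (rule LeastI[of _ m], simp) (rule Least_le, simp)
  have new: "new_vertex f m0"
    unfolding new_vertex_def
  proof (intro allI impI)
    fix i assume "i < m0"
    then show "f i \<noteq> f m0" using not_less_Least[of i "\<lambda>i. f i = f m"] m0 by (simp add: m0_def)
  qed
  have lm: "tree_label f m = tree_label f m0" using tree_label_cong[OF m0(1)] by simp
  show ?case
  proof (cases m0)
    case 0
    then show ?thesis using lm ln tree_label_0[of f] by simp
  next
    case (Suc m')
    have lm': "tree_label f m0 = tree_label f m' @ [card (old_children f m')]"
      using tree_label_new new Suc by blast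
    show ?thesis
    proof
      assume "tree_label f m = tree_label f n"
      then have eq: "tree_label f m' = tree_label f n'" "card (old_children f m') = card (old_children f n')"
        using lm lm' ln by auto
      have m'n': "m' < n'" using m0 Suc less.prems n' by simp
      show False
      proof (cases "f m' = f n'")
        case True
        then show False using old_children_mono[OF True m'n'] new Suc eq by simp
      next
        case False
        define n0 where "n0 = (LEAST i. f i = f n')"
        define m1 where "m1 = (LEAST i. f i = f m')"
        have n0: "f n0 = f n'" "n0 \<le> n'" unfolding n0_def by (rule LeastI[of _ n'], simp) (rule Least_le, simp)
        have m1: "f m1 = f m'" "m1 \<le> m'" unfolding m1_def by (rule LeastI[of _ m'], simp) (rule Least_le, simp)
        have newn: "new_vertex f n0"
          unfolding new_vertex_def
        proof (intro allI impI)
          fix i assume "i < n0"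
          then show "f i \<noteq> f n0" using not_less_Least[of i "\<lambda>i. f i = f n'"] n0 by (simp add: n0_def)
        qed
        have newm: "new_vertex f m1"
          unfolding new_vertex_def
        proof (intro allI impI)
          fix i assume "i < m1"
          then show "f i \<noteq> f m1" using not_less_Least[of i "\<lambda>i. f i = f m'"] m1 by (simp add: m1_def)
        qed
        have ne: "m1 \<noteq> n0" using False m1 n0 by auto
        have leq: "tree_label f m1 = tree_label f n0"
          using eq(1) tree_label_cong[OF m1(1)] tree_label_cong[OF n0(1)] by simp
        have "m1 < n" "n0 < n" using m1 n0 m'n' n' by auto
        then show False
          using less.IH[of n0 m1] less.IH[of m1 n0] newn newm ne leq by (metis nat_neq_iff)
      qed
    qed
  qed
qed

lemma tree_label_inj: "tree_label f m = tree_label f n \<longleftrightarrow> f m = f n"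
proof
  assume eq: "tree_label f m = tree_label f n"
  show "f m = f n"
  proof (rule ccontr)
    assume ne: "f m \<noteq> f n"
    define first where "first n = (LEAST i. f i = f n)" for n
    have first: "f (first n) = f n" for n unfolding first_def by (rule LeastI[of _ n]) simp
    have new: "new_vertex f (first n)" for n
      unfolding new_vertex_def
    proof (intro allI impI)
      fix i assume "i < first n"
      then show "f i \<noteq> f (first n)" using not_less_Least[of i "\<lambda>i. f i = f n"] first[of n] by (simp add: first_def)
    qed
    have "first m \<noteq> first n" using ne first[of m] first[of n] by auto
    moreover have "tree_label f (first m) = tree_label f (first n)"
      using eq tree_label_cong[OF first[of m]] tree_label_cong[OF first[of n]] by simp
    ultimately show False using tree_label_inj_less[OF new, of "first m" n] tree_label_inj_less[OF new, of "first n" m]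
      by (metis nat_neq_iff)
  qed
qed (rule tree_label_cong)

text \<open>Child numbers are handed out without gaps: the latest child of \<open>f n\<close> has
  number \<open>card (old_children f n) - 1\<close>, and removing it leaves the same claim at an
  earlier time.\<close>

lemma old_children_surj:
  "j < card (old_children f n) \<Longrightarrow> \<exists>m<n. new_vertex f (Suc m) \<and> f m = f n \<and> card (old_children f m) = j"
proof (induction n rule: less_induct)
  case (less n)
  have fin: "finite (old_children f n)" by (simp add: old_children_def)
  have ne: "old_children f n \<noteq> {}" using less.prems by auto
  define m where "m = Max (old_children f n)"
  have m: "m \<in> old_children f n" unfolding m_def using fin ne by (rule Max_in)
  have max: "k \<le> m" if "k \<in> old_children f n" for k unfolding m_def using fin that by (rule Max_ge)
  have mn: "m < n" "new_vertex f (Suc m)" "f m = f n" using m by (auto simp: old_children_def)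
  have "old_children f m = old_children f n - {m}"
  proof (intro equalityI subsetI)
    fix k assume "k \<in> old_children f m"
    then show "k \<in> old_children f n - {m}" using mn by (auto simp: old_children_def)
  next
    fix k assume k: "k \<in> old_children f n - {m}"
    then have "k < m" using max[of k] by simp
    then show "k \<in> old_children f m" using k mn by (auto simp: old_children_def)
  qed
  then have card: "card (old_children f m) = card (old_children f n) - 1" using m fin by simp
  show ?case
  proof (cases "j = card (old_children f m)")
    case True
    then show ?thesis using mn by blast
  next
    case False
    then have "j < card (old_children f m)" using card less.prems by simp
    then obtain k where "k < m" "new_vertex f (Suc k)" "f k = f m" "card (old_children f k) = j"
      using less.IH[OF mn(1)] by blast
    then show ?thesis using mn by (intro exI[of _ k]) simp
  qed
qed

text \<open>The steps to new vertices use one edge for each vertex other than the first, and these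
  edges are distinct. By the count hypothesis there are no further edges, so every step runs along
  one of them and the addresses form a plane tree. Each edge being used twice, there are at most
  \<open>L div 2\<close> of them.\<close>

lemma plane_cycle_exists:
  fixes f :: "nat \<Rightarrow> 'a" and \<gamma> :: "nat \<Rightarrow> nat" and L :: nat
  defines "step n \<equiv> {f n, f (Suc n mod L)}"
  assumes L: "L \<ge> 1" and tree: "card (f ` {..<L}) = card (step ` {..<L}) + 1"
    and twice: "\<And>n. n < L \<Longrightarrow> \<exists>m<L. m \<noteq> n \<and> step m = step n"
    and colour: "\<And>n m. n < L \<Longrightarrow> m < L \<Longrightarrow> step n = step m \<Longrightarrow> \<gamma> n = \<gamma> m"
  shows "\<exists>G c. (G, c) \<in> plane_cycles L \<gamma> \<and> (\<forall>n<L. \<forall>m<L. fst (c ! n) = fst (c ! m) \<longleftrightarrow> f n = f m)"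
proof -
  let ?l = "tree_label f"
  define c where "c = map (\<lambda>n. (?l n, ?l (Suc n mod L))) [0..<L]"
  define G where "G = ?l ` {..<L}"
  have c: "fst (c ! n) = ?l n" "snd (c ! n) = ?l (Suc n mod L)" if "n < L" for n
    using that by (auto simp: c_def)
  \<comment> \<open>Only steps before the last one qualify, since the last step returns to
    \<open>f 0\<close>.\<close>
  define News where "News = {n. Suc n < L \<and> new_vertex f (Suc n)}"
  have finN: "finite News" by (rule finite_subset[of _ "{..<L}"]) (auto simp: News_def)
  have modN: "Suc n mod L = Suc n" if "n \<in> News" for n using that by (simp add: News_def)
  have "inj_on step News"
  proof -
    have "step m \<noteq> step n" if "m \<in> News" "n \<in> News" "m < n" for m n
    proof -
      have "f (Suc n) \<noteq> f m" "f (Suc n) \<noteq> f (Suc m)"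
      proof -
        have "\<forall>k<Suc n. f k \<noteq> f (Suc n)" using that(2) by (simp add: News_def new_vertex_def)
        then have "f m \<noteq> f (Suc n)" "f (Suc m) \<noteq> f (Suc n)" using that(3) by simp_all
        then show "f (Suc n) \<noteq> f m" "f (Suc n) \<noteq> f (Suc m)" by auto
      qed
      then show ?thesis unfolding step_def modN[OF that(1)] modN[OF that(2)] by auto
    qed
    then show ?thesis by (intro inj_onI) (metis nat_neq_iff)
  qed
  then have cN: "card (step ` News) = card News" by (rule card_image)
  have "card (f ` {..<L}) = card News + 1"
  proof -
    define first where "first n = (LEAST i. f i = f n)" for n
    have f1: "f (first n) = f n" "first n \<le> n" for n unfolding first_def by (rule LeastI[of _ n], simp) (rule Least_le, simp)
    have new: "new_vertex f (first n)" for n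
      unfolding new_vertex_def
    proof (intro allI impI)
      fix i assume "i < first n"
      then show "f i \<noteq> f (first n)" using not_less_Least[of i "\<lambda>i. f i = f n"] f1[of n] by (simp add: first_def)
    qed
    have img: "f ` {..<L} = f ` (insert 0 (Suc ` News))"
    proof (intro equalityI subsetI)
      fix x assume "x \<in> f ` {..<L}"
      then obtain n where n: "n < L" "x = f n" by auto
      have "first n \<in> insert 0 (Suc ` News)"
      proof (cases "first n")
        case (Suc k)
        then have "k \<in> News" using new[of n] f1(2)[of n] n by (simp add: News_def)
        then show ?thesis using Suc by simp
      qed simp
      then show "x \<in> f ` (insert 0 (Suc ` News))" using n f1(1)[of n] by (metis image_eqI)
    next
      fix x assume "x \<in> f ` (insert 0 (Suc ` News))"
      then show "x \<in> f ` {..<L}" using L by (auto simp: News_def)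
    qed
    have "inj_on f (insert 0 (Suc ` News))"
    proof -
      have "f a \<noteq> f b" if "a \<in> insert 0 (Suc ` News)" "b \<in> insert 0 (Suc ` News)" "a < b" for a b
        using that by (auto simp: News_def new_vertex_def)
      then show ?thesis by (intro inj_onI) (metis nat_neq_iff)
    qed
    then have "card (f ` (insert 0 (Suc ` News))) = card (insert 0 (Suc ` News))" by (rule card_image)
    also have "\<dots> = card News + 1" using finN by (simp add: card_image)
    finally show ?thesis using img by simp
  qed
  then have "card (step ` News) = card (step ` {..<L})" using tree cN by simp
  moreover have "step ` News \<subseteq> step ` {..<L}" by (auto simp: News_def)
  \<comment> \<open>Every step has the same two ends as some step to a new vertex.\<close>
  ultimately have all: "step ` News = step ` {..<L}" by (intro card_subset_eq) auto
  have edges: "undirected c n \<in> tree_edges G" if n: "n < L" for n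
  proof -
    obtain m where m: "m \<in> News" "step n = step m" using all n by (metis image_iff lessThan_iff)
    have mL: "Suc m < L" "new_vertex f (Suc m)" using m by (auto simp: News_def)
    have "{f n, f (Suc n mod L)} = {f m, f (Suc m)}" using m(2) mL(1) by (simp add: step_def)
    then have "{?l n, ?l (Suc n mod L)} = {?l m, ?l (Suc m)}"
      unfolding doubleton_eq_iff by (metis tree_label_cong)
    also have "\<dots> = {?l m, ?l m @ [card (old_children f m)]}" using tree_label_new[OF mL(2)] by simp
    finally have "undirected c n = {?l m, ?l m @ [card (old_children f m)]}" using c[OF n] by (simp add: undirected_def)
    moreover have "?l m @ [card (old_children f m)] \<in> G"
      using mL tree_label_new[OF mL(2)] unfolding G_def by (metis imageI lessThan_iff)
    ultimately show ?thesis unfolding tree_edges_def by blast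
  qed
  have und: "undirected c n = undirected c m \<longleftrightarrow> step n = step m" if "n < L" "m < L" for n m
    using that c unfolding undirected_def step_def doubleton_eq_iff by (simp add: tree_label_inj)
  have vis: "visited c n = ?l ` {..n}" if "n < L" for n
  proof -
    have "visited c n = (\<lambda>m. fst (c ! m)) ` {..n}" by (auto simp: visited_def)
    also have "\<dots> = ?l ` {..n}" using c that by (intro image_cong) auto
    finally show ?thesis .
  qed
  have pt: "plane_tree G"
    unfolding plane_tree_def
  proof (intro conjI allI impI)
    show "finite G" by (simp add: G_def)
    show "[] \<in> G" using tree_label_0[of f] L unfolding G_def by (metis One_nat_def Suc_le_eq imageI lessThan_iff)
    fix u i assume "u @ [i] \<in> G"
    then obtain n where n: "n < L" "u @ [i] = ?l n" by (auto simp: G_def)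
    define n0 where "n0 = (LEAST k. f k = f n)"
    have n0: "f n0 = f n" "n0 \<le> n" unfolding n0_def by (rule LeastI[of _ n], simp) (rule Least_le, simp)
    have newn: "new_vertex f n0"
      unfolding new_vertex_def
    proof (intro allI impI)
      fix i assume "i < n0"
      then show "f i \<noteq> f n0" using not_less_Least[of i "\<lambda>i. f i = f n"] n0 by (simp add: n0_def)
    qed
    have ln: "?l n0 = u @ [i]" using tree_label_cong[OF n0(1)] n by simp
    then obtain k where k: "n0 = Suc k" using tree_label_0[of f] by (cases n0) auto
    then have "?l k @ [card (old_children f k)] = u @ [i]" using tree_label_new[of f k] newn ln by simp
    then have ui: "u = ?l k" "i = card (old_children f k)" by auto
    have kL: "k < L" using k n0 n by simp
    then show "u \<in> G" using ui by (simp add: G_def)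
    fix j assume "j < i"
    then obtain m where m: "m < k" "new_vertex f (Suc m)" "f m = f k" "card (old_children f m) = j"
      using old_children_surj[of j f k] ui by blast
    then have "?l (Suc m) = u @ [j]" using tree_label_new[OF m(2)] tree_label_cong[OF m(3)] ui by simp
    moreover have "Suc m < L" using m kL by simp
    ultimately show "u @ [j] \<in> G" unfolding G_def by (metis imageI lessThan_iff)
  qed
  have left: "\<exists>i. snd (c ! n) = fst (c ! n) @ [i] \<and> (\<forall>j<i. fst (c ! n) @ [j] \<in> visited c n)"
    if n: "n < L" and nv: "snd (c ! n) \<notin> visited c n" for n
  proof -
    \<comment> \<open>The last step leads back to the root, which has been visited.\<close>
    have "Suc n \<noteq> L"
    proof
      assume "Suc n = L"
      then have "snd (c ! n) = ?l 0" using c[OF n] by simp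
      moreover have "?l 0 \<in> visited c n" unfolding vis[OF n] by (rule imageI) simp
      ultimately show False using nv by simp
    qed
    then have mod: "Suc n mod L = Suc n" using n by simp
    have new: "new_vertex f (Suc n)"
      unfolding new_vertex_def
    proof (intro allI impI notI)
      fix m assume "m < Suc n" "f m = f (Suc n)"
      have "?l m = ?l (Suc n)" by (rule tree_label_cong) fact
      then have "?l m = snd (c ! n)" using c(2)[OF n] mod by simp
      moreover have "?l m \<in> visited c n" unfolding vis[OF n] by (rule imageI) (use \<open>m < Suc n\<close> in simp)
      ultimately show False using nv by simp
    qed
    have "\<forall>j<card (old_children f n). ?l n @ [j] \<in> ?l ` {..n}"
    proof (intro allI impI)
      fix j assume "j < card (old_children f n)"
      then obtain m where m: "m < n" "new_vertex f (Suc m)" "f m = f n" "card (old_children f m) = j"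
        using old_children_surj by blast
      then have "?l (Suc m) = ?l n @ [j]" using tree_label_new[OF m(2)] tree_label_cong[OF m(3)] by simp
      moreover have "?l (Suc m) \<in> ?l ` {..n}" by (rule imageI) (use m(1) in simp)
      ultimately show "?l n @ [j] \<in> ?l ` {..n}" by simp
    qed
    then show ?thesis using c[OF n] tree_label_new[OF new] mod vis[OF n] by simp
  qed
  have half: "card (tree_edges G) \<le> L div 2"
  proof -
    have "card G = card (f ` {..<L})"
    proof -
      define g where "g x = ?l (SOME n. n < L \<and> f n = x)" for x
      have g: "g (f n) = ?l n" if "n < L" for n
      proof -
        have "(SOME m. m < L \<and> f m = f n) < L \<and> f (SOME m. m < L \<and> f m = f n) = f n"
          by (rule someI[of _ n]) (use that in simp)
        then show ?thesis unfolding g_def using tree_label_cong by metis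
      qed
      have "G = g ` (f ` {..<L})" unfolding G_def image_image using g by (intro image_cong) auto
      moreover have "inj_on g (f ` {..<L})"
      proof (rule inj_onI)
        fix x y assume "x \<in> f ` {..<L}" "y \<in> f ` {..<L}" "g x = g y"
        then obtain n m where "n < L" "m < L" "x = f n" "y = f m" "?l n = ?l m" using g by auto
        then show "x = y" using tree_label_inj by metis
      qed
      ultimately show ?thesis by (simp add: card_image)
    qed
    then have e: "card (tree_edges G) = card (step ` {..<L})" using tree card_tree_edges[OF pt] by simp
    have "card {m \<in> {..<L}. step m = s} \<ge> 2" if s: "s \<in> step ` {..<L}" for s
    proof -
      obtain n where n: "n < L" "s = step n" using s by auto
      obtain m where m: "m < L" "m \<noteq> n" "step m = step n" using twice[OF n(1)] by blast
      have "{n, m} \<subseteq> {m \<in> {..<L}. step m = s}" using n m by auto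
      then have "card {n, m} \<le> card {m \<in> {..<L}. step m = s}" by (intro card_mono) auto
      then show ?thesis using m(2) by simp
    qed
    then have "(\<Sum>s\<in>step ` {..<L}. 2) \<le> (\<Sum>s\<in>step ` {..<L}. card {m \<in> {..<L}. step m = s})"
      by (rule sum_mono)
    also have "\<dots> = card {..<L}"
      using sum.image_gen[of "{..<L}" "\<lambda>_. 1 :: nat" step] by simp
    finally show ?thesis using e by simp
  qed
  have "(G, c) \<in> plane_cycles L \<gamma>"
    unfolding plane_cycles_def mem_Collect_eq case_prod_conv
  proof (intro conjI allI impI ballI)
    show "length c = L" by (simp add: c_def)
    show "snd (c ! n) = fst (c ! (Suc n mod L))" if "n < L" for n using c that L by simp
    show "fst (c ! 0) = []" using c(1)[of 0] L tree_label_0 by simp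
    show "\<exists>n<L. fst (c ! n) = v" if "v \<in> G" for v using that c by (auto simp: G_def)
    show "\<gamma> n = \<gamma> m" if "n < L" "m < L" "undirected c n = undirected c m" for n m
      using colour[OF that(1,2)] und[OF that(1,2)] that(3) by simp
  qed (use pt half edges left in auto)
  moreover have "\<forall>n<L. \<forall>m<L. fst (c ! n) = fst (c ! m) \<longleftrightarrow> f n = f m"
    using c tree_label_inj by metis
  ultimately show ?thesis by blast
qed

section \<open>Expansion of words into walks\<close>

lemma sum_PiE_insert:
  assumes "x \<notin> A"
  shows "(\<Sum>\<theta>\<in>Pi\<^sub>E (insert x A) T. f \<theta>) = (\<Sum>y\<in>T x. \<Sum>\<theta>\<in>Pi\<^sub>E A T. f (\<theta>(x := y)))"
proof -
  have "inj_on (\<lambda>(y, \<theta>). \<theta>(x := y)) (T x \<times> Pi\<^sub>E A T)" by (rule inj_combinator[OF assms])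
  from sum.reindex[OF this, of f]
  have "(\<Sum>\<theta>\<in>Pi\<^sub>E (insert x A) T. f \<theta>) = (\<Sum>(y, \<theta>)\<in>T x \<times> Pi\<^sub>E A T. f (\<theta>(x := y)))"
    by (simp only: PiE_insert_eq comp_def case_prod_unfold)
  then show ?thesis by (rule trans[OF _ sum.cartesian_product[symmetric]])
qed

lemma sum_PiE_Un:
  assumes "D \<inter> E = {}"
  shows "(\<Sum>\<phi>\<in>D \<union> E \<rightarrow>\<^sub>E T. f \<phi>) = (\<Sum>\<phi>\<in>D \<rightarrow>\<^sub>E T. \<Sum>\<theta>\<in>E \<rightarrow>\<^sub>E T. f (override_on \<phi> \<theta> E))"
proof -
  have "(\<Sum>\<phi>\<in>D \<union> E \<rightarrow>\<^sub>E T. f \<phi>) = (\<Sum>(\<phi>, \<theta>)\<in>(D \<rightarrow>\<^sub>E T) \<times> (E \<rightarrow>\<^sub>E T). f (override_on \<phi> \<theta> E))"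
  proof (rule sum.reindex_bij_witness[where j = "\<lambda>\<phi>. (restrict \<phi> D, restrict \<phi> E)"
        and i = "\<lambda>(\<phi>, \<theta>). override_on \<phi> \<theta> E"], goal_cases)
    case (1 \<phi>)
    then have "override_on (restrict \<phi> D) (restrict \<phi> E) E k = \<phi> k" for k
      using PiE_arb[OF 1, of k] by (cases "k \<in> D"; cases "k \<in> E") (simp_all add: override_on_def)
    then have "override_on (restrict \<phi> D) (restrict \<phi> E) E = \<phi>" by (rule ext)
    then show ?case by (simp only: prod.case)
  next
    case (2 \<phi>)
    then show ?case by auto
  next
    case (3 z)
    then obtain \<phi> \<theta> where z: "z = (\<phi>, \<theta>)" "\<phi> \<in> D \<rightarrow>\<^sub>E T" "\<theta> \<in> E \<rightarrow>\<^sub>E T" by blast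
    have "restrict (override_on \<phi> \<theta> E) D k = \<phi> k" for k
      using assms PiE_arb[OF z(2), of k] by (cases "k \<in> D") (auto simp: override_on_def)
    moreover have "restrict (override_on \<phi> \<theta> E) E k = \<theta> k" for k
      using PiE_arb[OF z(3), of k] by (cases "k \<in> E") (auto simp: override_on_def)
    ultimately show ?case using z(1) by (simp add: fun_eq_iff)
  next
    case (4 z)
    then show ?case using assms by (auto simp: override_on_def PiE_def extensional_def Pi_def)
  next
    case (5 \<phi>)
    then have "override_on (restrict \<phi> D) (restrict \<phi> E) E k = \<phi> k" for k
      using PiE_arb[OF 5, of k] by (cases "k \<in> D"; cases "k \<in> E") (simp_all add: override_on_def)
    then have "override_on (restrict \<phi> D) (restrict \<phi> E) E = \<phi>" by (rule ext)
    then show ?case by (simp only: prod.case)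
  qed
  then show ?thesis by (rule trans[OF _ sum.cartesian_product[symmetric]])
qed

text \<open>Each factor \<open>W n\<close> is a sum over private inner variables in
  \<open>I n\<close>. These sets are disjoint from \<open>D\<close> and from each other, so all
  inner sums merge with the outer one; the induction adds one block at a time.\<close>

lemma sum_expand:
  fixes F :: "('a \<Rightarrow> 'b) \<Rightarrow> 'c :: comm_semiring_1"
  assumes "finite A" and D: "\<And>n. n \<in> A \<Longrightarrow> D \<inter> I n = {}"
    and I: "\<And>n m. n \<in> A \<Longrightarrow> m \<in> A \<Longrightarrow> n \<noteq> m \<Longrightarrow> I n \<inter> I m = {}"
    and F: "\<And>\<phi> \<phi>'. (\<And>k. k \<in> D \<Longrightarrow> \<phi> k = \<phi>' k) \<Longrightarrow> F \<phi> = F \<phi>'"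
    and W: "\<And>n \<phi> \<phi>'. n \<in> A \<Longrightarrow> (\<And>k. k \<in> D \<Longrightarrow> \<phi> k = \<phi>' k) \<Longrightarrow> W n \<phi> = W n \<phi>'"
    and H: "\<And>n \<phi> \<phi>'. n \<in> A \<Longrightarrow> (\<And>k. k \<in> D \<union> I n \<Longrightarrow> \<phi> k = \<phi>' k) \<Longrightarrow> H n \<phi> = H n \<phi>'"
    and WH: "\<And>n \<phi>. n \<in> A \<Longrightarrow> (\<And>k. k \<in> D \<Longrightarrow> \<phi> k \<in> T) \<Longrightarrow>
      W n \<phi> = (\<Sum>\<theta>\<in>I n \<rightarrow>\<^sub>E T. H n (override_on \<phi> \<theta> (I n)))"
  shows "(\<Sum>\<phi>\<in>D \<rightarrow>\<^sub>E T. F \<phi> * (\<Prod>n\<in>A. W n \<phi>)) = (\<Sum>\<phi>\<in>D \<union> (\<Union>n\<in>A. I n) \<rightarrow>\<^sub>E T. F \<phi> * (\<Prod>n\<in>A. H n \<phi>))"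
  using assms
proof (induction A arbitrary: F rule: finite_induct)
  case empty
  show ?case by (simp only: UN_empty Un_empty_right prod.empty)
next
  case (insert a A)
  let ?U = "D \<union> (\<Union>n\<in>A. I n)"
  have disj: "?U \<inter> I a = {}" using insert.prems(1,2) insert.hyps(2) by blast
  have "(\<Sum>\<phi>\<in>D \<rightarrow>\<^sub>E T. F \<phi> * (\<Prod>n\<in>insert a A. W n \<phi>)) = (\<Sum>\<phi>\<in>D \<rightarrow>\<^sub>E T. (F \<phi> * W a \<phi>) * (\<Prod>n\<in>A. W n \<phi>))"
    using insert.hyps by (simp add: mult.assoc)
  also have "\<dots> = (\<Sum>\<phi>\<in>?U \<rightarrow>\<^sub>E T. (F \<phi> * W a \<phi>) * (\<Prod>n\<in>A. H n \<phi>))"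
  proof (rule insert.IH)
    fix \<phi> \<phi>' :: "'a \<Rightarrow> 'b" assume e: "\<And>k. k \<in> D \<Longrightarrow> \<phi> k = \<phi>' k"
    show "F \<phi> * W a \<phi> = F \<phi>' * W a \<phi>'"
      using insert.prems(3)[of \<phi> \<phi>'] insert.prems(4)[of a \<phi> \<phi>'] e by simp
  next
    fix n assume n: "n \<in> A"
    show "D \<inter> I n = {}" by (rule insert.prems(1)[OF insertI2[OF n]])
    show "I n \<inter> I m = {}" if "m \<in> A" "n \<noteq> m" for m
      by (rule insert.prems(2)[OF insertI2[OF n] insertI2[OF that(1)] that(2)])
    show "W n \<phi> = W n \<phi>'" if "\<And>k. k \<in> D \<Longrightarrow> \<phi> k = \<phi>' k" for \<phi> \<phi>'
      by (rule insert.prems(4)[OF insertI2[OF n] that])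
    show "H n \<phi> = H n \<phi>'" if "\<And>k. k \<in> D \<union> I n \<Longrightarrow> \<phi> k = \<phi>' k" for \<phi> \<phi>'
      by (rule insert.prems(5)[OF insertI2[OF n] that])
    show "W n \<phi> = (\<Sum>\<theta>\<in>I n \<rightarrow>\<^sub>E T. H n (override_on \<phi> \<theta> (I n)))" if "\<And>k. k \<in> D \<Longrightarrow> \<phi> k \<in> T" for \<phi>
      by (rule insert.prems(6)[OF insertI2[OF n] that])
  qed
  also have "\<dots> = (\<Sum>\<phi>\<in>?U \<rightarrow>\<^sub>E T. \<Sum>\<theta>\<in>I a \<rightarrow>\<^sub>E T.
      F (override_on \<phi> \<theta> (I a)) * (\<Prod>n\<in>insert a A. H n (override_on \<phi> \<theta> (I a))))"
  proof (rule sum.cong[OF refl])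
    fix \<phi> assume \<phi>: "\<phi> \<in> ?U \<rightarrow>\<^sub>E T"
    have ov: "override_on \<phi> \<theta> (I a) k = \<phi> k" if "k \<in> ?U" for \<theta> k
      using that disj by (auto simp: override_on_def)
    have "F (override_on \<phi> \<theta> (I a)) = F \<phi>" for \<theta>
      by (rule insert.prems(3)) (rule ov, blast)
    moreover have "H n (override_on \<phi> \<theta> (I a)) = H n \<phi>" if n: "n \<in> A" for \<theta> n
      by (rule insert.prems(5)[OF insertI2[OF n]], rule ov) (use n in blast)
    ultimately have "F (override_on \<phi> \<theta> (I a)) * (\<Prod>n\<in>insert a A. H n (override_on \<phi> \<theta> (I a))) =
        F \<phi> * (\<Prod>n\<in>A. H n \<phi>) * H a (override_on \<phi> \<theta> (I a))" for \<theta>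
      using insert.hyps by (simp add: mult_ac)
    moreover have "W a \<phi> = (\<Sum>\<theta>\<in>I a \<rightarrow>\<^sub>E T. H a (override_on \<phi> \<theta> (I a)))"
      by (rule insert.prems(6)) (use \<phi> in auto)
    ultimately show "(F \<phi> * W a \<phi>) * (\<Prod>n\<in>A. H n \<phi>) = (\<Sum>\<theta>\<in>I a \<rightarrow>\<^sub>E T.
      F (override_on \<phi> \<theta> (I a)) * (\<Prod>n\<in>insert a A. H n (override_on \<phi> \<theta> (I a))))"
      by (simp add: sum_distrib_left mult_ac)
  qed
  also have "\<dots> = (\<Sum>\<phi>\<in>?U \<union> I a \<rightarrow>\<^sub>E T. F \<phi> * (\<Prod>n\<in>insert a A. H n \<phi>))"
    by (rule sum_PiE_Un[OF disj, symmetric])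
  also have "?U \<union> I a = D \<union> (\<Union>n\<in>insert a A. I n)" by auto
  finally show ?case .
qed

section \<open>Products of matrices as sums over paths\<close>

fun mat_prod :: "nat \<Rightarrow> (nat \<Rightarrow> complex mat) \<Rightarrow> nat \<Rightarrow> complex mat" where
  "mat_prod N B 0 = 1\<^sub>m N"
| "mat_prod N B (Suc m) = mat_prod N B m * B m"

lemma mat_prod_carrier: "(\<And>i. i < m \<Longrightarrow> B i \<in> carrier_mat N N) \<Longrightarrow> mat_prod N B m \<in> carrier_mat N N"
  by (induction m) auto

lemma mat_prod_cong: "(\<And>i. i < m \<Longrightarrow> B i = B' i) \<Longrightarrow> mat_prod N B m = mat_prod N B' m"
  by (induction m) auto

text \<open>Converts the right-nested products of \<open>word_mat\<close> into left-nested ones,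
  which suit the path expansion.\<close>

lemma foldr_mat_prod:
  assumes "\<And>l. l \<in> set ls \<Longrightarrow> f l \<in> carrier_mat N N" "C \<in> carrier_mat N N"
  shows "foldr (\<lambda>l B. f l * B) ls C = mat_prod N (\<lambda>i. f (ls ! i)) (length ls) * C"
  using assms
proof (induction ls arbitrary: C rule: rev_induct)
  case Nil
  then show ?case by simp
next
  case (snoc x xs)
  have x: "f x \<in> carrier_mat N N" using snoc.prems by simp
  have P: "mat_prod N (\<lambda>i. f (xs ! i)) (length xs) \<in> carrier_mat N N"
    by (rule mat_prod_carrier) (use snoc.prems in auto)
  have "mat_prod N (\<lambda>i. f ((xs @ [x]) ! i)) (length xs) = mat_prod N (\<lambda>i. f (xs ! i)) (length xs)"
    by (rule mat_prod_cong) (simp add: nth_append)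
  moreover have "foldr (\<lambda>l B. f l * B) xs (f x * C) = mat_prod N (\<lambda>i. f (xs ! i)) (length xs) * (f x * C)"
    by (rule snoc.IH) (use snoc.prems(1) mult_carrier_mat[OF x snoc.prems(2)] in \<open>simp_all del: mult_carrier_mat\<close>)
  ultimately show ?case using snoc.prems(2) x P by (simp add: assoc_mult_mat)
qed

lemma letter_mat_carrier:
  "(\<And>v. v \<in> set_star_letter l \<Longrightarrow> A v \<in> carrier_mat N N) \<Longrightarrow> letter_mat A l \<in> carrier_mat N N"
  by (cases l) (auto simp: mat_adjoint_def)

lemma word_mat_prod:
  assumes "\<And>l v. l \<in> set (letters w) \<Longrightarrow> v \<in> set_star_letter l \<Longrightarrow> A v \<in> carrier_mat N N"
  shows "word_mat N A w = mat_prod N (\<lambda>i. letter_mat A (letters w ! i)) (length (letters w))"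
proof -
  have l: "letter_mat A l \<in> carrier_mat N N" if "l \<in> set (letters w)" for l
    using assms that by (intro letter_mat_carrier) auto
  have "mat_prod N (\<lambda>i. letter_mat A (letters w ! i)) (length (letters w)) \<in> carrier_mat N N"
    by (rule mat_prod_carrier) (use l in auto)
  then show ?thesis using foldr_mat_prod[of "letters w" "letter_mat A" N "1\<^sub>m N"] l
    by (simp add: word_mat_def)
qed

lemma mat_mult_index:
  assumes "A \<in> carrier_mat N N" "B \<in> carrier_mat N N" "i < N" "j < N"
  shows "(A * B) $$ (i, j) = (\<Sum>k<N. A $$ (i, k) * (B $$ (k, j) :: complex))"
  using assms by (simp add: scalar_prod_def atLeast0LessThan)

text \<open>The end point \<open>p m\<close> is a summation variable too, tied to \<open>b\<close>
  by an indicator. The indicator is the identity arc that closes a word, and with it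
  \<open>m = 0\<close> is no exception.\<close>

lemma mat_prod_path:
  assumes B: "\<And>i. i < m \<Longrightarrow> B i \<in> carrier_mat N N" and p: "inj_on p {0..m}" and ab: "a < N" "b < N"
  shows "mat_prod N B m $$ (a, b) = (\<Sum>\<theta>\<in>p ` {1..m} \<rightarrow>\<^sub>E {..<N}.
    (\<Prod>i<m. B i $$ ((\<theta>(p 0 := a)) (p i), (\<theta>(p 0 := a)) (p (Suc i)))) * of_bool ((\<theta>(p 0 := a)) (p m) = b))"
  using B p ab(2)
proof (induction m arbitrary: b)
  case 0
  then show ?case using ab by simp
next
  case (Suc m)
  let ?A = "p ` {1..m}"
  let ?f = "\<lambda>\<theta>. \<Prod>i<m. B i $$ ((\<theta>(p 0 := a)) (p i), (\<theta>(p 0 := a)) (p (Suc i)))"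
  have inj: "inj_on p {0..m}" using Suc.prems(2) by (rule inj_on_subset) auto
  have new: "p (Suc m) \<noteq> p i" if "i \<le> m" for i
    using inj_onD[OF Suc.prems(2), of "Suc m" i] that by auto
  have notin: "p (Suc m) \<notin> ?A"
  proof
    assume "p (Suc m) \<in> ?A"
    then obtain i where i: "i \<le> m" "p (Suc m) = p i" by auto
    from new[OF i(1)] i(2) show False by (rule notE)
  qed
  have ins: "p ` {1..Suc m} = insert (p (Suc m)) ?A" by (auto simp: atLeastAtMostSuc_conv)
  have C: "mat_prod N B m \<in> carrier_mat N N" "B m \<in> carrier_mat N N"
    using Suc.prems(1) by (auto intro: mat_prod_carrier)
  have IH: "mat_prod N B m $$ (a, k) = (\<Sum>\<theta>\<in>?A \<rightarrow>\<^sub>E {..<N}. ?f \<theta> * of_bool ((\<theta>(p 0 := a)) (p m) = k))" if "k < N" for k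
    by (rule Suc.IH) (use Suc.prems inj that in auto)
  have lt: "(\<theta>(p 0 := a)) (p m) < N" if "\<theta> \<in> ?A \<rightarrow>\<^sub>E {..<N}" for \<theta>
    using that ab(1) by (cases "m = 0") auto
  have "mat_prod N B (Suc m) $$ (a, b) = (\<Sum>k<N. mat_prod N B m $$ (a, k) * B m $$ (k, b))"
    using mat_mult_index[OF C ab(1) Suc.prems(3)] by simp
  also have "\<dots> = (\<Sum>k<N. \<Sum>\<theta>\<in>?A \<rightarrow>\<^sub>E {..<N}. ?f \<theta> * (of_bool ((\<theta>(p 0 := a)) (p m) = k) * B m $$ (k, b)))"
    by (intro sum.cong refl) (simp only: IH lessThan_iff sum_distrib_right mult.assoc)
  also have "\<dots> = (\<Sum>\<theta>\<in>?A \<rightarrow>\<^sub>E {..<N}. \<Sum>k<N. ?f \<theta> * (of_bool ((\<theta>(p 0 := a)) (p m) = k) * B m $$ (k, b)))"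
    by (rule sum.swap)
  also have "\<dots> = (\<Sum>\<theta>\<in>?A \<rightarrow>\<^sub>E {..<N}. ?f \<theta> * B m $$ ((\<theta>(p 0 := a)) (p m), b))"
    using lt by (intro sum.cong refl) (simp add: of_bool_def if_distrib[of "\<lambda>x. x * _"] sum.delta
        flip: sum_distrib_left cong: if_cong)
  also have "\<dots> = (\<Sum>\<theta>\<in>?A \<rightarrow>\<^sub>E {..<N}. \<Sum>y<N. ?f \<theta> * B m $$ ((\<theta>(p 0 := a)) (p m), y) * of_bool (y = b))"
    using Suc.prems(3) by (intro sum.cong refl) (simp add: of_bool_def if_distrib[of "\<lambda>x. _ * x"] sum.delta cong: if_cong)
  also have "\<dots> = (\<Sum>y<N. \<Sum>\<theta>\<in>?A \<rightarrow>\<^sub>E {..<N}. ?f \<theta> * B m $$ ((\<theta>(p 0 := a)) (p m), y) * of_bool (y = b))"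
    by (rule sum.swap)
  also have "\<dots> = (\<Sum>\<theta>\<in>p ` {1..Suc m} \<rightarrow>\<^sub>E {..<N}.
    (\<Prod>i<Suc m. B i $$ ((\<theta>(p 0 := a)) (p i), (\<theta>(p 0 := a)) (p (Suc i)))) * of_bool ((\<theta>(p 0 := a)) (p (Suc m)) = b))"
    unfolding ins sum_PiE_insert[OF notin]
  proof (intro sum.cong refl)
    fix y \<theta>
    have e: "((\<theta>(p (Suc m) := y))(p 0 := a)) (p i) = (\<theta>(p 0 := a)) (p i)" if "i \<le> m" for i
      using new[OF that] by (simp add: fun_upd_def) 
    have y: "((\<theta>(p (Suc m) := y))(p 0 := a)) (p (Suc m)) = y" using new[of 0] by simp
    have f: "(\<Prod>i<m. B i $$ (((\<theta>(p (Suc m) := y))(p 0 := a)) (p i), ((\<theta>(p (Suc m) := y))(p 0 := a)) (p (Suc i)))) = ?f \<theta>"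
      by (intro prod.cong refl) (simp only: lessThan_iff e less_imp_le Suc_leI)
    show "?f \<theta> * B m $$ ((\<theta>(p 0 := a)) (p m), y) * of_bool (y = b) =
      (\<Prod>i<Suc m. B i $$ (((\<theta>(p (Suc m) := y))(p 0 := a)) (p i), ((\<theta>(p (Suc m) := y))(p 0 := a)) (p (Suc i)))) *
      of_bool (((\<theta>(p (Suc m) := y))(p 0 := a)) (p (Suc m)) = b)"
      unfolding prod.lessThan_Suc f y e[OF order_refl] ..
  qed
  finally show ?case .
qed

text \<open>In the cyclic version the last factor leads back to \<open>p 0\<close>, so every
  position carries one free index and no indicator is left.\<close>

lemma mat_prod_trace:
  assumes B: "\<And>i. i < K \<Longrightarrow> B i \<in> carrier_mat N N" and p: "inj_on p {..<K}" and K: "K \<ge> 1"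
  shows "(\<Sum>a<N. mat_prod N B K $$ (a, a)) =
    (\<Sum>\<theta>\<in>p ` {..<K} \<rightarrow>\<^sub>E {..<N}. \<Prod>i<K. B i $$ (\<theta> (p i), \<theta> (p (Suc i mod K))))"
proof -
  obtain m where m: "K = Suc m" using K by (cases K) auto
  let ?A = "p ` {1..m}"
  let ?f = "\<lambda>\<theta>. \<Prod>i<m. B i $$ (\<theta> (p i), \<theta> (p (Suc i)))"
  have inj: "inj_on p {0..m}" using p unfolding m by (rule inj_on_subset) auto
  have C: "mat_prod N B m \<in> carrier_mat N N" "B m \<in> carrier_mat N N"
    using B by (auto simp: m intro: mat_prod_carrier)
  have notin: "p 0 \<notin> ?A"
  proof
    assume "p 0 \<in> ?A"
    then obtain i where i: "1 \<le> i" "i \<le> m" "p 0 = p i" by auto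
    then show False using inj_onD[OF inj i(3)] by auto
  qed
  have "{..<K} = insert 0 {1..m}" unfolding m by auto
  then have ins: "p ` {..<K} = insert (p 0) ?A" by (simp only: image_insert)
  have *: "mat_prod N B K $$ (a, a) =
     (\<Sum>\<theta>\<in>?A \<rightarrow>\<^sub>E {..<N}. \<Prod>i<K. B i $$ ((\<theta>(p 0 := a)) (p i), (\<theta>(p 0 := a)) (p (Suc i mod K))))" if a: "a < N" for a
  proof -
    have lt: "(\<theta>(p 0 := a)) (p m) < N" if "\<theta> \<in> ?A \<rightarrow>\<^sub>E {..<N}" for \<theta>
      using that a by (cases "m = 0") auto
    have "mat_prod N B K $$ (a, a) = (\<Sum>k<N. mat_prod N B m $$ (a, k) * B m $$ (k, a))"
      using mat_mult_index[OF C a a] m by simp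
    also have "\<dots> = (\<Sum>k<N. \<Sum>\<theta>\<in>?A \<rightarrow>\<^sub>E {..<N}. ?f (\<theta>(p 0 := a)) * (of_bool ((\<theta>(p 0 := a)) (p m) = k) * B m $$ (k, a)))"
    proof (intro sum.cong refl)
      fix k assume "k \<in> {..<N}"
      then show "mat_prod N B m $$ (a, k) * B m $$ (k, a) =
        (\<Sum>\<theta>\<in>?A \<rightarrow>\<^sub>E {..<N}. ?f (\<theta>(p 0 := a)) * (of_bool ((\<theta>(p 0 := a)) (p m) = k) * B m $$ (k, a)))"
        using mat_prod_path[of m B N p a k] B inj a m by (simp only: lessThan_iff sum_distrib_right mult.assoc less_SucI)
    qed
    also have "\<dots> = (\<Sum>\<theta>\<in>?A \<rightarrow>\<^sub>E {..<N}. \<Sum>k<N. ?f (\<theta>(p 0 := a)) * (of_bool ((\<theta>(p 0 := a)) (p m) = k) * B m $$ (k, a)))"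
      by (rule sum.swap)
    also have "\<dots> = (\<Sum>\<theta>\<in>?A \<rightarrow>\<^sub>E {..<N}. ?f (\<theta>(p 0 := a)) * B m $$ ((\<theta>(p 0 := a)) (p m), a))"
      using lt by (intro sum.cong refl) (simp add: of_bool_def if_distrib[of "\<lambda>x. x * _"] sum.delta
          flip: sum_distrib_left cong: if_cong)
    also have "\<dots> = (\<Sum>\<theta>\<in>?A \<rightarrow>\<^sub>E {..<N}. \<Prod>i<K. B i $$ ((\<theta>(p 0 := a)) (p i), (\<theta>(p 0 := a)) (p (Suc i mod K))))"
    proof (intro sum.cong refl)
      fix \<theta>
      have "(\<Prod>i<m. B i $$ ((\<theta>(p 0 := a)) (p i), (\<theta>(p 0 := a)) (p (Suc i mod K)))) = ?f (\<theta>(p 0 := a))"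
        by (intro prod.cong refl) (simp add: m)
      moreover have "(\<theta>(p 0 := a)) (p (Suc m mod K)) = a" by (simp add: m)
      ultimately show "?f (\<theta>(p 0 := a)) * B m $$ ((\<theta>(p 0 := a)) (p m), a) =
        (\<Prod>i<K. B i $$ ((\<theta>(p 0 := a)) (p i), (\<theta>(p 0 := a)) (p (Suc i mod K))))"
        by (simp only: m prod.lessThan_Suc)
    qed
    finally show ?thesis .
  qed
  show ?thesis unfolding ins sum_PiE_insert[OF notin] by (rule sum.cong[OF refl]) (simp only: lessThan_iff *)
qed

section \<open>Positions along a closed sequence of words\<close>

locale closed_words =
  fixes L :: nat and ws :: "nat \<Rightarrow> nat star_letter list"
  assumes L: "L \<ge> 1"
begin

text \<open>
  The step \<open>n\<close> contributes the positions \<open>pos n 0, \<dots>, pos n (m + 1)\<close>, where \<open>m\<close> is the length of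
  its word: the arc leaving \<open>pos n 0\<close> carries the Wigner matrix, the next \<open>m\<close> arcs carry the letters,
  and the last one carries the identity (label \<open>None\<close>), which keeps empty words from being special.
\<close>

definition pos :: "nat \<Rightarrow> nat \<Rightarrow> nat" where
  "pos n i = prod_encode (n, i)"

definition step_of :: "nat \<Rightarrow> nat" where
  "step_of k = fst (prod_decode k)"

definition positions :: "nat set" where
  "positions = {pos n i | n i. n < L \<and> i \<le> Suc (length (ws n))}"

definition starts :: "nat set" where
  "starts = (\<lambda>n. pos n 0) ` {..<L}"

definition next_pos :: "nat \<Rightarrow> nat" where
  "next_pos k = (case prod_decode k of (n, i) \<Rightarrow>
     if i \<le> length (ws n) then pos n (Suc i) else pos (Suc n mod L) 0)"

definition lab :: "nat \<Rightarrow> nat star_letter option" where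
  "lab k = (case prod_decode k of (n, i) \<Rightarrow>
     if 1 \<le> i \<and> i \<le> length (ws n) then Some (ws n ! (i - 1)) else None)"

lemma pos_eq [simp]: "pos n i = pos n' i' \<longleftrightarrow> n = n' \<and> i = i'"
  by (simp add: pos_def)

lemma step_of_pos [simp]: "step_of (pos n i) = n"
  by (simp add: step_of_def pos_def)

lemma next_pos [simp]: "i \<le> length (ws n) \<Longrightarrow> next_pos (pos n i) = pos n (Suc i)"
  by (simp add: next_pos_def pos_def)

lemma next_pos_last [simp]: "next_pos (pos n (Suc (length (ws n)))) = pos (Suc n mod L) 0"
  by (simp add: next_pos_def pos_def)

lemma lab_pos: "1 \<le> i \<Longrightarrow> i \<le> length (ws n) \<Longrightarrow> lab (pos n i) = Some (ws n ! (i - 1))"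
  by (simp add: lab_def pos_def)

lemma lab_last: "lab (pos n (Suc (length (ws n)))) = None"
  by (simp add: lab_def pos_def)

lemma pos_positions [simp]: "pos n i \<in> positions \<longleftrightarrow> n < L \<and> i \<le> Suc (length (ws n))"
  by (auto simp: positions_def)

lemma pos_starts [simp]: "pos n i \<in> starts \<longleftrightarrow> n < L \<and> i = 0"
  by (auto simp: starts_def)

lemma positionsE:
  assumes "k \<in> positions"
  obtains n i where "k = pos n i" "n < L" "i \<le> Suc (length (ws n))"
  using assms unfolding positions_def by blast

lemma mod_less [simp]: "Suc n mod L < L"
  using L by simp

lemma next_positions: "k \<in> positions \<Longrightarrow> next_pos k \<in> positions"
proof (erule positionsE)
  fix n i assume "k = pos n i" "n < L" "i \<le> Suc (length (ws n))"
  then show "next_pos k \<in> positions" by (cases "i = Suc (length (ws n))") simp_all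
qed

lemma finite_positions: "finite positions"
proof (rule finite_subset)
  show "positions \<subseteq> (\<lambda>(n, i). pos n i) ` (SIGMA n:{..<L}. {..Suc (length (ws n))})"
    by (auto elim!: positionsE)
qed (intro finite_imageI finite_SigmaI finite_lessThan finite_atMost)

text \<open>From any position the walk reaches the end of its word and then the start of the next
  step; running through the residues modulo \<open>L\<close> it meets every step.\<close>

lemma positions_transitive:
  assumes S: "S \<subseteq> positions" "S \<noteq> {}" "next_pos ` S \<subseteq> S"
  shows "S = positions"
proof -
  have nxS: "next_pos k \<in> S" if "k \<in> S" for k using S(3) that by auto
  have up: "pos n (i + j) \<in> S" if "pos n i \<in> S" "i + j \<le> Suc (length (ws n))" for n i j
    using that(2)
  proof (induction j)
    case (Suc j)
    then show ?case using nxS[of "pos n (i + j)"] by simp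
  qed (use that in simp)
  have turn: "pos (Suc n mod L) 0 \<in> S" if "pos n i \<in> S" for n i
  proof -
    have "i \<le> Suc (length (ws n))" using that S(1) pos_positions by blast
    then show ?thesis using up[OF that, of "Suc (length (ws n)) - i"] nxS[of "pos n (Suc (length (ws n)))"] by simp
  qed
  obtain k where "k \<in> S" using S(2) by blast
  then obtain n i where ni: "pos n i \<in> S" "n < L" using S(1) positionsE by (metis subsetD)
  have it: "pos ((n + Suc j) mod L) 0 \<in> S" for j
  proof (induction j)
    case 0
    then show ?case using turn[OF ni(1)] by simp
  next
    case (Suc j)
    then show ?case using turn[OF Suc] by (simp add: mod_Suc_eq)
  qed
  have "pos n' 0 \<in> S" if "n' < L" for n'
  proof -
    have "n + Suc (L + n' - n - 1) = L + n'" using ni(2) that by simp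
    then show ?thesis using it[of "L + n' - n - 1"] that by (simp add: mod_add_self1)
  qed
  then have "pos n' i' \<in> S" if "n' < L" "i' \<le> Suc (length (ws n'))" for n' i'
    using up[of n' 0 i'] that by simp
  then show ?thesis using S(1) by (auto elim!: positionsE)
qed

sublocale cyclic_walk positions next_pos starts
proof
  have img: "next_pos ` positions \<subseteq> positions" using next_positions by auto
  have "pos 0 0 \<in> positions" using L by simp
  then show ne: "positions \<noteq> {}" by blast
  show "starts \<subseteq> positions" by (auto simp: starts_def)
  show "finite positions" by (rule finite_positions)
  \<comment> \<open>The image is nonempty and invariant, hence everything; on a finite set, onto
    implies bijective.\<close>
  have "next_pos ` positions = positions"
    by (rule positions_transitive) (use img ne in auto)
  then show "bij_betw next_pos positions positions"
    using finite_positions by (simp add: bij_betw_def eq_card_imp_inj_on)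
qed (rule positions_transitive)

definition tail_positions :: "nat \<Rightarrow> nat \<Rightarrow> nat set" where
  "tail_positions s n = pos n ` {Suc s..Suc (length (ws n))}"

lemma pos_tail_positions [simp]:
  "pos n i \<in> tail_positions s n' \<longleftrightarrow> n = n' \<and> Suc s \<le> i \<and> i \<le> Suc (length (ws n))"
  by (auto simp: tail_positions_def)

lemma positions_diff_starts: "positions - starts = (\<Union>n<L. tail_positions 0 n)"
proof (intro equalityI subsetI)
  fix k assume k: "k \<in> positions - starts"
  then obtain n i where ni: "k = pos n i" "n < L" "i \<le> Suc (length (ws n))" using positionsE by blast
  then have "k \<in> tail_positions 0 n" using k by simp
  then show "k \<in> (\<Union>n<L. tail_positions 0 n)" using ni by blast
qed (auto simp: tail_positions_def starts_def)

definition letter_at :: "(nat \<Rightarrow> complex mat) \<Rightarrow> (nat \<Rightarrow> complex mat) \<Rightarrow> nat \<Rightarrow> nat \<Rightarrow> complex mat" where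
  "letter_at Xm Ym n i = (if i = 0 then Xm n else letter_mat Ym (ws n ! (i - 1)))"

text \<open>The indicator is the identity arc at the end of the step.\<close>

definition arcs_prod :: "(nat \<Rightarrow> complex mat) \<Rightarrow> (nat \<Rightarrow> complex mat) \<Rightarrow> nat \<Rightarrow> nat \<Rightarrow> (nat \<Rightarrow> nat) \<Rightarrow> complex" where
  "arcs_prod Xm Ym s n \<phi> = (\<Prod>i\<in>{s..length (ws n)}. letter_at Xm Ym n i $$ (\<phi> (pos n i), \<phi> (pos n (Suc i)))) *
     of_bool (\<phi> (pos n (Suc (length (ws n)))) = \<phi> (pos (Suc n mod L) 0))"

context
  fixes N :: nat and Xm Ym :: "nat \<Rightarrow> complex mat"
  assumes Xm: "\<And>n. n < L \<Longrightarrow> Xm n \<in> carrier_mat N N"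
    and Ym: "\<And>n l v. n < L \<Longrightarrow> l \<in> set (ws n) \<Longrightarrow> v \<in> set_star_letter l \<Longrightarrow> Ym v \<in> carrier_mat N N"
begin

text \<open>With \<open>s = 0\<close> the product starts with the Wigner matrix, with
  \<open>s = 1\<close> it is the word alone. One expansion thus serves both the full trace and the
  graphs attached to the vertices.\<close>

abbreviation segment :: "nat \<Rightarrow> nat \<Rightarrow> complex mat" where
  "segment s n \<equiv> mat_prod N (\<lambda>i. letter_at Xm Ym n (s + i)) (Suc (length (ws n)) - s)"

lemma letter_at_carrier: "n < L \<Longrightarrow> i \<le> length (ws n) \<Longrightarrow> letter_at Xm Ym n i \<in> carrier_mat N N"
proof -
  assume n: "n < L" "i \<le> length (ws n)"
  show ?thesis
  proof (cases i)
    case 0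
    then show ?thesis using Xm[OF n(1)] by (simp add: letter_at_def)
  next
    case (Suc j)
    then have "ws n ! j \<in> set (ws n)" using n by simp
    then have "letter_mat Ym (ws n ! j) \<in> carrier_mat N N" by (intro letter_mat_carrier Ym[OF n(1)])
    then show ?thesis using Suc by (simp add: letter_at_def)
  qed
qed

lemma segment_carrier: "n < L \<Longrightarrow> segment s n \<in> carrier_mat N N"
  by (rule mat_prod_carrier) (auto intro: letter_at_carrier)

lemma segment_1: "n < L \<Longrightarrow> segment 1 n = word_mat N Ym (Word (ws n))"
  using word_mat_prod[of "Word (ws n)" Ym N] Ym[of n] by (simp add: letter_at_def)

lemma segment_path:
  assumes n: "n < L" and s: "s \<le> 1" and \<phi>: "\<phi> (pos n s) < N" "\<phi> (pos (Suc n mod L) 0) < N"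
  shows "segment s n $$ (\<phi> (pos n s), \<phi> (pos (Suc n mod L) 0)) =
    (\<Sum>\<theta>\<in>tail_positions s n \<rightarrow>\<^sub>E {..<N}. arcs_prod Xm Ym s n (override_on \<phi> \<theta> (tail_positions s n)))"
proof -
  let ?m = "Suc (length (ws n)) - s" and ?p = "\<lambda>i. pos n (s + i)"
  let ?T = "tail_positions s n"
  have T: "?p ` {1..?m} = ?T"
  proof -
    have "?p ` {1..?m} = pos n ` ((\<lambda>i. s + i) ` {1..?m})" by (simp only: image_image)
    also have "(\<lambda>i. s + i) ` {1..?m} = {Suc s..Suc (length (ws n))}" using s by simp
    finally show ?thesis by (simp add: tail_positions_def)
  qed
  have "segment s n $$ (\<phi> (pos n s), \<phi> (pos (Suc n mod L) 0)) = (\<Sum>\<theta>\<in>?p ` {1..?m} \<rightarrow>\<^sub>E {..<N}.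
    (\<Prod>i<?m. letter_at Xm Ym n (s + i) $$ ((\<theta>(?p 0 := \<phi> (pos n s))) (?p i), (\<theta>(?p 0 := \<phi> (pos n s))) (?p (Suc i)))) *
    of_bool ((\<theta>(?p 0 := \<phi> (pos n s))) (?p ?m) = \<phi> (pos (Suc n mod L) 0)))"
    by (rule mat_prod_path) (use letter_at_carrier[OF n] \<phi> in \<open>auto simp: inj_on_def\<close>)
  also have "\<dots> = (\<Sum>\<theta>\<in>?T \<rightarrow>\<^sub>E {..<N}. arcs_prod Xm Ym s n (override_on \<phi> \<theta> ?T))"
    unfolding T
  proof (rule sum.cong[OF refl])
    fix \<theta> assume "\<theta> \<in> ?T \<rightarrow>\<^sub>E {..<N}"
    have e: "(\<theta>(?p 0 := \<phi> (pos n s))) (pos n i) = override_on \<phi> \<theta> ?T (pos n i)" if "s \<le> i" "i \<le> Suc (length (ws n))" for i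
      using that by (auto simp: override_on_def tail_positions_def)
    have b: "override_on \<phi> \<theta> ?T (pos (Suc n mod L) 0) = \<phi> (pos (Suc n mod L) 0)"
      by (auto simp: override_on_def tail_positions_def)
    have "(\<Prod>i<?m. letter_at Xm Ym n (s + i) $$ ((\<theta>(?p 0 := \<phi> (pos n s))) (?p i), (\<theta>(?p 0 := \<phi> (pos n s))) (?p (Suc i)))) =
      (\<Prod>i<?m. letter_at Xm Ym n (s + i) $$ (override_on \<phi> \<theta> ?T (pos n (s + i)), override_on \<phi> \<theta> ?T (pos n (Suc (s + i)))))"
    proof (rule prod.cong[OF refl])
      fix i assume "i \<in> {..<?m}"
      then have "s + i \<le> length (ws n)" by auto
      then show "letter_at Xm Ym n (s + i) $$ ((\<theta>(?p 0 := \<phi> (pos n s))) (?p i), (\<theta>(?p 0 := \<phi> (pos n s))) (?p (Suc i))) =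
        letter_at Xm Ym n (s + i) $$ (override_on \<phi> \<theta> ?T (pos n (s + i)), override_on \<phi> \<theta> ?T (pos n (Suc (s + i))))"
        using e[of "s + i"] e[of "Suc (s + i)"] by (simp only: add_Suc_right le_add1 le_SucI Suc_le_mono)
    qed
    also have "\<dots> = (\<Prod>i\<in>{s..length (ws n)}. letter_at Xm Ym n i $$ (override_on \<phi> \<theta> ?T (pos n i), override_on \<phi> \<theta> ?T (pos n (Suc i))))"
    proof (rule prod.reindex_bij_witness[where i = "\<lambda>i. i - s" and j = "\<lambda>i. s + i"])
    qed (use s in auto)
    finally show "(\<Prod>i<?m. letter_at Xm Ym n (s + i) $$ ((\<theta>(?p 0 := \<phi> (pos n s))) (?p i), (\<theta>(?p 0 := \<phi> (pos n s))) (?p (Suc i)))) *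
      of_bool ((\<theta>(?p 0 := \<phi> (pos n s))) (?p ?m) = \<phi> (pos (Suc n mod L) 0)) = arcs_prod Xm Ym s n (override_on \<phi> \<theta> ?T)"
      using e[of "Suc (length (ws n))"] s unfolding arcs_prod_def b by simp
  qed
  finally show ?thesis .
qed

text \<open>\<open>D\<close> holds the outer positions, at which the segments meet; the condition
  \<open>i \<le> s\<close> keeps the inner positions of all steps out of it.\<close>

lemma sum_segments:
  assumes s: "s \<le> 1" and A: "A \<subseteq> {..<L}" and D: "\<And>n. n \<in> A \<Longrightarrow> pos n s \<in> D \<and> pos (Suc n mod L) 0 \<in> D"
    and disj: "\<And>n i. pos n i \<in> D \<Longrightarrow> i \<le> s"
    and F: "\<And>\<phi> \<phi>'. (\<And>k. k \<in> D \<Longrightarrow> \<phi> k = \<phi>' k) \<Longrightarrow> F \<phi> = F \<phi>'"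
  shows "(\<Sum>\<phi>\<in>D \<rightarrow>\<^sub>E {..<N}. F \<phi> * (\<Prod>n\<in>A. segment s n $$ (\<phi> (pos n s), \<phi> (pos (Suc n mod L) 0)))) =
    (\<Sum>\<phi>\<in>D \<union> (\<Union>n\<in>A. tail_positions s n) \<rightarrow>\<^sub>E {..<N}. F \<phi> * (\<Prod>n\<in>A. arcs_prod Xm Ym s n \<phi>))"
proof (rule sum_expand)
  show "finite A" using A finite_subset by blast
next
  fix n show "D \<inter> tail_positions s n = {}"
  proof -
    have "pos n i \<notin> D" if "Suc s \<le> i" for i using disj[of n i] that by auto
    then show ?thesis by (auto simp: tail_positions_def)
  qed
next
  fix n m :: nat assume "n \<noteq> m"
  then show "tail_positions s n \<inter> tail_positions s m = {}" by (auto simp: tail_positions_def)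
next
  fix \<phi> \<phi>' :: "nat \<Rightarrow> nat" assume e: "\<And>k. k \<in> D \<Longrightarrow> \<phi> k = \<phi>' k"
  then show "F \<phi> = F \<phi>'" by (rule F)
next
  fix n and \<phi> \<phi>' :: "nat \<Rightarrow> nat" assume n: "n \<in> A" and e: "\<And>k. k \<in> D \<Longrightarrow> \<phi> k = \<phi>' k"
  show "segment s n $$ (\<phi> (pos n s), \<phi> (pos (Suc n mod L) 0)) = segment s n $$ (\<phi>' (pos n s), \<phi>' (pos (Suc n mod L) 0))"
    using e D[OF n] by (simp only:)
next
  fix n and \<phi> \<phi>' :: "nat \<Rightarrow> nat" assume n: "n \<in> A" and e: "\<And>k. k \<in> D \<union> tail_positions s n \<Longrightarrow> \<phi> k = \<phi>' k"
  have *: "\<phi> (pos n i) = \<phi>' (pos n i)" if "s \<le> i" "i \<le> Suc (length (ws n))" for i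
  proof (rule e)
    show "pos n i \<in> D \<union> tail_positions s n" using D[OF n] that by (cases "i = s") (auto simp: tail_positions_def)
  qed
  have **: "\<phi> (pos (Suc n mod L) 0) = \<phi>' (pos (Suc n mod L) 0)" by (rule e) (use D[OF n] in blast)
  have "(\<Prod>i\<in>{s..length (ws n)}. letter_at Xm Ym n i $$ (\<phi> (pos n i), \<phi> (pos n (Suc i)))) =
    (\<Prod>i\<in>{s..length (ws n)}. letter_at Xm Ym n i $$ (\<phi>' (pos n i), \<phi>' (pos n (Suc i))))"
    by (rule prod.cong[OF refl]) (simp add: *)
  then show "arcs_prod Xm Ym s n \<phi> = arcs_prod Xm Ym s n \<phi>'"
    unfolding arcs_prod_def ** using *[of "Suc (length (ws n))"] s by simp
next
  fix n and \<phi> :: "nat \<Rightarrow> nat" assume n: "n \<in> A" and e: "\<And>k. k \<in> D \<Longrightarrow> \<phi> k \<in> {..<N}"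
  show "segment s n $$ (\<phi> (pos n s), \<phi> (pos (Suc n mod L) 0)) =
    (\<Sum>\<theta>\<in>tail_positions s n \<rightarrow>\<^sub>E {..<N}. arcs_prod Xm Ym s n (override_on \<phi> \<theta> (tail_positions s n)))"
    by (rule segment_path) (use n A e D[OF n] s in auto)
qed

lemma arcs_prod_labels:
  "arcs_prod Xm Ym 1 n \<phi> = (\<Prod>k\<in>tail_positions 0 n. label_entry Ym (lab k) (\<phi> k) (\<phi> (next_pos k)))"
proof -
  have "(\<Prod>k\<in>tail_positions 0 n. label_entry Ym (lab k) (\<phi> k) (\<phi> (next_pos k))) =
    (\<Prod>i\<in>{1..Suc (length (ws n))}. label_entry Ym (lab (pos n i)) (\<phi> (pos n i)) (\<phi> (next_pos (pos n i))))"
    unfolding tail_positions_def by (subst prod.reindex) (auto simp: inj_on_def)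
  also have "\<dots> = (\<Prod>i\<in>{1..length (ws n)}. label_entry Ym (lab (pos n i)) (\<phi> (pos n i)) (\<phi> (next_pos (pos n i)))) *
    label_entry Ym None (\<phi> (pos n (Suc (length (ws n))))) (\<phi> (pos (Suc n mod L) 0))"
    by (simp add: lab_last)
  also have "(\<Prod>i\<in>{1..length (ws n)}. label_entry Ym (lab (pos n i)) (\<phi> (pos n i)) (\<phi> (next_pos (pos n i)))) =
    (\<Prod>i\<in>{1..length (ws n)}. letter_at Xm Ym n i $$ (\<phi> (pos n i), \<phi> (pos n (Suc i))))"
    by (rule prod.cong[OF refl]) (simp add: lab_pos label_entry_def letter_at_def)
  finally show ?thesis by (simp add: arcs_prod_def label_entry_def)
qed

lemma arcs_prod_start:
  "arcs_prod Xm Ym 0 n \<phi> = Xm n $$ (\<phi> (pos n 0), \<phi> (pos n 1)) * arcs_prod Xm Ym 1 n \<phi>"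
proof -
  have "{0..length (ws n)} = insert 0 {1..length (ws n)}" by auto
  then show ?thesis by (simp add: arcs_prod_def letter_at_def)
qed

text \<open>Two levels of expansion: the trace over the starts of the steps, then each step matrix
  over its inner positions.\<close>

lemma trace_walk_sum:
  "(\<Sum>i<N. mat_prod N (segment 0) L $$ (i, i)) =
    (\<Sum>\<phi>\<in>positions \<rightarrow>\<^sub>E {..<N}. (\<Prod>k\<in>starts. Xm (step_of k) $$ (\<phi> k, \<phi> (next_pos k))) *
       (\<Prod>k\<in>positions - starts. label_entry Ym (lab k) (\<phi> k) (\<phi> (next_pos k))))"
proof -
  have "(\<Sum>i<N. mat_prod N (segment 0) L $$ (i, i)) =
    (\<Sum>\<phi>\<in>(\<lambda>n. pos n 0) ` {..<L} \<rightarrow>\<^sub>E {..<N}. \<Prod>n<L. segment 0 n $$ (\<phi> (pos n 0), \<phi> (pos (Suc n mod L) 0)))"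
    by (rule mat_prod_trace) (rule segment_carrier, assumption, simp add: inj_on_def, rule L)
  also have "\<dots> = (\<Sum>\<phi>\<in>starts \<rightarrow>\<^sub>E {..<N}. 1 * (\<Prod>n<L. segment 0 n $$ (\<phi> (pos n 0), \<phi> (pos (Suc n mod L) 0))))"
    by (simp only: starts_def mult_1_left)
  also have "\<dots> = (\<Sum>\<phi>\<in>starts \<union> (\<Union>n<L. tail_positions 0 n) \<rightarrow>\<^sub>E {..<N}. 1 * (\<Prod>n<L. arcs_prod Xm Ym 0 n \<phi>))"
    by (rule sum_segments) auto
  also have "\<dots> = (\<Sum>\<phi>\<in>positions \<rightarrow>\<^sub>E {..<N}. (\<Prod>k\<in>starts. Xm (step_of k) $$ (\<phi> k, \<phi> (next_pos k))) *
       (\<Prod>k\<in>positions - starts. label_entry Ym (lab k) (\<phi> k) (\<phi> (next_pos k))))"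
  proof (rule sum.cong)
    show "starts \<union> (\<Union>n<L. tail_positions 0 n) \<rightarrow>\<^sub>E {..<N} = positions \<rightarrow>\<^sub>E {..<N}"
      using XS_V unfolding positions_diff_starts[symmetric] by (simp only: Un_Diff_cancel Un_absorb1)
  next
    fix \<phi>
    have "(\<Prod>k\<in>positions - starts. label_entry Ym (lab k) (\<phi> k) (\<phi> (next_pos k))) = (\<Prod>n<L. arcs_prod Xm Ym 1 n \<phi>)"
      unfolding arcs_prod_labels positions_diff_starts
      by (rule prod.UNION_disjoint) (auto simp: tail_positions_def)
    moreover have "(\<Prod>k\<in>starts. Xm (step_of k) $$ (\<phi> k, \<phi> (next_pos k))) = (\<Prod>n<L. Xm n $$ (\<phi> (pos n 0), \<phi> (pos n 1)))"
      unfolding starts_def by (subst prod.reindex) (auto simp: inj_on_def)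
    ultimately show "1 * (\<Prod>n<L. arcs_prod Xm Ym 0 n \<phi>) = (\<Prod>k\<in>starts. Xm (step_of k) $$ (\<phi> k, \<phi> (next_pos k))) *
       (\<Prod>k\<in>positions - starts. label_entry Ym (lab k) (\<phi> k) (\<phi> (next_pos k)))"
      by (simp only: arcs_prod_start prod.distrib mult_1_left)
  qed
  finally show ?thesis .
qed

text \<open>Read from right to left, it contracts each word to a single matrix and so turns a graph
  labelled by letters into one labelled by words.\<close>

lemma sum_word_graph:
  assumes A: "A \<subseteq> {..<L}" and D: "\<And>n. n \<in> A \<Longrightarrow> pos n 1 \<in> D \<and> pos (Suc n mod L) 0 \<in> D"
    and disj: "\<And>n i. pos n i \<in> D \<Longrightarrow> i \<le> 1"
    and F: "\<And>\<phi> \<phi>'. (\<And>k. k \<in> D \<Longrightarrow> \<phi> k = \<phi>' k) \<Longrightarrow> F \<phi> = F \<phi>'"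
  shows "(\<Sum>\<phi>\<in>D \<rightarrow>\<^sub>E {..<N}. F \<phi> * (\<Prod>n\<in>A. word_mat N Ym (Word (ws n)) $$ (\<phi> (pos n 1), \<phi> (pos (Suc n mod L) 0)))) =
    (\<Sum>\<phi>\<in>D \<union> (\<Union>n\<in>A. tail_positions 1 n) \<rightarrow>\<^sub>E {..<N}.
       F \<phi> * (\<Prod>k\<in>(\<Union>n\<in>A. tail_positions 0 n). label_entry Ym (lab k) (\<phi> k) (\<phi> (next_pos k))))"
proof -
  have "(\<Prod>n\<in>A. word_mat N Ym (Word (ws n)) $$ (\<phi> (pos n 1), \<phi> (pos (Suc n mod L) 0))) =
    (\<Prod>n\<in>A. segment 1 n $$ (\<phi> (pos n 1), \<phi> (pos (Suc n mod L) 0)))" for \<phi>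
    by (rule prod.cong[OF refl]) (use A segment_1 in auto)
  moreover have "(\<Prod>k\<in>(\<Union>n\<in>A. tail_positions 0 n). label_entry Ym (lab k) (\<phi> k) (\<phi> (next_pos k))) =
    (\<Prod>n\<in>A. arcs_prod Xm Ym 1 n \<phi>)" for \<phi>
    unfolding arcs_prod_labels
    by (rule prod.UNION_disjoint) (use finite_subset[OF A finite_lessThan] in \<open>auto simp: tail_positions_def\<close>)
  ultimately show ?thesis using sum_segments[OF order_refl A D disj F] by (simp only:)
qed

end

end

section \<open>Tree-like kernels and plane cycles\<close>

text \<open>\<open>g\<close> factors through \<open>f\<close>; if \<open>f\<close> does not take
  more values than \<open>g\<close>, the factor map is injective.\<close>

lemma image_card_eq_imp:
  assumes S: "finite S" and fg: "\<And>k l. k \<in> S \<Longrightarrow> l \<in> S \<Longrightarrow> f k = f l \<Longrightarrow> g k = g l"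
  shows "card (g ` S) \<le> card (f ` S)"
    and "card (f ` S) \<le> card (g ` S) \<Longrightarrow> k \<in> S \<Longrightarrow> l \<in> S \<Longrightarrow> g k = g l \<Longrightarrow> f k = f l"
proof -
  define h where "h x = g (SOME k. k \<in> S \<and> f k = x)" for x
  have h: "h (f k) = g k" if "k \<in> S" for k
  proof -
    have "\<exists>l. l \<in> S \<and> f l = f k" using that by blast
    then have "(SOME l. l \<in> S \<and> f l = f k) \<in> S \<and> f (SOME l. l \<in> S \<and> f l = f k) = f k" by (rule someI_ex)
    then show ?thesis unfolding h_def using fg[of "SOME l. l \<in> S \<and> f l = f k" k] that by blast
  qed
  have img: "h ` (f ` S) = g ` S" unfolding image_image using h by (rule image_cong[OF refl])
  show le: "card (g ` S) \<le> card (f ` S)" using card_image_le[of "f ` S" h] S unfolding img by simp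
  assume "card (f ` S) \<le> card (g ` S)" and kl: "k \<in> S" "l \<in> S" "g k = g l"
  then have "card (h ` (f ` S)) = card (f ` S)" using le img by simp
  then have "inj_on h (f ` S)" using S by (intro eq_card_imp_inj_on) auto
  moreover have "h (f k) = h (f l)" using h kl by simp
  ultimately show "f k = f l" using kl by (auto dest: inj_onD)
qed

lemma quotient_kernel:
  "V // {(x, y). x \<in> V \<and> y \<in> V \<and> f x = f y} = (\<lambda>v. {x \<in> V. f x = v}) ` f ` V"
proof -
  have "{(x, y). x \<in> V \<and> y \<in> V \<and> f x = f y} `` {x} = {y \<in> V. f y = f x}" if "x \<in> V" for x
    using that by auto
  then have "V // {(x, y). x \<in> V \<and> y \<in> V \<and> f x = f y} = (\<lambda>x. {y \<in> V. f y = f x}) ` V"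
    unfolding quotient_def by auto
  then show ?thesis by (simp only: image_image)
qed

lemma card_quotient_kernel:
  "card (V // {(x, y). x \<in> V \<and> y \<in> V \<and> f x = f y}) = card (f ` V)"
proof -
  let ?R = "{(x, y). x \<in> V \<and> y \<in> V \<and> f x = f y}"
  have "V // ?R = (\<lambda>v. {x \<in> V. f x = v}) ` f ` V" by (rule quotient_kernel)
  moreover have "inj_on (\<lambda>v. {x \<in> V. f x = v}) (f ` V)"
  proof (rule inj_onI)
    fix x y assume "x \<in> f ` V" "{k \<in> V. f k = x} = {k \<in> V. f k = y}"
    then show "x = y" by blast
  qed
  ultimately show ?thesis by (simp add: card_image)
qed

lemma equiv_kernel: "equiv V {(x, y). x \<in> V \<and> y \<in> V \<and> f x = f y}"
  by (auto simp: equiv_def refl_on_def sym_def trans_def)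

locale word_walk = closed_words L ws + random_family q M Y + wigner_family p M X a \<mu> \<nu>
  for L ws q and M :: "nat \<Rightarrow> 'w measure" and Y p X a \<mu> \<nu> +
  fixes \<gamma> :: "nat \<Rightarrow> nat"
  assumes \<gamma>: "\<And>n. n < L \<Longrightarrow> \<gamma> n < p"
    and ws_vars: "\<And>n l. n < L \<Longrightarrow> l \<in> set (ws n) \<Longrightarrow> set_star_letter l \<subseteq> {..<q}"
    and indep_X_Y: "\<And>N. N \<ge> 1 \<Longrightarrow> prob_space.indep_var (M N)
           (entry_space {..<p} N) (entries {..<p} N (X N))
           (entry_space {..<q} N) (entries {..<q} N (Y N))"

sublocale word_walk \<subseteq> trace_walk positions next_pos starts q M Y lab p X a \<mu> \<nu> "\<gamma> \<circ> step_of"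
proof
  fix k l assume k: "k \<in> positions - starts" "lab k = Some l"
  then obtain n i where ni: "k = pos n i" "n < L" "i \<le> Suc (length (ws n))" using positionsE by blast
  have "1 \<le> i \<and> i \<le> length (ws n)"
    using k(2) unfolding ni(1) lab_def pos_def by (simp split: if_splits)
  then have "l = ws n ! (i - 1)" "i - 1 < length (ws n)" using k(2) by (auto simp: ni(1) lab_pos)
  then show "set_star_letter l \<subseteq> {..<q}" using ws_vars[OF ni(2)] by simp
qed (use \<gamma> indep_X_Y in \<open>auto simp: starts_def\<close>)

context word_walk
begin

abbreviation same :: "(nat \<Rightarrow> nat) \<Rightarrow> (nat \<times> nat) set" where
  "same \<rho> \<equiv> connection positions (link \<rho>)"

lemma same_kernel: "k \<in> positions \<Longrightarrow> l \<in> positions \<Longrightarrow> \<rho> k = \<rho> l \<Longrightarrow> (k, l) \<in> same \<rho>"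
  by (rule connection_base) (simp_all add: link_def)

lemma same_next: "k \<in> positions - starts \<Longrightarrow> (k, next_pos k) \<in> same \<rho>"
  by (rule connection_base) (auto simp: link_def)

lemma same_end:
  assumes "n < L" "1 \<le> i" "i \<le> Suc (length (ws n))"
  shows "(pos n i, pos (Suc n mod L) 0) \<in> same \<rho>"
  using assms(3,2)
proof (induction i rule: inc_induct)
  case base
  show ?case using same_next[of "pos n (Suc (length (ws n)))" \<rho>] assms(1) by simp
next
  case (step i)
  have "(pos n i, pos n (Suc i)) \<in> same \<rho>" using same_next[of "pos n i" \<rho>] assms(1) step by simp
  moreover have "(pos n (Suc i), pos (Suc n mod L) 0) \<in> same \<rho>" using step by simp
  ultimately show ?case by (rule connection_trans)
qed

lemma same_coarser: "coarser \<rho> \<rho>' \<Longrightarrow> same \<rho> \<subseteq> same \<rho>'"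
  by (rule connection_mono) (auto simp: link_def coarser_def)

lemma card_parts_same: "same \<rho> = {(k, l). k \<in> positions \<and> l \<in> positions \<and> f k = f l} \<Longrightarrow>
    card (parts \<rho>) = card (f ` positions)"
  unfolding parts_def components_def by (simp only: card_quotient_kernel)

lemma edge_class_pos:
  "edge_class \<rho> (pos n 0) = (\<gamma> n, {\<rho> (pos n 0), \<rho> (pos n 1)})"
  by (simp add: edge_class_def)

text \<open>The two ends of a Wigner arc are labelled by a tree vertex and an incident edge, inner
  positions by themselves. The kernel of this labelling is the finest one belonging to
  \<open>c\<close>: at a vertex \<open>v\<close> it leaves one index for each incident edge, and
  these edges are the vertices of the graph \<open>T_v\<close>.\<close>

definition end_label :: "walk \<Rightarrow> nat \<Rightarrow> (nat list \<times> nat list set) + nat" where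
  "end_label c k = (case prod_decode k of (n, i) \<Rightarrow>
     if i = 0 then Inl (fst (c ! n), undirected c n)
     else if i = 1 then Inl (snd (c ! n), undirected c n) else Inr k)"

definition cycle_kernel :: "walk \<Rightarrow> nat \<Rightarrow> nat" where
  "cycle_kernel c = kernel_of positions (end_label c)"

text \<open>All positions of a step but the first belong to the vertex where the step arrives, since
  \<open>Y\<close>-arcs join them to the start of the next step.\<close>

definition vertex_at :: "walk \<Rightarrow> nat \<Rightarrow> nat list" where
  "vertex_at c k = (case prod_decode k of (n, i) \<Rightarrow> if i = 0 then fst (c ! n) else snd (c ! n))"

definition step_edge :: "walk \<Rightarrow> nat \<Rightarrow> nat list set" where
  "step_edge c k = undirected c (step_of k)"

lemma step_edge_pos [simp]: "step_edge c (pos n i) = undirected c n"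
  by (simp add: step_edge_def)

lemma vertex_at_pos [simp]: "vertex_at c (pos n i) = (if i = 0 then fst (c ! n) else snd (c ! n))"
  by (simp add: vertex_at_def pos_def)

lemma end_label_pos: "i \<le> 1 \<Longrightarrow> end_label c (pos n i) = Inl (vertex_at c (pos n i), undirected c n)"
  by (cases "i = 0") (simp_all add: end_label_def vertex_at_def pos_def)

lemma end_label_inner: "i > 1 \<Longrightarrow> end_label c (pos n i) = Inr (pos n i)"
  by (simp add: end_label_def pos_def)

lemma cycle_kernel_eq:
  "k \<in> positions \<Longrightarrow> l \<in> positions \<Longrightarrow> cycle_kernel c k = cycle_kernel c l \<longleftrightarrow> end_label c k = end_label c l"
  unfolding cycle_kernel_def by (rule kernel_of_eq_iff[OF finite_positions])

lemma end_label_vertex: "end_label c k = end_label c l \<Longrightarrow> vertex_at c k = vertex_at c l"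
  by (auto simp: end_label_def vertex_at_def split: prod.splits if_splits)

context
  fixes G c
  assumes cyc: "(G, c) \<in> plane_cycles L \<gamma>"
begin

lemma cycle_compatible: "compatible (step_edge c) (cycle_kernel c)"
  unfolding compatible_def
proof (intro ballI impI)
  fix k l assume k: "k \<in> starts" and l: "l \<in> starts" and e: "step_edge c k = step_edge c l"
  then obtain n m where nm: "k = pos n 0" "n < L" "l = pos m 0" "m < L" by (auto simp: starts_def)
  have u: "undirected c n = undirected c m" using e nm by simp
  then have "fst (c ! n) = fst (c ! m) \<and> snd (c ! n) = snd (c ! m) \<or> fst (c ! n) = snd (c ! m) \<and> snd (c ! n) = fst (c ! m)"
    unfolding undirected_def doubleton_eq_iff .
  then have "cycle_kernel c (pos n 0) = cycle_kernel c (pos m 0) \<and> cycle_kernel c (pos n 1) = cycle_kernel c (pos m 1) \<or>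
    cycle_kernel c (pos n 0) = cycle_kernel c (pos m 1) \<and> cycle_kernel c (pos n 1) = cycle_kernel c (pos m 0)"
    using nm u by (simp add: cycle_kernel_eq end_label_pos)
  then show "{cycle_kernel c k, cycle_kernel c (next_pos k)} = {cycle_kernel c l, cycle_kernel c (next_pos l)}"
    using nm by (auto simp: doubleton_eq_iff)
qed

lemma step_edge_starts: "step_edge c ` starts = tree_edges G"
  unfolding cycle_edges[OF cyc L] starts_def by (simp add: image_image)

lemma vertex_at_positions: "vertex_at c ` positions = G"
proof
  show "G \<subseteq> vertex_at c ` positions"
    unfolding cycle_vertices[OF cyc L]
  proof
    fix v assume "v \<in> (\<lambda>n. fst (c ! n)) ` {..<L}"
    then obtain n where "n < L" "v = fst (c ! n)" by auto
    then have "v = vertex_at c (pos n 0)" "pos n 0 \<in> positions" by simp_all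
    then show "v \<in> vertex_at c ` positions" by (rule image_eqI)
  qed
  have "fst (c ! n) \<in> G" if "n < L" for n using that unfolding cycle_vertices[OF cyc L] by blast
  then show "vertex_at c ` positions \<subseteq> G"
    using cycle_facts(4)[OF cyc L] by (auto elim!: positionsE)
qed

lemma same_vertex: "(k, l) \<in> same (cycle_kernel c) \<Longrightarrow> vertex_at c k = vertex_at c l"
proof (erule connection_invariant)
  fix x y assume xy: "(x, y) \<in> link (cycle_kernel c)" "x \<in> positions" "y \<in> positions"
  then consider "cycle_kernel c x = cycle_kernel c y" | "y = next_pos x" "x \<notin> starts"
    by (auto simp: link_def)
  then show "vertex_at c x = vertex_at c y"
  proof cases
    case 1
    then show ?thesis using end_label_vertex cycle_kernel_eq xy by blast
  next
    case 2
    obtain n i where ni: "x = pos n i" "n < L" "i \<le> Suc (length (ws n))" using positionsE[OF xy(2)] by blast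
    then have "i \<noteq> 0" using 2 by auto
    then show ?thesis using ni 2(1) cycle_facts(4)[OF cyc L ni(2)]
      by (cases "i = Suc (length (ws n))") simp_all
  qed
qed

lemma card_vertices: "card (vertex_at c ` positions) = card (tree_edges G) + 1"
  unfolding vertex_at_positions by (rule card_tree_edges) (rule cycle_facts(1)[OF cyc L])

text \<open>Links respect \<open>vertex_at\<close>, which gives one inclusion. By
  \<open>card_parts_le\<close> the left-hand relation has at most \<open>E + 1\<close> classes, and
  the tree has \<open>E + 1\<close> vertices; counting gives equality.\<close>

lemma same_cycle_kernel:
  "same (cycle_kernel c) = {(k, l). k \<in> positions \<and> l \<in> positions \<and> vertex_at c k = vertex_at c l}"
proof -
  let ?R = "{(k, l). k \<in> positions \<and> l \<in> positions \<and> vertex_at c k = vertex_at c l}"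
  have sub: "same (cycle_kernel c) \<subseteq> ?R" using same_vertex connection_in by fast
  note am = card_quotient_antimono[OF finite_positions equiv_connection equiv_kernel sub]
  have "card (positions // same (cycle_kernel c)) \<le> card (tree_edges G) + 1"
    using card_parts_le[OF cycle_compatible] unfolding step_edge_starts parts_def components_def .
  then have "card (positions // ?R) = card (positions // same (cycle_kernel c))"
    using am(1) unfolding card_quotient_kernel card_vertices by simp
  then show ?thesis by (rule am(2))
qed

lemma cycle_tree: "card (parts (cycle_kernel c)) = card (step_edge c ` starts) + 1"
  unfolding card_parts_same[OF same_cycle_kernel] card_vertices step_edge_starts ..

lemma cycle_parts: "parts (cycle_kernel c) = (\<lambda>v. {k \<in> positions. vertex_at c k = v}) ` G"
proof -
  have "parts (cycle_kernel c) = (\<lambda>v. {k \<in> positions. vertex_at c k = v}) ` vertex_at c ` positions"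
    unfolding parts_def components_def same_cycle_kernel by (rule quotient_kernel)
  then show ?thesis unfolding vertex_at_positions .
qed

context
  fixes \<rho>
  assumes coarse: "coarser (cycle_kernel c) \<rho>" and tree: "card (parts \<rho>) = card (step_edge c ` starts) + 1"
begin

text \<open>A coarser kernel with equally many components connects nothing new.\<close>

lemma same_fibre: "same \<rho> = {(k, l). k \<in> positions \<and> l \<in> positions \<and> vertex_at c k = vertex_at c l}"
proof -
  have "same (cycle_kernel c) = same \<rho>"
    by (rule card_quotient_antimono(2)[OF finite_positions equiv_connection equiv_connection same_coarser[OF coarse]])
      (use tree cycle_tree in \<open>simp add: parts_def components_def\<close>)
  then show ?thesis using same_cycle_kernel by simp
qed

text \<open>Equal classes force equal pairs of components, hence equal tree edges. The converse is
  compatibility together with the constant colour on each edge.\<close>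

lemma fibre_edges:
  assumes k: "k \<in> starts" and l: "l \<in> starts"
  shows "edge_class \<rho> k = edge_class \<rho> l \<longleftrightarrow> step_edge c k = step_edge c l"
proof
  obtain n m where nm: "k = pos n 0" "n < L" "l = pos m 0" "m < L" using k l by (auto simp: starts_def)
  show "step_edge c k = step_edge c l" if e: "edge_class \<rho> k = edge_class \<rho> l"
  proof -
    have *: "vertex_at c x = vertex_at c y" if "\<rho> x = \<rho> y" "x \<in> positions" "y \<in> positions" for x y
      using same_kernel[OF that(2,3,1)] unfolding same_fibre by simp
    have "{\<rho> (pos n 0), \<rho> (pos n 1)} = {\<rho> (pos m 0), \<rho> (pos m 1)}"
      using e unfolding nm(1,3) edge_class_pos by simp
    then have "\<rho> (pos n 0) = \<rho> (pos m 0) \<and> \<rho> (pos n 1) = \<rho> (pos m 1) \<or> \<rho> (pos n 0) = \<rho> (pos m 1) \<and> \<rho> (pos n 1) = \<rho> (pos m 0)"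
      unfolding doubleton_eq_iff .
    then have "fst (c ! n) = fst (c ! m) \<and> snd (c ! n) = snd (c ! m) \<or> fst (c ! n) = snd (c ! m) \<and> snd (c ! n) = fst (c ! m)"
      using *[of "pos n 0" "pos m 0"] *[of "pos n 1" "pos m 1"] *[of "pos n 0" "pos m 1"] *[of "pos n 1" "pos m 0"] nm by auto
    then have "undirected c n = undirected c m" unfolding undirected_def doubleton_eq_iff .
    then show ?thesis using nm by simp
  qed
  show "edge_class \<rho> k = edge_class \<rho> l" if e: "step_edge c k = step_edge c l"
  proof -
    have "\<gamma> n = \<gamma> m" using cycle_facts(8)[OF cyc L nm(2,4)] e nm by simp
    moreover have "{\<rho> k, \<rho> (next_pos k)} = {\<rho> l, \<rho> (next_pos l)}"
      by (rule compatibleD[OF compatible_coarser[OF cycle_compatible coarse] k l e])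
    ultimately show ?thesis using nm by (simp add: edge_class_def)
  qed
qed

lemma fibre_card: "card (edge_class \<rho> ` starts) = card (step_edge c ` starts)"
  using image_card_eq_imp(1)[OF finite_XS, of "edge_class \<rho>" "step_edge c"]
    image_card_eq_imp(1)[OF finite_XS, of "step_edge c" "edge_class \<rho>"] fibre_edges by (simp add: order_antisym)

lemma fibre_is_tree: "is_tree \<rho>"
  unfolding is_tree_def fibre_card by (rule tree)

text \<open>The classes of \<rho> and the edges of \<open>G\<close> induce the same partition of the
  steps, and colour and multiplicity can be read off its blocks.\<close>

lemma fibre_weight: "tree_weight \<rho> = weight_HW a L \<gamma> G c"
proof -
  \<comment> \<open>\<open>H\<close> expresses a factor through the block alone, taking the colour
    of its least step; this is the shape that \<open>prod_fibres\<close> requires.\<close>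
  define H where "H K = a (\<gamma> (step_of (Min K))) (card K div 2)" for K
  have Min: "Min {k \<in> starts. f k = f l} \<in> {k \<in> starts. f k = f l}" if "l \<in> starts" for f :: "nat \<Rightarrow> 'x" and l
    using that finite_XS by (intro Min_in) auto
  have "tree_weight \<rho> = (\<Prod>\<kappa>\<in>edge_class \<rho> ` starts. H {k \<in> starts. edge_class \<rho> k = \<kappa>})"
    unfolding tree_weight_def
  proof (rule prod.cong[OF refl])
    fix \<kappa> assume "\<kappa> \<in> edge_class \<rho> ` starts"
    then obtain l where l: "l \<in> starts" "\<kappa> = edge_class \<rho> l" by blast
    have "edge_class \<rho> (Min {k \<in> starts. edge_class \<rho> k = \<kappa>}) = \<kappa>"
      using Min[OF l(1), of "edge_class \<rho>"] l(2) by simp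
    then have "fst \<kappa> = \<gamma> (step_of (Min {k \<in> starts. edge_class \<rho> k = \<kappa>}))"
      by (metis edge_class_def fst_conv comp_apply)
    then show "a (fst \<kappa>) (card {k \<in> starts. edge_class \<rho> k = \<kappa>} div 2) = H {k \<in> starts. edge_class \<rho> k = \<kappa>}"
      by (simp add: H_def)
  qed
  also have "\<dots> = (\<Prod>\<kappa>\<in>step_edge c ` starts. H {k \<in> starts. step_edge c k = \<kappa>})"
    by (rule prod_fibres) (rule fibre_edges)
  also have "\<dots> = weight_HW a L \<gamma> G c"
    unfolding weight_HW_def step_edge_starts
  proof (rule prod.cong[OF refl])
    fix e assume "e \<in> tree_edges G"
    then obtain l where l: "l \<in> starts" "e = step_edge c l" unfolding step_edge_starts[symmetric] by blast
    let ?K = "{k \<in> starts. step_edge c k = e}"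
    have "Min ?K \<in> ?K" using Min[OF l(1), of "step_edge c"] l(2) by simp
    then obtain n where n: "n < L" "Min ?K = pos n 0" "undirected c n = e" by (auto simp: starts_def)
    have "edge_color L \<gamma> c e = \<gamma> n"
      unfolding edge_color_def
    proof (rule the_equality)
      show "\<exists>m<L. undirected c m = e \<and> \<gamma> m = \<gamma> n" using n by blast
      fix j assume "\<exists>m<L. undirected c m = e \<and> \<gamma> m = j"
      then obtain m where "m < L" "undirected c m = e" "\<gamma> m = j" by blast
      then show "j = \<gamma> n" using cycle_facts(8)[OF cyc L, of m n] n by simp
    qed
    moreover have "card ?K = card {n. n < L \<and> undirected c n = e}"
    proof -
      have "?K = (\<lambda>n. pos n 0) ` {n. n < L \<and> undirected c n = e}" by (auto simp: starts_def)
      then show ?thesis by (simp add: card_image inj_on_def)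
    qed
    ultimately show "H ?K = a (edge_color L \<gamma> c e) (half_visits L c e)"
      using n by (simp add: H_def half_visits_def)
  qed
  finally show ?thesis .
qed

end

text \<open>Under \<open>cycle_kernel c\<close> the end positions at \<open>v\<close> amount to one
  index for each incident edge. The inner positions are unconstrained and sum up to the word
  matrices of the steps arriving at \<open>v\<close>.\<close>

lemma free_sum_vertex:
  assumes v: "v \<in> G" and N: "N \<ge> 1"
    and Ym: "\<And>i. i < q \<Longrightarrow> Y N i \<omega> \<in> carrier_mat N N"
  shows "free_sum N (el N \<omega>) (cycle_kernel c) {k \<in> positions. vertex_at c k = v} / of_nat N =
    graph_trace N (vertex_graph L G c v) (\<lambda>n. word_mat N (\<lambda>i. Y N i \<omega>) (Word (ws n)))"
proof -
  let ?C = "{k \<in> positions. vertex_at c k = v}" and ?\<rho> = "cycle_kernel c"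
  define A where "A = {n. n < L \<and> snd (c ! n) = v}"
  \<comment> \<open>The end positions at \<open>v\<close>: starts of the steps that leave
    \<open>v\<close> and second positions of the steps that arrive.\<close>
  define D where "D = {k \<in> ?C. \<exists>n. k = pos n 0 \<or> k = pos n 1}"
  have D_pos: "pos n i \<in> D \<longleftrightarrow> n < L \<and> (i = 0 \<and> fst (c ! n) = v \<or> i = 1 \<and> snd (c ! n) = v)" for n i
    unfolding D_def by auto
  have D_cases: "\<exists>n i. k = pos n i \<and> i \<le> 1 \<and> n < L \<and> vertex_at c k = v" if "k \<in> D" for k
  proof -
    obtain n where n: "k = pos n 0 \<or> k = pos n 1" using \<open>k \<in> D\<close> unfolding D_def by blast
    moreover have "k \<in> positions" "vertex_at c k = v" using \<open>k \<in> D\<close> unfolding D_def by blast+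
    ultimately show ?thesis
      by (elim disjE) (rule exI[of _ n], rule exI[of _ 0], simp, rule exI[of _ n], rule exI[of _ 1], simp)
  qed
  let ?W = "\<lambda>n. word_mat N (\<lambda>i. Y N i \<omega>) (Word (ws n))"
  let ?resp = "\<lambda>\<phi>. \<forall>k\<in>D. \<forall>l\<in>D. step_edge c k = step_edge c l \<longrightarrow> \<phi> k = \<phi> l"
  let ?E = "\<lambda>\<phi>. \<Prod>k\<in>?C - starts. el N \<omega> k (\<phi> k) (\<phi> (next_pos k))"
  define F :: "(nat \<Rightarrow> nat) \<Rightarrow> complex" where
    "F \<phi> = of_bool (?resp \<phi>)" for \<phi>
  have C: "?C = D \<union> (\<Union>n\<in>A. tail_positions 1 n)"
  proof (intro equalityI subsetI)
    fix k assume k: "k \<in> ?C"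
    then obtain n i where ni: "k = pos n i" "n < L" "i \<le> Suc (length (ws n))" using positionsE by blast
    consider "i = 0" | "i = 1" | "i \<ge> 2" by linarith
    then show "k \<in> D \<union> (\<Union>n\<in>A. tail_positions 1 n)"
    proof cases
      case 3
      then have "n \<in> A" "k \<in> tail_positions 1 n" using ni k by (simp_all add: A_def)
      then show ?thesis by blast
    qed (use ni k in \<open>simp_all add: D_pos\<close>)
  next
    fix k assume "k \<in> D \<union> (\<Union>n\<in>A. tail_positions 1 n)"
    then consider "k \<in> D" | n where "n \<in> A" "k \<in> tail_positions 1 n" by blast
    then show "k \<in> ?C"
    proof cases
      case 1
      then show ?thesis by (simp add: D_def)
    next
      case 2
      then show ?thesis unfolding tail_positions_def A_def by auto
    qed
  qed
  have CX: "?C - starts = (\<Union>n\<in>A. tail_positions 0 n)"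
  proof (intro equalityI subsetI)
    fix k assume k: "k \<in> ?C - starts"
    then obtain n i where ni: "k = pos n i" "n < L" "i \<le> Suc (length (ws n))" using positionsE by blast
    then have "n \<in> A" "k \<in> tail_positions 0 n" using k by (auto simp: A_def)
    then show "k \<in> (\<Union>n\<in>A. tail_positions 0 n)" by blast
  qed (auto simp: A_def tail_positions_def)
  have Cp: "?C \<in> parts ?\<rho>" unfolding cycle_parts using v by blast
  have nxC: "next_pos k \<in> ?C" if "k \<in> ?C - starts" for k
    using part_closed(2)[OF Cp, of k] that by blast
  have "free_sum N (el N \<omega>) ?\<rho> ?C = (\<Sum>\<psi>\<in>?\<rho> ` ?C \<rightarrow>\<^sub>E {..<N}. ?E (\<lambda>k\<in>?C. \<psi> (?\<rho> k)))"
    unfolding free_sum_def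
  proof (rule sum.cong[OF refl], rule prod.cong[OF refl])
    fix \<psi> k assume k: "k \<in> ?C - starts"
    then show "el N \<omega> k (\<psi> (?\<rho> k)) (\<psi> (?\<rho> (next_pos k))) =
        el N \<omega> k ((\<lambda>k\<in>?C. \<psi> (?\<rho> k)) k) ((\<lambda>k\<in>?C. \<psi> (?\<rho> k)) (next_pos k))"
      using restrict_apply'[of k ?C "\<lambda>k. \<psi> (?\<rho> k)"] restrict_apply'[OF nxC[OF k], of "\<lambda>k. \<psi> (?\<rho> k)"] by (simp only: DiffD1)
  qed
  also have "\<dots> = (\<Sum>\<eta>\<in>{\<eta> \<in> ?C \<rightarrow>\<^sub>E {..<N}. \<forall>k\<in>?C. \<forall>l\<in>?C. ?\<rho> k = ?\<rho> l \<longrightarrow> \<eta> k = \<eta> l}. ?E \<eta>)"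
    by (rule sum_PiE_factor[OF refl])
  also have "\<dots> = (\<Sum>\<eta>\<in>?C \<rightarrow>\<^sub>E {..<N}. F \<eta> * ?E \<eta>)"
  proof -
    have "(\<forall>k\<in>?C. \<forall>l\<in>?C. ?\<rho> k = ?\<rho> l \<longrightarrow> \<eta> k = \<eta> l) \<longleftrightarrow>
      (?resp \<eta>)" for \<eta> :: "nat \<Rightarrow> nat"
    proof
      assume *: "\<forall>k\<in>?C. \<forall>l\<in>?C. ?\<rho> k = ?\<rho> l \<longrightarrow> \<eta> k = \<eta> l"
      show "?resp \<eta>"
      proof (intro ballI impI)
        fix k l assume k: "k \<in> D" and l: "l \<in> D" and e: "step_edge c k = step_edge c l"
        obtain n i m j where ni: "k = pos n i" "i \<le> 1" "vertex_at c k = v" and mj: "l = pos m j" "j \<le> 1" "vertex_at c l = v"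
          using D_cases[OF k] D_cases[OF l] by blast
        have kl: "k \<in> ?C" "l \<in> ?C" using k l unfolding D_def by blast+
        have "end_label c k = end_label c l"
          using ni mj e end_label_pos[OF ni(2), of c n] end_label_pos[OF mj(2), of c m] by (simp only: step_edge_pos)
        then have "?\<rho> k = ?\<rho> l" using cycle_kernel_eq[of k l c] kl by blast
        then show "\<eta> k = \<eta> l" using * kl by blast
      qed
    next
      assume *: "?resp \<eta>"
      show "\<forall>k\<in>?C. \<forall>l\<in>?C. ?\<rho> k = ?\<rho> l \<longrightarrow> \<eta> k = \<eta> l"
      proof (intro ballI impI)
        fix k l assume k: "k \<in> ?C" and l: "l \<in> ?C" and e: "?\<rho> k = ?\<rho> l"
        obtain n i where ni: "k = pos n i" "n < L" "i \<le> Suc (length (ws n))" using k positionsE by blast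
        obtain m j where mj: "l = pos m j" "m < L" "j \<le> Suc (length (ws m))" using l positionsE by blast
        have e: "end_label c k = end_label c l" using e cycle_kernel_eq[of k l c] k l by blast
        show "\<eta> k = \<eta> l"
        proof (cases "i \<le> 1 \<and> j \<le> 1")
          case True
          then have "step_edge c k = step_edge c l"
            using e ni(1) mj(1) end_label_pos[of i c n] end_label_pos[of j c m] by simp
          moreover have "k \<in> D" "l \<in> D" using True k l ni mj by (auto simp: D_def le_Suc_eq)
          ultimately show ?thesis using * by blast
        next
          case False
          then have "k = l"
            using e ni(1) mj(1) end_label_pos[of i c n] end_label_pos[of j c m] end_label_inner[of i c n] end_label_inner[of j c m]
            by (cases "i \<le> 1"; cases "j \<le> 1") simp_all
          then show ?thesis by simp
        qed
      qed
    qed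
    moreover have "finite (?C \<rightarrow>\<^sub>E {..<N})" using finite_positions by (intro finite_PiE) auto
    ultimately show ?thesis unfolding F_def
      by (simp only:) (simp add: of_bool_def if_distrib[of "\<lambda>x. x * _"] flip: sum.inter_filter cong: if_cong)
  qed
  also have "\<dots> = (\<Sum>\<phi>\<in>D \<union> (\<Union>n\<in>A. tail_positions 1 n) \<rightarrow>\<^sub>E {..<N}.
       F \<phi> * (\<Prod>k\<in>(\<Union>n\<in>A. tail_positions 0 n). label_entry (\<lambda>i. Y N i \<omega>) (lab k) (\<phi> k) (\<phi> (next_pos k))))"
    by (simp only: C[symmetric] CX[symmetric] el_def)
  also have "\<dots> = (\<Sum>\<phi>\<in>D \<rightarrow>\<^sub>E {..<N}. F \<phi> * (\<Prod>n\<in>A. ?W n $$ (\<phi> (pos n 1), \<phi> (pos (Suc n mod L) 0))))"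
  proof (rule sum_word_graph[symmetric])
    \<comment> \<open>The words contain no Wigner matrix, so the identity may stand in for the
      matrices \<open>Xm\<close>.\<close>
    fix n :: nat show "1\<^sub>m N \<in> carrier_mat N N" by simp
  next
    fix n l i assume "n < L" "l \<in> set (ws n)" "i \<in> set_star_letter l"
    then show "Y N i \<omega> \<in> carrier_mat N N" using ws_vars by (intro Ym) blast
  next
    show "A \<subseteq> {..<L}" by (auto simp: A_def)
  next
    fix n assume "n \<in> A"
    then show "pos n 1 \<in> D \<and> pos (Suc n mod L) 0 \<in> D"
      using cycle_facts(4)[OF cyc L, of n] by (simp add: A_def D_pos)
  next
    fix n i assume "pos n i \<in> D"
    then show "i \<le> 1" by (auto simp: D_pos)
  next
    fix \<phi> \<phi>' :: "nat \<Rightarrow> nat" assume e: "\<And>k. k \<in> D \<Longrightarrow> \<phi> k = \<phi>' k"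
    have "(?resp \<phi>) \<longleftrightarrow>
      (?resp \<phi>')"
      by (intro ball_cong refl) (simp only: e)
    then show "F \<phi> = F \<phi>'" by (simp only: F_def)
  qed
  also have "\<dots> = (\<Sum>\<phi>\<in>{\<phi> \<in> D \<rightarrow>\<^sub>E {..<N}. ?resp \<phi>}.
      \<Prod>n\<in>A. ?W n $$ (\<phi> (pos n 1), \<phi> (pos (Suc n mod L) 0)))"
  proof -
    have "finite (D \<rightarrow>\<^sub>E {..<N})" using finite_positions by (intro finite_PiE) (auto simp: D_def)
    then show ?thesis unfolding F_def
      by (simp add: of_bool_def if_distrib[of "\<lambda>x. x * _"] flip: sum.inter_filter cong: if_cong)
  qed
  also have "\<dots> = (\<Sum>\<psi>\<in>{e \<in> tree_edges G. v \<in> e} \<rightarrow>\<^sub>E {..<N}.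
      \<Prod>n\<in>A. ?W n $$
        ((\<lambda>k\<in>D. \<psi> (step_edge c k)) (pos n 1), (\<lambda>k\<in>D. \<psi> (step_edge c k)) (pos (Suc n mod L) 0)))"
  proof (rule sum_PiE_factor[symmetric])
    show "step_edge c ` D = {e \<in> tree_edges G. v \<in> e}"
    proof (intro equalityI subsetI)
      fix e assume "e \<in> step_edge c ` D"
      then obtain k where k: "k \<in> D" "e = step_edge c k" by blast
      obtain n i where ni: "k = pos n i" "i \<le> 1" "n < L" "vertex_at c k = v" using D_cases[OF k(1)] by blast
      then have "v \<in> undirected c n" by (auto simp: undirected_def split: if_splits)
      then show "e \<in> {e \<in> tree_edges G. v \<in> e}" using k(2) ni cycle_facts(3)[OF cyc L ni(3)] by simp
    next
      fix e assume e: "e \<in> {e \<in> tree_edges G. v \<in> e}"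
      then obtain n where n: "n < L" "e = undirected c n" unfolding cycle_edges[OF cyc L] by blast
      then have "v = fst (c ! n) \<or> v = snd (c ! n)" using e by (auto simp: undirected_def)
      then have "pos n 0 \<in> D \<or> pos n 1 \<in> D" using n by (simp add: D_pos) blast
      then show "e \<in> step_edge c ` D" using n(2) step_edge_pos by (metis image_eqI)
    qed
  qed
  also have "\<dots> = (\<Sum>\<psi>\<in>{e \<in> tree_edges G. v \<in> e} \<rightarrow>\<^sub>E {..<N}.
      \<Prod>n\<in>A. ?W n $$ (\<psi> (undirected c n), \<psi> (undirected c (Suc n mod L))))"
  proof (rule sum.cong[OF refl], rule prod.cong[OF refl])
    fix \<psi> :: "nat list set \<Rightarrow> nat" and n assume n: "n \<in> A"
    then have "pos n 1 \<in> D" "pos (Suc n mod L) 0 \<in> D"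
      using cycle_facts(4)[OF cyc L, of n] by (simp_all add: A_def D_pos)
    then show "?W n $$
        ((\<lambda>k\<in>D. \<psi> (step_edge c k)) (pos n 1), (\<lambda>k\<in>D. \<psi> (step_edge c k)) (pos (Suc n mod L) 0)) =
      ?W n $$ (\<psi> (undirected c n), \<psi> (undirected c (Suc n mod L)))"
      by simp
  qed
  also have "\<dots> = graph_trace N (vertex_graph L G c v) (\<lambda>n. ?W n) * of_nat N"
    using N by (simp add: graph_trace_def vertex_graph_def A_def)
  finally show ?thesis using N by simp
qed

end

text \<open>The vertices of \<open>G\<close> are the components of \<rho>, visited in the order of
  the steps. The extremal count makes the classes correspond to the pairs of components that they
  join, and this feeds \<open>plane_cycle_exists\<close>.\<close>

lemma tree_cycle_exists:
  assumes tree: "is_tree \<rho>"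
  shows "\<exists>G c. (G, c) \<in> plane_cycles L \<gamma> \<and> coarser (cycle_kernel c) \<rho> \<and>
    card (parts \<rho>) = card (step_edge c ` starts) + 1"
proof -
  note T = compatible_edge_class[of \<rho>] tree[unfolded is_tree_def]
  define cls where "cls k = same \<rho> `` {k}" for k
  have cls_eq: "cls k = cls l \<longleftrightarrow> (k, l) \<in> same \<rho>" if "k \<in> positions" "l \<in> positions" for k l
    unfolding cls_def using eq_equiv_class_iff[OF equiv_connection that] .
  have cls_\<rho>: "cls k = cls l" if "k \<in> positions" "l \<in> positions" "\<rho> k = \<rho> l" for k l
    using cls_eq[OF that(1,2)] same_kernel[OF that] by simp
  define f where "f n = cls (pos n 0)" for n
  define step where "step n = {f n, f (Suc n mod L)}" for n
  have cls_end: "cls (pos n i) = f (Suc n mod L)" if "n < L" "1 \<le> i" "i \<le> Suc (length (ws n))" for n i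
    unfolding f_def using same_end[OF that, of \<rho>] that by (subst cls_eq) auto
  have step_cls: "step n = {cls (pos n 0), cls (pos n 1)}" if "n < L" for n
    using cls_end[of n 1] that by (simp add: step_def f_def)
  have loop: "cls (pos n 0) \<noteq> cls (pos n 1)" if "n < L" for n
    using tree_not_linked[OF T, of "pos n 0"] that cls_eq[of "pos n 0" "pos n 1"] by simp
  have edge_step: "step n = step m" if "n < L" "m < L" "edge_class \<rho> (pos n 0) = edge_class \<rho> (pos m 0)" for n m
  proof -
    have "{\<rho> (pos n 0), \<rho> (pos n 1)} = {\<rho> (pos m 0), \<rho> (pos m 1)}"
      using that(3) unfolding edge_class_pos by simp
    then have "\<rho> (pos n 0) = \<rho> (pos m 0) \<and> \<rho> (pos n 1) = \<rho> (pos m 1) \<or> \<rho> (pos n 0) = \<rho> (pos m 1) \<and> \<rho> (pos n 1) = \<rho> (pos m 0)"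
      unfolding doubleton_eq_iff .
    then have "cls (pos n 0) = cls (pos m 0) \<and> cls (pos n 1) = cls (pos m 1) \<or> cls (pos n 0) = cls (pos m 1) \<and> cls (pos n 1) = cls (pos m 0)"
      using that cls_\<rho>[of "pos n 0" "pos m 0"] cls_\<rho>[of "pos n 1" "pos m 1"] cls_\<rho>[of "pos n 0" "pos m 1"] cls_\<rho>[of "pos n 1" "pos m 0"]
      by auto
    then show ?thesis unfolding step_cls[OF that(1)] step_cls[OF that(2)] doubleton_eq_iff .
  qed
  have parts: "parts \<rho> = f ` {..<L}"
  proof (intro equalityI subsetI)
    fix C assume "C \<in> parts \<rho>"
    then obtain k where k: "k \<in> positions" "C = cls k"
      unfolding parts_def components_def cls_def by (auto elim: quotientE)
    obtain n i where ni: "k = pos n i" "n < L" "i \<le> Suc (length (ws n))" using positionsE[OF k(1)] by blast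
    show "C \<in> f ` {..<L}"
    proof (cases "i = 0")
      case True
      then have "C = f n" using k ni by (simp add: f_def)
      then show ?thesis using ni by blast
    next
      case False
      then have "C = f (Suc n mod L)" using k ni cls_end[of n i] by simp
      then show ?thesis using mod_less by blast
    qed
  next
    fix C assume "C \<in> f ` {..<L}"
    then obtain n where n: "n < L" "C = f n" by blast
    show "C \<in> parts \<rho>" unfolding n(2) f_def cls_def by (rule part_of(1)) (use n in simp)
  qed
  let ?st = "step \<circ> step_of"
  have st_img: "?st ` starts = step ` {..<L}" unfolding starts_def by (simp add: image_image)
  have st_edge: "?st k = ?st l" if k: "k \<in> starts" and l: "l \<in> starts" and e: "edge_class \<rho> k = edge_class \<rho> l" for k l
  proof -
    obtain n m where nm: "k = pos n 0" "n < L" "l = pos m 0" "m < L" using k l by (auto simp: starts_def)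
    from edge_step[OF nm(2,4)] e show ?thesis unfolding nm(1,3) by simp
  qed
  \<comment> \<open>Contracting each component to one vertex gives a kernel with the same
    components, compatible with the pairs of components as classes; \<open>card_parts_le\<close> for
    this kernel bounds the number of pairs from below.\<close>
  have ge: "card (edge_class \<rho> ` starts) \<le> card (?st ` starts)"
  proof -
    define \<rho>' where "\<rho>' = kernel_of positions cls"
    have \<rho>'_eq: "\<rho>' k = \<rho>' l \<longleftrightarrow> cls k = cls l" if "k \<in> positions" "l \<in> positions" for k l
      unfolding \<rho>'_def by (rule kernel_of_eq_iff[OF finite_positions that])
    have "compatible ?st \<rho>'"
      unfolding compatible_def
    proof (intro ballI impI)
      fix k l assume k: "k \<in> starts" "l \<in> starts" "?st k = ?st l"
      then obtain n m where nm: "k = pos n 0" "n < L" "l = pos m 0" "m < L" by (auto simp: starts_def)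
      have "{cls (pos n 0), cls (pos n 1)} = {cls (pos m 0), cls (pos m 1)}"
        using k(3) nm step_cls by simp
      then have "cls (pos n 0) = cls (pos m 0) \<and> cls (pos n 1) = cls (pos m 1) \<or> cls (pos n 0) = cls (pos m 1) \<and> cls (pos n 1) = cls (pos m 0)"
        unfolding doubleton_eq_iff .
      then have "\<rho>' (pos n 0) = \<rho>' (pos m 0) \<and> \<rho>' (pos n 1) = \<rho>' (pos m 1) \<or> \<rho>' (pos n 0) = \<rho>' (pos m 1) \<and> \<rho>' (pos n 1) = \<rho>' (pos m 0)"
        using nm by (simp add: \<rho>'_eq)
      then show "{\<rho>' k, \<rho>' (next_pos k)} = {\<rho>' l, \<rho>' (next_pos l)}"
        using nm by (auto simp: doubleton_eq_iff)
    qed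
    then have "card (parts \<rho>') \<le> card (?st ` starts) + 1" by (rule card_parts_le)
    moreover have "same \<rho>' = same \<rho>"
    proof
      show "same \<rho>' \<subseteq> same \<rho>"
      proof (rule connection_least[OF equiv_connection])
        fix k l assume kl: "(k, l) \<in> link \<rho>'" "k \<in> positions" "l \<in> positions"
        then consider "\<rho>' k = \<rho>' l" | "l = next_pos k" "k \<notin> starts" by (auto simp: link_def)
        then show "(k, l) \<in> same \<rho>"
        proof cases
          case 1
          then show ?thesis using kl \<rho>'_eq[of k l] cls_eq[of k l] by blast
        next
          case 2
          then show ?thesis using kl same_next by simp
        qed
      qed
      show "same \<rho> \<subseteq> same \<rho>'"
      proof (rule same_coarser, unfold coarser_def, intro ballI impI)
        fix k l assume "k \<in> positions" "l \<in> positions" "\<rho> k = \<rho> l"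
        then show "\<rho>' k = \<rho>' l" using cls_\<rho>[of k l] \<rho>'_eq[of k l] by blast
      qed
    qed
    ultimately show ?thesis using T(2) by (simp add: parts_def components_def)
  qed
  have card_eq: "card (?st ` starts) = card (edge_class \<rho> ` starts)"
    by (rule order_antisym[OF image_card_eq_imp(1)[OF finite_XS st_edge] ge])
  have step_edge_class: "edge_class \<rho> (pos n 0) = edge_class \<rho> (pos m 0)" if "n < L" "m < L" "step n = step m" for n m
    by (rule image_card_eq_imp(2)[OF finite_XS st_edge ge]) (use that in simp_all)
  have tree_f: "card (f ` {..<L}) = card (step ` {..<L}) + 1"
    using T(2) card_eq parts st_img by simp
  have "\<exists>G c. (G, c) \<in> plane_cycles L \<gamma> \<and> (\<forall>n<L. \<forall>m<L. fst (c ! n) = fst (c ! m) \<longleftrightarrow> f n = f m)"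
  proof (rule plane_cycle_exists[OF L])
    show "card (f ` {..<L}) = card ((\<lambda>n. {f n, f (Suc n mod L)}) ` {..<L}) + 1"
      using tree_f by (simp add: step_def)
  next
    \<comment> \<open>Balance provides a step of the same class in the opposite direction; it
      differs from \<open>n\<close> because no class is a loop.\<close>
    fix n assume n: "n < L"
    let ?k = "pos n 0"
    have "card {k \<in> starts. edge_class \<rho> k = edge_class \<rho> ?k \<and> \<rho> k = \<rho> ?k} =
      card {k \<in> starts. edge_class \<rho> k = edge_class \<rho> ?k \<and> \<rho> (next_pos k) = \<rho> ?k}"
      by (rule tree_class_balanced[OF T]) (use n in simp)
    moreover have "?k \<in> {k \<in> starts. edge_class \<rho> k = edge_class \<rho> ?k \<and> \<rho> k = \<rho> ?k}" using n by simp
    then have "card {k \<in> starts. edge_class \<rho> k = edge_class \<rho> ?k \<and> \<rho> k = \<rho> ?k} \<noteq> 0"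
      using finite_XS by (metis (no_types, lifting) card_eq_0_iff empty_iff finite_Collect_conjI finite_subset mem_Collect_eq subsetI)
    ultimately have "{k \<in> starts. edge_class \<rho> k = edge_class \<rho> ?k \<and> \<rho> (next_pos k) = \<rho> ?k} \<noteq> {}" by force
    then obtain k where k: "k \<in> starts" "edge_class \<rho> k = edge_class \<rho> ?k" "\<rho> (next_pos k) = \<rho> ?k" by blast
    obtain m where m: "k = pos m 0" "m < L" using k(1) by (auto simp: starts_def)
    have "m \<noteq> n"
    proof
      assume "m = n"
      then have "\<rho> (pos n 1) = \<rho> (pos n 0)" using k(3) m by simp
      then show False using cls_\<rho>[of "pos n 1" "pos n 0"] loop[OF n] n by simp
    qed
    moreover have "step m = step n" using edge_step[OF m(2) n] k(2) m(1) by simp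
    ultimately show "\<exists>m<L. m \<noteq> n \<and> {f m, f (Suc m mod L)} = {f n, f (Suc n mod L)}"
      using m(2) unfolding step_def by blast
  next
    fix n m assume nm: "n < L" "m < L" "{f n, f (Suc n mod L)} = {f m, f (Suc m mod L)}"
    then have "edge_class \<rho> (pos n 0) = edge_class \<rho> (pos m 0)" by (intro step_edge_class) (simp_all add: step_def)
    then show "\<gamma> n = \<gamma> m" by (simp add: edge_class_pos)
  qed
  then obtain G c where cyc: "(G, c) \<in> plane_cycles L \<gamma>"
    and cf: "\<And>n m. n < L \<Longrightarrow> m < L \<Longrightarrow> fst (c ! n) = fst (c ! m) \<longleftrightarrow> f n = f m" by blast
  have at: "\<exists>n'<L. vertex_at c (pos n i) = fst (c ! n') \<and> cls (pos n i) = f n'" if "n < L" "i \<le> Suc (length (ws n))" for n i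
  proof (cases "i = 0")
    case True
    then show ?thesis using that by (intro exI[of _ n]) (simp add: f_def)
  next
    case False
    then show ?thesis using that cls_end[of n i] cycle_facts(4)[OF cyc L that(1)]
      by (intro exI[of _ "Suc n mod L"]) simp
  qed
  have vertex_cls: "vertex_at c k = vertex_at c l \<longleftrightarrow> cls k = cls l" if k: "k \<in> positions" and l: "l \<in> positions" for k l
  proof -
    obtain n i where ni: "k = pos n i" "n < L" "i \<le> Suc (length (ws n))" using positionsE[OF k] by blast
    obtain m j where mj: "l = pos m j" "m < L" "j \<le> Suc (length (ws m))" using positionsE[OF l] by blast
    obtain n' where n': "n' < L" "vertex_at c k = fst (c ! n')" "cls k = f n'" using at[OF ni(2,3)] ni(1) by blast
    obtain m' where m': "m' < L" "vertex_at c l = fst (c ! m')" "cls l = f m'" using at[OF mj(2,3)] mj(1) by blast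
    show ?thesis unfolding n' m' by (rule cf[OF n'(1) m'(1)])
  qed
  have "\<rho> k = \<rho> l" if k: "k \<in> positions" and l: "l \<in> positions" and e: "end_label c k = end_label c l" for k l
  proof -
    obtain n i where ni: "k = pos n i" "n < L" "i \<le> Suc (length (ws n))" using positionsE[OF k] by blast
    obtain m j where mj: "l = pos m j" "m < L" "j \<le> Suc (length (ws m))" using positionsE[OF l] by blast
    show ?thesis
    proof (cases "i \<le> 1 \<and> j \<le> 1")
      case False
      then have "k = l"
        using e ni(1) mj(1) end_label_pos[of i c n] end_label_pos[of j c m] end_label_inner[of i c n] end_label_inner[of j c m]
        by (cases "i \<le> 1"; cases "j \<le> 1") simp_all
      then show ?thesis by simp
    next
      case True
      have v: "cls k = cls l" using end_label_vertex[OF e] vertex_cls[OF k l] by simp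
      have u: "undirected c n = undirected c m"
        using e ni(1) mj(1) end_label_pos[of i c n] end_label_pos[of j c m] True by simp
      have "fst (c ! n) = fst (c ! m) \<and> snd (c ! n) = snd (c ! m) \<or> fst (c ! n) = snd (c ! m) \<and> snd (c ! n) = fst (c ! m)"
        using u unfolding undirected_def doubleton_eq_iff .
      then have "cls (pos n 0) = cls (pos m 0) \<and> cls (pos n 1) = cls (pos m 1) \<or> cls (pos n 0) = cls (pos m 1) \<and> cls (pos n 1) = cls (pos m 0)"
        using vertex_cls[of "pos n 0" "pos m 0"] vertex_cls[of "pos n 1" "pos m 1"] vertex_cls[of "pos n 0" "pos m 1"] vertex_cls[of "pos n 1" "pos m 0"] ni mj
        by simp
      then have "step n = step m" unfolding step_cls[OF ni(2)] step_cls[OF mj(2)] doubleton_eq_iff .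
      from step_edge_class[OF ni(2) mj(2) this]
      have "{\<rho> (pos n 0), \<rho> (pos n 1)} = {\<rho> (pos m 0), \<rho> (pos m 1)}" unfolding edge_class_pos by simp
      moreover have "\<rho> k \<in> {\<rho> (pos n 0), \<rho> (pos n 1)}" using ni(1) True by (auto simp: le_Suc_eq)
      ultimately obtain j' where j': "j' \<le> 1" "\<rho> k = \<rho> (pos m j')" by (metis One_nat_def empty_iff insert_iff le0 order_refl)
      \<comment> \<open>The two ends of the class lie in different components, so the component of
        \<open>l\<close> decides which end is meant.\<close>
      have "cls (pos m j') = cls (pos m j)"
        using cls_\<rho>[OF k _ j'(2)] v mj j'(1) by simp
      then have "j' = j" using loop[OF mj(2)] j'(1) True by (auto simp: le_Suc_eq)
      then show ?thesis using j' mj by simp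
    qed
  qed
  then have "coarser (cycle_kernel c) \<rho>" unfolding coarser_def using cycle_kernel_eq by blast
  moreover have "card (parts \<rho>) = card (step_edge c ` starts) + 1"
  proof -
    have "same \<rho> = {(k, l). k \<in> positions \<and> l \<in> positions \<and> vertex_at c k = vertex_at c l}"
    proof (intro equalityI subrelI)
      fix k l assume kl: "(k, l) \<in> same \<rho>"
      then show "(k, l) \<in> {(k, l). k \<in> positions \<and> l \<in> positions \<and> vertex_at c k = vertex_at c l}"
        using connection_in[OF kl] vertex_cls[of k l] cls_eq[of k l] by blast
    next
      fix k l assume "(k, l) \<in> {(k, l). k \<in> positions \<and> l \<in> positions \<and> vertex_at c k = vertex_at c l}"
      then show "(k, l) \<in> same \<rho>" using vertex_cls[of k l] cls_eq[of k l] by blast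
    qed
    from card_parts_same[OF this] show ?thesis unfolding card_vertices[OF cyc] step_edge_starts[OF cyc] .
  qed
  ultimately show ?thesis using cyc by blast
qed

definition fibre :: "walk \<Rightarrow> (nat \<Rightarrow> nat) set" where
  "fibre c = {\<rho> \<in> kernels positions. coarser (cycle_kernel c) \<rho> \<and> card (parts \<rho>) = card (step_edge c ` starts) + 1}"

text \<open>The components of \<rho> tell which starts of steps lie at the same vertex, and this
  determines the cycle.\<close>

lemma fibre_unique:
  assumes "(G, c) \<in> plane_cycles L \<gamma>" "(G', c') \<in> plane_cycles L \<gamma>" "\<rho> \<in> fibre c" "\<rho> \<in> fibre c'"
  shows "(G, c) = (G', c')"
proof (rule plane_cycle_unique[OF assms(1,2) L])
  fix n m assume nm: "n < L" "m < L"
  have \<rho>: "coarser (cycle_kernel c) \<rho>" "card (parts \<rho>) = card (step_edge c ` starts) + 1"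
      "coarser (cycle_kernel c') \<rho>" "card (parts \<rho>) = card (step_edge c' ` starts) + 1"
    using assms(3,4) unfolding fibre_def by blast+
  have "fst (c ! n) = fst (c ! m) \<longleftrightarrow> (pos n 0, pos m 0) \<in> same \<rho>"
    unfolding same_fibre[OF assms(1) \<rho>(1,2)] using nm by simp
  also have "\<dots> \<longleftrightarrow> fst (c' ! n) = fst (c' ! m)"
    unfolding same_fibre[OF assms(2) \<rho>(3,4)] using nm by simp
  finally show "fst (c ! n) = fst (c ! m) \<longleftrightarrow> fst (c' ! n) = fst (c' ! m)" .
qed

lemma tree_kernels: "{\<rho> \<in> kernels positions. is_tree \<rho>} = (\<Union>(G, c)\<in>plane_cycles L \<gamma>. fibre c)"
proof (intro equalityI subsetI)
  fix \<rho> assume "\<rho> \<in> {\<rho> \<in> kernels positions. is_tree \<rho>}"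
  then show "\<rho> \<in> (\<Union>(G, c)\<in>plane_cycles L \<gamma>. fibre c)"
    using tree_cycle_exists[of \<rho>] unfolding fibre_def by fast
next
  fix \<rho> assume "\<rho> \<in> (\<Union>(G, c)\<in>plane_cycles L \<gamma>. fibre c)"
  then obtain G c where "(G, c) \<in> plane_cycles L \<gamma>" "\<rho> \<in> fibre c" by blast
  then show "\<rho> \<in> {\<rho> \<in> kernels positions. is_tree \<rho>}"
    using fibre_is_tree[of G c \<rho>] unfolding fibre_def by blast
qed

definition word_graph_trace :: "nat list set \<Rightarrow> walk \<Rightarrow> nat list \<Rightarrow> nat \<Rightarrow> complex" where
  "word_graph_trace G c v N =
     (\<integral>\<omega>. graph_trace N (vertex_graph L G c v) (\<lambda>n. word_mat N (\<lambda>i. Y N i \<omega>) (Word (ws n))) \<partial>M N)"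

lemma word_graph_trace_free_sum:
  assumes "(G, c) \<in> plane_cycles L \<gamma>" "v \<in> G" "N \<ge> 1"
  shows "word_graph_trace G c v N =
    (\<integral>\<omega>. free_sum N (el N \<omega>) (cycle_kernel c) {k \<in> positions. vertex_at c k = v} / of_nat N \<partial>M N)"
  unfolding word_graph_trace_def
proof (rule Bochner_Integration.integral_cong[OF refl])
  fix \<omega> assume "\<omega> \<in> space (M N)"
  then have "\<And>i. i < q \<Longrightarrow> Y N i \<omega> \<in> carrier_mat N N"
    using random[OF assms(3)] by (simp add: random_matrix_def)
  then show "graph_trace N (vertex_graph L G c v) (\<lambda>n. word_mat N (\<lambda>i. Y N i \<omega>) (Word (ws n))) =
    free_sum N (el N \<omega>) (cycle_kernel c) {k \<in> positions. vertex_at c k = v} / of_nat N"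
    using free_sum_vertex[OF assms] by simp
qed

lemma word_graph_trace_convergent:
  assumes cyc: "(G, c) \<in> plane_cycles L \<gamma>" and v: "v \<in> G"
  shows "convergent (word_graph_trace G c v)"
proof -
  have "{k \<in> positions. vertex_at c k = v} \<in> parts (cycle_kernel c)" unfolding cycle_parts[OF cyc] using v by blast
  then have c: "convergent (\<lambda>N. \<integral>\<omega>. free_sum N (el N \<omega>) (cycle_kernel c) {k \<in> positions. vertex_at c k = v} / of_nat N \<partial>M N)"
    by (rule free_sum_convergent[OF cycle_compatible[OF cyc] cycle_tree[OF cyc]])
  have ev: "eventually (\<lambda>N. word_graph_trace G c v N =
      (\<integral>\<omega>. free_sum N (el N \<omega>) (cycle_kernel c) {k \<in> positions. vertex_at c k = v} / of_nat N \<partial>M N)) sequentially"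
    using eventually_ge_at_top[of 1] by eventually_elim (rule word_graph_trace_free_sum[OF cyc v])
  show ?thesis by (rule iffD2[OF convergent_cong[OF ev] c])
qed

text \<open>The vertices of \<open>G\<close> correspond to the components, and the normalised free
  sum of a component is the trace of its vertex graph; \<open>prod_lim_free_sum\<close> then
  applies.\<close>

lemma prod_word_graph_trace:
  assumes cyc: "(G, c) \<in> plane_cycles L \<gamma>"
  shows "(\<Prod>v\<in>G. lim (word_graph_trace G c v)) = (\<Sum>\<rho>\<in>fibre c. lim (scaled (card (step_edge c ` starts)) \<rho>))"
proof -
  let ?C = "\<lambda>v. {k \<in> positions. vertex_at c k = v}"
  have "inj_on ?C G"
  proof (rule inj_onI)
    fix u v assume uv: "u \<in> G" "v \<in> G" "?C u = ?C v"
    obtain k where "k \<in> positions" "vertex_at c k = u" using uv(1) unfolding vertex_at_positions[OF cyc, symmetric] by blast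
    then show "u = v" using uv(3) by blast
  qed
  then have "(\<Prod>C\<in>parts (cycle_kernel c). lim (\<lambda>N. \<integral>\<omega>. free_sum N (el N \<omega>) (cycle_kernel c) C / of_nat N \<partial>M N)) =
    (\<Prod>v\<in>G. lim (\<lambda>N. \<integral>\<omega>. free_sum N (el N \<omega>) (cycle_kernel c) (?C v) / of_nat N \<partial>M N))"
    unfolding cycle_parts[OF cyc] by (simp add: prod.reindex)
  also have "\<dots> = (\<Prod>v\<in>G. lim (word_graph_trace G c v))"
  proof (rule prod.cong[OF refl])
    fix v assume v: "v \<in> G"
    let ?F = "\<lambda>N. \<integral>\<omega>. free_sum N (el N \<omega>) (cycle_kernel c) (?C v) / of_nat N \<partial>M N"
    have "word_graph_trace G c v \<longlonglongrightarrow> lim (word_graph_trace G c v)"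
      using word_graph_trace_convergent[OF cyc v] by (simp add: convergent_LIMSEQ_iff)
    moreover have "eventually (\<lambda>N. word_graph_trace G c v N = ?F N) sequentially"
      using eventually_ge_at_top[of 1] by eventually_elim (rule word_graph_trace_free_sum[OF cyc v])
    ultimately have "?F \<longlonglongrightarrow> lim (word_graph_trace G c v)" by (rule Lim_transform_eventually)
    then show "lim ?F = lim (word_graph_trace G c v)" by (rule limI)
  qed
  finally show ?thesis unfolding fibre_def prod_lim_free_sum[OF cycle_compatible[OF cyc] cycle_tree[OF cyc]] by simp
qed

text \<open>\<open>tree_weight\<close> is constant on a fibre and factors out; the remaining sum of
  limits is the product over the vertices.\<close>

lemma walk_trace_cycles:
  "(\<lambda>N. (\<integral>\<omega>. walk_trace N \<omega> \<partial>M N) / of_nat N) \<longlonglongrightarrow>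
    (\<Sum>(G, c)\<in>plane_cycles L \<gamma>. complex_of_real (weight_HW a L \<gamma> G c) * (\<Prod>v\<in>G. lim (word_graph_trace G c v)))"
proof -
  let ?t = "\<lambda>\<rho>. complex_of_real (tree_weight \<rho>) * lim (scaled (card (edge_class \<rho> ` starts)) \<rho>)"
  have "(\<Sum>\<rho>\<in>{\<rho> \<in> kernels positions. is_tree \<rho>}. ?t \<rho>) = (\<Sum>(G, c)\<in>plane_cycles L \<gamma>. \<Sum>\<rho>\<in>fibre c. ?t \<rho>)"
    unfolding tree_kernels case_prod_unfold
  proof (rule sum.UNION_disjoint)
    show "finite (plane_cycles L \<gamma>)" by (rule finite_plane_cycles[OF L])
    show "\<forall>z\<in>plane_cycles L \<gamma>. finite (fibre (snd z))"
      using finite_kernels[OF finite_positions] by (simp add: fibre_def)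
    show "\<forall>z\<in>plane_cycles L \<gamma>. \<forall>z'\<in>plane_cycles L \<gamma>. z \<noteq> z' \<longrightarrow> fibre (snd z) \<inter> fibre (snd z') = {}"
      using fibre_unique by fastforce
  qed
  also have "\<dots> = (\<Sum>(G, c)\<in>plane_cycles L \<gamma>. complex_of_real (weight_HW a L \<gamma> G c) * (\<Prod>v\<in>G. lim (word_graph_trace G c v)))"
  proof (rule sum.cong[OF refl], clarify)
    fix G c assume cyc: "(G, c) \<in> plane_cycles L \<gamma>"
    have "?t \<rho> = complex_of_real (weight_HW a L \<gamma> G c) * lim (scaled (card (step_edge c ` starts)) \<rho>)" if "\<rho> \<in> fibre c" for \<rho>
    proof -
      have \<rho>: "coarser (cycle_kernel c) \<rho>" "card (parts \<rho>) = card (step_edge c ` starts) + 1"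
        using that unfolding fibre_def by blast+
      show ?thesis unfolding fibre_weight[OF cyc \<rho>] fibre_card[OF cyc \<rho>] ..
    qed
    then show "(\<Sum>\<rho>\<in>fibre c. ?t \<rho>) = complex_of_real (weight_HW a L \<gamma> G c) * (\<Prod>v\<in>G. lim (word_graph_trace G c v))"
      unfolding prod_word_graph_trace[OF cyc] by (simp add: sum_distrib_left)
  qed
  finally show ?thesis using walk_trace_limit by simp
qed

lemma walk_trace_matrix:
  assumes N: "N \<ge> 1" and \<omega>: "\<omega> \<in> space (M N)"
  shows "walk_trace N \<omega> = (\<Sum>i<N. mat_prod N (\<lambda>n. X N (\<gamma> n) \<omega> * word_mat N (\<lambda>i. Y N i \<omega>) (Word (ws n))) L $$ (i, i))"
proof -
  have Xm: "X N (\<gamma> n) \<omega> \<in> carrier_mat N N" if "n < L" for n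
    using laws[OF \<gamma>[OF that]] N \<omega> unfolding wigner_laws_def random_matrix_def by blast
  have Ym: "Y N v \<omega> \<in> carrier_mat N N" if "n < L" "l \<in> set (ws n)" "v \<in> set_star_letter l" for n l v
    using random[OF N] ws_vars[OF that(1,2)] that(3) \<omega> unfolding random_matrix_def by blast
  let ?Xm = "\<lambda>n. X N (\<gamma> n) \<omega>" and ?Ym = "\<lambda>i. Y N i \<omega>"
  have "walk_trace N \<omega> = (\<Sum>i<N. mat_prod N (\<lambda>n. mat_prod N (\<lambda>i. letter_at ?Xm ?Ym n (0 + i)) (Suc (length (ws n)) - 0)) L $$ (i, i))"
    unfolding walk_trace_def xentry_def el_def unfolding comp_def by (rule trace_walk_sum[OF Xm Ym, symmetric])
  moreover have "mat_prod N (\<lambda>i. letter_at ?Xm ?Ym n (0 + i)) (Suc (length (ws n)) - 0) =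
    ?Xm n * word_mat N ?Ym (Word (ws n))" if n: "n < L" for n
  proof -
    have c: "letter_at ?Xm ?Ym n i \<in> carrier_mat N N" if "i \<le> length (ws n)" for i
      by (rule letter_at_carrier[OF Xm Ym n that])
    have "mat_prod N (letter_at ?Xm ?Ym n) (Suc m) = ?Xm n * mat_prod N (\<lambda>i. letter_at ?Xm ?Ym n (1 + i)) m"
      if "m \<le> length (ws n)" for m
      using that
    proof (induction m)
      case 0
      then show ?case using Xm[OF n] by (simp add: letter_at_def)
    next
      case (Suc m)
      have "mat_prod N (\<lambda>i. letter_at ?Xm ?Ym n (1 + i)) m \<in> carrier_mat N N"
        by (rule mat_prod_carrier) (use Suc.prems c in auto)
      then show ?case using Suc c[of "Suc m"] Xm[OF n] by (simp add: assoc_mult_mat[of _ N N _ N _ N])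
    qed
    from this[OF order_refl] show ?thesis using segment_1[OF Xm Ym n] by simp
  qed
  then have "mat_prod N (\<lambda>n. mat_prod N (\<lambda>i. letter_at ?Xm ?Ym n (0 + i)) (Suc (length (ws n)) - 0)) L =
    mat_prod N (\<lambda>n. ?Xm n * word_mat N ?Ym (Word (ws n))) L"
    by (rule mat_prod_cong)
  ultimately show ?thesis by simp
qed

end

section \<open>Expansion of polynomials\<close>

text \<open>The linear extension of \<open>t\<close> from words to polynomials; its linearity
  replaces arguments about the support of sums.\<close>

definition poly_sum :: "('v star_word \<Rightarrow> complex) \<Rightarrow> 'v star_poly \<Rightarrow> complex" where
  "poly_sum t Q = (\<Sum>w\<in>Poly_Mapping.keys Q. Poly_Mapping.lookup Q w * t w)"

lemma poly_sum_superset: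
  assumes "finite S" "Poly_Mapping.keys Q \<subseteq> S"
  shows "poly_sum t Q = (\<Sum>w\<in>S. Poly_Mapping.lookup Q w * t w)"
  unfolding poly_sum_def using assms by (intro sum.mono_neutral_left) (auto simp: in_keys_iff)

lemma poly_sum_add: "poly_sum t (Q + R) = poly_sum t Q + poly_sum t R"
proof -
  let ?S = "Poly_Mapping.keys Q \<union> Poly_Mapping.keys R"
  have S: "finite ?S" by simp
  note sup = poly_sum_superset[OF S, of _ t]
  show ?thesis
    unfolding sup[OF keys_add] sup[OF Un_upper1] sup[OF Un_upper2]
    by (simp add: lookup_add distrib_right sum.distrib)
qed

lemma poly_sum_0: "poly_sum t 0 = 0"
  by (simp add: poly_sum_def)

lemma poly_sum_single: "poly_sum t (Poly_Mapping.single w x) = x * t w"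
  using poly_sum_superset[of "{w}" "Poly_Mapping.single w x" t] by simp

lemma poly_sum_sum: "poly_sum t (\<Sum>i\<in>I. Q i) = (\<Sum>i\<in>I. poly_sum t (Q i))"
proof (cases "finite I")
  case True
  then show ?thesis by (induction I rule: finite_induct) (simp_all add: poly_sum_0 poly_sum_add)
qed (simp add: poly_sum_0)

definition joint_word :: "(nat \<Rightarrow> nat) \<Rightarrow> nat \<Rightarrow> (nat \<Rightarrow> nat star_word) \<Rightarrow> (nat + nat) star_word" where
  "joint_word \<gamma> L w = (\<Sum>n\<leftarrow>[0..<L]. Word [Plain (Inl (\<gamma> n))] + map_star_word Inr (w n))"

lemma joint_word_Suc: "joint_word \<gamma> (Suc L) w = joint_word \<gamma> L w + (Word [Plain (Inl (\<gamma> L))] + map_star_word Inr (w L))"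
  by (simp add: joint_word_def)

lemma joint_word_cong: "(\<And>n. n < L \<Longrightarrow> w n = w' n) \<Longrightarrow> joint_word \<gamma> L w = joint_word \<gamma> L w'"
  unfolding joint_word_def by (intro arg_cong[where f = sum_list] map_cong) auto

text \<open>The product of sums is expanded by choosing one word for each step.\<close>

lemma joint_poly_expand:
  "(\<Prod>n\<leftarrow>[0..<L]. poly_var (Inl (\<gamma> n)) * poly_rename Inr (P n)) =
    (\<Sum>w\<in>Pi\<^sub>E {..<L} (\<lambda>n. Poly_Mapping.keys (P n)).
       Poly_Mapping.single (joint_word \<gamma> L w) (\<Prod>n<L. Poly_Mapping.lookup (P n) (w n)))"
proof (induction L)
  case 0
  have "(1 :: (nat + nat) star_poly) = Poly_Mapping.single 0 1" by (simp add: single_one)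
  then show ?case by (simp add: joint_word_def)
next
  case (Suc L)
  let ?K = "\<lambda>n. Poly_Mapping.keys (P n)" and ?c = "\<lambda>n. Poly_Mapping.lookup (P n)"
  have P: "poly_var (Inl (\<gamma> L)) * poly_rename Inr (P L) =
    (\<Sum>u\<in>?K L. Poly_Mapping.single (Word [Plain (Inl (\<gamma> L))] + map_star_word Inr u) (?c L u))"
    unfolding poly_var_def poly_rename_def sum_distrib_left mult_single mult_1_left ..
  have "(\<Prod>n\<leftarrow>[0..<Suc L]. poly_var (Inl (\<gamma> n)) * poly_rename Inr (P n)) =
    (\<Sum>w\<in>Pi\<^sub>E {..<L} ?K. Poly_Mapping.single (joint_word \<gamma> L w) (\<Prod>n<L. ?c n (w n))) *
    (\<Sum>u\<in>?K L. Poly_Mapping.single (Word [Plain (Inl (\<gamma> L))] + map_star_word Inr u) (?c L u))"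
    using Suc P by simp
  also have "\<dots> = (\<Sum>w\<in>Pi\<^sub>E {..<L} ?K. \<Sum>u\<in>?K L.
    Poly_Mapping.single (joint_word \<gamma> L w + (Word [Plain (Inl (\<gamma> L))] + map_star_word Inr u)) ((\<Prod>n<L. ?c n (w n)) * ?c L u))"
    unfolding sum_product mult_single ..
  also have "\<dots> = (\<Sum>u\<in>?K L. \<Sum>w\<in>Pi\<^sub>E {..<L} ?K.
    Poly_Mapping.single (joint_word \<gamma> L w + (Word [Plain (Inl (\<gamma> L))] + map_star_word Inr u)) ((\<Prod>n<L. ?c n (w n)) * ?c L u))"
    by (rule sum.swap)
  also have "\<dots> = (\<Sum>u\<in>?K L. \<Sum>w\<in>Pi\<^sub>E {..<L} ?K.
    Poly_Mapping.single (joint_word \<gamma> (Suc L) (w(L := u))) (\<Prod>n<Suc L. ?c n ((w(L := u)) n)))"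
  proof (intro sum.cong refl)
    fix u w
    have "joint_word \<gamma> L (w(L := u)) = joint_word \<gamma> L w" by (rule joint_word_cong) simp
    moreover have "(\<Prod>n<L. ?c n ((w(L := u)) n)) = (\<Prod>n<L. ?c n (w n))" by (rule prod.cong) auto
    ultimately show "Poly_Mapping.single (joint_word \<gamma> L w + (Word [Plain (Inl (\<gamma> L))] + map_star_word Inr u)) ((\<Prod>n<L. ?c n (w n)) * ?c L u) =
      Poly_Mapping.single (joint_word \<gamma> (Suc L) (w(L := u))) (\<Prod>n<Suc L. ?c n ((w(L := u)) n))"
      by (simp only: joint_word_Suc prod.lessThan_Suc fun_upd_same)
  qed
  also have "\<dots> = (\<Sum>w\<in>Pi\<^sub>E {..<Suc L} ?K. Poly_Mapping.single (joint_word \<gamma> (Suc L) w) (\<Prod>n<Suc L. ?c n (w n)))"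
    unfolding lessThan_Suc by (rule sum_PiE_insert[symmetric]) simp
  finally show ?case .
qed

lemma poly_mat_index: "i < N \<Longrightarrow> j < N \<Longrightarrow> poly_mat N A Q $$ (i, j) = poly_sum (\<lambda>w. word_mat N A w $$ (i, j)) Q"
  by (simp add: poly_mat_def poly_sum_def)

lemma set_star_word: "set_star_word w = (\<Union>l\<in>set (letters w). set_star_letter l)"
  by (cases w) simp

lemma set_star_word_add: "set_star_word (u + w) = set_star_word u \<union> set_star_word w"
  by (simp add: set_star_word plus_star_word_def)

lemma word_mat_carrier:
  assumes "\<And>v. v \<in> set_star_word w \<Longrightarrow> A v \<in> carrier_mat N N"
  shows "word_mat N A w \<in> carrier_mat N N"
proof -
  have A: "A v \<in> carrier_mat N N" if "l \<in> set (letters w)" "v \<in> set_star_letter l" for l v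
    by (rule assms) (use that in \<open>auto simp: set_star_word\<close>)
  have "word_mat N A w = mat_prod N (\<lambda>i. letter_mat A (letters w ! i)) (length (letters w))"
    by (rule word_mat_prod) (rule A)
  moreover have "letter_mat A (letters w ! i) \<in> carrier_mat N N" if "i < length (letters w)" for i
    by (rule letter_mat_carrier) (rule A[OF nth_mem[OF that]])
  ultimately show ?thesis by (simp only: mat_prod_carrier)
qed

lemma word_mat_add:
  assumes u: "\<And>v. v \<in> set_star_word u \<Longrightarrow> A v \<in> carrier_mat N N"
    and w: "\<And>v. v \<in> set_star_word w \<Longrightarrow> A v \<in> carrier_mat N N"
  shows "word_mat N A (u + w) = word_mat N A u * word_mat N A w"
proof -
  have A: "A v \<in> carrier_mat N N" if "l \<in> set (letters u)" "v \<in> set_star_letter l" for l v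
    by (rule u) (use that in \<open>auto simp: set_star_word\<close>)
  have l: "letter_mat A l \<in> carrier_mat N N" if "l \<in> set (letters u)" for l
    by (rule letter_mat_carrier) (rule A[OF that])
  have "word_mat N A (u + w) = foldr (\<lambda>l B. letter_mat A l * B) (letters u) (word_mat N A w)"
    by (simp add: word_mat_def plus_star_word_def)
  also have "\<dots> = mat_prod N (\<lambda>i. letter_mat A (letters u ! i)) (length (letters u)) * word_mat N A w"
    by (rule foldr_mat_prod[OF l word_mat_carrier[OF w]])
  also have "mat_prod N (\<lambda>i. letter_mat A (letters u ! i)) (length (letters u)) = word_mat N A u"
    by (rule word_mat_prod[symmetric]) (rule A)
  finally show ?thesis .
qed

lemma letter_mat_map: "letter_mat A (map_star_letter f l) = letter_mat (\<lambda>v. A (f v)) l"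
  by (cases l) simp_all

lemma word_mat_map: "word_mat N A (map_star_word f w) = word_mat N (\<lambda>v. A (f v)) w"
  by (cases w) (simp add: word_mat_def foldr_map comp_def letter_mat_map)

lemma set_joint_word:
  "v \<in> set_star_word (joint_word \<gamma> L w) \<Longrightarrow> (\<exists>n<L. v = Inl (\<gamma> n)) \<or> (\<exists>n<L. \<exists>u\<in>set_star_word (w n). v = Inr u)"
proof (induction L)
  case 0
  then show ?case by (simp add: joint_word_def zero_star_word_def)
next
  case (Suc L)
  then consider "v \<in> set_star_word (joint_word \<gamma> L w)" | "v = Inl (\<gamma> L)" | u where "u \<in> set_star_word (w L)" "v = Inr u"
    by (auto simp: joint_word_Suc set_star_word_add star_word.set_map)
  then show ?case using Suc.IH less_Suc_eq by cases blast+
qed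

lemma word_mat_joint:
  assumes X: "\<And>n. n < L \<Longrightarrow> Xm (\<gamma> n) \<in> carrier_mat N N"
    and Y: "\<And>n v. n < L \<Longrightarrow> v \<in> set_star_word (w n) \<Longrightarrow> Ym v \<in> carrier_mat N N"
  shows "word_mat N (case_sum Xm Ym) (joint_word \<gamma> L w) = mat_prod N (\<lambda>n. Xm (\<gamma> n) * word_mat N Ym (w n)) L"
  using assms
proof (induction L)
  case 0
  then show ?case by (simp add: joint_word_def word_mat_def zero_star_word_def)
next
  case (Suc L)
  let ?A = "case_sum Xm Ym" and ?x = "Word [Plain (Inl (\<gamma> L))] :: (nat + nat) star_word" and ?u = "map_star_word Inr (w L)"
  have IH: "word_mat N ?A (joint_word \<gamma> L w) = mat_prod N (\<lambda>n. Xm (\<gamma> n) * word_mat N Ym (w n)) L"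
    by (rule Suc.IH) (rule Suc.prems(1)[OF less_SucI], assumption, rule Suc.prems(2)[OF less_SucI])
  have j: "?A v \<in> carrier_mat N N" if "v \<in> set_star_word (joint_word \<gamma> L w)" for v
    using set_joint_word[OF that] Suc.prems(1)[OF less_SucI] Suc.prems(2)[OF less_SucI] by (elim disjE exE bexE conjE) simp_all
  have x: "?A v \<in> carrier_mat N N" if "v \<in> set_star_word ?x" for v
    using that Suc.prems(1)[OF lessI] by simp
  have u: "?A v \<in> carrier_mat N N" if "v \<in> set_star_word ?u" for v
  proof -
    obtain v' where "v = Inr v'" "v' \<in> set_star_word (w L)" using \<open>v \<in> set_star_word ?u\<close> unfolding star_word.set_map by blast
    then show ?thesis using Suc.prems(2)[OF lessI, of v'] by simp
  qed
  have xu: "?A v \<in> carrier_mat N N" if "v \<in> set_star_word (?x + ?u)" for v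
    using that unfolding set_star_word_add by (elim UnE) (rule x, assumption, rule u)
  have "word_mat N ?A ?x = Xm (\<gamma> L)" using Suc.prems(1)[OF lessI] by (simp add: word_mat_def)
  moreover have "word_mat N ?A ?u = word_mat N Ym (w L)" by (simp add: word_mat_map)
  moreover have "word_mat N ?A (?x + ?u) = word_mat N ?A ?x * word_mat N ?A ?u"
    by (rule word_mat_add) (rule x, assumption, rule u)
  moreover have "word_mat N ?A (joint_word \<gamma> L w + (?x + ?u)) = word_mat N ?A (joint_word \<gamma> L w) * word_mat N ?A (?x + ?u)"
    by (rule word_mat_add) (rule j, assumption, rule xu)
  ultimately show ?case by (simp add: joint_word_Suc IH)
qed

context word_walk
begin

lemma integrable_word_graph_trace:
  assumes cyc: "(G, c) \<in> plane_cycles L \<gamma>" and v: "v \<in> G" and N: "N \<ge> 1"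
  shows "integrable (M N) (\<lambda>\<omega>. graph_trace N (vertex_graph L G c v) (\<lambda>n. word_mat N (\<lambda>i. Y N i \<omega>) (Word (ws n))))"
proof -
  interpret prob_space "M N" by (rule prob[OF N])
  let ?C = "{k \<in> positions. vertex_at c k = v}"
  have C: "?C \<in> parts (cycle_kernel c)" unfolding cycle_parts[OF cyc] using v by blast
  have "integrable (M N) (\<lambda>\<omega>. free_sum N (el N \<omega>) (cycle_kernel c) ?C / of_nat N)"
  proof (rule integrable_divide)
    show "integrable (M N) (\<lambda>\<omega>. free_sum N (el N \<omega>) (cycle_kernel c) ?C)"
      unfolding free_sum_def el_def
    proof (intro Bochner_Integration.integrable_sum all_moments_integrable all_moments_prod all_moments_label N)
      fix \<psi> k assume \<psi>: "\<psi> \<in> cycle_kernel c ` ?C \<rightarrow>\<^sub>E {..<N}" and k: "k \<in> ?C - starts"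
      then show "\<psi> (cycle_kernel c k) < N" by auto
      have "next_pos k \<in> ?C" using part_closed(2)[OF C, of k] k by blast
      then have "cycle_kernel c (next_pos k) \<in> cycle_kernel c ` ?C" by (rule imageI)
      then show "\<psi> (cycle_kernel c (next_pos k)) < N" using PiE_mem[OF \<psi>] by simp
      show "set_star_letter l \<subseteq> {..<q}" if "lab k = Some l" for l
        by (rule lab_vars[OF _ that]) (use k in blast)
    qed
  qed
  moreover have "integrable (M N) (\<lambda>\<omega>. graph_trace N (vertex_graph L G c v) (\<lambda>n. word_mat N (\<lambda>i. Y N i \<omega>) (Word (ws n)))) \<longleftrightarrow>
    integrable (M N) (\<lambda>\<omega>. free_sum N (el N \<omega>) (cycle_kernel c) ?C / of_nat N)"
  proof (rule Bochner_Integration.integrable_cong[OF refl])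
    fix \<omega> assume "\<omega> \<in> space (M N)"
    then have "\<And>i. i < q \<Longrightarrow> Y N i \<omega> \<in> carrier_mat N N"
      using random[OF N] by (simp add: random_matrix_def)
    then show "graph_trace N (vertex_graph L G c v) (\<lambda>n. word_mat N (\<lambda>i. Y N i \<omega>) (Word (ws n))) =
      free_sum N (el N \<omega>) (cycle_kernel c) ?C / of_nat N"
      using free_sum_vertex[OF cyc v N] by simp
  qed
  ultimately show ?thesis by simp
qed

end

section \<open>Multilinear passage from words to polynomials\<close>

locale heavy_trace = random_family q M Y + wigner_family p M X a \<mu> \<nu>
  for q and M :: "nat \<Rightarrow> 'w measure" and Y p X a \<mu> \<nu> +
  fixes L :: nat and \<gamma> :: "nat \<Rightarrow> nat" and P :: "nat \<Rightarrow> nat star_poly"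
  assumes L: "L \<ge> 1" and \<gamma>: "\<And>n. n < L \<Longrightarrow> \<gamma> n < p"
    and P_vars: "\<And>n. n < L \<Longrightarrow> poly_vars (P n) \<subseteq> {..<q}"
    and indep_X_Y: "\<And>N. N \<ge> 1 \<Longrightarrow> prob_space.indep_var (M N)
           (entry_space {..<p} N) (entries {..<p} N (X N))
           (entry_space {..<q} N) (entries {..<q} N (Y N))"
begin

abbreviation words :: "nat \<Rightarrow> nat star_word set" where
  "words n \<equiv> Poly_Mapping.keys (P n)"

abbreviation coefficient :: "nat \<Rightarrow> nat star_word \<Rightarrow> complex" where
  "coefficient n \<equiv> Poly_Mapping.lookup (P n)"

definition vertex_trace :: "nat list set \<Rightarrow> walk \<Rightarrow> nat list \<Rightarrow> (nat \<Rightarrow> nat star_word) \<Rightarrow> nat \<Rightarrow> complex" where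
  "vertex_trace G c v w N = (\<integral>\<omega>. graph_trace N (vertex_graph L G c v) (\<lambda>n. word_mat N (\<lambda>i. Y N i \<omega>) (w n)) \<partial>M N)"

lemma words_vars: "n < L \<Longrightarrow> w \<in> words n \<Longrightarrow> l \<in> set (letters w) \<Longrightarrow> set_star_letter l \<subseteq> {..<q}"
  using P_vars[of n] unfolding poly_vars_def by (cases w) fastforce

lemma word_walk:
  assumes "\<And>n l. n < L \<Longrightarrow> l \<in> set (letters (w n)) \<Longrightarrow> set_star_letter l \<subseteq> {..<q}"
  shows "word_walk L (\<lambda>n. letters (w n)) q M Y p X a \<mu> \<nu> \<gamma>"
  by unfold_locales (use L \<gamma> assms indep_X_Y in auto)

text \<open>The arcs of the graph at \<open>v\<close> are the steps arriving there, so only their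
  words enter.\<close>

lemma vertex_trace_cong:
  assumes "\<And>n. n < L \<Longrightarrow> snd (c ! n) = v \<Longrightarrow> w n = w' n"
  shows "graph_trace N (vertex_graph L G c v) (\<lambda>n. word_mat N A (w n)) =
    graph_trace N (vertex_graph L G c v) (\<lambda>n. word_mat N A (w' n))"
proof -
  have "(\<Prod>e\<in>arcs (vertex_graph L G c v). word_mat N A (w e) $$ (\<phi> (tail (vertex_graph L G c v) e), \<phi> (head (vertex_graph L G c v) e))) =
    (\<Prod>e\<in>arcs (vertex_graph L G c v). word_mat N A (w' e) $$ (\<phi> (tail (vertex_graph L G c v) e), \<phi> (head (vertex_graph L G c v) e)))" for \<phi>
    by (rule prod.cong[OF refl]) (simp add: vertex_graph_def assms)
  then show ?thesis unfolding graph_trace_def by (simp only:)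
qed

definition arrivals :: "walk \<Rightarrow> nat list \<Rightarrow> nat set" where
  "arrivals c v = {n. n < L \<and> snd (c ! n) = v}"

lemma finite_arrivals: "finite (arrivals c v)"
  by (simp add: arrivals_def)

context
  fixes G c v
  assumes cyc: "(G, c) \<in> plane_cycles L \<gamma>" and v: "v \<in> G"
begin

lemma vertex_trace_props:
  assumes "h \<in> Pi\<^sub>E (arrivals c v) words"
  shows "N \<ge> 1 \<Longrightarrow> integrable (M N) (\<lambda>\<omega>. graph_trace N (vertex_graph L G c v) (\<lambda>n. word_mat N (\<lambda>i. Y N i \<omega>) (h n)))"
    and "convergent (vertex_trace G c v h)"
proof -
  \<comment> \<open>\<open>word_walk\<close> wants a word for every step, so the steps that arrive
    elsewhere get the empty word.\<close>
  define w where "w n = (if n \<in> arrivals c v then h n else Word [])" for n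
  interpret W: word_walk L "\<lambda>n. letters (w n)" q M Y p X a \<mu> \<nu> \<gamma>
  proof (rule word_walk)
    fix n l assume n: "n < L" "l \<in> set (letters (w n))"
    then have "n \<in> arrivals c v" by (auto simp: w_def split: if_splits)
    then show "set_star_letter l \<subseteq> {..<q}"
      using words_vars[OF n(1), of "w n" l] n(2) PiE_mem[OF assms, of n] by (simp add: w_def)
  qed
  have eq: "graph_trace N (vertex_graph L G c v) (\<lambda>n. word_mat N A (Word (letters (w n)))) =
    graph_trace N (vertex_graph L G c v) (\<lambda>n. word_mat N A (h n))" for N A
    unfolding star_word.collapse by (rule vertex_trace_cong) (simp add: w_def arrivals_def)
  show "integrable (M N) (\<lambda>\<omega>. graph_trace N (vertex_graph L G c v) (\<lambda>n. word_mat N (\<lambda>i. Y N i \<omega>) (h n)))" if "N \<ge> 1"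
    using W.integrable_word_graph_trace[OF cyc v that] unfolding eq .
  have "W.word_graph_trace G c v = vertex_trace G c v h"
    unfolding W.word_graph_trace_def vertex_trace_def eq ..
  then show "convergent (vertex_trace G c v h)" using W.word_graph_trace_convergent[OF cyc v] by simp
qed

lemma graph_trace_poly:
  "graph_trace N (vertex_graph L G c v) (\<lambda>n. poly_mat N A (P n)) =
    (\<Sum>h\<in>Pi\<^sub>E (arrivals c v) words. (\<Prod>n\<in>arrivals c v. coefficient n (h n)) *
       graph_trace N (vertex_graph L G c v) (\<lambda>n. word_mat N A (h n)))"
proof -
  let ?V = "{e \<in> tree_edges G. v \<in> e}" and ?t = "undirected c" and ?h = "\<lambda>n. undirected c (Suc n mod L)"
  have mem: "?t n \<in> ?V" "?h n \<in> ?V" if n: "n \<in> arrivals c v" for n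
  proof -
    have nL: "n < L" "Suc n mod L < L" and s: "snd (c ! n) = v" using n L by (auto simp: arrivals_def)
    show "?t n \<in> ?V" using cycle_facts(3)[OF cyc L nL(1)] s by (simp add: undirected_def)
    show "?h n \<in> ?V" using cycle_facts(3)[OF cyc L nL(2)] cycle_facts(4)[OF cyc L nL(1)] s by (simp add: undirected_def)
  qed
  have "(\<Sum>\<phi>\<in>?V \<rightarrow>\<^sub>E {..<N}. \<Prod>n\<in>arrivals c v. poly_mat N A (P n) $$ (\<phi> (?t n), \<phi> (?h n))) =
    (\<Sum>\<phi>\<in>?V \<rightarrow>\<^sub>E {..<N}. \<Sum>h\<in>Pi\<^sub>E (arrivals c v) words. \<Prod>n\<in>arrivals c v. coefficient n (h n) * word_mat N A (h n) $$ (\<phi> (?t n), \<phi> (?h n)))"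
  proof (rule sum.cong[OF refl])
    fix \<phi> assume \<phi>: "\<phi> \<in> ?V \<rightarrow>\<^sub>E {..<N}"
    have "(\<Prod>n\<in>arrivals c v. poly_mat N A (P n) $$ (\<phi> (?t n), \<phi> (?h n))) =
      (\<Prod>n\<in>arrivals c v. \<Sum>w\<in>words n. coefficient n w * word_mat N A w $$ (\<phi> (?t n), \<phi> (?h n)))"
    proof (rule prod.cong[OF refl])
      fix n assume n: "n \<in> arrivals c v"
      have "\<phi> (?t n) < N" "\<phi> (?h n) < N" using PiE_mem[OF \<phi> mem(1)[OF n]] PiE_mem[OF \<phi> mem(2)[OF n]] by simp_all
      then show "poly_mat N A (P n) $$ (\<phi> (?t n), \<phi> (?h n)) = (\<Sum>w\<in>words n. coefficient n w * word_mat N A w $$ (\<phi> (?t n), \<phi> (?h n)))"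
        by (simp add: poly_mat_index poly_sum_def)
    qed
    also have "\<dots> =
      (\<Sum>h\<in>Pi\<^sub>E (arrivals c v) words. \<Prod>n\<in>arrivals c v. coefficient n (h n) * word_mat N A (h n) $$ (\<phi> (?t n), \<phi> (?h n)))"
      by (rule prod_sum_PiE[OF finite_arrivals]) simp
    finally show "(\<Prod>n\<in>arrivals c v. poly_mat N A (P n) $$ (\<phi> (?t n), \<phi> (?h n))) =
      (\<Sum>h\<in>Pi\<^sub>E (arrivals c v) words. \<Prod>n\<in>arrivals c v. coefficient n (h n) * word_mat N A (h n) $$ (\<phi> (?t n), \<phi> (?h n)))" .
  qed
  also have "\<dots> = (\<Sum>h\<in>Pi\<^sub>E (arrivals c v) words. \<Sum>\<phi>\<in>?V \<rightarrow>\<^sub>E {..<N}. \<Prod>n\<in>arrivals c v. coefficient n (h n) * word_mat N A (h n) $$ (\<phi> (?t n), \<phi> (?h n)))"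
    by (rule sum.swap)
  also have "\<dots> = (\<Sum>h\<in>Pi\<^sub>E (arrivals c v) words. (\<Prod>n\<in>arrivals c v. coefficient n (h n)) *
      (\<Sum>\<phi>\<in>?V \<rightarrow>\<^sub>E {..<N}. \<Prod>n\<in>arrivals c v. word_mat N A (h n) $$ (\<phi> (?t n), \<phi> (?h n))))"
    unfolding prod.distrib sum_distrib_left ..
  finally show ?thesis
    by (simp add: graph_trace_def vertex_graph_def arrivals_def flip: sum_divide_distrib)
qed

text \<open>\<open>lim\<close> is a total operator, so convergence is used for each choice of words
  and then passed on to the finite combination.\<close>

lemma limit_trace_words:
  "limit_trace M Y (vertex_graph L G c v) P =
    (\<Sum>h\<in>Pi\<^sub>E (arrivals c v) words. (\<Prod>n\<in>arrivals c v. coefficient n (h n)) * lim (vertex_trace G c v h))"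
  unfolding limit_trace_def
proof (rule limI, rule Lim_transform_eventually)
  show "(\<lambda>N. \<Sum>h\<in>Pi\<^sub>E (arrivals c v) words. (\<Prod>n\<in>arrivals c v. coefficient n (h n)) * vertex_trace G c v h N) \<longlonglongrightarrow>
    (\<Sum>h\<in>Pi\<^sub>E (arrivals c v) words. (\<Prod>n\<in>arrivals c v. coefficient n (h n)) * lim (vertex_trace G c v h))"
    by (intro tendsto_sum tendsto_mult tendsto_const) (use vertex_trace_props(2) in \<open>simp add: convergent_LIMSEQ_iff\<close>)
  show "\<forall>\<^sub>F N in sequentially. (\<Sum>h\<in>Pi\<^sub>E (arrivals c v) words. (\<Prod>n\<in>arrivals c v. coefficient n (h n)) * vertex_trace G c v h N) =
    (\<integral>\<omega>. graph_trace N (vertex_graph L G c v) (\<lambda>e. poly_mat N (\<lambda>i. Y N i \<omega>) (P e)) \<partial>M N)"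
    using eventually_ge_at_top[of 1]
  proof eventually_elim
    case (elim N)
    have "(\<integral>\<omega>. graph_trace N (vertex_graph L G c v) (\<lambda>e. poly_mat N (\<lambda>i. Y N i \<omega>) (P e)) \<partial>M N) =
      (\<Sum>h\<in>Pi\<^sub>E (arrivals c v) words. \<integral>\<omega>. (\<Prod>n\<in>arrivals c v. coefficient n (h n)) *
         graph_trace N (vertex_graph L G c v) (\<lambda>n. word_mat N (\<lambda>i. Y N i \<omega>) (h n)) \<partial>M N)"
      unfolding graph_trace_poly
      by (intro Bochner_Integration.integral_sum integrable_mult_right vertex_trace_props(1) elim)
    then show ?case by (simp add: vertex_trace_def)
  qed
qed

end

text \<open>Every step arrives at exactly one vertex, so choices of words made separately at the
  vertices glue to one choice for the whole cycle.\<close>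

lemma weight_TR_words:
  assumes cyc: "(G, c) \<in> plane_cycles L \<gamma>"
  shows "weight_TR M Y P L G c =
    (\<Sum>w\<in>Pi\<^sub>E {..<L} words. (\<Prod>n<L. coefficient n (w n)) * (\<Prod>v\<in>G. lim (vertex_trace G c v w)))"
proof -
  let ?A = "arrivals c"
  let ?g = "\<lambda>v h. (\<Prod>n\<in>?A v. coefficient n (h n)) * lim (vertex_trace G c v h)"
  have finG: "finite G" using cycle_facts(1)[OF cyc L] by (simp add: plane_tree_def)
  have A: "(\<Union>v\<in>G. ?A v) = {..<L}"
  proof -
    have "snd (c ! n) \<in> G" if n: "n < L" for n
      using cycle_facts(4)[OF cyc L n] L unfolding cycle_vertices[OF cyc L] by auto
    then show ?thesis by (auto simp: arrivals_def)
  qed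
  have "weight_TR M Y P L G c = (\<Prod>v\<in>G. \<Sum>h\<in>Pi\<^sub>E (?A v) words. ?g v h)"
    unfolding weight_TR_def by (intro prod.cong refl limit_trace_words[OF cyc])
  also have "\<dots> = (\<Prod>v\<in>G. \<Sum>h\<in>{h \<in> Pi\<^sub>E (?A v) words. True}. ?g v h)" by simp
  also have "\<dots> = (\<Sum>w\<in>{w \<in> Pi\<^sub>E (\<Union>v\<in>G. ?A v) words. \<forall>v\<in>G. True}. \<Prod>v\<in>G. ?g v (restrict w (?A v)))"
    by (rule prod_sum_partition[OF finG]) (auto simp: arrivals_def)
  also have "\<dots> = (\<Sum>w\<in>Pi\<^sub>E {..<L} words. \<Prod>v\<in>G. ?g v (restrict w (?A v)))"
    by (simp add: A)
  also have "\<dots> = (\<Sum>w\<in>Pi\<^sub>E {..<L} words. (\<Prod>n<L. coefficient n (w n)) * (\<Prod>v\<in>G. lim (vertex_trace G c v w)))"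
  proof (rule sum.cong[OF refl])
    fix w
    have "vertex_trace G c v (restrict w (?A v)) = vertex_trace G c v w" for v
    proof -
      have "graph_trace N (vertex_graph L G c v) (\<lambda>n. word_mat N B (restrict w (?A v) n)) =
        graph_trace N (vertex_graph L G c v) (\<lambda>n. word_mat N B (w n))" for N B
        by (rule vertex_trace_cong) (simp add: arrivals_def)
      then show ?thesis unfolding vertex_trace_def by (simp only:)
    qed
    moreover have "(\<Prod>n\<in>?A v. coefficient n (restrict w (?A v) n)) = (\<Prod>n\<in>?A v. coefficient n (w n))" for v
      by (rule prod.cong) simp_all
    moreover have "(\<Prod>n<L. coefficient n (w n)) = (\<Prod>v\<in>G. \<Prod>n\<in>?A v. coefficient n (w n))"
      unfolding A[symmetric] by (rule prod.UNION_disjoint[OF finG]) (auto simp: arrivals_def)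
    ultimately show "(\<Prod>v\<in>G. ?g v (restrict w (?A v))) = (\<Prod>n<L. coefficient n (w n)) * (\<Prod>v\<in>G. lim (vertex_trace G c v w))"
      by (simp only: prod.distrib)
  qed
  finally show ?thesis .
qed

definition word_trace :: "(nat \<Rightarrow> nat star_word) \<Rightarrow> nat \<Rightarrow> 'w \<Rightarrow> complex" where
  "word_trace w N \<omega> = (\<Sum>i<N. word_mat N (case_sum (\<lambda>j. X N j \<omega>) (\<lambda>i. Y N i \<omega>)) (joint_word \<gamma> L w) $$ (i, i))"

lemma word_trace_props:
  assumes w: "w \<in> Pi\<^sub>E {..<L} words"
  shows "N \<ge> 1 \<Longrightarrow> integrable (M N) (word_trace w N)"
    and "(\<lambda>N. (\<integral>\<omega>. word_trace w N \<omega> \<partial>M N) / of_nat N) \<longlonglongrightarrow>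
      (\<Sum>(G, c)\<in>plane_cycles L \<gamma>. complex_of_real (weight_HW a L \<gamma> G c) * (\<Prod>v\<in>G. lim (vertex_trace G c v w)))"
proof -
  have vars: "set_star_letter l \<subseteq> {..<q}" if "n < L" "l \<in> set (letters (w n))" for n l
    using words_vars[OF that(1), of "w n" l] PiE_mem[OF w, of n] that by simp
  interpret W: word_walk L "\<lambda>n. letters (w n)" q M Y p X a \<mu> \<nu> \<gamma>
    by (rule word_walk) (rule vars)
  have eq: "W.walk_trace N \<omega> = word_trace w N \<omega>" if N: "N \<ge> 1" and \<omega>: "\<omega> \<in> space (M N)" for N \<omega>
  proof -
    have "X N (\<gamma> n) \<omega> \<in> carrier_mat N N" if "n < L" for n
      using laws[OF \<gamma>[OF that]] N \<omega> unfolding wigner_laws_def random_matrix_def by blast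
    moreover have "Y N v \<omega> \<in> carrier_mat N N" if "n < L" "v \<in> set_star_word (w n)" for n v
    proof -
      have "v < q" using vars[OF that(1)] that(2) unfolding set_star_word by blast
      then show ?thesis using random[OF N] \<omega> unfolding random_matrix_def by blast
    qed
    ultimately have "word_mat N (case_sum (\<lambda>j. X N j \<omega>) (\<lambda>i. Y N i \<omega>)) (joint_word \<gamma> L w) =
      mat_prod N (\<lambda>n. X N (\<gamma> n) \<omega> * word_mat N (\<lambda>i. Y N i \<omega>) (w n)) L"
      using word_mat_joint[of L "\<lambda>j. X N j \<omega>" \<gamma> N w "\<lambda>i. Y N i \<omega>"] by blast
    then show ?thesis using W.walk_trace_matrix[OF N \<omega>] by (simp add: word_trace_def)
  qed
  show "integrable (M N) (word_trace w N)" if "N \<ge> 1"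
    using Bochner_Integration.integrable_cong[OF refl eq[OF that], of "M N"] W.integrable_walk_trace[OF that] by simp
  have "W.word_graph_trace G c v = vertex_trace G c v w" for G c v
    unfolding W.word_graph_trace_def vertex_trace_def star_word.collapse ..
  then have lim: "(\<lambda>N. (\<integral>\<omega>. W.walk_trace N \<omega> \<partial>M N) / of_nat N) \<longlonglongrightarrow>
      (\<Sum>(G, c)\<in>plane_cycles L \<gamma>. complex_of_real (weight_HW a L \<gamma> G c) * (\<Prod>v\<in>G. lim (vertex_trace G c v w)))"
    using W.walk_trace_cycles by simp
  have "\<forall>\<^sub>F N in sequentially. (\<integral>\<omega>. W.walk_trace N \<omega> \<partial>M N) / of_nat N = (\<integral>\<omega>. word_trace w N \<omega> \<partial>M N) / of_nat N"
    using eventually_ge_at_top[of 1]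
  proof eventually_elim
    case (elim N)
    have "(\<integral>\<omega>. W.walk_trace N \<omega> \<partial>M N) = (\<integral>\<omega>. word_trace w N \<omega> \<partial>M N)"
      by (rule Bochner_Integration.integral_cong[OF refl eq[OF elim]])
    then show ?case by simp
  qed
  with lim show "(\<lambda>N. (\<integral>\<omega>. word_trace w N \<omega> \<partial>M N) / of_nat N) \<longlonglongrightarrow>
      (\<Sum>(G, c)\<in>plane_cycles L \<gamma>. complex_of_real (weight_HW a L \<gamma> G c) * (\<Prod>v\<in>G. lim (vertex_trace G c v w)))"
    by (rule Lim_transform_eventually)
qed

text \<open>The trace and the weights are expanded over the same choices of words, so the finite
  sums over words and over cycles can be exchanged.\<close>

lemma mean_trace_limit:
  "mean_trace M X Y (\<Prod>n\<leftarrow>[0..<L]. poly_var (Inl (\<gamma> n)) * poly_rename Inr (P n)) \<longlonglongrightarrow>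
    (\<Sum>(G, c)\<in>plane_cycles L \<gamma>. complex_of_real (weight_HW a L \<gamma> G c) * weight_TR M Y P L G c)"
proof -
  let ?W = "Pi\<^sub>E {..<L} words" and ?k = "\<lambda>w. \<Prod>n<L. coefficient n (w n)"
  let ?Q = "\<Prod>n\<leftarrow>[0..<L]. poly_var (Inl (\<gamma> n)) * poly_rename Inr (P n) :: (nat + nat) star_poly"
  have "(\<lambda>N. \<Sum>w\<in>?W. ?k w * ((\<integral>\<omega>. word_trace w N \<omega> \<partial>M N) / of_nat N)) \<longlonglongrightarrow>
    (\<Sum>w\<in>?W. ?k w * (\<Sum>(G, c)\<in>plane_cycles L \<gamma>. complex_of_real (weight_HW a L \<gamma> G c) * (\<Prod>v\<in>G. lim (vertex_trace G c v w))))"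
    by (intro tendsto_sum tendsto_mult tendsto_const word_trace_props(2))
  also have "(\<Sum>w\<in>?W. ?k w * (\<Sum>(G, c)\<in>plane_cycles L \<gamma>. complex_of_real (weight_HW a L \<gamma> G c) * (\<Prod>v\<in>G. lim (vertex_trace G c v w)))) =
    (\<Sum>z\<in>plane_cycles L \<gamma>. \<Sum>w\<in>?W. ?k w * (case z of (G, c) \<Rightarrow> complex_of_real (weight_HW a L \<gamma> G c) * (\<Prod>v\<in>G. lim (vertex_trace G c v w))))"
    unfolding sum_distrib_left by (rule sum.swap)
  also have "\<dots> = (\<Sum>(G, c)\<in>plane_cycles L \<gamma>. complex_of_real (weight_HW a L \<gamma> G c) * weight_TR M Y P L G c)"
    by (rule sum.cong[OF refl], clarify) (simp add: weight_TR_words sum_distrib_left mult.left_commute)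
  finally show ?thesis
  proof (rule Lim_transform_eventually)
    show "\<forall>\<^sub>F N in sequentially. (\<Sum>w\<in>?W. ?k w * ((\<integral>\<omega>. word_trace w N \<omega> \<partial>M N) / of_nat N)) = mean_trace M X Y ?Q N"
      using eventually_ge_at_top[of 1]
    proof eventually_elim
      case (elim N)
      have "(\<Sum>i<N. poly_mat N (case_sum (\<lambda>j. X N j \<omega>) (\<lambda>i. Y N i \<omega>)) ?Q $$ (i, i)) = (\<Sum>w\<in>?W. ?k w * word_trace w N \<omega>)" for \<omega>
      proof -
        let ?A = "case_sum (\<lambda>j. X N j \<omega>) (\<lambda>i. Y N i \<omega>)"
        have "(\<Sum>i<N. poly_mat N ?A ?Q $$ (i, i)) = (\<Sum>i<N. \<Sum>w\<in>?W. ?k w * word_mat N ?A (joint_word \<gamma> L w) $$ (i, i))"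
          by (intro sum.cong refl) (simp only: poly_mat_index lessThan_iff joint_poly_expand poly_sum_sum poly_sum_single)
        also have "\<dots> = (\<Sum>w\<in>?W. \<Sum>i<N. ?k w * word_mat N ?A (joint_word \<gamma> L w) $$ (i, i))"
          by (rule sum.swap)
        finally show ?thesis by (simp only: word_trace_def sum_distrib_left)
      qed
      then have "mean_trace M X Y ?Q N = (\<integral>\<omega>. (\<Sum>w\<in>?W. ?k w * word_trace w N \<omega>) / of_nat N \<partial>M N)"
        unfolding mean_trace_def by (simp only:)
      also have "\<dots> = (\<Sum>w\<in>?W. \<integral>\<omega>. ?k w * word_trace w N \<omega> \<partial>M N) / of_nat N"
        unfolding integral_divide_zero
        by (intro arg_cong2[where f = "(/)"] refl Bochner_Integration.integral_sum integrable_mult_right word_trace_props(1) elim)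
      finally show ?case by (simp add: sum_divide_distrib)
    qed
  qed
qed

end

theorem proposition2p8:
  fixes M :: "nat \<Rightarrow> 'w measure"
    and X Y :: "nat \<Rightarrow> nat \<Rightarrow> 'w \<Rightarrow> complex mat"
    and a :: "nat \<Rightarrow> nat \<Rightarrow> real"
    and p q L :: nat
    and \<gamma> :: "nat \<Rightarrow> nat"
    and P :: "nat \<Rightarrow> nat star_poly"
  assumes "\<And>N. N \<ge> 1 \<Longrightarrow> prob_space (M N)"
    and "\<And>j. j < p \<Longrightarrow> heavy_wigner M (\<lambda>N. X N j) (a j)"
    and "\<And>N i. N \<ge> 1 \<Longrightarrow> i < q \<Longrightarrow> random_matrix (M N) N (Y N i)"
    and "\<And>N. N \<ge> 1 \<Longrightarrow> prob_space.indep_vars (M N)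
           (\<lambda>j. entry_space {j} N) (\<lambda>j. entries {j} N (X N)) {..<p}"
    and "\<And>N. N \<ge> 1 \<Longrightarrow> prob_space.indep_var (M N)
           (entry_space {..<p} N) (entries {..<p} N (X N))
           (entry_space {..<q} N) (entries {..<q} N (Y N))"
    and "traces_converge q M Y" and "traces_factorize q M Y" and "traces_bounded q M Y"
    and "L \<ge> 1"
    and "\<gamma> \<in> {..<L} \<rightarrow> {..<p}"
    and "\<And>n. n < L \<Longrightarrow> poly_vars (P n) \<subseteq> {..<q}"
  defines "Q \<equiv> \<Prod>n\<leftarrow>[0..<L]. poly_var (Inl (\<gamma> n)) * poly_rename Inr (P n)"
  shows "convergent (mean_trace M X Y Q) \<and>
    limit_distribution M X Y Q =
      (\<Sum>(G, c)\<in>plane_cycles L \<gamma>. complex_of_real (weight_HW a L \<gamma> G c) * weight_TR M Y P L G c)"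
proof -
  \<comment> \<open>The laws depend on the colour; the guard \<open>j < p\<close> inside the
    quantifiers lets \<open>choice\<close> pick them for all \<open>j\<close> at once.\<close>
  have "\<forall>j. \<exists>\<mu> \<nu>. j < p \<longrightarrow> wigner_laws M (\<lambda>N. X N j) (a j) \<mu> \<nu>"
    using assms(2) unfolding heavy_wigner_laws by blast
  from choice[OF this] obtain \<mu> where "\<forall>j. \<exists>\<nu>. j < p \<longrightarrow> wigner_laws M (\<lambda>N. X N j) (a j) (\<mu> j) \<nu>" ..
  from choice[OF this] obtain \<mu> \<nu> where laws: "\<And>j. j < p \<Longrightarrow> wigner_laws M (\<lambda>N. X N j) (a j) (\<mu> j) (\<nu> j)"
    by blast
  interpret heavy_trace q M Y p X a \<mu> \<nu> L \<gamma> P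
  proof (intro heavy_trace.intro random_family.intro wigner_family.intro heavy_trace_axioms.intro)
    show "\<gamma> n < p" if "n < L" for n using assms(10) that by auto
  qed (fact assms(1) assms(3-9) assms(11) laws)+
  show ?thesis
    unfolding limit_distribution_def Q_def using mean_trace_limit by (auto simp: convergent_def limI)
qed

end
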